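(* Assume that $\alpha > -1$ and $\alpha+\beta > -1/2$. Then $$M^{\alpha,\beta}_{*,\mathrm{tru}}f(x) \lesssim \begin{cases} Lf(x), & \text{if } \alpha+\beta \ge 1/2,\\ x^{\beta}\big[L\big(|z^{-\beta}f|^{1+\theta}\big)(x)\big]^{1/(1+\theta)}, & \text{if } \alpha+\beta < 1/2,\end{cases}$$ uniformly in locally integrable functions $f$ on $\mathbb{R}_+$ and $x \in \mathbb{R}_+$, with any fixed $\theta > 0$ such that $\frac{1}{1+\theta} < \alpha + \beta +1/2$. Consequently, if $1 < p < \infty$ satisfies $\frac1p<\alpha+\beta+\frac12$, then $M^{\alpha,\beta}_{*,\mathrm{tru}}$ is bounded on $L^p(\mathbb{R}_+,x^{\delta}dx)$ for any $\delta \in \mathbb{R}$. Moreover, in case $\alpha+\beta \ge 1/2$, $M^{\alpha,\beta}_{*,\mathrm{tru}}$ is of weak type $(1,1)$ with respect to the measure space $(\mathbb{R}_+,x^{\delta}dx)$ with any $\delta \in \mathbb{R}$.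
   Context: $\mathbb{R}_+=(0,\infty)$; $\alpha,\beta$ are real. $X\lesssim Y$ means $X\le CY$ with a constant $C>0$ independent of $f$ and $x$ (it may depend on $\alpha,\beta,\theta$). Let $d\mu_\alpha(x)=x^{2\alpha+1}dx$ on $\mathbb{R}_+$, and let $J_\nu$ be the Bessel function of the first kind and order $\nu$. For $\alpha>-1$, $\alpha+\beta>-1/2$ and $t,x,z>0$ with $t\ne|x-z|$, $t\ne x+z$, put $$K_t^{\alpha,\beta}(x,z) = \frac{2^{\alpha+\beta}\Gamma(\alpha+\beta+1)}{t^{\alpha+\beta}(xz)^{\alpha}} \int_0^{\infty} J_{\alpha+\beta}(ty)J_{\alpha}(xy) J_{\alpha}(zy) y^{1-\alpha-\beta}\, dy,$$ where the integral converges absolutely if $\alpha+\beta>1/2$ and otherwise is understood as a conditionally convergent (at $\infty$) improper Riemann integral. Define $$M_t^{\alpha,\beta}f(x)=\int_0^{\infty}K^{\alpha,\beta}_t(x,z)f(z)\, d\mu_{\alpha}(z),\qquad M^{\alpha,\beta}_{*,\mathrm{tru}}f(x) = \sup_{0 < t < x/2} \big|M^{\alpha,\beta}_t f(x) \big|,\qquad x\in\mathbb{R}_+.$$ The local Hardy--Littlewood maximal operator is $$Lf(x)=\sup_{0<t<x/2}\frac{1}{2t}\int_{x-t}^{x+t}|f(z)|\,dz .$$ The expression $z^{-\beta}f$ denotes the function $z\mapsto z^{-\beta}f(z)$. *)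

theory Defs
  imports "HOL-Analysis.Analysis"
begin

text \<open>
  Functions on \<open>(0, \<infinity>)\<close> are functions on \<^typ>\<open>real\<close> of which only the values on
  \<open>{0<..}\<close> are ever used. Functions are complex valued and Lebesgue measurable; maximal
  functions take values in \<^typ>\<open>ennreal\<close>.
\<close>

text \<open>
  For \<open>x > 0\<close>; \<^const>\<open>rGamma\<close> is the reciprocal Gamma function, so terms at poles of
  \<^const>\<open>Gamma\<close> vanish and every real order is covered.
\<close>
definition bessel_J :: "real \<Rightarrow> real \<Rightarrow> real" where
  "bessel_J \<nu> x =
     (\<Sum>m. (-1) ^ m * rGamma (real m + \<nu> + 1) / fact m * (x / 2) powr (2 * real m + \<nu>))"

definition power_measure :: "real \<Rightarrow> real measure" where
  "power_measure \<delta> = density (lebesgue_on {0<..}) (\<lambda>x. ennreal (x powr \<delta>))"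

abbreviation mu :: "real \<Rightarrow> real measure" where
  "mu \<alpha> \<equiv> power_measure (2 * \<alpha> + 1)"

text \<open>
  The integral over \<open>(0, \<infinity>)\<close> is improper at infinity, \<open>lim\<^sub>R \<integral>\<^sub>0\<^sup>R\<close>; this limit is the
  Lebesgue integral whenever the latter converges absolutely. For fixed \<open>t\<close> and \<open>x\<close>, the
  excluded values \<open>t = \<bar>x - z\<bar>\<close> and \<open>t = x + z\<close>, where the value of \<open>K\<close> below is irrelevant,
  form a null set of \<open>z\<close>.
\<close>
definition K :: "real \<Rightarrow> real \<Rightarrow> real \<Rightarrow> real \<Rightarrow> real \<Rightarrow> real" where
  "K \<alpha> \<beta> t x z =
     2 powr (\<alpha> + \<beta>) * Gamma (\<alpha> + \<beta> + 1) / (t powr (\<alpha> + \<beta>) * (x * z) powr \<alpha>) *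
     Lim at_top (\<lambda>R. LINT y:{0<..<R}|lborel.
       bessel_J (\<alpha> + \<beta>) (t * y) * bessel_J \<alpha> (x * y) * bessel_J \<alpha> (z * y)
         * y powr (1 - \<alpha> - \<beta>))"

definition M :: "real \<Rightarrow> real \<Rightarrow> real \<Rightarrow> (real \<Rightarrow> complex) \<Rightarrow> real \<Rightarrow> complex" where
  "M \<alpha> \<beta> t f x = (LINT z|mu \<alpha>. complex_of_real (K \<alpha> \<beta> t x z) * f z)"

text \<open>
  The Bochner integral is \<open>0\<close> by convention when it does not exist. To keep an upper bound for
  the maximal function from holding for that reason, the value is set to \<open>\<infinity>\<close> as soon as one
  of the integrals defining \<open>M \<alpha> \<beta> t f x\<close>, \<open>0 < t < x / 2\<close>, fails to exist.
\<close>
definition M_tru :: "real \<Rightarrow> real \<Rightarrow> (real \<Rightarrow> complex) \<Rightarrow> real \<Rightarrow> ennreal" where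
  "M_tru \<alpha> \<beta> f x =
     (SUP t\<in>{0<..<x / 2}.
        if integrable (mu \<alpha>) (\<lambda>z. complex_of_real (K \<alpha> \<beta> t x z) * f z)
        then ennreal (norm (M \<alpha> \<beta> t f x)) else \<infinity>)"

definition local_HL :: "(real \<Rightarrow> 'a::real_normed_vector) \<Rightarrow> real \<Rightarrow> ennreal" where
  "local_HL f x =
     (SUP t\<in>{0<..<x / 2}.
        ennreal (1 / (2 * t)) * (\<integral>\<^sup>+z\<in>{x - t..x + t}. ennreal (norm (f z)) \<partial>lebesgue))"

definition locally_integrable :: "(real \<Rightarrow> complex) \<Rightarrow> bool" where
  "locally_integrable f \<longleftrightarrow>
     (\<forall>S. compact S \<and> S \<subseteq> {0<..} \<longrightarrow> set_integrable lebesgue S f)"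

text \<open>Only used for \<open>p > 0\<close>.\<close>
definition ennpowr :: "ennreal \<Rightarrow> real \<Rightarrow> ennreal" where
  "ennpowr a p = (if a = \<infinity> then \<infinity> else ennreal (enn2real a powr p))"

definition Lp_norm :: "'a measure \<Rightarrow> real \<Rightarrow> ('a \<Rightarrow> ennreal) \<Rightarrow> ennreal" where
  "Lp_norm N p g = ennpowr (\<integral>\<^sup>+x. ennpowr (g x) p \<partial>N) (1 / p)"

definition in_Lp :: "'a measure \<Rightarrow> real \<Rightarrow> ('a \<Rightarrow> complex) \<Rightarrow> bool" where
  "in_Lp N p f \<longleftrightarrow>
     f \<in> borel_measurable N \<and> Lp_norm N p (\<lambda>x. ennreal (norm (f x))) < \<infinity>"

definition bounded_on_Lp ::
    "'a measure \<Rightarrow> real \<Rightarrow> (('a \<Rightarrow> complex) \<Rightarrow> 'a \<Rightarrow> ennreal) \<Rightarrow> bool" where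
  "bounded_on_Lp N p T \<longleftrightarrow>
     (\<exists>C>0. \<forall>f. in_Lp N p f \<longrightarrow>
        T f \<in> borel_measurable N \<and>
        Lp_norm N p (T f) \<le> ennreal C * Lp_norm N p (\<lambda>x. ennreal (norm (f x))))"

definition weak_type_1_1 ::
    "'a measure \<Rightarrow> (('a \<Rightarrow> complex) \<Rightarrow> 'a \<Rightarrow> ennreal) \<Rightarrow> bool" where
  "weak_type_1_1 N T \<longleftrightarrow>
     (\<exists>C>0. \<forall>f. in_Lp N 1 f \<longrightarrow>
        T f \<in> borel_measurable N \<and>
        (\<forall>s>0. ennreal s * emeasure N {x \<in> space N. T f x > ennreal s}
           \<le> ennreal C * Lp_norm N 1 (\<lambda>x. ennreal (norm (f x)))))"

end

theory Submission
  imports Defs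
begin

text \<open>
  Put \<open>\<mu> = \<alpha> + \<beta>\<close>, fix \<open>x\<close> and \<open>z\<close>, and regard the integral defining the kernel, up to a power of \<open>t\<close>, as the
  derivative at \<open>w = t\<^sup>2\<close> of a function \<open>F w\<close> given by an absolutely convergent integral of
  Bessel functions, the one in \<open>w\<close> having order \<open>\<mu> + 1\<close>; the asymptotics of Bessel functions give locally
  uniform convergence of the differentiated integral away from \<open>w = (x \<plusminus> z)\<^sup>2\<close>.
  By Weber's second exponential integral the Laplace transform of \<open>F\<close> is
  \<open>2 / q powr (\<mu> + 1) * exp (- q (x\<^sup>2 + z\<^sup>2)) * I\<^sub>\<alpha> (2 x z q)\<close>. Inserting Schlaefli's integral for
  \<open>I\<^sub>\<alpha>\<close> exhibits the same function as the Laplace transform of a constant times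
  the integral over \<open>0 \<le> \<phi> \<le> \<pi>\<close> of \<open>cos (\<alpha> \<phi>) * max 0 (w - x\<^sup>2 - z\<^sup>2 + 2 x z cos \<phi>) powr \<mu>\<close>, plus a function
  vanishing for \<open>w < (x + z)\<^sup>2\<close>. Since the Laplace transform is injective, this determines \<open>F\<close>, and
  differentiation shows that for \<open>t < x / 2\<close> the kernel vanishes if \<open>t < \<bar>x - z\<bar>\<close>, while for
  \<open>\<bar>x - z\<bar> < t\<close> it is, after multiplication by the density of the measure, at most a constant times
  \<open>(1 - ((x - z) / t)\<^sup>2) powr (\<mu> - 1 / 2) / t\<close>.

  For \<open>\<mu> \<ge> 1 / 2\<close> this is an average over \<open>(x - t, x + t)\<close>; otherwise Young's inequality with an
  exponent for which the profile is still integrable gives the bound by a power mean. The averages involve only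
  \<open>(x / 2, 3 x / 2)\<close>, where all power weights are essentially constant, so a covering argument
  gives their weak type \<open>(1, 1)\<close> and truncation the strong type. The maximal function is
  measurable because \<open>M\<^sub>t f x\<close> is continuous in \<open>t\<close>, so that the supremum may be restricted to rational
  \<open>t / x\<close>.
\<close>

section \<open>Bessel functions and oscillatory integrals\<close>

text \<open>For \<open>\<alpha> + \<beta> \<le> 1 / 2\<close> the kernel integral converges only
  conditionally, so Fubini cannot be applied to it. Its primitive in \<open>w\<close> carries a
  Bessel function of order one higher; the gain of a factor \<open>1 / y\<close> at infinity gives
  absolute convergence whenever \<open>\<alpha> + \<beta> > -1/2\<close>, at the price of one
  differentiation at the end. The variable \<open>w = t^2\<close> is used because the Laplace
  transform in \<open>w\<close> of \<open>w powr ((\<mu> + 1) / 2) * J_{\<mu>+1}(sqrt w * y)\<close>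
  is a Gaussian in \<open>y\<close> times a power of \<open>y\<close>, which is what Weber's
  integral requires. Schlaefli's integral replaces Poisson's, which stops at order
  \<open>-1/2\<close>, whereas \<alpha> ranges down to \<open>-1\<close>. The truncation
  \<open>t < x / 2\<close> has two effects. It forces \<open>t^2 < x^2 + z^2 < (x + z)^2\<close>, so
  the hyperbolic part of Schlaefli's integral and the singularity at \<open>(x + z)^2\<close> never
  enter, and only angles with \<open>cos \<phi> > 0\<close> contribute. It also makes
  \<open>z\<close> comparable with \<open>x\<close> wherever the kernel is nonzero, so that every
  power weight can be frozen at \<open>x\<close>.\<close>

definition bessel_coeff :: "real \<Rightarrow> nat \<Rightarrow> real" where
  "bessel_coeff \<nu> m = rGamma (real m + \<nu> + 1) / fact m"

text \<open>The entire factor common to both kinds of Bessel functions: the argument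
  \<open>- (x\<^sup>2 / 4)\<close> leads to \<open>bessel_J\<close>, the argument
  \<open>s\<^sup>2 / 4\<close> to the modified function, each up to a power. In this normalization
  differentiation is exactly a shift of the order by one.\<close>

definition bessel_P :: "real \<Rightarrow> real \<Rightarrow> real" where
  "bessel_P \<nu> s = (\<Sum>m. bessel_coeff \<nu> m * s ^ m)"

lemma bessel_coeff_pos: "\<nu> > -1 \<Longrightarrow> bessel_coeff \<nu> m > 0"
  unfolding bessel_coeff_def by (intro divide_pos_pos) (auto simp: rGamma_inverse_Gamma intro!: Gamma_real_pos)

lemma bessel_coeff_Suc: "real (Suc m) * bessel_coeff \<nu> (Suc m) = bessel_coeff (\<nu> + 1) m"
proof -
  have "real (Suc m) * (a / (real (Suc m) * b)) = a / b" for a b :: real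
    by simp
  moreover have "real (Suc m) + \<nu> + 1 = real m + (\<nu> + 1) + 1"
    by simp
  ultimately show ?thesis
    unfolding bessel_coeff_def fact_Suc of_nat_mult of_nat_fact by metis
qed

lemma bessel_coeff_rec: "(real m + \<nu> + 1) * bessel_coeff (\<nu> + 1) m = bessel_coeff \<nu> m"
proof -
  have "(real m + \<nu> + 1) * rGamma (real m + \<nu> + 1 + 1) = rGamma (real m + \<nu> + 1)"
    by (rule rGamma_plus1)
  then show ?thesis
    unfolding bessel_coeff_def by (simp add: field_simps)
qed

text \<open>Passing from \<open>rGamma u\<close> to \<open>rGamma (u + 1)\<close> divides by
  \<open>u\<close>, so the values decrease once \<open>u \<ge> 1\<close>. As
  \<open>\<nu> > -1\<close>, this is the case from the second value on, and the larger of the first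
  two values bounds all of them.\<close>

lemma bessel_coeff_bound:
  assumes "\<nu> > -1"
  obtains B where "B > 0" "\<And>m. bessel_coeff \<nu> m \<le> B / fact m"
proof
  let ?B = "max (rGamma (\<nu> + 1)) (rGamma (\<nu> + 2))"
  show "?B > 0"
    using assms by (auto simp: rGamma_inverse_Gamma less_max_iff_disj)
  have "rGamma (real m + \<nu> + 1) \<le> ?B" for m
  proof (induction m)
    case (Suc m)
    show ?case
    proof (cases "m = 0")
      case True
      then show ?thesis by (simp add: add_ac)
    next
      case False
      have "(real m + \<nu> + 1) * rGamma (real m + \<nu> + 1 + 1) = rGamma (real m + \<nu> + 1)"
        by (rule rGamma_plus1)
      moreover have "1 \<le> real m + \<nu> + 1" "rGamma (real m + \<nu> + 1 + 1) \<ge> 0"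
        using False assms by (auto simp: rGamma_inverse_Gamma intro!: less_imp_le[OF Gamma_real_pos])
      ultimately have "rGamma (real m + \<nu> + 1 + 1) \<le> rGamma (real m + \<nu> + 1)"
        by (metis mult_le_cancel_right1 not_less)
      with Suc show ?thesis by (simp add: algebra_simps)
    qed
  qed simp
  then show "bessel_coeff \<nu> m \<le> ?B / fact m" for m
    unfolding bessel_coeff_def by (intro divide_right_mono) auto
qed

lemma bessel_P_summable_norm:
  assumes "\<nu> > -1"
  shows "summable (\<lambda>m. norm (bessel_coeff \<nu> m * s ^ m))"
proof -
  obtain B where B: "B > 0" "\<And>m. bessel_coeff \<nu> m \<le> B / fact m"
    using bessel_coeff_bound[OF assms] by blast
  have "summable (\<lambda>m. B * (\<bar>s\<bar> ^ m /\<^sub>R fact m))"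
    by (intro summable_mult summable_exp_generic)
  then show ?thesis
  proof (rule summable_comparison_test')
    fix m :: nat
    have "norm (bessel_coeff \<nu> m * s ^ m) = bessel_coeff \<nu> m * \<bar>s\<bar> ^ m"
      using bessel_coeff_pos[OF assms, of m] by (simp add: abs_mult power_abs)
    also have "\<dots> \<le> (B / fact m) * \<bar>s\<bar> ^ m"
      by (intro mult_right_mono B) auto
    finally show "norm (norm (bessel_coeff \<nu> m * s ^ m)) \<le> B * (\<bar>s\<bar> ^ m /\<^sub>R fact m)"
      by (simp add: field_simps)
  qed
qed

lemma bessel_P_summable: "\<nu> > -1 \<Longrightarrow> summable (\<lambda>m. bessel_coeff \<nu> m * s ^ m)"
  using bessel_P_summable_norm by (rule summable_norm_cancel)

lemma bessel_P_sums: "\<nu> > -1 \<Longrightarrow> (\<lambda>m. bessel_coeff \<nu> m * s ^ m) sums bessel_P \<nu> s"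
  unfolding bessel_P_def using bessel_P_summable by (rule summable_sums)

lemma DERIV_bessel_P:
  assumes "\<nu> > -1"
  shows "(bessel_P \<nu> has_real_derivative bessel_P (\<nu> + 1) s) (at s)"
proof -
  have "((\<lambda>s. \<Sum>m. bessel_coeff \<nu> m * s ^ m) has_real_derivative (\<Sum>m. diffs (bessel_coeff \<nu>) m * s ^ m)) (at s)"
    using bessel_P_summable[OF assms] by (rule termdiffs_strong_converges_everywhere)
  moreover have "diffs (bessel_coeff \<nu>) = bessel_coeff (\<nu> + 1)"
    unfolding diffs_def using bessel_coeff_Suc by auto
  ultimately show ?thesis
    unfolding bessel_P_def[abs_def] by simp
qed

text \<open>Split the factor \<open>real m + \<nu> + 1\<close> of \<open>bessel_coeff_rec\<close>
  into \<open>\<nu> + 1\<close> and \<open>m\<close>; the factor \<open>m\<close> lowers the index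
  and raises the order. This single identity yields the three-term recurrences of \<open>J\<close>
  and \<open>I\<close> and the derivative of the primitive of the kernel integral.\<close>

lemma bessel_P_rec:
  assumes "\<nu> > -1"
  shows "bessel_P \<nu> s = (\<nu> + 1) * bessel_P (\<nu> + 1) s + s * bessel_P (\<nu> + 2) s"
proof -
  have 1: "(\<lambda>m. (\<nu> + 1) * (bessel_coeff (\<nu> + 1) m * s ^ m)) sums ((\<nu> + 1) * bessel_P (\<nu> + 1) s)"
    using assms by (intro sums_mult bessel_P_sums) auto
  have "(\<lambda>m. s * (bessel_coeff (\<nu> + 2) m * s ^ m)) sums (s * bessel_P (\<nu> + 2) s)"
    using assms by (intro sums_mult bessel_P_sums) auto
  moreover have "s * (bessel_coeff (\<nu> + 2) m * s ^ m) = (\<lambda>m. real m * bessel_coeff (\<nu> + 1) m * s ^ m) (Suc m)" for m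
    using bessel_coeff_Suc[of m "\<nu> + 1"] by (simp add: algebra_simps)
  ultimately have 2: "(\<lambda>m. real m * bessel_coeff (\<nu> + 1) m * s ^ m) sums (s * bessel_P (\<nu> + 2) s)"
    using sums_Suc_iff[of "\<lambda>m. real m * bessel_coeff (\<nu> + 1) m * s ^ m" "s * bessel_P (\<nu> + 2) s"] by simp
  have "(\<nu> + 1) * (bessel_coeff (\<nu> + 1) m * s ^ m) + real m * bessel_coeff (\<nu> + 1) m * s ^ m = bessel_coeff \<nu> m * s ^ m" for m
    unfolding bessel_coeff_rec[of m \<nu>, symmetric] by (simp add: algebra_simps)
  with sums_add[OF 1 2] bessel_P_sums[OF assms, of s] show ?thesis
    by (simp add: sums_unique2)
qed

lemma continuous_bessel_P [continuous_intros]: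
  assumes "\<nu> > -1" "continuous_on A f"
  shows "continuous_on A (\<lambda>x. bessel_P \<nu> (f x))"
proof -
  have "continuous_on UNIV (bessel_P \<nu>)"
    using DERIV_bessel_P[OF assms(1)] by (meson DERIV_isCont continuous_at_imp_continuous_on)
  then show ?thesis
    using assms(2) continuous_on_compose2 by blast
qed

lemma measurable_bessel_P [measurable]: "\<nu> > -1 \<Longrightarrow> bessel_P \<nu> \<in> borel_measurable borel"
  by (intro borel_measurable_continuous_onI continuous_bessel_P continuous_on_id) auto

lemma bessel_P_pos:
  assumes "\<nu> > -1" "s \<ge> 0"
  shows "bessel_P \<nu> s > 0"
proof -
  have "bessel_coeff \<nu> m * s ^ m \<ge> 0" for m
    using bessel_coeff_pos[OF assms(1), of m] assms(2) by auto
  then have "(\<Sum>m<1. bessel_coeff \<nu> m * s ^ m) \<le> bessel_P \<nu> s"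
    unfolding bessel_P_def by (intro sum_le_suminf bessel_P_summable assms) auto
  then show ?thesis
    using bessel_coeff_pos[OF assms(1), of 0] by simp
qed

lemma bessel_J_eq:
  assumes "\<nu> > -1" "x > 0"
  shows "bessel_J \<nu> x = (x / 2) powr \<nu> * bessel_P \<nu> (- (x\<^sup>2 / 4))"
proof -
  have "(-1) ^ m * rGamma (real m + \<nu> + 1) / fact m * (x / 2) powr (2 * real m + \<nu>)
      = (x / 2) powr \<nu> * (bessel_coeff \<nu> m * (- (x\<^sup>2 / 4)) ^ m)" for m
  proof -
    have "(x / 2) powr (2 * real m + \<nu>) = (x / 2) powr \<nu> * (x / 2) ^ (2 * m)"
    proof -
      have "(x / 2) powr (2 * real m) = (x / 2) ^ (2 * m)"
        using assms powr_realpow[of "x / 2" "2 * m"] by simp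
      then show ?thesis
        by (simp add: powr_add)
    qed
    moreover have "(- (x\<^sup>2 / 4)) ^ m = (-1) ^ m * (x / 2) ^ (2 * m)"
    proof -
      have "x\<^sup>2 / 4 = (x / 2)\<^sup>2"
        by (simp add: power_divide)
      then show ?thesis
        by (metis power_minus power_mult)
    qed
    ultimately show ?thesis
      unfolding bessel_coeff_def by simp
  qed
  then show ?thesis
    unfolding bessel_J_def bessel_P_def
    using suminf_mult[OF bessel_P_summable[OF assms(1)], of "(x / 2) powr \<nu>" "- (x\<^sup>2 / 4)"] by simp
qed

lemma DERIV_bessel_J:
  assumes "\<nu> > -1" "x > 0"
  shows "(bessel_J \<nu> has_real_derivative (\<nu> / x * bessel_J \<nu> x - bessel_J (\<nu> + 1) x)) (at x)"
proof -
  have "((\<lambda>x. (x / 2) powr \<nu> * bessel_P \<nu> (- (x\<^sup>2 / 4))) has_real_derivative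
      (\<nu> / x * bessel_J \<nu> x - bessel_J (\<nu> + 1) x)) (at x)"
    using assms 
    apply (auto intro!: derivative_eq_intros DERIV_chain2[OF DERIV_bessel_P] simp: bessel_J_eq powr_diff powr_add)
    apply (simp add: field_simps power2_eq_square)
    done
  then show ?thesis
    apply (rule has_field_derivative_transform_within_open[where S="{0<..}"])
    using assms by (auto simp: bessel_J_eq)
qed

lemma bessel_J_rec:
  assumes "\<nu> > -1" "x > 0"
  shows "bessel_J (\<nu> + 2) x = 2 * (\<nu> + 1) / x * bessel_J (\<nu> + 1) x - bessel_J \<nu> x"
proof -
  define A where "A = (x / 2) powr \<nu>"
  have "bessel_J (\<nu> + 2) x = A * (x / 2)\<^sup>2 * bessel_P (\<nu> + 2) (- (x\<^sup>2 / 4))"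
    "bessel_J (\<nu> + 1) x = A * (x / 2) * bessel_P (\<nu> + 1) (- (x\<^sup>2 / 4))"
    "bessel_J \<nu> x = A * bessel_P \<nu> (- (x\<^sup>2 / 4))"
    using assms by (simp_all add: bessel_J_eq powr_add A_def)
  note e = this
  show ?thesis
    unfolding e bessel_P_rec[OF assms(1), of "- (x\<^sup>2 / 4)"]
    using assms(2) by (simp add: field_simps power2_eq_square)
qed

text \<open>Together with \<open>DERIV_bessel_J\<close> this makes the orders \<open>\<nu>\<close>
  and \<open>\<nu> + 1\<close> a closed linear first-order system, which takes the place of Bessel's
  differential equation.\<close>

lemma DERIV_bessel_J':
  assumes "\<nu> > -1" "x > 0"
  shows "(bessel_J (\<nu> + 1) has_real_derivative (bessel_J \<nu> x - (\<nu> + 1) / x * bessel_J (\<nu> + 1) x)) (at x)"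
proof -
  have *: "(\<nu> + 1) / x * bessel_J (\<nu> + 1) x - bessel_J (\<nu> + 1 + 1) x
      = bessel_J \<nu> x - (\<nu> + 1) / x * bessel_J (\<nu> + 1) x"
    using bessel_J_rec[OF assms] assms by (simp add: field_simps)
  show ?thesis
    using DERIV_bessel_J[of "\<nu> + 1" x] assms unfolding * by simp
qed

section \<open>Asymptotics of Bessel functions at infinity\<close>

text \<open>The barriers \<open>f y - M / y\<close> and \<open>f y + M / y\<close> are increasing
  and decreasing, and the first lies below the second. The supremum of the lower barrier therefore
  separates them, and it is the limit together with its rate.\<close>

lemma limit_rate:
  fixes f f' :: "real \<Rightarrow> real" and M :: real
  assumes der: "\<And>y. y \<ge> 1 \<Longrightarrow> (f has_real_derivative f' y) (at y)"
    and bound: "\<And>y. y \<ge> 1 \<Longrightarrow> \<bar>f' y\<bar> \<le> M / y\<^sup>2"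
  obtains a where "\<And>y. y \<ge> 1 \<Longrightarrow> \<bar>f y - a\<bar> \<le> M / y"
proof -
  have M: "M \<ge> 0"
    using bound[of 1] by simp
  have up: "f y - M / y \<le> f z - M / z" if "1 \<le> y" "y \<le> z" for y z
  proof (rule DERIV_nonneg_imp_nondecreasing[OF that(2)])
    fix t assume "y \<le> t" "t \<le> z"
    then have t: "t \<ge> 1" using that by simp
    have "((\<lambda>y. f y - M / y) has_real_derivative f' t + M / t\<^sup>2) (at t)"
      using t by (auto intro!: derivative_eq_intros der simp: power2_eq_square)
    moreover have "f' t + M / t\<^sup>2 \<ge> 0"
      using bound[OF t] by linarith
    ultimately show "\<exists>d. ((\<lambda>y. f y - M / y) has_real_derivative d) (at t) \<and> d \<ge> 0"
      by blast
  qed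
  have down: "f z + M / z \<le> f y + M / y" if "1 \<le> y" "y \<le> z" for y z
  proof (rule DERIV_nonpos_imp_nonincreasing[OF that(2)])
    fix t assume "y \<le> t" "t \<le> z"
    then have t: "t \<ge> 1" using that by simp
    have "((\<lambda>y. f y + M / y) has_real_derivative f' t - M / t\<^sup>2) (at t)"
      using t by (auto intro!: derivative_eq_intros der simp: power2_eq_square)
    moreover have "f' t - M / t\<^sup>2 \<le> 0"
      using bound[OF t] by linarith
    ultimately show "\<exists>d. ((\<lambda>y. f y + M / y) has_real_derivative d) (at t) \<and> d \<le> 0"
      by blast
  qed
  have le: "f y - M / y \<le> f z + M / z" if "1 \<le> y" "1 \<le> z" for y z
  proof -
    have "M / y \<ge> 0" "M / z \<ge> 0" using that M by auto
    then show ?thesis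
      using up[of y z] down[of z y] that by (cases "y \<le> z") linarith+
  qed
  define a where "a = Sup ((\<lambda>y. f y - M / y) ` {1..})"
  have "f y - M / y \<le> a" if "1 \<le> y" for y
    unfolding a_def using le[OF _ order.refl] that
    by (intro cSup_upper bdd_aboveI[of _ "f 1 + M / 1"]) auto
  moreover have "a \<le> f y + M / y" if "1 \<le> y" for y
    unfolding a_def using le[OF _ that] by (intro cSup_least) auto
  ultimately have "\<bar>f y - a\<bar> \<le> M / y" if "1 \<le> y" for y
    using that by (smt (verit))
  then show thesis by (rule that)
qed

text \<open>After multiplication by \<open>sqrt y\<close> Bessel's equation is a harmonic oscillator
  with the integrable perturbation \<open>c / y\<^sup>2\<close>. An energy estimate bounds the
  solution, and variation of constants shows that its amplitudes converge at rate
  \<open>1 / y\<close>.\<close>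

lemma bessel_J_asymptotics:
  assumes \<nu>: "\<nu> > -1"
  obtains a b C where "C > 0"
    "\<And>y. y \<ge> 1 \<Longrightarrow> \<bar>sqrt y * bessel_J \<nu> y\<bar> \<le> C"
    "\<And>y. y \<ge> 1 \<Longrightarrow> \<bar>sqrt y * bessel_J \<nu> y - (a * cos y + b * sin y)\<bar> \<le> C / y"
proof -
  define c where "c = \<nu>\<^sup>2 - 1 / 4"
  define u where "u = (\<lambda>y. sqrt y * bessel_J \<nu> y)"
  \<comment> \<open>This is the derivative of \<open>u\<close>; with \<open>c\<close> as above,
    \<open>u'' = (c / y\<^sup>2 - 1) * u\<close>.\<close>
  define v where "v = (\<lambda>y. sqrt y * ((\<nu> + 1 / 2) / y * bessel_J \<nu> y - bessel_J (\<nu> + 1) y))"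
  have sq: "sqrt y * sqrt y = y" if "y > 0" for y
    using that by simp
  have du: "(u has_real_derivative v y) (at y)" if "y > 0" for y
    unfolding u_def v_def using that \<nu>
    apply (auto intro!: derivative_eq_intros DERIV_bessel_J)
    using sq[of y] by (simp add: field_simps)
  have dv: "(v has_real_derivative (c / y\<^sup>2 - 1) * u y) (at y)" if "y > 0" for y
    unfolding u_def v_def c_def using that \<nu>
    apply (auto intro!: derivative_eq_intros DERIV_bessel_J DERIV_bessel_J')
    subgoal premises p
    proof -
      define r where "r = sqrt y"
      have r: "r > 0" "y = r * r" using p by (auto simp: r_def)
      show ?thesis
        unfolding r_def[symmetric] unfolding r(2) using r(1) by (simp add: divide_simps power2_eq_square) (simp add: algebra_simps)
    qed
    done
  define C0 where "C0 = \<bar>c\<bar>"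
  define E where "E = (\<lambda>y. ((u y)\<^sup>2 + (v y)\<^sup>2))"
  \<comment> \<open>The oscillator preserves \<open>E\<close>, so only the perturbation contributes
    to its derivative, which is at most \<open>C0 * E y / y\<^sup>2\<close> by
    \<open>2 * u * v \<le> u\<^sup>2 + v\<^sup>2\<close>. The factor \<open>exp (C0 / y)\<close> has
    logarithmic derivative \<open>- C0 / y\<^sup>2\<close> and compensates this growth.\<close>
  have E_le: "E y * exp (C0 / y) \<le> E 1 * exp (C0 / 1)" if "y \<ge> 1" for y
  proof (rule DERIV_nonpos_imp_nonincreasing[OF that])
    fix t :: real assume "1 \<le> t" "t \<le> y"
    then have t: "t > 0" by simp
    have "((\<lambda>y. E y * exp (C0 / y)) has_real_derivative
       (2 * u t * v t + 2 * v t * ((c / t\<^sup>2 - 1) * u t)) * exp (C0 / t) - C0 / t\<^sup>2 * (E t * exp (C0 / t))) (at t)"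
      unfolding E_def using t
      by (auto intro!: derivative_eq_intros du dv simp: power2_eq_square algebra_simps)
    moreover have "(2 * u t * v t + 2 * v t * ((c / t\<^sup>2 - 1) * u t)) * exp (C0 / t) - C0 / t\<^sup>2 * (E t * exp (C0 / t))
       = (c * (2 * u t * v t) - C0 * E t) * (exp (C0 / t) / t\<^sup>2)"
      using t by (simp add: field_simps)
    moreover have "c * (2 * u t * v t) - C0 * E t \<le> 0"
    proof -
      have "\<bar>2 * u t * v t\<bar> \<le> E t"
        unfolding E_def using sum_squares_bound[of "\<bar>u t\<bar>" "\<bar>v t\<bar>"] by (simp add: abs_mult)
      then have "\<bar>c * (2 * u t * v t)\<bar> \<le> C0 * E t"
        unfolding C0_def abs_mult[of c] by (intro mult_left_mono) auto
      then show ?thesis by linarith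
    qed
    ultimately show "\<exists>d. ((\<lambda>y. E y * exp (C0 / y)) has_real_derivative d) (at t) \<and> d \<le> 0"
      by (metis divide_nonneg_nonneg exp_ge_zero mult_nonpos_nonneg zero_le_power2)
  qed
  define B where "B = sqrt (E 1 * exp C0) + 1"
  have B: "B > 0"
    unfolding B_def E_def by (simp add: add_nonneg_pos)
  have uB: "\<bar>u y\<bar> \<le> B" if "y \<ge> 1" for y
  proof -
    have "(u y)\<^sup>2 \<le> E y * exp 0"
      unfolding E_def by simp
    also have "\<dots> \<le> E y * exp (C0 / y)"
      using that unfolding E_def C0_def by (intro mult_left_mono) auto
    also have "\<dots> \<le> E 1 * exp C0"
      using E_le[OF that] by simp
    finally have "sqrt ((u y)\<^sup>2) \<le> sqrt (E 1 * exp C0)"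
      by (rule real_sqrt_le_mono)
    then show ?thesis unfolding B_def by simp
  qed
  have bd: "\<bar>c * u y / y\<^sup>2 * t\<bar> \<le> C0 * B / y\<^sup>2" if "y \<ge> 1" "\<bar>t\<bar> \<le> 1" for y t
  proof -
    have "\<bar>c * u y / y\<^sup>2 * t\<bar> = \<bar>c\<bar> * \<bar>u y\<bar> * \<bar>t\<bar> / y\<^sup>2"
      by (simp add: abs_mult)
    also have "\<dots> \<le> \<bar>c\<bar> * B * 1 / y\<^sup>2"
      using uB[of y] that B by (intro divide_right_mono mult_mono) auto
    finally show ?thesis by (simp add: C0_def)
  qed
  \<comment> \<open>In a frame rotating with the unperturbed oscillator the main terms cancel and
    the derivative is \<open>c * u y / y\<^sup>2\<close> times a sine or cosine. The limits of the
    two rotated coordinates are the coefficients of \<open>cos\<close> and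
    \<open>sin\<close>.\<close>
  obtain a where a: "\<And>y. y \<ge> 1 \<Longrightarrow> \<bar>(u y * cos y - v y * sin y) - a\<bar> \<le> C0 * B / y"
  proof (rule limit_rate)
    fix y :: real assume y: "y \<ge> 1"
    show "((\<lambda>y. u y * cos y - v y * sin y) has_real_derivative (c * u y / y\<^sup>2 * (- sin y))) (at y)"
      using y by (auto intro!: derivative_eq_intros du dv simp: field_simps)
    show "\<bar>c * u y / y\<^sup>2 * (- sin y)\<bar> \<le> C0 * B / y\<^sup>2"
      using y by (intro bd) auto
  qed blast
  obtain b where b: "\<And>y. y \<ge> 1 \<Longrightarrow> \<bar>(u y * sin y + v y * cos y) - b\<bar> \<le> C0 * B / y"
  proof (rule limit_rate)
    fix y :: real assume y: "y \<ge> 1"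
    show "((\<lambda>y. u y * sin y + v y * cos y) has_real_derivative (c * u y / y\<^sup>2 * cos y)) (at y)"
      using y by (auto intro!: derivative_eq_intros du dv simp: field_simps)
    show "\<bar>c * u y / y\<^sup>2 * cos y\<bar> \<le> C0 * B / y\<^sup>2"
      using y by (intro bd) auto
  qed blast
  have main: "\<bar>u y - (a * cos y + b * sin y)\<bar> \<le> 2 * C0 * B / y" if y: "y \<ge> 1" for y
  proof -
    have "u y * (cos y)\<^sup>2 + u y * (sin y)\<^sup>2 = u y"
      by (simp flip: distrib_left)
    then have "u y - (a * cos y + b * sin y) = (u y * cos y - v y * sin y - a) * cos y + (u y * sin y + v y * cos y - b) * sin y"
      by (simp add: algebra_simps power2_eq_square)
    also have "\<bar>\<dots>\<bar> \<le> C0 * B / y * 1 + C0 * B / y * 1"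
      using a[OF y] b[OF y]
      by (intro order.trans[OF abs_triangle_ineq] add_mono) (auto simp only: abs_mult intro!: mult_mono abs_cos_le_one abs_sin_le_one abs_ge_zero order.trans[OF abs_ge_zero])
    finally show ?thesis by (simp add: mult_ac)
  qed
  have CB: "2 * C0 * B \<ge> 0"
    using B by (simp add: C0_def)
  show thesis
  proof (rule that[of "B + 2 * C0 * B"])
    show "B + 2 * C0 * B > 0"
      using B by (simp add: C0_def add_pos_nonneg)
    fix y :: real assume y: "y \<ge> 1"
    show "\<bar>sqrt y * bessel_J \<nu> y\<bar> \<le> B + 2 * C0 * B"
      using uB[OF y] CB unfolding u_def by linarith
    show "\<bar>sqrt y * bessel_J \<nu> y - (a * cos y + b * sin y)\<bar> \<le> (B + 2 * C0 * B) / y"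
      using main[OF y] divide_pos_pos[OF B, of y] y unfolding u_def add_divide_distrib by linarith
  qed
qed

lemma bessel_P_bounds:
  assumes "\<omega> > -1"
  obtains C where "C > 0" "\<And>s. 0 \<le> s \<Longrightarrow> s \<le> 1 \<Longrightarrow> \<bar>bessel_P \<omega> (- (s\<^sup>2 / 4))\<bar> \<le> C"
    "\<And>s. 1 \<le> s \<Longrightarrow> \<bar>bessel_P \<omega> (- (s\<^sup>2 / 4))\<bar> \<le> C * s powr (- \<omega> - 1 / 2)"
proof -
  have "continuous_on {0..1} (\<lambda>s. bessel_P \<omega> (- (s\<^sup>2 / 4)))"
    using assms by (intro continuous_intros) auto
  then have "bounded ((\<lambda>s. bessel_P \<omega> (- (s\<^sup>2 / 4))) ` {0..1})"
    by (intro compact_imp_bounded compact_continuous_image) auto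
  then obtain B where "\<forall>p\<in>(\<lambda>s. bessel_P \<omega> (- (s\<^sup>2 / 4))) ` {0..1}. \<bar>p\<bar> \<le> B"
    unfolding bounded_real ..
  then have B: "\<And>s. 0 \<le> s \<Longrightarrow> s \<le> 1 \<Longrightarrow> \<bar>bessel_P \<omega> (- (s\<^sup>2 / 4))\<bar> \<le> B"
    by simp
  obtain a b C where C: "C > 0" "\<And>y. y \<ge> 1 \<Longrightarrow> \<bar>sqrt y * bessel_J \<omega> y\<bar> \<le> C"
    by (rule bessel_J_asymptotics[OF assms]) (rule that)
  show thesis
  proof (rule that[of "max B (2 powr \<omega> * C)"])
    show "max B (2 powr \<omega> * C) > 0" using C by (simp add: less_max_iff_disj)
    fix s :: real assume s: "1 \<le> s"
    have "\<bar>bessel_P \<omega> (- (s\<^sup>2 / 4))\<bar> = 2 powr \<omega> * \<bar>sqrt s * bessel_J \<omega> s\<bar> * s powr (- \<omega> - 1 / 2)"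
    proof -
      have "\<bar>sqrt s * bessel_J \<omega> s\<bar> = s powr (1 / 2) * (s powr \<omega> / 2 powr \<omega> * \<bar>bessel_P \<omega> (- (s\<^sup>2 / 4))\<bar>)"
        using s assms by (simp add: bessel_J_eq powr_half_sqrt abs_mult powr_divide)
      moreover have "s powr (1 / 2) * s powr \<omega> * s powr (- \<omega> - 1 / 2) = 1"
        using s by (simp flip: powr_add)
      ultimately show ?thesis
      proof -
        have "2 powr \<omega> * (A * (B / 2 powr \<omega> * p)) * c = (A * B * c) * p" for A B p c :: real
          by (simp add: field_simps)
        then show ?thesis
          using \<open>s powr (1 / 2) * s powr \<omega> * s powr (- \<omega> - 1 / 2) = 1\<close>
            \<open>\<bar>sqrt s * bessel_J \<omega> s\<bar> = s powr (1 / 2) * (s powr \<omega> / 2 powr \<omega> * \<bar>bessel_P \<omega> (- (s\<^sup>2 / 4))\<bar>)\<close>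
          by simp
      qed
    qed
    also have "\<dots> \<le> 2 powr \<omega> * C * s powr (- \<omega> - 1 / 2)"
      using C(2)[OF s] by (intro mult_right_mono mult_left_mono) auto
    also have "\<dots> \<le> max B (2 powr \<omega> * C) * s powr (- \<omega> - 1 / 2)"
      by (intro mult_right_mono) auto
    finally show "\<bar>bessel_P \<omega> (- (s\<^sup>2 / 4))\<bar> \<le> max B (2 powr \<omega> * C) * s powr (- \<omega> - 1 / 2)" .
  next
    fix s :: real assume "0 \<le> s" "s \<le> 1"
    then have "\<bar>bessel_P \<omega> (- (s\<^sup>2 / 4))\<bar> \<le> B" by (rule B)
    then show "\<bar>bessel_P \<omega> (- (s\<^sup>2 / 4))\<bar> \<le> max B (2 powr \<omega> * C)" by linarith
  qed
qed

section \<open>Oscillatory integrals and the tail of the triple Bessel product\<close>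

lemma integral_powr_Icc:
  fixes s R R' :: real
  assumes "0 < R" "R \<le> R'" "s > 0"
  shows "((\<lambda>y. y powr (- s - 1)) has_integral (R powr (- s) - R' powr (- s)) / s) {R..R'}"
proof -
  have "((\<lambda>y. y powr (- s - 1)) has_integral (- (R' powr (- s)) / s - (- (R powr (- s)) / s))) {R..R'}"
  proof (rule fundamental_theorem_of_calculus[OF assms(2)])
    fix y assume "y \<in> {R..R'}"
    then have "((\<lambda>y. - (y powr (- s)) / s) has_real_derivative (y powr (- s - 1))) (at y)"
      using assms by (auto intro!: derivative_eq_intros simp: field_simps)
    then show "((\<lambda>y. - (y powr (- s)) / s) has_vector_derivative y powr (- s - 1)) (at y within {R..R'})"
      by (metis has_real_derivative_iff_has_vector_derivative has_vector_derivative_at_within)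
  qed
  then show ?thesis
    by (simp add: diff_divide_distrib)
qed

text \<open>One integration by parts gains \<open>1 / \<bar>\<omega>\<bar>\<close>. The remaining
  integrand \<open>y powr (- s - 1)\<close> is estimated by its exact integral, whose
  \<open>R'\<close> term cancels the boundary term at \<open>R'\<close>; this leaves
  \<open>2 * R powr (- s)\<close>.\<close>

lemma oscillatory_integral_bound:
  fixes s \<omega> R R' :: real
  assumes s: "s > 0" and \<omega>: "\<omega> \<noteq> 0" and R: "0 < R" "R \<le> R'"
  shows "norm (integral {R..R'} (\<lambda>y. y powr (- s) * cis (\<omega> * y))) \<le> 2 * R powr (- s) / \<bar>\<omega>\<bar>"
proof -
  define f where "f = (\<lambda>y. of_real (y powr (- s)) * cis (\<omega> * y) / (\<i> * of_real \<omega>))"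
  define g where "g = (\<lambda>y. of_real (y powr (- s - 1)) * cis (\<omega> * y))"
  define h where "h = (\<lambda>y. of_real (y powr (- s)) * cis (\<omega> * y))"
  have *: "((\<lambda>y. h y - of_real s / (\<i> * of_real \<omega>) * g y) has_integral (f R' - f R)) {R..R'}"
  proof (rule fundamental_theorem_of_calculus[OF R(2)])
    fix y assume "y \<in> {R..R'}"
    then have y: "y > 0" using R by auto
    have d1: "((\<lambda>y. cis (\<omega> * y)) has_vector_derivative \<omega> *\<^sub>R (\<i> * cis (\<omega> * y))) (at y within A)" for A
    proof -
      have "((\<lambda>y. cos (\<omega> * y)) has_vector_derivative (- \<omega> * sin (\<omega> * y))) (at y within A)"
        "((\<lambda>y. sin (\<omega> * y)) has_vector_derivative (\<omega> * cos (\<omega> * y))) (at y within A)"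
        by (auto intro!: derivative_eq_intros simp: has_real_derivative_iff_has_vector_derivative[symmetric])
      then have "((\<lambda>y. of_real (cos (\<omega> * y)) + \<i> * of_real (sin (\<omega> * y))) has_vector_derivative
          of_real (- \<omega> * sin (\<omega> * y)) + \<i> * of_real (\<omega> * cos (\<omega> * y))) (at y within A)"
        by (intro has_vector_derivative_add has_vector_derivative_mult_right has_vector_derivative_of_real)
           (simp_all only: has_real_derivative_iff_has_vector_derivative)
      moreover have "of_real (cos (\<omega> * y)) + \<i> * of_real (sin (\<omega> * y)) = cis (\<omega> * y)" for y
        by (simp add: complex_eq_iff)
      moreover have "of_real (- \<omega> * sin (\<omega> * y)) + \<i> * of_real (\<omega> * cos (\<omega> * y)) = \<omega> *\<^sub>R (\<i> * cis (\<omega> * y))"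
        by (simp add: complex_eq_iff)
      ultimately show ?thesis by simp
    qed
    have d2: "((\<lambda>y. y powr (- s)) has_real_derivative (- s * y powr (- s - 1))) (at y within A)" for A
      using has_real_derivative_powr[OF y, of "- s"]
      by (rule has_field_derivative_at_within)
    have "((\<lambda>y. of_real (y powr (- s)) * cis (\<omega> * y) / (\<i> * of_real \<omega>)) has_vector_derivative
       (of_real (y powr (- s)) * (\<omega> *\<^sub>R (\<i> * cis (\<omega> * y))) + of_real (- s * y powr (- s - 1)) * cis (\<omega> * y)) / (\<i> * of_real \<omega>))
       (at y within {R..R'})"
      by (intro has_vector_derivative_divide has_vector_derivative_mult has_vector_derivative_of_real d1 d2)
    moreover have "(of_real (y powr (- s)) * (\<omega> *\<^sub>R (\<i> * cis (\<omega> * y))) + of_real (- s * y powr (- s - 1)) * cis (\<omega> * y)) / (\<i> * of_real \<omega>)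
        = h y - of_real s / (\<i> * of_real \<omega>) * g y"
    proof -
      have "(A * (w * (\<i> * c)) + - r * B * c) / (\<i> * w) = A * c - r / (\<i> * w) * (B * c)" if "w \<noteq> 0" for A B c w r :: complex
        using that by (simp add: field_simps)
      then show ?thesis
        using \<omega> by (simp add: h_def g_def scaleR_conv_of_real)
    qed
    ultimately show "(f has_vector_derivative (h y - of_real s / (\<i> * of_real \<omega>) * g y)) (at y within {R..R'})"
      unfolding f_def by simp
  qed
  have gi: "g integrable_on {R..R'}" "h integrable_on {R..R'}"
    unfolding g_def h_def using R by (auto intro!: integrable_continuous_real continuous_intros)
  have eq: "integral {R..R'} h = f R' - f R + of_real s / (\<i> * of_real \<omega>) * integral {R..R'} g"
  proof -
    have "integral {R..R'} (\<lambda>y. h y - of_real s / (\<i> * of_real \<omega>) * g y) = f R' - f R"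
      using * by (rule integral_unique)
    moreover have "integral {R..R'} (\<lambda>y. h y - of_real s / (\<i> * of_real \<omega>) * g y)
       = integral {R..R'} h - of_real s / (\<i> * of_real \<omega>) * integral {R..R'} g"
      using gi(1) by (subst integral_diff[OF gi(2)]) (rule integrable_on_mult_right, assumption, simp)
    ultimately show ?thesis by simp
  qed
  have "norm (integral {R..R'} g) \<le> integral {R..R'} (\<lambda>y. y powr (- s - 1))"
    using integral_powr_Icc[OF R s] gi
    by (intro integral_norm_bound_integral) (auto simp: g_def norm_mult integrable_on_def)
  also have "\<dots> = (R powr (- s) - R' powr (- s)) / s"
    using integral_powr_Icc[OF R s] by (rule integral_unique)
  finally have G: "norm (integral {R..R'} g) \<le> (R powr (- s) - R' powr (- s)) / s" .
  have F: "norm (f y) = y powr (- s) / \<bar>\<omega>\<bar>" for y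
    unfolding f_def by (simp add: norm_mult norm_divide)
  have "norm (integral {R..R'} h) \<le> norm (f R') + norm (f R) + s / \<bar>\<omega>\<bar> * norm (integral {R..R'} g)"
  proof -
    have "norm (of_real s / (\<i> * of_real \<omega>) * integral {R..R'} g) = s / \<bar>\<omega>\<bar> * norm (integral {R..R'} g)"
      using s by (simp add: norm_mult norm_divide)
    then show ?thesis
      unfolding eq using norm_triangle_ineq[of "f R' - f R" "of_real s / (\<i> * of_real \<omega>) * integral {R..R'} g"]
        norm_triangle_ineq4[of "f R'" "f R"] by linarith
  qed
  also have "\<dots> \<le> norm (f R') + norm (f R) + s / \<bar>\<omega>\<bar> * ((R powr (- s) - R' powr (- s)) / s)"
    using G s by (intro add_left_mono mult_left_mono) auto
  also have "\<dots> = 2 * R powr (- s) / \<bar>\<omega>\<bar>"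
    using s \<omega> unfolding F by (simp add: field_simps)
  finally show ?thesis by (simp add: h_def)
qed

lemma trig_expansion:
  "of_real (a * cos t + b * sin t) = (\<Sum>\<sigma>\<in>{-1, 1}. (of_real a - \<i> * of_real (\<sigma> * b)) / 2 * cis (\<sigma> * t))"
proof -
  have "(of_real a - \<i> * of_real (- 1 * b)) / 2 * cis (- 1 * t) + (of_real a - \<i> * of_real (1 * b)) / 2 * cis (1 * t)
      = of_real (a * cos t + b * sin t)"
  proof (rule complex_eqI)
    show "Im ((of_real a - \<i> * of_real (- 1 * b)) / 2 * cis (- 1 * t) + (of_real a - \<i> * of_real (1 * b)) / 2 * cis (1 * t))
      = Im (of_real (a * cos t + b * sin t))"
      by simp argo
  qed simp
  then show ?thesis by simp
qed

text \<open>The product expands into eight exponentials whose frequencies are the signed sums of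
  \<open>t\<close>, \<open>x\<close> and \<open>z\<close>. The constant depends only on the
  amplitudes, so the estimate is uniform as long as all eight frequencies stay away from zero by
  \<delta>.\<close>

lemma triple_trig_integral_bound:
  fixes a1 a2 a3 b1 b2 b3 s :: real
  assumes s: "s > 0"
  obtains C where "C \<ge> 0"
    "\<And>t x z \<delta> R R'. 0 < R \<Longrightarrow> R \<le> R' \<Longrightarrow> \<delta> > 0 \<Longrightarrow>
       (\<And>\<sigma>1 \<sigma>2 \<sigma>3. \<sigma>1 \<in> {-1, 1} \<Longrightarrow> \<sigma>2 \<in> {-1, 1} \<Longrightarrow> \<sigma>3 \<in> {-1, 1} \<Longrightarrow> \<delta> \<le> \<bar>\<sigma>1 * t + \<sigma>2 * x + \<sigma>3 * z\<bar>) \<Longrightarrow>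
       \<bar>integral {R..R'} (\<lambda>y. y powr (- s) * ((a1 * cos (t * y) + b1 * sin (t * y)) *
          (a2 * cos (x * y) + b2 * sin (x * y)) * (a3 * cos (z * y) + b3 * sin (z * y))))\<bar> \<le> C * R powr (- s) / \<delta>"
proof -
  define S where "S = {-1, 1 :: real}"
  define k where "k = (\<lambda>a b \<sigma>. (of_real a - \<i> * of_real (\<sigma> * b)) / 2 :: complex)"
  define c where "c = (\<lambda>\<sigma>1 \<sigma>2 \<sigma>3. k a1 b1 \<sigma>1 * k a2 b2 \<sigma>2 * k a3 b3 \<sigma>3)"
  define C where "C = (\<Sum>\<sigma>1\<in>S. \<Sum>\<sigma>2\<in>S. \<Sum>\<sigma>3\<in>S. norm (c \<sigma>1 \<sigma>2 \<sigma>3) * 2)"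
  show thesis
  proof (rule that[of C])
    show "C \<ge> 0" unfolding C_def by (intro sum_nonneg) auto
    fix t x z \<delta> R R' :: real
    assume R: "0 < R" "R \<le> R'" and \<delta>: "\<delta> > 0"
      and sep: "\<And>\<sigma>1 \<sigma>2 \<sigma>3. \<sigma>1 \<in> {-1, 1} \<Longrightarrow> \<sigma>2 \<in> {-1, 1} \<Longrightarrow> \<sigma>3 \<in> {-1, 1} \<Longrightarrow> \<delta> \<le> \<bar>\<sigma>1 * t + \<sigma>2 * x + \<sigma>3 * z\<bar>"
    define f where "f = (\<lambda>y. y powr (- s) * ((a1 * cos (t * y) + b1 * sin (t * y)) *
          (a2 * cos (x * y) + b2 * sin (x * y)) * (a3 * cos (z * y) + b3 * sin (z * y))))"
    define h where "h = (\<lambda>\<sigma>1 \<sigma>2 \<sigma>3 y. c \<sigma>1 \<sigma>2 \<sigma>3 * (of_real (y powr (- s)) * cis ((\<sigma>1 * t + \<sigma>2 * x + \<sigma>3 * z) * y)))"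
    have f_eq: "of_real (f y) = (\<Sum>\<sigma>1\<in>S. \<Sum>\<sigma>2\<in>S. \<Sum>\<sigma>3\<in>S. h \<sigma>1 \<sigma>2 \<sigma>3 y)" for y
    proof -
      have "of_real (f y) = of_real (y powr (- s)) * ((\<Sum>\<sigma>\<in>S. k a1 b1 \<sigma> * cis (\<sigma> * (t * y))) *
         (\<Sum>\<sigma>\<in>S. k a2 b2 \<sigma> * cis (\<sigma> * (x * y))) * (\<Sum>\<sigma>\<in>S. k a3 b3 \<sigma> * cis (\<sigma> * (z * y))))"
        unfolding f_def S_def k_def trig_expansion[symmetric] by simp
      also have "\<dots> = (\<Sum>\<sigma>1\<in>S. \<Sum>\<sigma>2\<in>S. \<Sum>\<sigma>3\<in>S. h \<sigma>1 \<sigma>2 \<sigma>3 y)"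
      proof -
        have prod3: "r * ((\<Sum>\<sigma>\<in>S. f \<sigma>) * (\<Sum>\<sigma>\<in>S. g \<sigma>) * (\<Sum>\<sigma>\<in>S. h \<sigma>)) =
            (\<Sum>\<sigma>1\<in>S. \<Sum>\<sigma>2\<in>S. \<Sum>\<sigma>3\<in>S. r * (f \<sigma>1 * g \<sigma>2 * h \<sigma>3))" for r :: complex and f g h
          by (simp add: S_def algebra_simps)
        show ?thesis
          unfolding prod3 h_def c_def
        proof (intro sum.cong refl)
          fix \<sigma>1 \<sigma>2 \<sigma>3 :: real
          have cis3: "cis ((\<sigma>1 * t + \<sigma>2 * x + \<sigma>3 * z) * y) = cis (\<sigma>1 * (t * y)) * cis (\<sigma>2 * (x * y)) * cis (\<sigma>3 * (z * y))"
            by (simp add: cis_mult algebra_simps)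
          show "complex_of_real (y powr - s) * (k a1 b1 \<sigma>1 * cis (\<sigma>1 * (t * y)) * (k a2 b2 \<sigma>2 * cis (\<sigma>2 * (x * y))) *
              (k a3 b3 \<sigma>3 * cis (\<sigma>3 * (z * y)))) =
            k a1 b1 \<sigma>1 * k a2 b2 \<sigma>2 * k a3 b3 \<sigma>3 *
              (complex_of_real (y powr - s) * cis ((\<sigma>1 * t + \<sigma>2 * x + \<sigma>3 * z) * y))"
            unfolding cis3 by (simp only: mult_ac)
        qed
      qed
      finally show ?thesis .
    qed
    have hi: "h \<sigma>1 \<sigma>2 \<sigma>3 integrable_on {R..R'}" for \<sigma>1 \<sigma>2 \<sigma>3
      unfolding h_def using R by (intro integrable_continuous_real continuous_intros) auto
    have hb: "norm (integral {R..R'} (h \<sigma>1 \<sigma>2 \<sigma>3)) \<le> norm (c \<sigma>1 \<sigma>2 \<sigma>3) * 2 * R powr (- s) / \<delta>"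
      if "\<sigma>1 \<in> S" "\<sigma>2 \<in> S" "\<sigma>3 \<in> S" for \<sigma>1 \<sigma>2 \<sigma>3
    proof -
      let ?l = "\<sigma>1 * t + \<sigma>2 * x + \<sigma>3 * z"
      have l: "\<delta> \<le> \<bar>?l\<bar>" using sep that unfolding S_def by blast
      then have "norm (integral {R..R'} (\<lambda>y. of_real (y powr (- s)) * cis (?l * y))) \<le> 2 * R powr (- s) / \<bar>?l\<bar>"
        using \<delta> R s by (intro oscillatory_integral_bound) auto
      also have "\<dots> \<le> 2 * R powr (- s) / \<delta>"
        using l \<delta> by (intro divide_left_mono) auto
      finally have "norm (c \<sigma>1 \<sigma>2 \<sigma>3) * norm (integral {R..R'} (\<lambda>y. of_real (y powr (- s)) * cis (?l * y)))
         \<le> norm (c \<sigma>1 \<sigma>2 \<sigma>3) * (2 * R powr (- s) / \<delta>)"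
        by (intro mult_left_mono) auto
      then show ?thesis unfolding h_def by (simp add: norm_mult)
    qed
    have fi: "f integrable_on {R..R'}"
      unfolding f_def using R by (intro integrable_continuous_real continuous_intros) auto
    have "\<bar>integral {R..R'} f\<bar> = norm (integral {R..R'} (\<lambda>y. complex_of_real (f y)))"
      using integral_linear[OF fi, of "of_real :: real \<Rightarrow> complex"] bounded_linear_of_real[where 'a=complex] by (simp add: o_def)
    also have "integral {R..R'} (\<lambda>y. complex_of_real (f y)) = (\<Sum>\<sigma>1\<in>S. \<Sum>\<sigma>2\<in>S. \<Sum>\<sigma>3\<in>S. integral {R..R'} (h \<sigma>1 \<sigma>2 \<sigma>3))"
    proof -
      have S: "finite S" by (simp add: S_def)
      show ?thesis
        unfolding f_eq by (subst integral_sum[OF S], intro integrable_sum S hi, rule sum.cong[OF refl])+ simp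
    qed
    also have "norm \<dots> \<le> (\<Sum>\<sigma>1\<in>S. \<Sum>\<sigma>2\<in>S. \<Sum>\<sigma>3\<in>S. norm (c \<sigma>1 \<sigma>2 \<sigma>3) * 2 * R powr (- s) / \<delta>)"
      by (intro sum_norm_le hb)
    also have "\<dots> = C * R powr (- s) / \<delta>"
      unfolding C_def sum_distrib_right sum_divide_distrib ..
    finally show "\<bar>integral {R..R'} f\<bar> \<le> C * R powr (- s) / \<delta>" .
  qed
qed

lemma continuous_on_bessel_J [continuous_intros]:
  assumes "\<nu> > -1" "continuous_on A f" "\<And>x. x \<in> A \<Longrightarrow> f x > 0"
  shows "continuous_on A (\<lambda>x. bessel_J \<nu> (f x))"
proof -
  have "continuous_on {0<..} (bessel_J \<nu>)"
    using DERIV_bessel_J[OF assms(1)] by (meson DERIV_isCont continuous_at_imp_continuous_on greaterThan_iff)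
  then show ?thesis
    using assms(2,3) by (auto intro: continuous_on_compose2)
qed

definition bessel_product :: "real \<Rightarrow> real \<Rightarrow> real \<Rightarrow> real \<Rightarrow> real \<Rightarrow> real \<Rightarrow> real" where
  "bessel_product \<mu> \<nu> x z t y = bessel_J \<mu> (t * y) * bessel_J \<nu> (x * y) * bessel_J \<nu> (z * y) * y powr (1 - \<mu>)"

text \<open>Uniformity for \<open>t\<close> near \<open>t0\<close> is the point: it lets the
  derivative in \<open>w\<close> pass through the limit at infinity. The excluded values of
  \<open>t0\<close> are those for which a signed sum of \<open>t0\<close>, \<open>x\<close>,
  \<open>z\<close> vanishes. Each Bessel factor is replaced by its leading trigonometric term; the
  leading product oscillates, and the error has an additional \<open>1 / y\<close> and is integrated
  absolutely. The exponent arises from \<open>y powr (1 - \<mu>)\<close> times three factors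
  \<open>y powr (- 1 / 2)\<close>.\<close>

lemma bessel_product_tail:
  fixes \<mu> \<nu> x z t0 :: real
  assumes \<mu>: "\<mu> > -1/2" and \<nu>: "\<nu> > -1" and pos: "x > 0" "z > 0" "t0 > 0"
    and ne: "t0 \<noteq> \<bar>x - z\<bar>" "t0 \<noteq> x + z"
  obtains \<rho> R0 C where "0 < \<rho>" "\<rho> < t0" "R0 > 0" "C \<ge> 0"
    "\<And>t R R'. \<bar>t - t0\<bar> \<le> \<rho> \<Longrightarrow> R0 \<le> R \<Longrightarrow> R \<le> R' \<Longrightarrow>
       \<bar>integral {R..R'} (bessel_product \<mu> \<nu> x z t)\<bar> \<le> C * R powr (- (\<mu> + 1 / 2))"
proof -
  define s where "s = \<mu> + 1 / 2"
  have s: "s > 0" using \<mu> by (simp add: s_def)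
  have \<mu>': "\<mu> > -1" using \<mu> by simp
  obtain a1 b1 C1 where u1: "C1 > 0" "\<And>y. y \<ge> 1 \<Longrightarrow> \<bar>sqrt y * bessel_J \<mu> y\<bar> \<le> C1"
    "\<And>y. y \<ge> 1 \<Longrightarrow> \<bar>sqrt y * bessel_J \<mu> y - (a1 * cos y + b1 * sin y)\<bar> \<le> C1 / y"
    by (rule bessel_J_asymptotics[OF \<mu>']) (rule that)
  obtain a b C2 where u2: "C2 > 0" "\<And>y. y \<ge> 1 \<Longrightarrow> \<bar>sqrt y * bessel_J \<nu> y\<bar> \<le> C2"
    "\<And>y. y \<ge> 1 \<Longrightarrow> \<bar>sqrt y * bessel_J \<nu> y - (a * cos y + b * sin y)\<bar> \<le> C2 / y"
    by (rule bessel_J_asymptotics[OF \<nu>]) (rule that)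
  obtain C3 where C3: "C3 \<ge> 0"
    "\<And>t x z \<delta> R R'. 0 < R \<Longrightarrow> R \<le> R' \<Longrightarrow> \<delta> > 0 \<Longrightarrow>
       (\<And>\<sigma>1 \<sigma>2 \<sigma>3. \<sigma>1 \<in> {-1, 1} \<Longrightarrow> \<sigma>2 \<in> {-1, 1} \<Longrightarrow> \<sigma>3 \<in> {-1, 1} \<Longrightarrow> \<delta> \<le> \<bar>\<sigma>1 * t + \<sigma>2 * x + \<sigma>3 * z\<bar>) \<Longrightarrow>
       \<bar>integral {R..R'} (\<lambda>y. y powr (- s) * ((a1 * cos (t * y) + b1 * sin (t * y)) *
          (a * cos (x * y) + b * sin (x * y)) * (a * cos (z * y) + b * sin (z * y))))\<bar> \<le> C3 * R powr (- s) / \<delta>"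
  proof (rule triple_trig_integral_bound[where ?a1.0 = a1 and ?b1.0 = b1 and ?a2.0 = a and ?b2.0 = b and ?a3.0 = a and ?b3.0 = b, OF s], goal_cases)
    case (1 C)
    show ?case by (rule 1(1)[OF 1(2) 1(3)])
  qed
  \<comment> \<open>Half of the least frequency at \<open>t0\<close>, so that for
    \<open>\<bar>t - t0\<bar> \<le> \<delta>\<close> every frequency still has modulus at least
    \<delta>. The bound \<open>t0 / 2\<close> in \<rho> keeps \<open>t\<close> positive, and beyond
    \<open>R0\<close> all three Bessel arguments are at least 1, where the asymptotics
    apply.\<close>
  define \<delta> where "\<delta> = min (min (t0 + x + z) \<bar>t0 + x - z\<bar>) (min \<bar>t0 - x + z\<bar> \<bar>t0 - x - z\<bar>) / 2"
  define \<rho> where "\<rho> = min \<delta> (t0 / 2)"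
  define R0 where "R0 = max (2 / t0) (max (1 / x) (1 / z))"
  define B1 where "B1 = \<bar>a1\<bar> + \<bar>b1\<bar>"
  define B2 where "B2 = \<bar>a\<bar> + \<bar>b\<bar>"
  define D where "D = 2 * C1 * C2 * C2 / t0 + B1 * C2 * C2 / x + B1 * B2 * C2 / z"
  define C where "C = (C3 / \<delta> + D / s) / sqrt (t0 / 2 * x * z)"
  have \<delta>: "\<delta> > 0" using ne pos by (auto simp: \<delta>_def)
  have \<rho>: "0 < \<rho>" "\<rho> < t0" "\<rho> \<le> \<delta>" "\<rho> \<le> t0 / 2" using \<delta> pos by (auto simp: \<rho>_def)
  have R0: "R0 > 0" using pos by (auto simp: R0_def less_max_iff_disj)
  have B: "B1 \<ge> 0" "B2 \<ge> 0" by (auto simp: B1_def B2_def)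
  have D: "D \<ge> 0" using u1(1) u2(1) B pos by (auto simp: D_def intro!: add_nonneg_nonneg divide_nonneg_nonneg mult_nonneg_nonneg)
  have C: "C \<ge> 0" using C3(1) \<delta> D s pos by (auto simp: C_def intro!: add_nonneg_nonneg divide_nonneg_nonneg)
  have trig: "\<bar>a * cos y + b * sin y\<bar> \<le> \<bar>a\<bar> + \<bar>b\<bar>" for a b y :: real
    using mult_left_mono[OF abs_cos_le_one, of "\<bar>a\<bar>" y] mult_left_mono[OF abs_sin_le_one, of "\<bar>b\<bar>" y]
      abs_triangle_ineq[of "a * cos y" "b * sin y"] by (simp add: abs_mult)
  show thesis
  proof (rule that[OF \<rho>(1,2) R0 C])
    fix t R R' :: real
    assume t: "\<bar>t - t0\<bar> \<le> \<rho>" and R: "R0 \<le> R" "R \<le> R'"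
    have t0: "t0 / 2 \<le> t" using t \<rho> by linarith
    then have tp: "t > 0" using pos by linarith
    have Rp: "R > 0" using R R0 by linarith
    have sep: "\<delta> \<le> \<bar>\<sigma>1 * t + \<sigma>2 * x + \<sigma>3 * z\<bar>" if "\<sigma>1 \<in> {-1, 1}" "\<sigma>2 \<in> {-1, 1}" "\<sigma>3 \<in> {-1, 1}" for \<sigma>1 \<sigma>2 \<sigma>3
    proof -
      have "2 * \<delta> \<le> t0 + x + z" "2 * \<delta> \<le> \<bar>t0 + x - z\<bar>" "2 * \<delta> \<le> \<bar>t0 - x + z\<bar>" "2 * \<delta> \<le> \<bar>t0 - x - z\<bar>"
        by (auto simp: \<delta>_def)
      note sep0 = this
      have shift: "\<delta> \<le> \<bar>t + c\<bar>" if "2 * \<delta> \<le> \<bar>t0 + c\<bar>" for c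
        using t \<rho>(3) that by linarith
      have h: "\<delta> \<le> \<bar>t + (x + z)\<bar>" "\<delta> \<le> \<bar>t + (x - z)\<bar>" "\<delta> \<le> \<bar>t + (- x + z)\<bar>" "\<delta> \<le> \<bar>t + (- x - z)\<bar>"
        by (rule shift; use sep0 in linarith)+
      \<comment> \<open>Multiplication by the sign \<open>\<sigma>1\<close> makes the coefficient of
        \<open>t\<close> equal to 1 and leaves only the four combinations listed in
        \<open>h\<close>.\<close>
      define p q where "p = \<sigma>1 * \<sigma>2" and "q = \<sigma>1 * \<sigma>3"
      have \<sigma>: "\<sigma>1 * \<sigma>1 = 1" "\<bar>\<sigma>1\<bar> = 1" "p = 1 \<or> p = -1" "q = 1 \<or> q = -1"
        using that by (auto simp: p_def q_def)
      have "\<sigma>1 * t + \<sigma>2 * x + \<sigma>3 * z = \<sigma>1 * (t + (p * x + q * z))"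
        unfolding p_def q_def by (simp add: distrib_left mult.assoc[symmetric] \<sigma>(1))
      then have "\<bar>\<sigma>1 * t + \<sigma>2 * x + \<sigma>3 * z\<bar> = \<bar>t + (p * x + q * z)\<bar>"
        by (simp add: abs_mult \<sigma>(2))
      moreover have "\<delta> \<le> \<bar>t + (p * x + q * z)\<bar>"
        using \<sigma>(3)
      proof
        assume p: "p = 1"
        show ?thesis using \<sigma>(4) by (rule disjE) (use h p in simp_all)
      next
        assume p: "p = -1"
        show ?thesis using \<sigma>(4) by (rule disjE) (use h p in simp_all)
      qed
      ultimately show ?thesis by simp
    qed
    define u where "u = (\<lambda>y. sqrt (t * y) * bessel_J \<mu> (t * y))"
    define v where "v = (\<lambda>y. sqrt (x * y) * bessel_J \<nu> (x * y))"
    define w where "w = (\<lambda>y. sqrt (z * y) * bessel_J \<nu> (z * y))"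
    define u' where "u' = (\<lambda>y. a1 * cos (t * y) + b1 * sin (t * y))"
    define v' where "v' = (\<lambda>y. a * cos (x * y) + b * sin (x * y))"
    define w' where "w' = (\<lambda>y. a * cos (z * y) + b * sin (z * y))"
    define m where "m = (\<lambda>y. y powr (- s) * (u' y * v' y * w' y))"
    define e where "e = (\<lambda>y. y powr (- s) * (u y * v y * w y - u' y * v' y * w' y))"
    have eq: "bessel_product \<mu> \<nu> x z t y = (1 / sqrt (t * x * z)) * (m y + e y)" if "y \<in> {R..R'}" for y
    proof -
      have y: "y > 0" using that Rp by auto
      have "y powr (- s) * (sqrt y * sqrt y * sqrt y) = y powr (1 - \<mu>)"
      proof -
        have "y powr (- s) * (sqrt y * sqrt y * sqrt y) = y powr (- s + 1 / 2 + 1 / 2 + 1 / 2)"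
          using y unfolding powr_add by (simp add: powr_half_sqrt)
        then show ?thesis by (simp add: s_def)
      qed
      moreover have "m y + e y = y powr (- s) * (u y * v y * w y)"
        unfolding m_def e_def by (simp flip: distrib_left)
      moreover have "u y * v y * w y = sqrt t * sqrt x * sqrt z * (sqrt y * sqrt y * sqrt y) *
          (bessel_J \<mu> (t * y) * bessel_J \<nu> (x * y) * bessel_J \<nu> (z * y))"
        unfolding u_def v_def w_def real_sqrt_mult by (simp only: mult_ac)
      ultimately have "m y + e y = sqrt t * sqrt x * sqrt z * bessel_product \<mu> \<nu> x z t y"
      proof -
        assume 1: "y powr (- s) * (sqrt y * sqrt y * sqrt y) = y powr (1 - \<mu>)"
          and 2: "m y + e y = y powr (- s) * (u y * v y * w y)"
          and 3: "u y * v y * w y = sqrt t * sqrt x * sqrt z * (sqrt y * sqrt y * sqrt y) *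
            (bessel_J \<mu> (t * y) * bessel_J \<nu> (x * y) * bessel_J \<nu> (z * y))"
        have "m y + e y = sqrt t * sqrt x * sqrt z * (bessel_J \<mu> (t * y) * bessel_J \<nu> (x * y) * bessel_J \<nu> (z * y) *
            (y powr (- s) * (sqrt y * sqrt y * sqrt y)))"
          unfolding 2 3 by (simp only: mult_ac)
        then show ?thesis
          unfolding 1 bessel_product_def .
      qed
      moreover have "sqrt (t * x * z) = sqrt t * sqrt x * sqrt z" "sqrt t * sqrt x * sqrt z \<noteq> 0"
        using pos tp by (simp_all add: real_sqrt_mult)
      ultimately show ?thesis
        by simp
    qed
    have cont: "m integrable_on {R..R'}" "e integrable_on {R..R'}"
      unfolding m_def e_def u_def v_def w_def u'_def v'_def w'_def using \<mu>' \<nu> pos tp Rp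
      by (auto intro!: integrable_continuous_real continuous_intros)
    have e_bound: "norm (e y) \<le> D * y powr (- s - 1)" if y: "y \<in> {R..R'}" for y
    proof -
      have y0: "y > 0" "y \<ge> R0" using y Rp R by auto
      have ge1: "t * y \<ge> 1" "x * y \<ge> 1" "z * y \<ge> 1"
      proof -
        have "t * y \<ge> (t0 / 2) * (2 / t0)"
          using t0 y0 pos by (intro mult_mono) (auto simp: R0_def)
        then show "t * y \<ge> 1" using pos by simp
        have "x * y \<ge> x * (1 / x)" "z * y \<ge> z * (1 / z)"
          using y0 pos by (intro mult_left_mono; simp add: R0_def)+
        then show "x * y \<ge> 1" "z * y \<ge> 1" using pos by auto
      qed
      have b: "\<bar>v y\<bar> \<le> C2" "\<bar>w y\<bar> \<le> C2" "\<bar>u' y\<bar> \<le> B1" "\<bar>v' y\<bar> \<le> B2"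
        unfolding v_def w_def u'_def v'_def B1_def B2_def using u2(2) ge1 trig by auto
      have d: "\<bar>u y - u' y\<bar> \<le> C1 / (t * y)" "\<bar>v y - v' y\<bar> \<le> C2 / (x * y)" "\<bar>w y - w' y\<bar> \<le> C2 / (z * y)"
        unfolding u_def v_def w_def u'_def v'_def w'_def using u1(3) u2(3) ge1 by auto
      \<comment> \<open>Telescoping: one factor at a time is exchanged for its leading term, so that
        each summand contains exactly one error of size \<open>1 / y\<close>.\<close>
      have split: "u y * v y * w y - u' y * v' y * w' y = (u y - u' y) * v y * w y + u' y * (v y - v' y) * w y + u' y * v' y * (w y - w' y)"
        by (simp add: algebra_simps)
      have "\<bar>u y * v y * w y - u' y * v' y * w' y\<bar> \<le> \<bar>u y - u' y\<bar> * \<bar>v y\<bar> * \<bar>w y\<bar> + \<bar>u' y\<bar> * \<bar>v y - v' y\<bar> * \<bar>w y\<bar> + \<bar>u' y\<bar> * \<bar>v' y\<bar> * \<bar>w y - w' y\<bar>"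
        unfolding split abs_mult[symmetric]
        by (rule order.trans[OF abs_triangle_ineq]) (rule add_right_mono[OF abs_triangle_ineq])
      also have "\<dots> \<le> C1 / (t * y) * C2 * C2 + B1 * (C2 / (x * y)) * C2 + B1 * B2 * (C2 / (z * y))"
      proof -
        have m3: "\<bar>p\<bar> * \<bar>q\<bar> * \<bar>r\<bar> \<le> a * b * c" if "\<bar>p\<bar> \<le> a" "\<bar>q\<bar> \<le> b" "\<bar>r\<bar> \<le> c" for p q r a b c :: real
        proof -
          have nn: "0 \<le> a" "0 \<le> b" using that(1,2) by linarith+
          show ?thesis
            by (rule mult_mono[OF mult_mono[OF that(1,2) nn(1) abs_ge_zero] that(3) mult_nonneg_nonneg[OF nn] abs_ge_zero])
        qed
        show ?thesis
          by (rule add_mono[OF add_mono[OF m3[OF d(1) b(1,2)] m3[OF b(3) d(2) b(2)]] m3[OF b(3,4) d(3)]])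
      qed
      also have "\<dots> \<le> D * (1 / y)"
      proof -
        have "C1 / (t * y) \<le> C1 / (t0 / 2 * y)"
          using t0 pos y0 u1(1) tp by (intro divide_left_mono mult_right_mono mult_pos_pos) linarith+
        then have "C1 / (t * y) * C2 * C2 \<le> C1 / (t0 / 2 * y) * C2 * C2"
          using u2(1) by (intro mult_right_mono) auto
        then show ?thesis
        proof -
          assume le: "C1 / (t * y) * C2 * C2 \<le> C1 / (t0 / 2 * y) * C2 * C2"
          have "D * (1 / y) = C1 / (t0 / 2 * y) * C2 * C2 + B1 * (C2 / (x * y)) * C2 + B1 * B2 * (C2 / (z * y))"
            unfolding D_def by (simp add: add_divide_distrib mult_ac)
          then show ?thesis using le by simp
        qed
      qed
      finally have "\<bar>u y * v y * w y - u' y * v' y * w' y\<bar> \<le> D * (1 / y)" .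
      then have "y powr (- s) * \<bar>u y * v y * w y - u' y * v' y * w' y\<bar> \<le> y powr (- s) * (D * (1 / y))"
        by (intro mult_left_mono) auto
      also have "\<dots> = D * y powr (- s - 1)"
        using y0(1) by (simp add: powr_diff)
      finally show ?thesis
        unfolding e_def by (simp add: abs_mult)
    qed
    have "norm (integral {R..R'} e) \<le> integral {R..R'} (\<lambda>y. D * y powr (- s - 1))"
      using e_bound cont(2) has_integral_integrable[OF has_integral_mult_right[OF integral_powr_Icc[OF Rp R(2) s], of D]]
      by (intro integral_norm_bound_integral)
    also have "\<dots> = D * ((R powr (- s) - R' powr (- s)) / s)"
      using integral_powr_Icc[OF Rp R(2) s] by (simp add: integral_unique)
    also have "\<dots> \<le> D * (R powr (- s) / s)"
      using D s by (intro mult_left_mono divide_right_mono) auto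
    finally have Ib: "\<bar>integral {R..R'} e\<bar> \<le> D / s * R powr (- s)" by simp
    have Im: "\<bar>integral {R..R'} m\<bar> \<le> C3 / \<delta> * R powr (- s)"
      using C3(2)[OF Rp R(2) \<delta> sep] unfolding m_def u'_def v'_def w'_def by simp
    have "integral {R..R'} (bessel_product \<mu> \<nu> x z t) = integral {R..R'} (\<lambda>y. (1 / sqrt (t * x * z)) * (m y + e y))"
      by (rule Henstock_Kurzweil_Integration.integral_cong) (rule eq)
    then have split: "integral {R..R'} (bessel_product \<mu> \<nu> x z t) = (1 / sqrt (t * x * z)) * (integral {R..R'} m + integral {R..R'} e)"
      unfolding integral_mult_right by (simp only: Henstock_Kurzweil_Integration.integral_add[OF cont])
    have "\<bar>integral {R..R'} m + integral {R..R'} e\<bar> \<le> C3 / \<delta> * R powr (- s) + D / s * R powr (- s)"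
      using Im Ib by linarith
    moreover have "1 / sqrt (t * x * z) \<le> 1 / sqrt (t0 / 2 * x * z)"
      using t0 pos tp by (intro divide_left_mono real_sqrt_le_mono mult_right_mono mult_pos_pos) auto
    ultimately have "\<bar>integral {R..R'} (bessel_product \<mu> \<nu> x z t)\<bar> \<le> (1 / sqrt (t0 / 2 * x * z)) * (C3 / \<delta> * R powr (- s) + D / s * R powr (- s))"
      unfolding split abs_mult using pos tp by (intro mult_mono) auto
    also have "\<dots> = C * R powr (- s)"
      unfolding C_def by (simp add: field_simps)
    finally show "\<bar>integral {R..R'} (bessel_product \<mu> \<nu> x z t)\<bar> \<le> C * R powr (- (\<mu> + 1 / 2))"
      unfolding s_def .
  qed
qed

section \<open>Differentiation under the integral and bounds for a single factor\<close>

text \<open>The mean value theorem carries the bound on \<open>f'\<close> over to the difference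
  quotients, which then converge dominatedly. Measurability of \<open>f' w0\<close> is derived, as
  it is a pointwise limit of difference quotients along a sequence.\<close>

lemma has_real_derivative_LINT:
  fixes f f' :: "real \<Rightarrow> 'a \<Rightarrow> real"
  assumes \<delta>: "\<delta> > 0"
    and der: "\<And>w y. \<bar>w - w0\<bar> < \<delta> \<Longrightarrow> y \<in> space N \<Longrightarrow> ((\<lambda>w. f w y) has_real_derivative f' w y) (at w)"
    and int: "\<And>w. \<bar>w - w0\<bar> < \<delta> \<Longrightarrow> integrable N (f w)"
    and bound: "\<And>w y. \<bar>w - w0\<bar> < \<delta> \<Longrightarrow> y \<in> space N \<Longrightarrow> \<bar>f' w y\<bar> \<le> B y"
    and B: "integrable N B"
  shows "((\<lambda>w. \<integral>y. f w y \<partial>N) has_real_derivative (\<integral>y. f' w0 y \<partial>N)) (at w0)" "integrable N (f' w0)"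
proof -
  have quot: "\<bar>(f w y - f w0 y) / (w - w0)\<bar> \<le> B y" if w: "\<bar>w - w0\<bar> < \<delta>" "w \<noteq> w0" and y: "y \<in> space N" for w y
  proof -
    have "\<exists>v. \<bar>v - w0\<bar> < \<delta> \<and> f w y - f w0 y = (w - w0) * f' v y"
    proof (cases "w < w0")
      case True
      then obtain v where "w < v" "v < w0" "f w0 y - f w y = (w0 - w) * f' v y"
        using MVT2[OF True, of "\<lambda>w. f w y" "\<lambda>w. f' w y"] der[OF _ y] w \<delta> by force
      then show ?thesis using w by (intro exI[of _ v]) (auto simp: algebra_simps)
    next
      case False
      then have "w0 < w" using w by simp
      then obtain v where "w0 < v" "v < w" "f w y - f w0 y = (w - w0) * f' v y"
        using MVT2[OF \<open>w0 < w\<close>, of "\<lambda>w. f w y" "\<lambda>w. f' w y"] der[OF _ y] w \<delta> by force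
      then show ?thesis using w by (intro exI[of _ v]) auto
    qed
    then obtain v where v: "\<bar>v - w0\<bar> < \<delta>" "f w y - f w0 y = (w - w0) * f' v y" by blast
    have "(f w y - f w0 y) / (w - w0) = f' v y"
      unfolding v(2) using w by simp
    then show ?thesis using bound[OF v(1) y] by simp
  qed
  have lim: "(\<lambda>i. (f (X i) y - f w0 y) / (X i - w0)) \<longlonglongrightarrow> f' w0 y"
    if X: "\<And>i. X i \<noteq> w0" "X \<longlonglongrightarrow> w0" and y: "y \<in> space N" for X :: "nat \<Rightarrow> real" and y
    using der[of w0 y] \<delta> y X unfolding has_field_derivative_iff tendsto_at_iff_sequentially by (auto simp: o_def)
  have meas: "f' w0 \<in> borel_measurable N"
  proof (rule borel_measurable_LIMSEQ_real)
    let ?X = "\<lambda>i. w0 + (\<delta> / 2) * inverse (real (Suc i))"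
    show "(\<lambda>i. (f (?X i) y - f w0 y) / (?X i - w0)) \<longlonglongrightarrow> f' w0 y" if "y \<in> space N" for y
    proof (rule lim[OF _ _ that])
      show "?X i \<noteq> w0" for i using \<delta> by simp
      show "?X \<longlonglongrightarrow> w0"
        using tendsto_add[OF tendsto_const[of w0] tendsto_mult[OF tendsto_const[of "\<delta> / 2"] LIMSEQ_inverse_real_of_nat]]
        by (simp only: mult_zero_right add_0_right)
    qed
    fix i
    have "inverse (real (Suc i)) \<le> 1" by (simp add: divide_simps)
    then have "\<delta> / 2 * inverse (real (Suc i)) \<le> \<delta> / 2 * 1"
      using \<delta> by (intro mult_left_mono) auto
    then have "\<bar>?X i - w0\<bar> < \<delta>" using \<delta> by simp
    then show "(\<lambda>y. (f (?X i) y - f w0 y) / (?X i - w0)) \<in> borel_measurable N"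
      using int[of "?X i"] int[of w0] \<delta> by (intro borel_measurable_divide borel_measurable_diff) auto
  qed
  show "integrable N (f' w0)"
  proof (rule Bochner_Integration.integrable_bound[OF B meas], rule AE_I2)
    show "norm (f' w0 y) \<le> norm (B y)" if "y \<in> space N" for y
      using bound[of w0 y] \<delta> that by simp
  qed
  show "((\<lambda>w. \<integral>y. f w y \<partial>N) has_real_derivative (\<integral>y. f' w0 y \<partial>N)) (at w0)"
    unfolding has_field_derivative_iff tendsto_at_iff_sequentially
  proof (intro allI impI)
    fix X :: "nat \<Rightarrow> real" assume "\<forall>i. X i \<in> UNIV - {w0}" and X: "X \<longlonglongrightarrow> w0"
    then have Xne: "X i \<noteq> w0" for i by auto
    obtain n0 where n0: "\<And>n. n \<ge> n0 \<Longrightarrow> \<bar>X n - w0\<bar> < \<delta>"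
      using X \<delta> unfolding LIMSEQ_def dist_real_def by meson
    have "(\<lambda>i. \<integral>y. (f (X (i + n0)) y - f w0 y) / (X (i + n0) - w0) \<partial>N) \<longlonglongrightarrow> (\<integral>y. f' w0 y \<partial>N)"
    proof (rule integral_dominated_convergence[where w = B])
      show "AE y in N. (\<lambda>i. (f (X (i + n0)) y - f w0 y) / (X (i + n0) - w0)) \<longlonglongrightarrow> f' w0 y"
        using lim[OF Xne X] by (intro AE_I2 LIMSEQ_ignore_initial_segment)
      show "AE y in N. norm ((f (X (i + n0)) y - f w0 y) / (X (i + n0) - w0)) \<le> B y" for i
        using quot[OF n0 Xne] by (intro AE_I2) auto
      show "(\<lambda>y. (f (X (i + n0)) y - f w0 y) / (X (i + n0) - w0)) \<in> borel_measurable N" for i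
        using int[OF n0[of "i + n0"]] int[of w0] \<delta> by (intro borel_measurable_divide borel_measurable_diff) auto
    qed (use meas B in auto)
    moreover have "(\<integral>y. (f (X (i + n0)) y - f w0 y) / (X (i + n0) - w0) \<partial>N)
        = ((\<integral>y. f (X (i + n0)) y \<partial>N) - (\<integral>y. f w0 y \<partial>N)) / (X (i + n0) - w0)" for i
      unfolding integral_divide_zero using int[OF n0[of "i + n0"]] int[of w0] \<delta>
      by (subst Bochner_Integration.integral_diff) auto
    ultimately have "(\<lambda>i. ((\<integral>y. f (X (i + n0)) y \<partial>N) - (\<integral>y. f w0 y \<partial>N)) / (X (i + n0) - w0)) \<longlonglongrightarrow> (\<integral>y. f' w0 y \<partial>N)"
      by (simp only:)
    then show "((\<lambda>w. ((\<integral>y. f w y \<partial>N) - (\<integral>y. f w0 y \<partial>N)) / (w - w0)) \<circ> X) \<longlonglongrightarrow> (\<integral>y. f' w0 y \<partial>N)"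
      unfolding o_def by (rule LIMSEQ_offset)
  qed
qed

lemma set_integrable_lborel_nonneg:
  fixes f :: "real \<Rightarrow> real"
  assumes "f integrable_on S" "\<And>x. x \<in> S \<Longrightarrow> f x \<ge> 0" "f \<in> borel_measurable borel" "S \<in> sets borel"
  shows "set_integrable lborel S f"
proof -
  have "set_integrable lebesgue S f"
    using assms by (intro nonnegative_absolutely_integrable_1)
  then show ?thesis
    unfolding set_integrable_def using assms(3,4) by (subst (asm) integrable_completion) auto
qed

lemma set_integrable_powr_0:
  "a > -1 \<Longrightarrow> c \<ge> 0 \<Longrightarrow> set_integrable lborel {0<..c} (\<lambda>y::real. y powr a)"
  by (intro set_integrable_lborel_nonneg integrable_on_powr_from_0') auto

lemma set_integrable_powr_inf:
  "a < -1 \<Longrightarrow> c > 0 \<Longrightarrow> set_integrable lborel {c..} (\<lambda>y::real. y powr a)"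
  using has_integral_powr_to_inf[of a c] by (intro set_integrable_lborel_nonneg) (auto simp: integrable_on_def)

text \<open>The threshold is placed at \<open>y = 1\<close> and not at \<open>x * y = 1\<close>, so
  that the bounds for the two scales \<open>x\<close> and \<open>z\<close> can be multiplied. The
  gap between \<open>1\<close> and \<open>1 / x\<close> is covered by compactness.\<close>

lemma bessel_J_scaled_bound:
  assumes \<nu>: "\<nu> > -1" and x: "x > 0"
  obtains C where "C > 0" "\<And>y. 0 < y \<Longrightarrow> y \<le> 1 \<Longrightarrow> \<bar>bessel_J \<nu> (x * y)\<bar> \<le> C * y powr \<nu>"
    "\<And>y. 1 \<le> y \<Longrightarrow> \<bar>bessel_J \<nu> (x * y)\<bar> \<le> C * y powr (- 1 / 2)"
proof -
  have "continuous_on {0..1} (\<lambda>y. bessel_P \<nu> (- ((x * y)\<^sup>2 / 4)))"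
    using \<nu> by (intro continuous_intros) auto
  then have "bounded ((\<lambda>y. bessel_P \<nu> (- ((x * y)\<^sup>2 / 4))) ` {0..1})"
    by (intro compact_imp_bounded compact_continuous_image) auto
  then obtain B1 where "\<forall>p\<in>(\<lambda>y. bessel_P \<nu> (- ((x * y)\<^sup>2 / 4))) ` {0..1}. \<bar>p\<bar> \<le> B1"
    unfolding bounded_real ..
  then have B1: "\<bar>bessel_P \<nu> (- ((x * y)\<^sup>2 / 4))\<bar> \<le> B1" if "0 \<le> y" "y \<le> 1" for y
    using that by simp
  have "continuous_on {1..1 / x} (\<lambda>y. sqrt y * bessel_J \<nu> (x * y))"
    using \<nu> x by (intro continuous_intros) auto
  then have "bounded ((\<lambda>y. sqrt y * bessel_J \<nu> (x * y)) ` {1..1/x})"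
    by (intro compact_imp_bounded compact_continuous_image) auto
  then obtain B2 where "\<forall>p\<in>(\<lambda>y. sqrt y * bessel_J \<nu> (x * y)) ` {1..1/x}. \<bar>p\<bar> \<le> B2"
    unfolding bounded_real ..
  then have B2: "\<bar>sqrt y * bessel_J \<nu> (x * y)\<bar> \<le> B2" if "1 \<le> y" "y \<le> 1 / x" for y
    using that by simp
  obtain C0 where C0: "C0 > 0" "\<And>y. y \<ge> 1 \<Longrightarrow> \<bar>sqrt y * bessel_J \<nu> y\<bar> \<le> C0"
    by (rule bessel_J_asymptotics[OF \<nu>]) (rule that)
  define C where "C = max ((x / 2) powr \<nu> * B1) (max B2 (C0 / sqrt x))"
  show thesis
  proof (rule that[of C])
    show "C > 0" using C0 x by (simp add: C_def less_max_iff_disj)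
  next
    fix y :: real assume y: "0 < y" "y \<le> 1"
    have "\<bar>bessel_J \<nu> (x * y)\<bar> = (x / 2) powr \<nu> * \<bar>bessel_P \<nu> (- ((x * y)\<^sup>2 / 4))\<bar> * y powr \<nu>"
      using y x \<nu> by (simp add: bessel_J_eq abs_mult powr_mult powr_divide)
    also have "\<dots> \<le> (x / 2) powr \<nu> * B1 * y powr \<nu>"
      using B1[of y] y by (intro mult_right_mono mult_left_mono) auto
    also have "\<dots> \<le> C * y powr \<nu>"
      by (intro mult_right_mono) (auto simp: C_def)
    finally show "\<bar>bessel_J \<nu> (x * y)\<bar> \<le> C * y powr \<nu>" .
  next
    fix y :: real assume y: "1 \<le> y"
    have "\<bar>sqrt y * bessel_J \<nu> (x * y)\<bar> \<le> C"
    proof (cases "y \<le> 1 / x")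
      case True
      then show ?thesis using B2[OF y] by (simp add: C_def)
    next
      case False
      then have "x * y \<ge> 1" using x by (simp add: field_simps)
      then have "\<bar>sqrt x * (sqrt y * bessel_J \<nu> (x * y))\<bar> \<le> C0"
        using C0(2)[of "x * y"] by (simp add: real_sqrt_mult)
      then have "\<bar>sqrt y * bessel_J \<nu> (x * y)\<bar> \<le> C0 / sqrt x"
        using x by (simp add: abs_mult field_simps)
      then show ?thesis by (simp add: C_def)
    qed
    moreover have "y powr (-1 / 2) * sqrt y = 1"
      using y by (simp add: powr_half_sqrt[symmetric] flip: powr_add)
    ultimately show "\<bar>bessel_J \<nu> (x * y)\<bar> \<le> C * y powr (-1 / 2)"
    proof -
      assume le: "\<bar>sqrt y * bessel_J \<nu> (x * y)\<bar> \<le> C" and one: "y powr (-1 / 2) * sqrt y = 1"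
      have "bessel_J \<nu> (x * y) = y powr (-1 / 2) * (sqrt y * bessel_J \<nu> (x * y))"
        unfolding mult.assoc[symmetric] one by simp
      then have "\<bar>bessel_J \<nu> (x * y)\<bar> = y powr (-1 / 2) * \<bar>sqrt y * bessel_J \<nu> (x * y)\<bar>"
        by (metis abs_mult abs_of_nonneg powr_ge_zero)
      then show ?thesis
        using mult_left_mono[OF le powr_ge_zero[of y "-1/2"]] by (simp add: mult.commute)
    qed
  qed
qed

section \<open>The primitive of the kernel integral\<close>

lemma measurable_bessel_J [measurable]: "bessel_J \<nu> \<in> borel_measurable borel"
  unfolding bessel_J_def[abs_def] by measurable

text \<open>The tail bound makes \<open>f\<close> Cauchy along the integers, and letting
  \<open>R'\<close> tend to infinity preserves it. The rate obtained for the limit therefore has the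
  same constant, which turns into uniform convergence when \<open>f\<close> depends on a
  parameter.\<close>

lemma tail_bound_limit:
  fixes f :: "real \<Rightarrow> real"
  assumes s: "s > 0" and tail: "\<And>R R'. R0 \<le> R \<Longrightarrow> R \<le> R' \<Longrightarrow> \<bar>f R' - f R\<bar> \<le> C * R powr (- s)"
  obtains g where "(f \<longlongrightarrow> g) at_top" "\<And>R. R0 \<le> R \<Longrightarrow> \<bar>f R - g\<bar> \<le> C * R powr (- s)"
proof -
  have lim0: "((\<lambda>R. C * R powr (- s)) \<longlongrightarrow> 0) at_top"
    using tendsto_mult_right_zero[OF tendsto_neg_powr[of "- s" "\<lambda>R. R" at_top]] s by (simp add: filterlim_ident)
  have "Cauchy (\<lambda>n. f (real n))"
    unfolding Cauchy_altdef2
  proof (intro allI impI)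
    fix e :: real assume "e > 0"
    then have "\<forall>\<^sub>F R in at_top. C * R powr (- s) < e"
      using order_tendstoD(2)[OF lim0] by blast
    then have "\<forall>\<^sub>F n in sequentially. C * real n powr (- s) < e \<and> R0 \<le> real n"
      by (intro eventually_conj) (auto dest!: eventually_compose_filterlim[OF _ filterlim_real_sequentially]
        intro!: eventually_compose_filterlim[OF eventually_ge_at_top filterlim_real_sequentially])
    then obtain N where N: "C * real N powr (- s) < e" "R0 \<le> real N"
      by (auto simp: eventually_sequentially)
    then have "\<forall>n\<ge>N. dist (f (real n)) (f (real N)) < e"
      using le_less_trans[OF tail[OF N(2)] N(1)] by (simp add: dist_real_def)
    then show "\<exists>N. \<forall>n\<ge>N. dist (f (real n)) (f (real N)) < e" ..
  qed
  then obtain g where g: "(\<lambda>n. f (real n)) \<longlonglongrightarrow> g"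
    using convergent_eq_Cauchy by blast
  have b: "\<bar>f R - g\<bar> \<le> C * R powr (- s)" if R: "R0 \<le> R" for R
  proof (rule LIMSEQ_le_const2)
    show "(\<lambda>n. \<bar>f R - f (real n)\<bar>) \<longlonglongrightarrow> \<bar>f R - g\<bar>"
      by (intro tendsto_intros g)
    obtain N :: nat where "R \<le> real N" using real_arch_simple by blast
    then show "\<exists>N. \<forall>n\<ge>N. \<bar>f R - f (real n)\<bar> \<le> C * R powr (- s)"
    proof (intro exI[of _ N] allI impI)
      fix n assume "R \<le> real N" "N \<le> n"
      then have "R \<le> real n" by linarith
      from tail[OF R this] show "\<bar>f R - f (real n)\<bar> \<le> C * R powr (- s)"
        by (simp only: abs_minus_commute)
    qed
  qed
  have "((\<lambda>R. f R - g) \<longlongrightarrow> 0) at_top"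
  proof (rule Lim_null_comparison[OF _ lim0])
    show "\<forall>\<^sub>F R in at_top. norm (f R - g) \<le> C * R powr (- s)"
      using eventually_ge_at_top[of R0] by eventually_elim (use b in simp)
  qed
  then have "(f \<longlongrightarrow> g) at_top" by (simp add: LIM_zero_iff)
  with b show thesis by (intro that)
qed

locale bessel_triple =
  fixes \<mu> \<nu> x z :: real
  assumes \<mu>: "\<mu> > -1/2" and \<nu>: "\<nu> > -1" and x: "x > 0" and z: "z > 0"
begin

definition Phi :: "real \<Rightarrow> real" where
  "Phi y = bessel_J \<nu> (x * y) * bessel_J \<nu> (z * y)"

text \<open>Up to a constant this is \<open>w powr ((\<mu> + 1) / 2) * y powr (- \<mu>) * bessel_J
  (\<mu> + 1) (sqrt w * y) * Phi y\<close>. It decays like \<open>y powr (- \<mu> - 3 / 2)\<close>,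
  which is integrable at infinity, and its derivative in \<open>w\<close> is
  \<open>Gint w y\<close>, which at \<open>w = t\<^sup>2\<close> is the integrand of the kernel up
  to a factor depending on \<open>t\<close>.\<close>

definition Fint :: "real \<Rightarrow> real \<Rightarrow> real" where
  "Fint w y = w powr (\<mu> + 1) * bessel_P (\<mu> + 1) (- (w * y\<^sup>2 / 4)) * (y * Phi y)"

definition Gint :: "real \<Rightarrow> real \<Rightarrow> real" where
  "Gint w y = w powr \<mu> * bessel_P \<mu> (- (w * y\<^sup>2 / 4)) * (y * Phi y)"

definition F :: "real \<Rightarrow> real" where
  "F w = (LINT y:{0<..}|lborel. Fint w y)"

lemma measurable_Phi [measurable]: "Phi \<in> borel_measurable borel"
  unfolding Phi_def[abs_def] by measurable

lemma measurable_Fint [measurable]: "(\<lambda>(w, y). Fint w y) \<in> borel_measurable (borel \<Otimes>\<^sub>M borel)"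
proof -
  have [measurable]: "bessel_P (\<mu> + 1) \<in> borel_measurable borel" using \<mu> by (intro measurable_bessel_P) simp
  show ?thesis unfolding Fint_def[abs_def] by measurable
qed

lemma measurable_Fint2 [measurable]: "Fint w \<in> borel_measurable borel"
  using measurable_compose[OF measurable_Pair1' measurable_Fint, of w] by simp

lemma measurable_Gint2 [measurable]: "Gint w \<in> borel_measurable borel"
proof -
  have [measurable]: "bessel_P \<mu> \<in> borel_measurable borel" using \<mu> by (intro measurable_bessel_P) simp
  show ?thesis unfolding Gint_def[abs_def] by measurable
qed

lemma Phi_bound:
  obtains C where "C > 0" "\<And>y. 0 < y \<Longrightarrow> y \<le> 1 \<Longrightarrow> \<bar>y * Phi y\<bar> \<le> C * y powr (2 * \<nu> + 1)"
    "\<And>y. 1 \<le> y \<Longrightarrow> \<bar>y * Phi y\<bar> \<le> C"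
proof -
  obtain C1 where C1: "C1 > 0" "\<And>y. 0 < y \<Longrightarrow> y \<le> 1 \<Longrightarrow> \<bar>bessel_J \<nu> (x * y)\<bar> \<le> C1 * y powr \<nu>"
    "\<And>y. 1 \<le> y \<Longrightarrow> \<bar>bessel_J \<nu> (x * y)\<bar> \<le> C1 * y powr (- 1 / 2)"
    by (rule bessel_J_scaled_bound[OF \<nu> x]) (rule that)
  obtain C2 where C2: "C2 > 0" "\<And>y. 0 < y \<Longrightarrow> y \<le> 1 \<Longrightarrow> \<bar>bessel_J \<nu> (z * y)\<bar> \<le> C2 * y powr \<nu>"
    "\<And>y. 1 \<le> y \<Longrightarrow> \<bar>bessel_J \<nu> (z * y)\<bar> \<le> C2 * y powr (- 1 / 2)"
    by (rule bessel_J_scaled_bound[OF \<nu> z]) (rule that)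
  have bd: "\<bar>y * Phi y\<bar> \<le> y * ((C1 * y powr e) * (C2 * y powr e))"
    if "y > 0" "\<bar>bessel_J \<nu> (x * y)\<bar> \<le> C1 * y powr e" "\<bar>bessel_J \<nu> (z * y)\<bar> \<le> C2 * y powr e" for y e
    unfolding Phi_def abs_mult using that C1(1) by (intro mult_mono) auto
  have pw: "y * ((C1 * y powr e) * (C2 * y powr e)) = C1 * C2 * y powr (2 * e + 1)" if "y > 0" for y e
    using that by (simp add: powr_add flip: powr_add[of y e e])
  show thesis
  proof (rule that[of "C1 * C2"])
    show "C1 * C2 > 0" using C1 C2 by simp
    show "\<bar>y * Phi y\<bar> \<le> C1 * C2 * y powr (2 * \<nu> + 1)" if "0 < y" "y \<le> 1" for y
      using bd[OF that(1) C1(2)[OF that] C2(2)[OF that]] pw[OF that(1), of \<nu>] by simp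
    show "\<bar>y * Phi y\<bar> \<le> C1 * C2" if "1 \<le> y" for y
    proof -
      have "\<bar>y * Phi y\<bar> \<le> y * ((C1 * y powr (-1/2)) * (C2 * y powr (-1/2)))"
        using that by (intro bd C1(3) C2(3)) auto
      also have "\<dots> = C1 * C2 * y powr (2 * (-1/2) + 1)"
        using that by (intro pw) simp
      finally show ?thesis using that by simp
    qed
  qed
qed

text \<open>For \<open>\<kappa> > -1/2\<close> the exponent \<open>- \<kappa> - 1 / 2\<close> is
  negative, so the bound near zero and the bound at infinity each hold on the whole half
  line.\<close>

lemma bessel_P_bound_nonneg:
  assumes "\<kappa> > -1/2"
  obtains C where "C > 0" "\<And>s. 0 \<le> s \<Longrightarrow> \<bar>bessel_P \<kappa> (- (s\<^sup>2 / 4))\<bar> \<le> C"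
    "\<And>s. 0 < s \<Longrightarrow> \<bar>bessel_P \<kappa> (- (s\<^sup>2 / 4))\<bar> \<le> C * s powr (- \<kappa> - 1 / 2)"
proof -
  have "\<kappa> > -1" using assms by simp
  then obtain C where C: "C > 0" "\<And>s. 0 \<le> s \<Longrightarrow> s \<le> 1 \<Longrightarrow> \<bar>bessel_P \<kappa> (- (s\<^sup>2 / 4))\<bar> \<le> C"
    "\<And>s. 1 \<le> s \<Longrightarrow> \<bar>bessel_P \<kappa> (- (s\<^sup>2 / 4))\<bar> \<le> C * s powr (- \<kappa> - 1 / 2)"
    by (rule bessel_P_bounds) (rule that)
  show thesis
  proof (rule that[OF C(1)])
    fix s :: real assume s: "s \<ge> 0"
    show "\<bar>bessel_P \<kappa> (- (s\<^sup>2 / 4))\<bar> \<le> C"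
    proof (cases "s \<le> 1")
      case False
      then have "s powr (- \<kappa> - 1 / 2) \<le> s powr 0"
        using assms by (intro powr_mono) auto
      then have "C * s powr (- \<kappa> - 1 / 2) \<le> C * 1"
        using C(1) False by (intro mult_left_mono) auto
      then show ?thesis using C(3)[of s] False by simp
    qed (use C(2) s in auto)
  next
    fix s :: real assume s: "s > 0"
    show "\<bar>bessel_P \<kappa> (- (s\<^sup>2 / 4))\<bar> \<le> C * s powr (- \<kappa> - 1 / 2)"
    proof (cases "s \<ge> 1")
      case False
      then have "1 powr (- \<kappa> - 1 / 2) \<le> s powr (- \<kappa> - 1 / 2)"
        using assms s by (intro powr_mono2') auto
      then have "C * 1 \<le> C * s powr (- \<kappa> - 1 / 2)"
        using C(1) False by (intro mult_left_mono) auto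
      then show ?thesis using C(2)[of s] False s by simp
    qed (use C(3) s in auto)
  qed
qed

text \<open>A single integrable function of \<open>y\<close> with the dependence on \<open>w\<close>
  split off; this serves both the convergence of \<open>F\<close> and Fubini in its Laplace
  transform. The two powers of \<open>w\<close> belong to \<open>y \<le> 1\<close> and
  \<open>y > 1\<close>; the second is \<open>\<mu> + 1 + (- \<mu> - 3 / 2) / 2\<close>.\<close>

lemma Fint_dominated:
  obtains B where "\<And>y. B y \<ge> 0" "set_integrable lborel {0<..} B"
    "\<And>w y. w > 0 \<Longrightarrow> y > 0 \<Longrightarrow> \<bar>Fint w y\<bar> \<le> (w powr (\<mu> + 1) + w powr (\<mu> / 2 + 1 / 4)) * B y"
proof -
  have \<mu>1: "\<mu> + 1 > -1/2" using \<mu> by simp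
  obtain C1 where C1: "C1 > 0" "\<And>s. 0 \<le> s \<Longrightarrow> \<bar>bessel_P (\<mu> + 1) (- (s\<^sup>2 / 4))\<bar> \<le> C1"
    "\<And>s. 0 < s \<Longrightarrow> \<bar>bessel_P (\<mu> + 1) (- (s\<^sup>2 / 4))\<bar> \<le> C1 * s powr (- (\<mu> + 1) - 1 / 2)"
    by (rule bessel_P_bound_nonneg[OF \<mu>1]) (rule that)
  obtain C2 where C2: "C2 > 0" "\<And>y. 0 < y \<Longrightarrow> y \<le> 1 \<Longrightarrow> \<bar>y * Phi y\<bar> \<le> C2 * y powr (2 * \<nu> + 1)"
    "\<And>y. 1 \<le> y \<Longrightarrow> \<bar>y * Phi y\<bar> \<le> C2"
    by (rule Phi_bound) (rule that)
  define B where "B = (\<lambda>y. C1 * C2 * (if y \<le> 1 then y powr (2 * \<nu> + 1) else y powr (- \<mu> - 3 / 2)))"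
  have Bpos: "B y \<ge> 0" for y using C1(1) C2(1) by (simp add: B_def)
  show thesis
  proof (rule that[of B])
    have "set_integrable lborel ({0<..1} \<union> {1<..}) (\<lambda>y. if y \<le> 1 then y powr (2 * \<nu> + 1) else y powr (- \<mu> - 3 / 2))"
    proof (intro set_integrable_Un)
      show "set_integrable lborel {0<..1} (\<lambda>y. if y \<le> 1 then y powr (2 * \<nu> + 1) else y powr (- \<mu> - 3 / 2))"
        using set_integrable_powr_0[of "2 * \<nu> + 1" 1] \<nu> by (subst set_integrable_cong[OF refl refl, of _ _ "\<lambda>y. y powr (2 * \<nu> + 1)"]) auto
      have ex: "- \<mu> - 3 / 2 < -1" using \<mu> by argo
      have "set_integrable lborel {1<..} (\<lambda>y. y powr (- \<mu> - 3 / 2))"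
        by (rule set_integrable_subset[OF set_integrable_powr_inf[OF ex, of 1]]) auto
      then show "set_integrable lborel {1<..} (\<lambda>y. if y \<le> 1 then y powr (2 * \<nu> + 1) else y powr (- \<mu> - 3 / 2))"
        by (subst set_integrable_cong[OF refl refl, of _ _ "\<lambda>y. y powr (- \<mu> - 3 / 2)"]) auto
    qed auto
    moreover have "{0<..1} \<union> {1<..} = {0::real<..}" by auto
    ultimately show "set_integrable lborel {0<..} B"
      unfolding B_def by (intro set_integrable_mult_right) simp
    fix w y :: real assume w: "w > 0" and y: "y > 0"
    define s where "s = sqrt w * y"
    have s: "s > 0" "w * y\<^sup>2 = s\<^sup>2" using w y by (auto simp: s_def power_mult_distrib)
    show "\<bar>Fint w y\<bar> \<le> (w powr (\<mu> + 1) + w powr (\<mu> / 2 + 1 / 4)) * B y"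
    proof (cases "y \<le> 1")
      case True
      have "\<bar>Fint w y\<bar> \<le> w powr (\<mu> + 1) * C1 * (C2 * y powr (2 * \<nu> + 1))"
        unfolding Fint_def s abs_mult[of "_ * _" "y * Phi y"] abs_mult[of "w powr _"] using C1(1) C1(2)[of s] C2(2)[OF y True] s
        by (intro mult_mono) auto
      also have "\<dots> = w powr (\<mu> + 1) * B y" using True by (simp add: B_def)
      also have "\<dots> \<le> (w powr (\<mu> + 1) + w powr (\<mu> / 2 + 1 / 4)) * B y"
        using Bpos by (intro mult_right_mono) auto
      finally show ?thesis .
    next
      case False
      have "\<bar>Fint w y\<bar> \<le> w powr (\<mu> + 1) * (C1 * s powr (- (\<mu> + 1) - 1 / 2)) * C2"
        unfolding Fint_def s abs_mult[of "_ * _" "y * Phi y"] abs_mult[of "w powr _"] using C1(1) C1(3)[of s] C2(3)[of y] False s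
        by (intro mult_mono) auto
      also have "s powr (- (\<mu> + 1) - 1 / 2) = w powr ((- \<mu> - 3 / 2) / 2) * y powr (- \<mu> - 3 / 2)"
      proof -
        have "- (\<mu> + 1) - 1 / 2 = - \<mu> - 3 / 2" by (simp add: field_simps)
        moreover have "sqrt w powr e = w powr (e / 2)" for e
          using w by (simp add: powr_half_sqrt[symmetric] powr_powr)
        ultimately show ?thesis
          unfolding s_def using w y by (simp only: powr_mult real_sqrt_ge_zero less_imp_le)
      qed
      also have "w powr (\<mu> + 1) * (C1 * (w powr ((- \<mu> - 3 / 2) / 2) * y powr (- \<mu> - 3 / 2))) * C2
          = w powr (\<mu> + 1 + (- \<mu> - 3 / 2) / 2) * (C1 * C2 * y powr (- \<mu> - 3 / 2))"
        unfolding powr_add by (simp only: mult_ac)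
      also have "\<dots> = w powr (\<mu> / 2 + 1 / 4) * B y"
        using False by (simp add: B_def) (simp add: field_simps)
      also have "\<dots> \<le> (w powr (\<mu> + 1) + w powr (\<mu> / 2 + 1 / 4)) * B y"
        using Bpos by (intro mult_right_mono) auto
      finally show ?thesis .
    qed
  qed (rule Bpos)
qed

lemma Fint_integrable: "w > 0 \<Longrightarrow> set_integrable lborel {0<..} (Fint w)"
proof -
  assume w: "w > 0"
  obtain B where B: "\<And>y. B y \<ge> 0" "set_integrable lborel {0<..} B"
    "\<And>w y. w > 0 \<Longrightarrow> y > 0 \<Longrightarrow> \<bar>Fint w y\<bar> \<le> (w powr (\<mu> + 1) + w powr (\<mu> / 2 + 1 / 4)) * B y"
    by (rule Fint_dominated) (rule that)
  show ?thesis
  proof (rule set_integrable_bound)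
    show "set_integrable lborel {0<..} (\<lambda>y. (w powr (\<mu> + 1) + w powr (\<mu> / 2 + 1 / 4)) * B y)"
      using B(2) by (intro set_integrable_mult_right) simp
    show "AE y in lborel. y \<in> {0<..} \<longrightarrow> norm (Fint w y) \<le> norm ((w powr (\<mu> + 1) + w powr (\<mu> / 2 + 1 / 4)) * B y)"
      using order.trans[OF B(3)[OF w] abs_ge_self] by (intro AE_I2) simp
  qed (simp add: set_borel_measurable_def)
qed

text \<open>The product rule gives terms of orders \<open>\<mu> + 1\<close> and
  \<open>\<mu> + 2\<close>, and \<open>bessel_P_rec\<close> is exactly the identity that merges them
  into order \<mu>.\<close>

lemma DERIV_Fint:
  assumes "w > 0"
  shows "((\<lambda>w. Fint w y) has_real_derivative Gint w y) (at w)"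
proof -
  have "\<mu> + 1 > -1" using \<mu> by simp
  then have "((\<lambda>w. w powr (\<mu> + 1) * bessel_P (\<mu> + 1) (- (w * y\<^sup>2 / 4)) * (y * Phi y)) has_real_derivative
    ((\<mu> + 1) * w powr \<mu> * bessel_P (\<mu> + 1) (- (w * y\<^sup>2 / 4))
      + w powr (\<mu> + 1) * (bessel_P (\<mu> + 1 + 1) (- (w * y\<^sup>2 / 4)) * (- (y\<^sup>2 / 4)))) * (y * Phi y)) (at w)"
    using assms by (auto intro!: derivative_eq_intros DERIV_chain2[OF DERIV_bessel_P])
  moreover have "(\<mu> + 1) * w powr \<mu> * bessel_P (\<mu> + 1) (- (w * y\<^sup>2 / 4))
      + w powr (\<mu> + 1) * (bessel_P (\<mu> + 1 + 1) (- (w * y\<^sup>2 / 4)) * (- (y\<^sup>2 / 4)))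
    = w powr \<mu> * bessel_P \<mu> (- (w * y\<^sup>2 / 4))"
  proof -
    have "\<mu> > -1" using \<mu> by simp
    have "w powr (\<mu> + 1) = w powr \<mu> * w" using assms by (simp add: powr_add)
    then show ?thesis
      unfolding bessel_P_rec[OF \<open>\<mu> > -1\<close>, of "- (w * y\<^sup>2 / 4)"] by (simp add: algebra_simps)
  qed
  ultimately show ?thesis
    unfolding Fint_def Gint_def by simp
qed

lemma Gint_bound:
  assumes "0 < w1"
  obtains C where "C > 0" "\<And>w y. w1 \<le> w \<Longrightarrow> w \<le> w2 \<Longrightarrow> y > 0 \<Longrightarrow> \<bar>Gint w y\<bar> \<le> C * \<bar>y * Phi y\<bar>"
proof -
  obtain C1 where C1: "C1 > 0" "\<And>s. 0 \<le> s \<Longrightarrow> \<bar>bessel_P \<mu> (- (s\<^sup>2 / 4))\<bar> \<le> C1"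
    by (rule bessel_P_bound_nonneg[OF \<mu>]) (rule that)
  show thesis
  proof (rule that[of "(w1 powr \<mu> + w2 powr \<mu>) * C1"])
    show "(w1 powr \<mu> + w2 powr \<mu>) * C1 > 0" using C1 assms by (intro mult_pos_pos add_pos_nonneg) auto
    fix w y :: real assume w: "w1 \<le> w" "w \<le> w2" and y: "y > 0"
    \<comment> \<open>The sign of \<mu> is not fixed, so either endpoint may carry the maximum; the
      sum of both values bounds it in every case.\<close>
    have "w powr \<mu> \<le> w1 powr \<mu> + w2 powr \<mu>"
    proof (cases "\<mu> \<ge> 0")
      case True
      then have "w powr \<mu> \<le> w2 powr \<mu>" using w assms by (intro powr_mono2) auto
      then show ?thesis by (simp add: add_increasing)
    next
      case False
      then have "w powr \<mu> \<le> w1 powr \<mu>" using w assms by (intro powr_mono2') auto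
      then show ?thesis by (simp add: add_increasing2)
    qed
    moreover have "w * y\<^sup>2 = (sqrt w * y)\<^sup>2" using w assms by (simp add: power_mult_distrib)
    then have "\<bar>bessel_P \<mu> (- (w * y\<^sup>2 / 4))\<bar> \<le> C1"
      using C1(2)[of "sqrt w * y"] w assms y by simp
    ultimately show "\<bar>Gint w y\<bar> \<le> (w1 powr \<mu> + w2 powr \<mu>) * C1 * \<bar>y * Phi y\<bar>"
      unfolding Gint_def abs_mult[of "_ * _" "y * Phi y"] abs_mult[of "w powr _"] using C1(1)
      by (intro mult_right_mono mult_mono) auto
  qed
qed

lemma yPhi_integrable: "set_integrable lborel {0<..<R} (\<lambda>y. y * Phi y)"
proof -
  obtain C where C: "C > 0" "\<And>y. 0 < y \<Longrightarrow> y \<le> 1 \<Longrightarrow> \<bar>y * Phi y\<bar> \<le> C * y powr (2 * \<nu> + 1)"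
    "\<And>y. 1 \<le> y \<Longrightarrow> \<bar>y * Phi y\<bar> \<le> C"
    by (rule Phi_bound) (rule that)
  have 1: "set_integrable lborel {0<..1} (\<lambda>y. y * Phi y)"
  proof (rule set_integrable_bound)
    show "set_integrable lborel {0<..1} (\<lambda>y. C * y powr (2 * \<nu> + 1))"
      using \<nu> by (intro set_integrable_mult_right set_integrable_powr_0) auto
    show "AE y in lborel. y \<in> {0<..1} \<longrightarrow> norm (y * Phi y) \<le> norm (C * y powr (2 * \<nu> + 1))"
      using order.trans[OF C(2) abs_ge_self] by (intro AE_I2) simp
  qed (simp add: set_borel_measurable_def)
  have 2: "set_integrable lborel {1..<R} (\<lambda>y. y * Phi y)"
  proof (rule set_integrable_bound)
    show "set_integrable lborel {1..<R} (\<lambda>y. C)"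
      by (rule set_integrable_subset[OF borel_integrable_atLeastAtMost'[of 1 R]]) auto
    show "AE y in lborel. y \<in> {1..<R} \<longrightarrow> norm (y * Phi y) \<le> norm C"
      using order.trans[OF C(3) abs_ge_self] by (intro AE_I2) simp
  qed (simp add: set_borel_measurable_def)
  show ?thesis
    by (rule set_integrable_subset[OF set_integrable_Un[OF 1 2]]) auto
qed

lemma Gint_integrable: "w > 0 \<Longrightarrow> set_integrable lborel {0<..<R} (Gint w)"
proof -
  assume w: "w > 0"
  obtain C where C: "C > 0" "\<And>w' y. w \<le> w' \<Longrightarrow> w' \<le> w \<Longrightarrow> y > 0 \<Longrightarrow> \<bar>Gint w' y\<bar> \<le> C * \<bar>y * Phi y\<bar>"
    by (rule Gint_bound[OF w, of w]) (rule that)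
  show ?thesis
  proof (rule set_integrable_bound)
    show "set_integrable lborel {0<..<R} (\<lambda>y. C * (y * Phi y))"
      using yPhi_integrable by (intro set_integrable_mult_right) simp
    show "AE y in lborel. y \<in> {0<..<R} \<longrightarrow> norm (Gint w y) \<le> norm (C * (y * Phi y))"
      using C by (intro AE_I2) (simp add: abs_mult)
  qed (simp add: set_borel_measurable_def)
qed

lemma bessel_product_eq:
  assumes "t > 0" "y > 0"
  shows "bessel_product \<mu> \<nu> x z t y = 1 / (2 powr \<mu> * t powr \<mu>) * Gint (t\<^sup>2) y"
proof -
  have \<mu>1: "\<mu> > -1" using \<mu> by simp
  have 1: "bessel_J \<mu> (t * y) = t powr \<mu> * y powr \<mu> / 2 powr \<mu> * bessel_P \<mu> (- (t\<^sup>2 * y\<^sup>2 / 4))"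
    using assms \<mu>1 by (simp add: bessel_J_eq powr_divide powr_mult power_mult_distrib)
  have 2: "y powr \<mu> * y powr (1 - \<mu>) = y"
    using assms by (simp flip: powr_add)
  have 3: "(t\<^sup>2) powr \<mu> = t powr \<mu> * t powr \<mu>"
    using assms by (simp add: power2_eq_square powr_mult)
  have "bessel_product \<mu> \<nu> x z t y = t powr \<mu> / 2 powr \<mu> * bessel_P \<mu> (- (t\<^sup>2 * y\<^sup>2 / 4)) * ((y powr \<mu> * y powr (1 - \<mu>)) * Phi y)"
    unfolding bessel_product_def 1 Phi_def by (simp add: mult_ac)
  also have "\<dots> = 1 / (2 powr \<mu> * t powr \<mu>) * Gint (t\<^sup>2) y"
    unfolding 2 Gint_def 3 using assms by simp
  finally show ?thesis .
qed

lemma DERIV_Fint_truncated: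
  assumes w: "w > 0"
  shows "((\<lambda>w. LINT y:{0<..<R}|lborel. Fint w y) has_real_derivative (LINT y:{0<..<R}|lborel. Gint w y)) (at w)"
proof -
  have w2: "w / 2 > 0" using w by simp
  obtain C where C: "C > 0" "\<And>w' y. w / 2 \<le> w' \<Longrightarrow> w' \<le> 2 * w \<Longrightarrow> y > 0 \<Longrightarrow> \<bar>Gint w' y\<bar> \<le> C * \<bar>y * Phi y\<bar>"
    by (rule Gint_bound[OF w2, of "2 * w"]) (rule that)
  show ?thesis
    unfolding set_lebesgue_integral_def
  proof (rule has_real_derivative_LINT(1)[where \<delta> = "w / 2" and B = "\<lambda>y. indicator {0<..<R} y *\<^sub>R (C * \<bar>y * Phi y\<bar>)"])
    fix w' y :: real assume w': "\<bar>w' - w\<bar> < w / 2"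
    then have bd: "w / 2 \<le> w'" "w' \<le> 2 * w" "w' > 0" using w by linarith+
    show "((\<lambda>w. indicat_real {0<..<R} y *\<^sub>R Fint w y) has_real_derivative indicat_real {0<..<R} y *\<^sub>R Gint w' y) (at w')"
      using DERIV_cmult[OF DERIV_Fint[OF bd(3)]] by simp
    show "\<bar>indicat_real {0<..<R} y *\<^sub>R Gint w' y\<bar> \<le> indicat_real {0<..<R} y *\<^sub>R (C * \<bar>y * Phi y\<bar>)"
      using C(2)[OF bd(1,2)] by (auto simp: indicator_def)
  next
    fix w' :: real assume w': "\<bar>w' - w\<bar> < w / 2"
    then have "w' > 0" using w by linarith
    have "set_integrable lborel {0<..<R} (Fint w')"
      by (rule set_integrable_subset[OF Fint_integrable[OF \<open>w' > 0\<close>]]) auto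
    then show "integrable lborel (\<lambda>y. indicat_real {0<..<R} y *\<^sub>R Fint w' y)"
      by (simp add: set_integrable_def)
  next
    have "set_integrable lborel {0<..<R} (\<lambda>y. C * \<bar>y * Phi y\<bar>)"
      using set_integrable_abs[OF yPhi_integrable] by (intro set_integrable_mult_right) simp
    then show "integrable lborel (\<lambda>y. indicat_real {0<..<R} y *\<^sub>R (C * \<bar>y * Phi y\<bar>))"
      by (simp add: set_integrable_def)
  qed (use w in auto)
qed

lemma Fint_truncated_tendsto:
  assumes w: "w > 0"
  shows "(\<lambda>n. LINT y:{0<..<real n}|lborel. Fint w y) \<longlonglongrightarrow> F w"
  unfolding F_def set_lebesgue_integral_def
proof (rule integral_dominated_convergence[where w = "\<lambda>y. norm (indicator {0<..} y *\<^sub>R Fint w y)"])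
  show "integrable lborel (\<lambda>y. norm (indicat_real {0<..} y *\<^sub>R Fint w y))"
    using Fint_integrable[OF w] unfolding set_integrable_def by (rule integrable_norm)
  show "AE y in lborel. (\<lambda>n. indicat_real {0<..<real n} y *\<^sub>R Fint w y) \<longlonglongrightarrow> indicat_real {0<..} y *\<^sub>R Fint w y"
  proof (intro AE_I2 tendsto_eventually)
    fix y :: real
    obtain N :: nat where N: "y < real N" using reals_Archimedean2 by blast
    show "\<forall>\<^sub>F n in sequentially. indicat_real {0<..<real n} y *\<^sub>R Fint w y = indicat_real {0<..} y *\<^sub>R Fint w y"
      using eventually_ge_at_top[of N] by eventually_elim (use N in \<open>auto simp: indicator_def\<close>)
  qed
  show "AE y in lborel. norm (indicat_real {0<..<real n} y *\<^sub>R Fint w y) \<le> norm (indicat_real {0<..} y *\<^sub>R Fint w y)" for n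
    by (intro AE_I2) (auto simp: indicator_def)
qed auto

text \<open>The truncated integrals of \<open>Gint\<close> are the derivatives of the truncated
  integrals of \<open>Fint\<close>. The former converge uniformly near \<open>t0\<^sup>2\<close> by
  the tail estimate and the latter converge pointwise to \<open>F\<close>, so the conditionally
  convergent limit is the derivative of \<open>F\<close>.\<close>

lemma DERIV_F:
  assumes t0: "t0 > 0" and ne: "t0 \<noteq> \<bar>x - z\<bar>" "t0 \<noteq> x + z"
  obtains g where "((\<lambda>R. LINT y:{0<..<R}|lborel. Gint (t0\<^sup>2) y) \<longlongrightarrow> g) at_top"
    "(F has_real_derivative g) (at (t0\<^sup>2))"
proof -
  define s where "s = \<mu> + 1 / 2"
  have s: "s > 0" using \<mu> by (simp add: s_def)
  define GR where "GR = (\<lambda>R w. LINT y:{0<..<R}|lborel. Gint w y)"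
  obtain \<rho> R0 C where \<rho>: "0 < \<rho>" "\<rho> < t0" and R0: "R0 > 0" and C: "C \<ge> 0"
    and tail: "\<And>t R R'. \<bar>t - t0\<bar> \<le> \<rho> \<Longrightarrow> R0 \<le> R \<Longrightarrow> R \<le> R' \<Longrightarrow>
       \<bar>integral {R..R'} (bessel_product \<mu> \<nu> x z t)\<bar> \<le> C * R powr (- (\<mu> + 1 / 2))"
  proof (rule bessel_product_tail[OF \<mu> \<nu> x z t0 ne], goal_cases)
    case (1 \<rho> R0 C)
    show ?case by (rule 1(1)[OF 1(2-5) 1(6)])
  qed
  define S where "S = {(t0 - \<rho>)\<^sup>2..(t0 + \<rho>)\<^sup>2}"
  define D where "D = C * (2 powr \<mu> * ((t0 - \<rho>) powr \<mu> + (t0 + \<rho>) powr \<mu>))"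
  have S_pos: "w > 0" if "w \<in> S" for w
    using that \<rho> by (auto simp: S_def intro: less_le_trans[of _ "(t0 - \<rho>)\<^sup>2"])
  have GR_tail: "\<bar>GR R' w - GR R w\<bar> \<le> D * R powr (- s)" if w: "w \<in> S" and R: "R0 \<le> R" "R \<le> R'" for w R R'
  proof -
    define t where "t = sqrt w"
    have wp: "w > 0" by (rule S_pos[OF w])
    have t: "t > 0" "w = t\<^sup>2" using wp by (auto simp: t_def)
    have t1: "t0 - \<rho> \<le> t" "t \<le> t0 + \<rho>"
      using w \<rho> t unfolding S_def by (auto simp: power_mono_iff)
    have "t powr \<mu> \<le> (t0 - \<rho>) powr \<mu> + (t0 + \<rho>) powr \<mu>"
    proof (cases "\<mu> \<ge> 0")
      case True
      then have "t powr \<mu> \<le> (t0 + \<rho>) powr \<mu>" using t t1 by (intro powr_mono2) auto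
      then show ?thesis by (simp add: add_increasing)
    next
      case False
      then have "t powr \<mu> \<le> (t0 - \<rho>) powr \<mu>" using t1 \<rho> by (intro powr_mono2') auto
      then show ?thesis by (simp add: add_increasing2)
    qed
    then have tD: "2 powr \<mu> * t powr \<mu> * C \<le> D"
      using C unfolding D_def by (subst mult.commute[of _ C]) (intro mult_left_mono, auto)
    have R0': "R > 0" using R R0 by simp
    have int: "set_integrable lborel {0<..<R'} (Gint w)"
      by (rule Gint_integrable[OF wp])
    have "{0<..<R'} = {0<..<R} \<union> {R..<R'}" using R R0' by auto
    then have "GR R' w = GR R w + (LINT y:{R..<R'}|lborel. Gint w y)"
      unfolding GR_def using int R0' R
      by (simp, subst set_integral_Un) (auto intro: set_integrable_subset[OF int])
    also have "(LINT y:{R..<R'}|lborel. Gint w y) = integral {R..<R'} (Gint w)"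
      by (rule set_borel_integral_eq_integral(2)) (rule set_integrable_subset[OF int], use R0' in auto)
    also have "\<dots> = integral {R..R'} (Gint w)"
      by (rule integral_spike_set) (rule negligible_subset[of "{R'}"]; auto)+
    also have "\<dots> = integral {R..R'} (\<lambda>y. 2 powr \<mu> * t powr \<mu> * bessel_product \<mu> \<nu> x z t y)"
      using R0' t by (intro Henstock_Kurzweil_Integration.integral_cong) (simp add: bessel_product_eq)
    also have "\<dots> = 2 powr \<mu> * t powr \<mu> * integral {R..R'} (bessel_product \<mu> \<nu> x z t)"
      by simp
    finally have "\<bar>GR R' w - GR R w\<bar> = 2 powr \<mu> * t powr \<mu> * \<bar>integral {R..R'} (bessel_product \<mu> \<nu> x z t)\<bar>"
      by (simp add: abs_mult)
    also have "\<dots> \<le> 2 powr \<mu> * t powr \<mu> * (C * R powr (- s))"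
      using tail[of t R R'] t1 R unfolding s_def by (intro mult_left_mono) auto
    also have "\<dots> \<le> D * R powr (- s)"
      using tD by (simp add: mult.assoc[symmetric] mult_right_mono)
    finally show ?thesis .
  qed
  have "\<exists>g. ((\<lambda>R. GR R w) \<longlongrightarrow> g) at_top \<and> (\<forall>R\<ge>R0. \<bar>GR R w - g\<bar> \<le> D * R powr (- s))" if w: "w \<in> S" for w
    using tail_bound_limit[of s R0 "\<lambda>R. GR R w" D, OF s GR_tail[OF w]] by (metis (no_types, lifting))
  then obtain g where g: "\<And>w. w \<in> S \<Longrightarrow> ((\<lambda>R. GR R w) \<longlongrightarrow> g w) at_top"
    "\<And>w R. w \<in> S \<Longrightarrow> R \<ge> R0 \<Longrightarrow> \<bar>GR R w - g w\<bar> \<le> D * R powr (- s)"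
    by metis
  have t0S: "t0\<^sup>2 \<in> S" "t0\<^sup>2 \<in> interior S"
    using \<rho> t0 by (auto simp: S_def intro!: power_mono power_strict_mono)
  \<comment> \<open>The theorem on sequences of derivatives produces some limit function; it is
    identified with \<open>F\<close> afterwards by uniqueness of limits.\<close>
  have "\<exists>f. \<forall>w\<in>S. (\<lambda>n. LINT y:{0<..<real n}|lborel. Fint w y) \<longlonglongrightarrow> f w \<and> (f has_derivative (\<lambda>h. g w * h)) (at w within S)"
  proof (rule has_derivative_sequence[where f' = "\<lambda>n w h. GR (real n) w * h", OF _ _ _ t0S(1) Fint_truncated_tendsto])
    show "convex S" by (simp add: S_def)
    show "((\<lambda>w. LINT y:{0<..<real n}|lborel. Fint w y) has_derivative (\<lambda>h. GR (real n) w * h)) (at w within S)" if "w \<in> S" for n w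
      using DERIV_Fint_truncated[OF S_pos[OF that], of "real n"] unfolding GR_def has_field_derivative_def
      by (rule has_derivative_at_withinI)
    show "0 < t0\<^sup>2" using t0 by simp
    fix e :: real assume e: "e > 0"
    have "((\<lambda>R. D * R powr (- s)) \<longlongrightarrow> 0) at_top"
      using tendsto_mult_right_zero[OF tendsto_neg_powr[of "- s" "\<lambda>R. R" at_top]] s by (simp add: filterlim_ident)
    then have "\<forall>\<^sub>F R in at_top. D * R powr (- s) < e"
      using e by (rule order_tendstoD(2))
    then have "\<forall>\<^sub>F n in sequentially. D * real n powr (- s) < e"
      by (rule eventually_compose_filterlim[OF _ filterlim_real_sequentially])
    moreover have "\<forall>\<^sub>F n in sequentially. R0 \<le> real n"
      by (rule eventually_compose_filterlim[OF eventually_ge_at_top filterlim_real_sequentially])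
    ultimately show "\<forall>\<^sub>F n in sequentially. \<forall>w\<in>S. \<forall>h. norm (GR (real n) w * h - g w * h) \<le> e * norm h"
    proof eventually_elim
      case (elim n)
      show ?case
      proof (intro ballI allI)
        fix w h assume w: "w \<in> S"
        have "\<bar>GR (real n) w - g w\<bar> \<le> e"
          using g(2)[OF w elim(2)] elim(1) by simp
        then show "norm (GR (real n) w * h - g w * h) \<le> e * norm h"
          unfolding left_diff_distrib[symmetric] real_norm_def abs_mult by (rule mult_right_mono) simp
      qed
    qed
  qed
  then obtain f where f: "\<And>w. w \<in> S \<Longrightarrow> (\<lambda>n. LINT y:{0<..<real n}|lborel. Fint w y) \<longlonglongrightarrow> f w"
    "\<And>w. w \<in> S \<Longrightarrow> (f has_derivative (\<lambda>h. g w * h)) (at w within S)"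
    by blast
  have fF: "f w = F w" if "w \<in> S" for w
    using f(1)[OF that] Fint_truncated_tendsto[OF S_pos[OF that]] by (rule LIMSEQ_unique)
  have "(f has_real_derivative g (t0\<^sup>2)) (at (t0\<^sup>2))"
    using f(2)[OF t0S(1)] unfolding has_field_derivative_def at_within_interior[OF t0S(2)] .
  then have "(F has_real_derivative g (t0\<^sup>2)) (at (t0\<^sup>2))"
    by (rule has_field_derivative_transform_within_open[OF _ open_interior t0S(2)])
      (rule fF, erule subsetD[OF interior_subset])
  with g(1)[OF t0S(1)] show thesis
    unfolding GR_def by (intro that)
qed

end

section \<open>Weber's second exponential integral\<close>

lemma laplace_monomial:
  fixes \<rho> p :: real
  assumes \<rho>: "\<rho> > -1" and p: "p > 0"
  shows "set_integrable lborel {0<..} (\<lambda>s. s powr \<rho> * exp (- p * s))"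
    "(LINT s:{0<..}|lborel. s powr \<rho> * exp (- p * s)) = Gamma (\<rho> + 1) / p powr (\<rho> + 1)"
proof -
  define f where "f = (\<lambda>t::real. t powr \<rho> / exp t)"
  have hi: "(f has_integral Gamma (\<rho> + 1)) {0..}"
    using Gamma_integral_real[of "\<rho> + 1"] \<rho> by (simp add: f_def)
  have hi': "(f has_integral Gamma (\<rho> + 1)) {0<..}"
  proof -
    have "f integrable_on {0<..}"
      by (rule integrable_spike_set[OF has_integral_integrable[OF hi]]) (rule negligible_subset[of "{0}"]; auto)+
    moreover have "integral {0<..} f = integral {0..} f"
      by (rule integral_spike_set) (rule negligible_subset[of "{0}"]; auto)+
    ultimately show ?thesis using integral_unique[OF hi] by (metis integrable_integral)
  qed
  have fa: "f absolutely_integrable_on {0<..}"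
    using hi' by (intro nonnegative_absolutely_integrable_1) (auto simp: integrable_on_def f_def)
  have img: "(\<lambda>s. p * s) ` {0<..} = {0<..}"
  proof
    show "{0<..} \<subseteq> (\<lambda>s. p * s) ` {0<..}"
    proof
      fix v :: real assume "v \<in> {0<..}"
      then have "v = p * (v / p)" "v / p \<in> {0<..}" using p by auto
      then show "v \<in> (\<lambda>s. p * s) ` {0<..}" by blast
    qed
  qed (use p in auto)
  have "(\<lambda>s. \<bar>p\<bar> * f (p * s)) absolutely_integrable_on {0<..} \<and> integral {0<..} (\<lambda>s. \<bar>p\<bar> * f (p * s)) = Gamma (\<rho> + 1)"
    by (subst has_absolute_integral_change_of_variables_1'[where g = "\<lambda>s. p * s" and g' = "\<lambda>s. p"])
       (use fa integral_unique[OF hi'] img p in \<open>auto simp: inj_on_def intro!: derivative_eq_intros\<close>)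
  note cv = this
  have eq: "\<bar>p\<bar> * f (p * s) = p powr (\<rho> + 1) * (s powr \<rho> * exp (- p * s))" if "s \<in> {0<..}" for s
    using that p by (simp add: f_def powr_mult powr_add exp_minus field_simps)
  have 1: "(\<lambda>s. p powr (\<rho> + 1) * (s powr \<rho> * exp (- p * s))) absolutely_integrable_on {0<..}"
    by (rule set_integrable_cong[THEN iffD1, OF refl refl _ conjunct1[OF cv]]) (rule eq)
  have 2: "integral {0<..} (\<lambda>s. p powr (\<rho> + 1) * (s powr \<rho> * exp (- p * s))) = Gamma (\<rho> + 1)"
    by (rule trans[OF Henstock_Kurzweil_Integration.integral_cong[symmetric] conjunct2[OF cv]]) (rule eq)
  have "(\<lambda>s. (1 / p powr (\<rho> + 1)) * (p powr (\<rho> + 1) * (s powr \<rho> * exp (- p * s)))) absolutely_integrable_on {0<..}"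
    using 1 by (intro set_integrable_mult_right) simp
  then have "(\<lambda>s. s powr \<rho> * exp (- p * s)) absolutely_integrable_on {0<..}" using p by simp
  then show *: "set_integrable lborel {0<..} (\<lambda>s. s powr \<rho> * exp (- p * s))"
    unfolding set_integrable_def by (subst (asm) integrable_completion) auto
  show "(LINT s:{0<..}|lborel. s powr \<rho> * exp (- p * s)) = Gamma (\<rho> + 1) / p powr (\<rho> + 1)"
  proof -
    have "p powr (\<rho> + 1) * integral {0<..} (\<lambda>s. s powr \<rho> * exp (- p * s)) = Gamma (\<rho> + 1)"
      using 2 by (simp only: integral_mult_right)
    then show ?thesis
      unfolding set_borel_integral_eq_integral(2)[OF *] using p by (simp only: nonzero_eq_divide_eq mult.commute powr_gt_zero less_numeral_extra) (simp add: nonzero_eq_divide_eq mult.commute)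
  qed
qed

lemma set_integral_power_series:
  fixes d :: "nat \<Rightarrow> real" and k :: "real \<Rightarrow> real"
  assumes k: "k \<in> borel_measurable borel"
    and int: "\<And>m. set_integrable lborel {0<..} (\<lambda>s. s ^ m * k s)"
    and sum: "summable (\<lambda>m. \<bar>d m\<bar> * (LINT s:{0<..}|lborel. \<bar>s ^ m * k s\<bar>))"
    and conv: "\<And>s. s > 0 \<Longrightarrow> summable (\<lambda>m. norm (d m * s ^ m))"
  shows "set_integrable lborel {0<..} (\<lambda>s. (\<Sum>m. d m * s ^ m) * k s)"
    "(\<lambda>m. d m * (LINT s:{0<..}|lborel. s ^ m * k s)) sums (LINT s:{0<..}|lborel. (\<Sum>m. d m * s ^ m) * k s)"
proof -
  define f where "f = (\<lambda>m s. indicator {0<..} s *\<^sub>R (d m * (s ^ m * k s)))"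
  have f_int: "integrable lborel (f m)" for m
    using set_integrable_mult_right[OF int[of m], of "d m"] unfolding f_def set_integrable_def .
  have f_AE: "AE s in lborel. summable (\<lambda>m. norm (f m s))"
  proof (rule AE_I2)
    fix s :: real
    show "summable (\<lambda>m. norm (f m s))"
    proof (cases "s > 0")
      case True
      have "summable (\<lambda>m. norm (d m * s ^ m) * \<bar>k s\<bar>)" by (rule summable_mult2[OF conv[OF True]])
      then show ?thesis using True by (simp add: f_def abs_mult mult.assoc)
    qed (simp add: f_def)
  qed
  have f_norm: "(\<integral>s. norm (f m s) \<partial>lborel) = \<bar>d m\<bar> * (LINT s:{0<..}|lborel. \<bar>s ^ m * k s\<bar>)" for m
  proof -
    have "(\<integral>s. norm (f m s) \<partial>lborel) = (\<integral>s. \<bar>d m\<bar> * (indicator {0<..} s *\<^sub>R \<bar>s ^ m * k s\<bar>) \<partial>lborel)"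
      by (rule Bochner_Integration.integral_cong) (auto simp: f_def abs_mult indicator_def)
    then show ?thesis by (simp add: set_lebesgue_integral_def)
  qed
  have f_sum: "summable (\<lambda>m. \<integral>s. norm (f m s) \<partial>lborel)" unfolding f_norm by (rule sum)
  have f_suminf: "(\<Sum>m. f m s) = indicator {0<..} s *\<^sub>R ((\<Sum>m. d m * s ^ m) * k s)" for s
  proof (cases "s > 0")
    case True
    have "(\<Sum>m. d m * s ^ m * k s) = (\<Sum>m. d m * s ^ m) * k s"
      using suminf_mult2[OF summable_norm_cancel[OF conv[OF True]], of "k s"] by simp
    then show ?thesis using True by (simp add: f_def mult.assoc)
  qed (simp add: f_def)
  have f_val: "(\<integral>s. f m s \<partial>lborel) = d m * (LINT s:{0<..}|lborel. s ^ m * k s)" for m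
  proof -
    have "(\<integral>s. f m s \<partial>lborel) = (LINT s:{0<..}|lborel. d m * (s ^ m * k s))"
      unfolding f_def set_lebesgue_integral_def ..
    then show ?thesis by simp
  qed
  show "set_integrable lborel {0<..} (\<lambda>s. (\<Sum>m. d m * s ^ m) * k s)"
    using integrable_suminf[OF f_int f_AE f_sum] unfolding f_suminf set_integrable_def .
  have "(\<lambda>m. \<integral>s. f m s \<partial>lborel) sums (\<integral>s. (\<Sum>m. f m s) \<partial>lborel)"
    by (rule sums_integral[OF f_int f_AE f_sum])
  then show "(\<lambda>m. d m * (LINT s:{0<..}|lborel. s ^ m * k s)) sums (LINT s:{0<..}|lborel. (\<Sum>m. d m * s ^ m) * k s)"
    unfolding f_val f_suminf set_lebesgue_integral_def .
qed

lemma laplace_monomial_power: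
  fixes \<rho> p :: real
  assumes \<rho>: "\<rho> > -1" and p: "p > 0"
  shows "set_integrable lborel {0<..} (\<lambda>s. s ^ m * (s powr \<rho> * exp (- p * s)))"
    "(LINT s:{0<..}|lborel. s ^ m * (s powr \<rho> * exp (- p * s))) = Gamma (\<rho> + real m + 1) / p powr (\<rho> + real m + 1)"
    "(LINT s:{0<..}|lborel. \<bar>s ^ m * (s powr \<rho> * exp (- p * s))\<bar>) = Gamma (\<rho> + real m + 1) / p powr (\<rho> + real m + 1)"
proof -
  have eq: "s ^ m * (s powr \<rho> * exp (- p * s)) = s powr (\<rho> + real m) * exp (- p * s)" if "s \<in> {0<..}" for s
    using that by (simp add: powr_add powr_realpow)
  have \<rho>m: "\<rho> + real m > -1" using \<rho> by simp
  note lm = laplace_monomial[OF \<rho>m p]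
  show "set_integrable lborel {0<..} (\<lambda>s. s ^ m * (s powr \<rho> * exp (- p * s)))"
    using lm(1) by (subst set_integrable_cong[OF refl refl eq]) auto
  show "(LINT s:{0<..}|lborel. s ^ m * (s powr \<rho> * exp (- p * s))) = Gamma (\<rho> + real m + 1) / p powr (\<rho> + real m + 1)"
    using lm(2) by (subst set_lebesgue_integral_cong[OF _ allI[OF impI[OF eq]]]) auto
  show "(LINT s:{0<..}|lborel. \<bar>s ^ m * (s powr \<rho> * exp (- p * s))\<bar>) = Gamma (\<rho> + real m + 1) / p powr (\<rho> + real m + 1)"
    using lm(2) by (subst set_lebesgue_integral_cong[of _ _ _ "\<lambda>s. s powr (\<rho> + real m) * exp (- p * s)"]) (auto simp: powr_add powr_realpow)
qed

lemma bessel_coeff_Gamma: "\<nu> > -1 \<Longrightarrow> bessel_coeff \<nu> m * Gamma (\<nu> + real m + 1) = 1 / fact m"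
proof -
  assume "\<nu> > -1"
  then have "Gamma (\<nu> + real m + 1) > 0" by (intro Gamma_real_pos) simp
  then show ?thesis by (simp add: bessel_coeff_def rGamma_inverse_Gamma add_ac)
qed

text \<open>The additional factor \<open>s ^ n\<close> is present because, in a product of two
  Bessel functions, expanding one of them into powers requires all moments of the other. The
  Pochhammer symbol is the quotient of the Gamma value from the integral by the one in the
  coefficient.\<close>

lemma laplace_bessel_P_gen:
  fixes \<nu> a p :: real and n :: nat
  assumes \<nu>: "\<nu> > -1" and p: "p > 0"
  shows "set_integrable lborel {0<..} (\<lambda>s. bessel_P \<nu> (- a * s) * (s powr (\<nu> + real n) * exp (- p * s)))"
    "(\<lambda>m. (- a / p) ^ m / fact m * pochhammer (\<nu> + real m + 1) n / p powr (\<nu> + real n + 1))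
      sums (LINT s:{0<..}|lborel. bessel_P \<nu> (- a * s) * (s powr (\<nu> + real n) * exp (- p * s)))"
proof -
  define d where "d = (\<lambda>m. bessel_coeff \<nu> m * (- a) ^ m)"
  have \<nu>n: "\<nu> + real n > -1" using \<nu> by simp
  have Gp: "Gamma (\<nu> + real n + real m + 1) = pochhammer (\<nu> + real m + 1) n * Gamma (\<nu> + real m + 1)" for m
  proof -
    have pos: "\<nu> + real m + 1 > 0" using \<nu> by simp
    then have "pochhammer (\<nu> + real m + 1) n = Gamma (\<nu> + real m + 1 + real n) / Gamma (\<nu> + real m + 1)"
      by (intro pochhammer_Gamma) (auto simp: nonpos_Ints_def)
    moreover have "Gamma (\<nu> + real m + 1) > 0" by (rule Gamma_real_pos[OF pos])
    ultimately show ?thesis by (simp add: add_ac)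
  qed
  have tm: "c * (Gamma (\<nu> + real n + real m + 1) / p powr (\<nu> + real n + real m + 1))
      = (x / p) ^ m / fact m * pochhammer (\<nu> + real m + 1) n / p powr (\<nu> + real n + 1)"
    if "c = bessel_coeff \<nu> m * x ^ m" for m x c
  proof -
    have "p powr (\<nu> + real n + real m + 1) = p powr (\<nu> + real n + 1) * p ^ m"
      using p by (simp add: powr_add powr_realpow)
    then have "c * (Gamma (\<nu> + real n + real m + 1) / p powr (\<nu> + real n + real m + 1))
       = (bessel_coeff \<nu> m * Gamma (\<nu> + real m + 1)) * (x ^ m / p ^ m) * pochhammer (\<nu> + real m + 1) n / p powr (\<nu> + real n + 1)"
      unfolding that Gp by (simp add: mult_ac)
    then show ?thesis unfolding bessel_coeff_Gamma[OF \<nu>] by (simp add: power_divide)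
  qed
  \<comment> \<open>Each of the \<open>n\<close> factors is at most a constant times
    \<open>2 ^ m\<close>. For fixed \<open>n\<close> the Pochhammer symbol thus only rescales the
    argument of the dominating exponential series.\<close>
  have poch: "pochhammer (\<nu> + real m + 1) n \<le> (\<bar>\<nu>\<bar> + real n + 2) ^ n * (2 ^ n) ^ m" for m
  proof -
    have "pochhammer (\<nu> + real m + 1) n = (\<Prod>i<n. \<nu> + real m + 1 + real i)" by (simp add: pochhammer_prod atLeast0LessThan)
    also have "\<dots> \<le> (\<Prod>i<n. (\<bar>\<nu>\<bar> + real n + 2) * 2 ^ m)"
    proof (rule prod_mono)
      fix i assume "i \<in> {..<n}"
      then have i: "i < n" by simp
      have m2: "real m + 1 \<le> 2 ^ m" by (metis Suc_leI add.commute less_exp of_nat_1 of_nat_Suc of_nat_le_iff of_nat_numeral of_nat_power plus_1_eq_Suc)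
      then have "1 \<le> (2::real) ^ m" by simp
      have "\<nu> + real m + 1 + real i \<le> (\<bar>\<nu>\<bar> + real n) * 1 + 1 * (real m + 1)" using i by simp
      also have "\<dots> \<le> (\<bar>\<nu>\<bar> + real n) * 2 ^ m + 1 * 2 ^ m"
        using m2 \<open>1 \<le> (2::real) ^ m\<close> by (intro add_mono mult_left_mono) auto
      also have "\<dots> \<le> (\<bar>\<nu>\<bar> + real n + 2) * 2 ^ m" by (simp add: algebra_simps)
      finally show "0 \<le> \<nu> + real m + 1 + real i \<and> \<nu> + real m + 1 + real i \<le> (\<bar>\<nu>\<bar> + real n + 2) * 2 ^ m"
        using \<nu> by simp
    qed
    also have "\<dots> = (\<bar>\<nu>\<bar> + real n + 2) ^ n * (2 ^ n) ^ m" by (simp add: power_mult_distrib mult.commute flip: power_mult)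
    finally show ?thesis .
  qed
  have summ: "summable (\<lambda>m. \<bar>d m\<bar> * (LINT s:{0<..}|lborel. \<bar>s ^ m * (s powr (\<nu> + real n) * exp (- p * s))\<bar>))"
  proof -
    have eq: "\<bar>d m\<bar> * (Gamma (\<nu> + real n + real m + 1) / p powr (\<nu> + real n + real m + 1))
       = (\<bar>a\<bar> / p) ^ m / fact m * pochhammer (\<nu> + real m + 1) n / p powr (\<nu> + real n + 1)" for m
      using bessel_coeff_pos[OF \<nu>, of m] by (intro tm) (simp add: d_def abs_mult power_abs)
    have pos: "pochhammer (\<nu> + real m + 1) n > 0" for m using \<nu> by (intro pochhammer_pos) simp
    have "summable (\<lambda>m. (\<bar>\<nu>\<bar> + real n + 2) ^ n / p powr (\<nu> + real n + 1) * ((2 ^ n * \<bar>a\<bar> / p) ^ m /\<^sub>R fact m))"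
      by (intro summable_mult summable_exp_generic)
    then show ?thesis
      unfolding laplace_monomial_power(3)[OF \<nu>n p] eq
    proof (rule summable_comparison_test')
      fix m
      have "(\<bar>a\<bar> / p) ^ m / fact m * pochhammer (\<nu> + real m + 1) n / p powr (\<nu> + real n + 1)
         \<le> (\<bar>a\<bar> / p) ^ m / fact m * ((\<bar>\<nu>\<bar> + real n + 2) ^ n * (2 ^ n) ^ m) / p powr (\<nu> + real n + 1)"
        using p by (intro divide_right_mono mult_left_mono poch) auto
      also have "\<dots> = (\<bar>\<nu>\<bar> + real n + 2) ^ n / p powr (\<nu> + real n + 1) * ((2 ^ n * \<bar>a\<bar> / p) ^ m /\<^sub>R fact m)"
        by (simp add: power_mult_distrib power_divide field_simps)
      finally show "norm ((\<bar>a\<bar> / p) ^ m / fact m * pochhammer (\<nu> + real m + 1) n / p powr (\<nu> + real n + 1))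
         \<le> (\<bar>\<nu>\<bar> + real n + 2) ^ n / p powr (\<nu> + real n + 1) * ((2 ^ n * \<bar>a\<bar> / p) ^ m /\<^sub>R fact m)"
        using pos[of m] p by (simp add: abs_mult)
    qed
  qed
  have ser: "(\<Sum>m. d m * s ^ m) = bessel_P \<nu> (- a * s)" for s
    unfolding bessel_P_def d_def by (simp add: power_mult_distrib mult.assoc flip: power_mult_distrib)
  have conv: "summable (\<lambda>m. norm (d m * s ^ m))" for s
    using bessel_P_summable_norm[OF \<nu>, of "- a * s"] by (simp add: d_def power_mult_distrib abs_mult power_abs mult.assoc)
  note ps = set_integral_power_series[where k = "\<lambda>s. s powr (\<nu> + real n) * exp (- p * s)" and d = d, OF _ laplace_monomial_power(1)[OF \<nu>n p] summ conv]
  show "set_integrable lborel {0<..} (\<lambda>s. bessel_P \<nu> (- a * s) * (s powr (\<nu> + real n) * exp (- p * s)))"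
    using ps(1) unfolding ser by simp
  show "(\<lambda>m. (- a / p) ^ m / fact m * pochhammer (\<nu> + real m + 1) n / p powr (\<nu> + real n + 1))
      sums (LINT s:{0<..}|lborel. bessel_P \<nu> (- a * s) * (s powr (\<nu> + real n) * exp (- p * s)))"
    using ps(2) unfolding ser laplace_monomial_power(2)[OF \<nu>n p] tm[OF d_def[THEN fun_cong]] by simp
qed

lemma laplace_bessel_P:
  fixes \<nu> a p :: real
  assumes \<nu>: "\<nu> > -1" and p: "p > 0"
  shows "set_integrable lborel {0<..} (\<lambda>s. bessel_P \<nu> (- a * s) * (s powr \<nu> * exp (- p * s)))"
    "(LINT s:{0<..}|lborel. bessel_P \<nu> (- a * s) * (s powr \<nu> * exp (- p * s))) = exp (- a / p) / p powr (\<nu> + 1)"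
proof -
  show "set_integrable lborel {0<..} (\<lambda>s. bessel_P \<nu> (- a * s) * (s powr \<nu> * exp (- p * s)))"
    using laplace_bessel_P_gen(1)[OF assms, of a 0] by simp
  have "(\<lambda>m. (- a / p) ^ m / fact m / p powr (\<nu> + 1)) sums (LINT s:{0<..}|lborel. bessel_P \<nu> (- a * s) * (s powr \<nu> * exp (- p * s)))"
    using laplace_bessel_P_gen(2)[OF assms, of a 0] by simp
  moreover have "(\<lambda>m. (- a / p) ^ m / fact m / p powr (\<nu> + 1)) sums (exp (- a / p) / p powr (\<nu> + 1))"
  proof -
    have "(- a / p) ^ m /\<^sub>R fact m = (- a / p) ^ m / fact m" for m by (simp add: divide_inverse mult.commute)
    then show ?thesis using sums_divide[OF exp_converges[of "- a / p"], of "p powr (\<nu> + 1)"] by (simp only:)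
  qed
  ultimately show "(LINT s:{0<..}|lborel. bessel_P \<nu> (- a * s) * (s powr \<nu> * exp (- p * s))) = exp (- a / p) / p powr (\<nu> + 1)"
    by (rule sums_unique2)
qed

section \<open>The Laplace transform of a product of two Bessel functions\<close>

text \<open>The terms below \<open>k\<close> vanish, and after a shift of the index by
  \<open>k\<close> the binomial coefficient cancels the factorial.\<close>

lemma binomial_exp_sums: "(\<lambda>m. x ^ m / fact m * real (m choose k)) sums (x ^ k / fact k * exp x)"
  for x :: real
proof -
  have "(\<lambda>m. x ^ (m + k) / fact (m + k) * real ((m + k) choose k)) = (\<lambda>m. x ^ k / fact k * (x ^ m /\<^sub>R fact m))"
  proof
    fix m
    have "real ((m + k) choose k) = fact (m + k) / (fact k * fact m)"
      using binomial_fact[of k "m + k", where 'a = real] by simp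
    then show "x ^ (m + k) / fact (m + k) * real ((m + k) choose k) = x ^ k / fact k * (x ^ m /\<^sub>R fact m)"
      by (simp add: power_add field_simps)
  qed
  moreover have "(\<lambda>m. x ^ k / fact k * (x ^ m /\<^sub>R fact m)) sums (x ^ k / fact k * exp x)"
    by (intro sums_mult exp_converges)
  ultimately have "(\<lambda>m. x ^ (m + k) / fact (m + k) * real ((m + k) choose k)) sums (x ^ k / fact k * exp x)" by simp
  moreover have "(\<Sum>m<k. x ^ m / fact m * real (m choose k)) = 0" by (intro sum.neutral) auto
  ultimately show ?thesis
    using sums_iff_shift[of "\<lambda>m. x ^ m / fact m * real (m choose k)" k "x ^ k / fact k * exp x"] by simp
qed

text \<open>Rewrites a polynomial in \<open>m\<close> in the basis of binomial coefficients
  \<open>m choose k\<close> with coefficients free of \<open>m\<close>. Each basis element can then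
  be summed over \<open>m\<close> against the exponential series by
  \<open>binomial_exp_sums\<close>.\<close>

lemma pochhammer_Vandermonde:
  fixes \<nu> :: real
  shows "pochhammer (\<nu> + real m + 1) n = (\<Sum>k\<le>n. fact n / fact (n - k) * pochhammer (\<nu> + real k + 1) (n - k) * real (m choose k))"
proof -
  have "(real m + (\<nu> + real n)) gchoose n = (\<Sum>k\<le>n. (real m gchoose k) * ((\<nu> + real n) gchoose (n - k)))"
    using gbinomial_Vandermonde[of "real m" "\<nu> + real n" n] by (simp add: atLeast0AtMost)
  moreover have "(real m + (\<nu> + real n)) gchoose n = pochhammer (\<nu> + real m + 1) n / fact n"
    by (simp add: gbinomial_pochhammer' add_ac)
  moreover have "(\<nu> + real n) gchoose (n - k) = pochhammer (\<nu> + real k + 1) (n - k) / fact (n - k)" if "k \<le> n" for k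
    using that by (simp add: gbinomial_pochhammer' of_nat_diff algebra_simps)
  ultimately have "pochhammer (\<nu> + real m + 1) n = fact n * (\<Sum>k\<le>n. (real m gchoose k) * (pochhammer (\<nu> + real k + 1) (n - k) / fact (n - k)))"
    by (simp add: field_simps)
  then show ?thesis
    by (simp add: sum_distrib_left binomial_gbinomial mult_ac)
qed

lemma bessel_coeff_pochhammer:
  assumes "\<nu> > -1" "k \<le> n"
  shows "bessel_coeff \<nu> n * fact n * pochhammer (\<nu> + real k + 1) (n - k) = bessel_coeff \<nu> k * fact k"
proof -
  have pos: "\<nu> + real k + 1 > 0" "\<nu> + real n + 1 > 0" using assms by auto
  then have "pochhammer (\<nu> + real k + 1) (n - k) = Gamma (\<nu> + real k + 1 + real (n - k)) / Gamma (\<nu> + real k + 1)"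
    by (intro pochhammer_Gamma) (auto simp: nonpos_Ints_def)
  also have "\<nu> + real k + 1 + real (n - k) = \<nu> + real n + 1" using assms by (simp add: of_nat_diff)
  finally show ?thesis
    using Gamma_real_pos[OF pos(1)] Gamma_real_pos[OF pos(2)]
    by (simp add: bessel_coeff_def rGamma_inverse_Gamma add_ac field_simps)
qed

text \<open>This is Weber's second exponential integral after the substitution
  \<open>s = y^2\<close>. The factor with \<open>b\<close> is expanded into powers and the moments
  of the other factor are summed in closed form; with \<open>x = - a / p\<close> and
  \<open>y = - b / p\<close> the double series is the Cauchy product of
  \<open>bessel_P \<nu> (x * y)\<close> and \<open>exp y\<close>.\<close>

lemma laplace_bessel_P_product:
  fixes \<nu> a b p :: real
  assumes \<nu>: "\<nu> > -1" and p: "p > 0" and a: "a \<ge> 0" and b: "b \<ge> 0"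
  shows "set_integrable lborel {0<..} (\<lambda>s. bessel_P \<nu> (- b * s) * (bessel_P \<nu> (- a * s) * (s powr \<nu> * exp (- p * s))))"
    "(LINT s:{0<..}|lborel. bessel_P \<nu> (- b * s) * (bessel_P \<nu> (- a * s) * (s powr \<nu> * exp (- p * s))))
     = exp (- (a + b) / p) * bessel_P \<nu> (a * b / p\<^sup>2) / p powr (\<nu> + 1)"
proof -
  define d where "d = (\<lambda>n. bessel_coeff \<nu> n * (- b) ^ n)"
  define k where "k = (\<lambda>s. bessel_P \<nu> (- a * s) * (s powr \<nu> * exp (- p * s)))"
  have [measurable]: "bessel_P \<nu> \<in> borel_measurable borel" by (rule measurable_bessel_P[OF \<nu>])
  have km: "k \<in> borel_measurable borel" unfolding k_def by measurable
  have keq: "s ^ n * k s = bessel_P \<nu> (- a * s) * (s powr (\<nu> + real n) * exp (- p * s))" if "s \<in> {0<..}" for n s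
    using that by (simp add: k_def powr_add powr_realpow mult_ac)
  have kint: "set_integrable lborel {0<..} (\<lambda>s. s ^ n * k s)" for n
    using laplace_bessel_P_gen(1)[OF \<nu> p, of a n] by (subst set_integrable_cong[OF refl refl keq]) auto
  define x where "x = - a / p"
  define y where "y = - b / p"
  have kval: "(LINT s:{0<..}|lborel. s ^ n * k s) = exp x * (\<Sum>j\<le>n. fact n / fact (n - j) * pochhammer (\<nu> + real j + 1) (n - j) * (x ^ j / fact j)) / p powr (\<nu> + real n + 1)" for n
  proof -
    have "(LINT s:{0<..}|lborel. s ^ n * k s) = (LINT s:{0<..}|lborel. bessel_P \<nu> (- a * s) * (s powr (\<nu> + real n) * exp (- p * s)))"
      by (rule set_lebesgue_integral_cong) (use keq in auto)
    moreover have "(\<lambda>m. x ^ m / fact m * pochhammer (\<nu> + real m + 1) n / p powr (\<nu> + real n + 1)) sums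
        (LINT s:{0<..}|lborel. bessel_P \<nu> (- a * s) * (s powr (\<nu> + real n) * exp (- p * s)))"
      unfolding x_def by (rule laplace_bessel_P_gen(2)[OF \<nu> p])
    moreover have "(\<lambda>m. x ^ m / fact m * pochhammer (\<nu> + real m + 1) n / p powr (\<nu> + real n + 1)) sums
       ((\<Sum>j\<le>n. fact n / fact (n - j) * pochhammer (\<nu> + real j + 1) (n - j) * (x ^ j / fact j * exp x)) / p powr (\<nu> + real n + 1))"
    proof (rule sums_divide)
      have "(\<lambda>m. \<Sum>j\<le>n. fact n / fact (n - j) * pochhammer (\<nu> + real j + 1) (n - j) * (x ^ m / fact m * real (m choose j))) sums
         (\<Sum>j\<le>n. fact n / fact (n - j) * pochhammer (\<nu> + real j + 1) (n - j) * (x ^ j / fact j * exp x))"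
        by (intro sums_sum sums_mult binomial_exp_sums)
      moreover have "(\<Sum>j\<le>n. fact n / fact (n - j) * pochhammer (\<nu> + real j + 1) (n - j) * (x ^ m / fact m * real (m choose j)))
         = x ^ m / fact m * pochhammer (\<nu> + real m + 1) n" for m
        unfolding pochhammer_Vandermonde[of \<nu> m n] sum_distrib_left by (intro sum.cong refl) (simp only: mult_ac)
      ultimately show "(\<lambda>m. x ^ m / fact m * pochhammer (\<nu> + real m + 1) n) sums
         (\<Sum>j\<le>n. fact n / fact (n - j) * pochhammer (\<nu> + real j + 1) (n - j) * (x ^ j / fact j * exp x))" by simp
    qed
    ultimately show ?thesis
      by (simp add: sums_unique2 sum_distrib_left mult_ac)
  qed
  \<comment> \<open>\<open>bessel_coeff_pochhammer\<close> removes \<open>n\<close> from the Bessel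
    coefficient. What remains is coefficient \<open>j\<close> of one series times coefficient
    \<open>n - j\<close> of the other, which is the shape of a Cauchy product.\<close>
  have dk: "d n * (LINT s:{0<..}|lborel. s ^ n * k s) = exp x / p powr (\<nu> + 1) * (\<Sum>j\<le>n. (bessel_coeff \<nu> j * (x * y) ^ j) * (y ^ (n - j) /\<^sub>R fact (n - j)))" for n
  proof -
    have pp: "p powr (\<nu> + real n + 1) = p powr (\<nu> + 1) * p ^ n" using p by (simp add: powr_add powr_realpow)
    have "(- b) ^ n / p ^ n = y ^ n" unfolding y_def power_divide ..
    then have "d n * (LINT s:{0<..}|lborel. s ^ n * k s) = exp x / p powr (\<nu> + 1) *
        (\<Sum>j\<le>n. (bessel_coeff \<nu> n * fact n * pochhammer (\<nu> + real j + 1) (n - j)) * (x ^ j * y ^ n / (fact j * fact (n - j))))"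
    proof -
      assume Y: "(- b) ^ n / p ^ n = y ^ n"
      define S where "S = (\<Sum>j\<le>n. fact n / fact (n - j) * pochhammer (\<nu> + real j + 1) (n - j) * (x ^ j / fact j))"
      have "d n * (LINT s:{0<..}|lborel. s ^ n * k s) = exp x / p powr (\<nu> + 1) * (bessel_coeff \<nu> n * ((- b) ^ n / p ^ n) * S)"
        unfolding kval pp d_def S_def[symmetric] by simp
      also have "bessel_coeff \<nu> n * ((- b) ^ n / p ^ n) * S =
          (\<Sum>j\<le>n. (bessel_coeff \<nu> n * fact n * pochhammer (\<nu> + real j + 1) (n - j)) * (x ^ j * y ^ n / (fact j * fact (n - j))))"
        unfolding Y S_def sum_distrib_left by (intro sum.cong refl) (simp add: mult_ac)
      finally show ?thesis .
    qed
    also have "(\<Sum>j\<le>n. (bessel_coeff \<nu> n * fact n * pochhammer (\<nu> + real j + 1) (n - j)) * (x ^ j * y ^ n / (fact j * fact (n - j))))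
       = (\<Sum>j\<le>n. (bessel_coeff \<nu> j * (x * y) ^ j) * (y ^ (n - j) /\<^sub>R fact (n - j)))"
    proof (rule sum.cong[OF refl])
      fix j assume "j \<in> {..n}"
      then have j: "j \<le> n" by simp
      have "y ^ n = y ^ j * y ^ (n - j)" using j by (simp flip: power_add)
      then show "(bessel_coeff \<nu> n * fact n * pochhammer (\<nu> + real j + 1) (n - j)) * (x ^ j * y ^ n / (fact j * fact (n - j)))
        = (bessel_coeff \<nu> j * (x * y) ^ j) * (y ^ (n - j) /\<^sub>R fact (n - j))"
        unfolding bessel_coeff_pochhammer[OF \<nu> j] by (simp add: power_mult_distrib field_simps)
    qed
    finally show ?thesis .
  qed
  \<comment> \<open>A crude bound suffices. With \<open>r = 2 * sqrt (a * s)\<close> the growth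
    exponent \<open>- \<nu> - 1 / 2\<close> stays below 2 because \<open>\<nu> > -1\<close>, so the
    function grows at most linearly in \<open>s\<close> and costs one additional moment.\<close>
  obtain C where C: "C > 0" "\<And>s. s > 0 \<Longrightarrow> \<bar>bessel_P \<nu> (- a * s)\<bar> \<le> C * (1 + s)"
  proof -
    obtain C where C: "C > 0" "\<And>s. 0 \<le> s \<Longrightarrow> s \<le> 1 \<Longrightarrow> \<bar>bessel_P \<nu> (- (s\<^sup>2 / 4))\<bar> \<le> C"
      "\<And>s. 1 \<le> s \<Longrightarrow> \<bar>bessel_P \<nu> (- (s\<^sup>2 / 4))\<bar> \<le> C * s powr (- \<nu> - 1 / 2)"
      by (rule bessel_P_bounds[OF \<nu>]) (rule that)
    show thesis
    proof (rule that[of "C * (1 + 4 * a)"])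
      show "C * (1 + 4 * a) > 0" using C(1) a by (intro mult_pos_pos) auto
      fix s :: real assume s: "s > 0"
      define r where "r = 2 * sqrt (a * s)"
      have r: "r \<ge> 0" "r\<^sup>2 / 4 = a * s" using a s by (auto simp: r_def power_mult_distrib)
      have "\<bar>bessel_P \<nu> (- (r\<^sup>2 / 4))\<bar> \<le> C * (1 + r\<^sup>2)"
      proof (cases "r \<le> 1")
        case True
        have "C * 1 \<le> C * (1 + r\<^sup>2)" using C(1) by (intro mult_left_mono) auto
        then show ?thesis using C(2)[OF r(1) True] by linarith
      next
        case False
        then have "r powr (- \<nu> - 1 / 2) \<le> r powr 2" using \<nu> by (intro powr_mono) auto
        then have "r powr (- \<nu> - 1 / 2) \<le> 1 + r\<^sup>2" using False by (simp add: powr_numeral)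
        then have "C * r powr (- \<nu> - 1 / 2) \<le> C * (1 + r\<^sup>2)" using C(1) by (intro mult_left_mono) auto
        then show ?thesis using C(3)[of r] False by simp
      qed
      also have "\<dots> = C * (1 + 4 * a * s)" using r(2) by simp
      also have "\<dots> \<le> C * ((1 + 4 * a) * (1 + s))" using C(1) a s by (intro mult_left_mono) (auto simp: algebra_simps)
      finally show "\<bar>bessel_P \<nu> (- a * s)\<bar> \<le> C * (1 + 4 * a) * (1 + s)" unfolding r(2) by (simp add: mult_ac)
    qed
  qed
  \<comment> \<open>By \<open>bessel_coeff_Gamma\<close> the Gamma factor of the moment cancels
    against the coefficient and leaves \<open>1 / fact n\<close>; the linear growth contributes at
    most \<open>2 ^ n\<close>. The terms are dominated by the exponential series at
    \<open>2 * b / p\<close>.\<close>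
  have summ: "summable (\<lambda>n. \<bar>d n\<bar> * (LINT s:{0<..}|lborel. \<bar>s ^ n * k s\<bar>))"
  proof (rule summable_comparison_test')
    define D where "D = C * (1 + (\<bar>\<nu>\<bar> + 2) / p) / p powr (\<nu> + 1)"
    show "summable (\<lambda>n. D * ((2 * b / p) ^ n /\<^sub>R fact n))"
      by (intro summable_mult summable_exp_generic)
    fix n :: nat
    have "(LINT s:{0<..}|lborel. \<bar>s ^ n * k s\<bar>) \<le> (LINT s:{0<..}|lborel. C * (s ^ n * (s powr \<nu> * exp (- p * s)) + s ^ Suc n * (s powr \<nu> * exp (- p * s))))"
    proof (rule set_integral_mono)
      show "set_integrable lborel {0<..} (\<lambda>s. \<bar>s ^ n * k s\<bar>)" by (rule set_integrable_abs[OF kint])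
      show "set_integrable lborel {0<..} (\<lambda>s. C * (s ^ n * (s powr \<nu> * exp (- p * s)) + s ^ Suc n * (s powr \<nu> * exp (- p * s))))"
        by (intro set_integrable_mult_right set_integral_add(1) laplace_monomial_power(1)[OF \<nu> p])
      fix s :: real assume "s \<in> {0<..}"
      then have s: "s > 0" by simp
      have "\<bar>s ^ n * k s\<bar> = \<bar>bessel_P \<nu> (- a * s)\<bar> * (s ^ n * (s powr \<nu> * exp (- p * s)))"
        using s by (simp add: k_def abs_mult)
      also have "\<dots> \<le> C * (1 + s) * (s ^ n * (s powr \<nu> * exp (- p * s)))"
        using C(2)[OF s] s by (intro mult_right_mono) auto
      finally show "\<bar>s ^ n * k s\<bar> \<le> C * (s ^ n * (s powr \<nu> * exp (- p * s)) + s ^ Suc n * (s powr \<nu> * exp (- p * s)))"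
        by (simp add: algebra_simps)
    qed
    also have "\<dots> = C * (Gamma (\<nu> + real n + 1) / p powr (\<nu> + real n + 1) + Gamma (\<nu> + real (Suc n) + 1) / p powr (\<nu> + real (Suc n) + 1))"
      unfolding laplace_monomial_power(2)[OF \<nu> p, symmetric]
      by (simp only: set_integral_mult_right set_integral_add(2)[OF laplace_monomial_power(1)[OF \<nu> p] laplace_monomial_power(1)[OF \<nu> p]])
    also have "\<dots> = C * Gamma (\<nu> + real n + 1) / p powr (\<nu> + real n + 1) * (1 + (\<nu> + real n + 1) / p)"
    proof -
      have "\<nu> + real n + 1 > 0" using \<nu> by simp
      then have "Gamma (\<nu> + real n + 1 + 1) = (\<nu> + real n + 1) * Gamma (\<nu> + real n + 1)"
        by (intro Gamma_plus1) (auto simp: nonpos_Ints_def)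
      moreover have "\<nu> + real (Suc n) + 1 = \<nu> + real n + 1 + 1" by simp
      moreover have "p powr (X + 1) = p powr X * p" for X using p by (simp add: powr_add)
      moreover have "C * (A / B + v * A / (B * p)) = C * A / B * (1 + v / p)" if "B \<noteq> 0" for A B v
        using that p by (simp add: field_simps)
      ultimately show ?thesis using p by (simp only: powr_eq_0_iff) simp
    qed
    also have "\<dots> \<le> C * Gamma (\<nu> + real n + 1) / p powr (\<nu> + real n + 1) * ((1 + (\<bar>\<nu>\<bar> + 2) / p) * 2 ^ n)"
    proof (rule mult_left_mono)
      have n2: "real n + 1 \<le> 2 ^ n" by (metis Suc_leI add.commute less_exp of_nat_1 of_nat_Suc of_nat_le_iff of_nat_numeral of_nat_power plus_1_eq_Suc)
      then have "1 \<le> (2::real) ^ n" by simp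
      have "\<nu> + real n + 1 \<le> \<bar>\<nu>\<bar> * 1 + (real n + 1)" by simp
      also have "\<dots> \<le> \<bar>\<nu>\<bar> * 2 ^ n + 2 * 2 ^ n" using n2 \<open>1 \<le> (2::real) ^ n\<close> by (intro add_mono mult_left_mono) auto
      finally have "(\<nu> + real n + 1) / p \<le> (\<bar>\<nu>\<bar> + 2) * 2 ^ n / p" using p by (intro divide_right_mono) (auto simp: algebra_simps)
      then show "1 + (\<nu> + real n + 1) / p \<le> (1 + (\<bar>\<nu>\<bar> + 2) / p) * 2 ^ n"
        unfolding distrib_right mult_1_left times_divide_eq_left using \<open>1 \<le> (2::real) ^ n\<close> by linarith
      show "0 \<le> C * Gamma (\<nu> + real n + 1) / p powr (\<nu> + real n + 1)"
        using C(1) \<nu> by (intro divide_nonneg_nonneg mult_nonneg_nonneg less_imp_le[OF Gamma_real_pos]) auto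
    qed
    finally have "\<bar>d n\<bar> * (LINT s:{0<..}|lborel. \<bar>s ^ n * k s\<bar>) \<le> \<bar>d n\<bar> * (C * Gamma (\<nu> + real n + 1) / p powr (\<nu> + real n + 1) * ((1 + (\<bar>\<nu>\<bar> + 2) / p) * 2 ^ n))"
      by (rule mult_left_mono) simp
    also have "\<dots> = D * ((2 * b / p) ^ n /\<^sub>R fact n)"
    proof -
      have "\<bar>d n\<bar> = bessel_coeff \<nu> n * b ^ n"
        using bessel_coeff_pos[OF \<nu>, of n] b by (simp add: d_def abs_mult power_abs)
      moreover have "p powr (\<nu> + real n + 1) = p powr (\<nu> + 1) * p ^ n" using p by (simp add: powr_add powr_realpow)
      ultimately have "\<bar>d n\<bar> * (C * Gamma (\<nu> + real n + 1) / p powr (\<nu> + real n + 1) * ((1 + (\<bar>\<nu>\<bar> + 2) / p) * 2 ^ n))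
        = (bessel_coeff \<nu> n * Gamma (\<nu> + real n + 1)) * (b ^ n / p ^ n * 2 ^ n) * D"
        unfolding D_def by (simp add: mult_ac)
      then show ?thesis unfolding bessel_coeff_Gamma[OF \<nu>] by (simp add: power_mult_distrib power_divide field_simps)
    qed
    finally have le: "\<bar>d n\<bar> * (LINT s:{0<..}|lborel. \<bar>s ^ n * k s\<bar>) \<le> D * ((2 * b / p) ^ n /\<^sub>R fact n)" .
    have "(LINT s:{0<..}|lborel. \<bar>s ^ n * k s\<bar>) \<ge> 0"
      unfolding set_lebesgue_integral_def by (intro Bochner_Integration.integral_nonneg) auto
    then show "norm (\<bar>d n\<bar> * (LINT s:{0<..}|lborel. \<bar>s ^ n * k s\<bar>)) \<le> D * ((2 * b / p) ^ n /\<^sub>R fact n)"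
      using le by (simp add: abs_mult)
  qed
  have conv: "summable (\<lambda>m. norm (d m * s ^ m))" for s
    using bessel_P_summable_norm[OF \<nu>, of "- b * s"] by (simp add: d_def power_mult_distrib abs_mult power_abs mult.assoc)
  have ser: "(\<Sum>m. d m * s ^ m) = bessel_P \<nu> (- b * s)" for s
    unfolding bessel_P_def d_def by (simp add: mult.assoc flip: power_mult_distrib)
  have "(\<lambda>n. d n * (LINT s:{0<..}|lborel. s ^ n * k s)) sums (LINT s:{0<..}|lborel. bessel_P \<nu> (- b * s) * k s)"
    using set_integral_power_series(2)[OF km kint summ conv] unfolding ser .
  moreover have "(\<lambda>n. d n * (LINT s:{0<..}|lborel. s ^ n * k s)) sums (exp x / p powr (\<nu> + 1) * (bessel_P \<nu> (x * y) * exp y))"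
    unfolding dk
  proof (rule sums_mult)
    have "summable (\<lambda>j. norm (bessel_coeff \<nu> j * (x * y) ^ j))" by (rule bessel_P_summable_norm[OF \<nu>])
    moreover have "summable (\<lambda>j. norm (y ^ j /\<^sub>R fact j))" by (rule summable_norm_exp)
    ultimately have "(\<lambda>n. \<Sum>j\<le>n. (bessel_coeff \<nu> j * (x * y) ^ j) * (y ^ (n - j) /\<^sub>R fact (n - j))) sums
       ((\<Sum>j. bessel_coeff \<nu> j * (x * y) ^ j) * (\<Sum>j. y ^ j /\<^sub>R fact j))"
      by (rule Cauchy_product_sums)
    then show "(\<lambda>n. \<Sum>j\<le>n. (bessel_coeff \<nu> j * (x * y) ^ j) * (y ^ (n - j) /\<^sub>R fact (n - j))) sums (bessel_P \<nu> (x * y) * exp y)"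
      unfolding bessel_P_def exp_def .
  qed
  ultimately have "(LINT s:{0<..}|lborel. bessel_P \<nu> (- b * s) * k s) = exp x / p powr (\<nu> + 1) * (bessel_P \<nu> (x * y) * exp y)"
    by (rule sums_unique2)
  moreover have "x * y = a * b / p\<^sup>2" by (simp add: x_def y_def power2_eq_square)
  moreover have "exp x * exp y = exp (- (a + b) / p)" by (simp add: x_def y_def add_divide_distrib diff_divide_distrib flip: exp_add)
  ultimately show "(LINT s:{0<..}|lborel. bessel_P \<nu> (- b * s) * (bessel_P \<nu> (- a * s) * (s powr \<nu> * exp (- p * s))))
     = exp (- (a + b) / p) * bessel_P \<nu> (a * b / p\<^sup>2) / p powr (\<nu> + 1)"
    unfolding k_def by (simp add: mult_ac)
  show "set_integrable lborel {0<..} (\<lambda>s. bessel_P \<nu> (- b * s) * (bessel_P \<nu> (- a * s) * (s powr \<nu> * exp (- p * s))))"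
    using set_integral_power_series(1)[OF km kint summ conv] unfolding ser k_def .
qed

section \<open>Schlaefli's integral\<close>

definition mod_bessel_I :: "real \<Rightarrow> real \<Rightarrow> real" where
  "mod_bessel_I \<nu> s = (s / 2) powr \<nu> * bessel_P \<nu> (s\<^sup>2 / 4)"

definition schlaefli_cos :: "real \<Rightarrow> real \<Rightarrow> real" where
  "schlaefli_cos \<nu> s = (LINT \<phi>:{0..pi}|lborel. exp (s * cos \<phi>) * cos (\<nu> * \<phi>))"

definition schlaefli_cosh :: "real \<Rightarrow> real \<Rightarrow> real" where
  "schlaefli_cosh \<nu> s = (LINT u:{0..}|lborel. exp (- s * cosh u - \<nu> * u))"

text \<open>Schlaefli's representation of the modified Bessel function, multiplied by
  \<open>pi\<close>. The two parts are kept as separate functions because their inverse Laplace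
  transforms start at different thresholds: the one of the hyperbolic part vanishes below
  \<open>(x + z)\<^sup>2\<close>.\<close>

definition schlaefli :: "real \<Rightarrow> real \<Rightarrow> real" where
  "schlaefli \<nu> s = schlaefli_cos \<nu> s - sin (\<nu> * pi) * schlaefli_cosh \<nu> s"

section \<open>Convergence, derivatives and recurrences of the two parts\<close>

lemma set_integrable_exp_decay:
  assumes "a > (0::real)"
  shows "set_integrable lborel {0..} (\<lambda>u. exp (- a * u))"
proof -
  have "((\<lambda>u. exp (- a * u)) has_integral exp (- a * 0) / a) {0..}"
    by (rule has_integral_exp_minus_to_infinity[OF assms])
  then show ?thesis
    by (intro set_integrable_lborel_nonneg) (auto simp: integrable_on_def)
qed

text \<open>\<open>cosh u\<close> dominates \<open>u\<^sup>2 / 4\<close>, and completing the square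
  absorbs the linear term \<open>c * u\<close> at the cost of \<open>c\<^sup>2 / s\<close>. With
  \<open>c = \<bar>\<nu>\<bar> + 1\<close> one unit of linear decay is left over, which makes the
  hyperbolic integral converge for every real order.\<close>

lemma cosh_linear_bound:
  fixes s \<nu> :: real
  assumes s: "s > 0"
  obtains B where "\<And>u. u \<ge> 0 \<Longrightarrow> - s * cosh u - \<nu> * u \<le> B - u"
proof -
  define c where "c = \<bar>\<nu>\<bar> + 1"
  have c: "c > 0" by (simp add: c_def)
  have "- s * cosh u - \<nu> * u \<le> c\<^sup>2 / s - u" if u: "u \<ge> 0" for u
  proof -
    have "u\<^sup>2 / 4 \<le> cosh u"
    proof -
      have "1 + u / 2 \<le> exp (u / 2)" by (rule exp_ge_add_one_self)
      then have "(1 + u / 2)\<^sup>2 \<le> (exp (u / 2))\<^sup>2" using u by (intro power_mono) auto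
      also have "(exp (u / 2))\<^sup>2 = exp u" by (simp flip: exp_of_nat_mult)
      finally have 1: "(1 + u / 2)\<^sup>2 \<le> exp u" .
      have "1 - u + u\<^sup>2 / 4 \<le> 1 * exp (- u) + u\<^sup>2 / 4" using exp_ge_add_one_self[of "- u"] by simp
      have "u\<^sup>2 / 2 \<le> exp u + exp (- u)"
      proof -
        have "1 + u + u\<^sup>2 / 2 \<le> exp u" using exp_lower_Taylor_quadratic[OF u] by simp
        then show ?thesis using u exp_gt_zero[of "- u"] by linarith
      qed
      then show ?thesis by (simp add: cosh_def)
    qed
    then have "s * (u\<^sup>2 / 4) \<le> s * cosh u" using s by (intro mult_left_mono) auto
    moreover have "c * u \<le> s * (u\<^sup>2 / 4) + c\<^sup>2 / s"
    proof -
      have "0 \<le> (s * u / 2 - c)\<^sup>2 / s" using s by simp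
      also have "(s * u / 2 - c)\<^sup>2 / s = s * (u\<^sup>2 / 4) + c\<^sup>2 / s - c * u"
        using s by (simp add: power2_diff field_simps power2_eq_square)
      finally show ?thesis by simp
    qed
    moreover have "- \<nu> * u \<le> \<bar>\<nu>\<bar> * u" using u by (intro mult_right_mono) auto
    ultimately show ?thesis by (simp add: c_def algebra_simps)
  qed
  then show thesis by (rule that)
qed

lemma schlaefli_cosh_integrable:
  fixes s :: real
  assumes s: "s > 0"
  shows "set_integrable lborel {0..} (\<lambda>u. exp (- s * cosh u - \<nu> * u))"
proof -
  obtain B where B: "\<And>u. u \<ge> 0 \<Longrightarrow> - s * cosh u - \<nu> * u \<le> B - u"
    by (rule cosh_linear_bound[OF s]) (rule that)
  show ?thesis
  proof (rule set_integrable_bound)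
    show "set_integrable lborel {0..} (\<lambda>u. exp B * exp (- 1 * u))"
      by (intro set_integrable_mult_right set_integrable_exp_decay) auto
    show "AE u in lborel. u \<in> {0..} \<longrightarrow> norm (exp (- s * cosh u - \<nu> * u)) \<le> norm (exp B * exp (- 1 * u))"
      using B by (intro AE_I2) (auto simp flip: exp_add)
  qed (simp add: set_borel_measurable_def cosh_def)
qed

lemma schlaefli_cos_integrable: "set_integrable lborel {0..pi} (\<lambda>\<phi>. exp (s * cos \<phi>) * cos (\<nu> * \<phi>))"
  by (intro borel_integrable_atLeastAtMost' continuous_intros)

lemma DERIV_schlaefli_cos:
  "(schlaefli_cos \<nu> has_real_derivative (schlaefli_cos (\<nu> - 1) s + schlaefli_cos (\<nu> + 1) s) / 2) (at s)"
proof -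
  have eq: "cos \<phi> * (exp (s * cos \<phi>) * cos (\<nu> * \<phi>)) = (exp (s * cos \<phi>) * cos ((\<nu> - 1) * \<phi>) + exp (s * cos \<phi>) * cos ((\<nu> + 1) * \<phi>)) / 2" for \<phi>
  proof -
    have "cos ((\<nu> - 1) * \<phi>) + cos ((\<nu> + 1) * \<phi>) = 2 * (cos \<phi> * cos (\<nu> * \<phi>))"
      by (simp add: left_diff_distrib distrib_right cos_add cos_diff)
    then show ?thesis by (simp add: distrib_left[symmetric])
  qed
  have "((\<lambda>s. LINT \<phi>:{0..pi}|lborel. exp (s * cos \<phi>) * cos (\<nu> * \<phi>)) has_real_derivative
      (LINT \<phi>:{0..pi}|lborel. cos \<phi> * (exp (s * cos \<phi>) * cos (\<nu> * \<phi>)))) (at s)"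
    unfolding set_lebesgue_integral_def
  proof (rule has_real_derivative_LINT(1)[where \<delta> = 1 and B = "\<lambda>\<phi>. indicator {0..pi} \<phi> *\<^sub>R exp (\<bar>s\<bar> + 1)"])
    fix w \<phi> :: real assume w: "\<bar>w - s\<bar> < 1"
    show "((\<lambda>w. indicat_real {0..pi} \<phi> *\<^sub>R (exp (w * cos \<phi>) * cos (\<nu> * \<phi>))) has_real_derivative
         indicat_real {0..pi} \<phi> *\<^sub>R (cos \<phi> * (exp (w * cos \<phi>) * cos (\<nu> * \<phi>)))) (at w)"
      by (auto intro!: derivative_eq_intros)
    have "\<bar>w * cos \<phi>\<bar> \<le> (\<bar>s\<bar> + 1) * 1"
      unfolding abs_mult using w by (intro mult_mono) auto
    then have "exp (w * cos \<phi>) \<le> exp (\<bar>s\<bar> + 1)" by simp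
    then have "\<bar>cos \<phi>\<bar> * (exp (w * cos \<phi>) * \<bar>cos (\<nu> * \<phi>)\<bar>) \<le> 1 * (exp (\<bar>s\<bar> + 1) * 1)"
      by (intro mult_mono) auto
    then show "\<bar>indicat_real {0..pi} \<phi> *\<^sub>R (cos \<phi> * (exp (w * cos \<phi>) * cos (\<nu> * \<phi>)))\<bar> \<le> indicat_real {0..pi} \<phi> *\<^sub>R exp (\<bar>s\<bar> + 1)"
      by (auto simp: indicator_def abs_mult)
  next
    show "integrable lborel (\<lambda>\<phi>. indicat_real {0..pi} \<phi> *\<^sub>R (exp (w * cos \<phi>) * cos (\<nu> * \<phi>)))" for w
      using schlaefli_cos_integrable[of w \<nu>] by (simp add: set_integrable_def)
    have "set_integrable lborel {0..pi} (\<lambda>\<phi>. exp (\<bar>s\<bar> + 1))"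
      by (intro borel_integrable_atLeastAtMost' continuous_intros)
    then show "integrable lborel (\<lambda>\<phi>. indicat_real {0..pi} \<phi> *\<^sub>R exp (\<bar>s\<bar> + 1))"
      by (simp add: set_integrable_def)
  qed auto
  also have "(LINT \<phi>:{0..pi}|lborel. cos \<phi> * (exp (s * cos \<phi>) * cos (\<nu> * \<phi>))) = (schlaefli_cos (\<nu> - 1) s + schlaefli_cos (\<nu> + 1) s) / 2"
    unfolding eq schlaefli_cos_def by (simp add: set_integral_add(2) schlaefli_cos_integrable)
  finally show ?thesis unfolding schlaefli_cos_def[abs_def] .
qed

lemma DERIV_schlaefli_cosh:
  assumes s: "s > 0"
  shows "(schlaefli_cosh \<nu> has_real_derivative - (schlaefli_cosh (\<nu> - 1) s + schlaefli_cosh (\<nu> + 1) s) / 2) (at s)"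
proof -
  have eq: "- cosh u * exp (- w * cosh u - \<nu> * u) = - (exp (- w * cosh u - (\<nu> - 1) * u) + exp (- w * cosh u - (\<nu> + 1) * u)) / 2" for u w :: real
  proof -
    have "exp (- w * cosh u - (\<nu> - 1) * u) = exp u * exp (- w * cosh u - \<nu> * u)"
      "exp (- w * cosh u - (\<nu> + 1) * u) = exp (- u) * exp (- w * cosh u - \<nu> * u)"
      by (simp_all flip: exp_add add: algebra_simps)
    then show ?thesis by (simp add: cosh_def algebra_simps)
  qed
  have "((\<lambda>s. LINT u:{0..}|lborel. exp (- s * cosh u - \<nu> * u)) has_real_derivative
      (LINT u:{0..}|lborel. - cosh u * exp (- s * cosh u - \<nu> * u))) (at s)"
    unfolding set_lebesgue_integral_def
  proof (rule has_real_derivative_LINT(1)[where \<delta> = "s / 2" and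
        B = "\<lambda>u. indicator {0..} u *\<^sub>R ((exp (- (s / 2) * cosh u - (\<nu> - 1) * u) + exp (- (s / 2) * cosh u - (\<nu> + 1) * u)) / 2)"])
    fix w u :: real assume w: "\<bar>w - s\<bar> < s / 2"
    then have w2: "s / 2 \<le> w" by linarith
    show "((\<lambda>w. indicat_real {0..} u *\<^sub>R exp (- w * cosh u - \<nu> * u)) has_real_derivative
         indicat_real {0..} u *\<^sub>R (- cosh u * exp (- w * cosh u - \<nu> * u))) (at w)"
      by (auto intro!: derivative_eq_intros)
    have "s / 2 * cosh u \<le> w * cosh u" using w2 by (intro mult_right_mono) auto
    then have "exp (- w * cosh u - (\<nu> - 1) * u) + exp (- w * cosh u - (\<nu> + 1) * u)
        \<le> exp (- (s / 2) * cosh u - (\<nu> - 1) * u) + exp (- (s / 2) * cosh u - (\<nu> + 1) * u)"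
      by (intro add_mono) auto
    moreover have "exp (- w * cosh u - (\<nu> - 1) * u) + exp (- w * cosh u - (\<nu> + 1) * u) > 0"
      by (intro add_pos_pos) auto
    ultimately show "\<bar>indicat_real {0..} u *\<^sub>R (- cosh u * exp (- w * cosh u - \<nu> * u))\<bar>
      \<le> indicat_real {0..} u *\<^sub>R ((exp (- (s / 2) * cosh u - (\<nu> - 1) * u) + exp (- (s / 2) * cosh u - (\<nu> + 1) * u)) / 2)"
      unfolding eq by (auto simp: indicator_def)
  next
    fix w assume "\<bar>w - s\<bar> < s / 2"
    then have "w > 0" using s by linarith
    then show "integrable lborel (\<lambda>u. indicat_real {0..} u *\<^sub>R exp (- w * cosh u - \<nu> * u))"
      using schlaefli_cosh_integrable[of w \<nu>] by (simp add: set_integrable_def)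
  next
    have "s / 2 > 0" using s by simp
    then have "set_integrable lborel {0..} (\<lambda>u. (exp (- (s / 2) * cosh u - (\<nu> - 1) * u) + exp (- (s / 2) * cosh u - (\<nu> + 1) * u)) / 2)"
      by (intro set_integrable_divide set_integral_add(1) schlaefli_cosh_integrable)
    then show "integrable lborel (\<lambda>u. indicator {0..} u *\<^sub>R ((exp (- (s / 2) * cosh u - (\<nu> - 1) * u) + exp (- (s / 2) * cosh u - (\<nu> + 1) * u)) / 2))"
      by (simp add: set_integrable_def)
  qed (use s in auto)
  also have "(LINT u:{0..}|lborel. - cosh u * exp (- s * cosh u - \<nu> * u)) = - (schlaefli_cosh (\<nu> - 1) s + schlaefli_cosh (\<nu> + 1) s) / 2"
    unfolding eq schlaefli_cosh_def using schlaefli_cosh_integrable[OF s]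
    by (simp add: set_integral_add(2) set_lebesgue_integral_def[symmetric] set_integral_uminus del: minus_add_distrib)
  finally show ?thesis unfolding schlaefli_cosh_def[abs_def] .
qed

text \<open>Integration of an exact derivative. The term with
  \<open>exp (- s) * sin (\<nu> * pi)\<close> is the boundary value at \<open>pi\<close>; it spoils
  the Bessel recurrence for non-integral \<nu>, and the boundary value at 0 in
  \<open>schlaefli_cosh_rec\<close> cancels it in the combination \<open>schlaefli\<close>.\<close>

lemma schlaefli_cos_rec:
  assumes s: "s > 0"
  shows "schlaefli_cos (\<nu> - 1) s - schlaefli_cos (\<nu> + 1) s = 2 * \<nu> / s * schlaefli_cos \<nu> s - 2 * exp (- s) * sin (\<nu> * pi) / s"
proof -
  define f where "f = (\<lambda>\<phi>. - 2 * exp (s * cos \<phi>) * sin (\<nu> * \<phi>) / s)"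
  define f' where "f' = (\<lambda>\<phi>. 2 * (sin \<phi> * sin (\<nu> * \<phi>)) * exp (s * cos \<phi>) - 2 * \<nu> / s * (exp (s * cos \<phi>) * cos (\<nu> * \<phi>)))"
  have "(LBINT \<phi>. indicator {0..pi} \<phi> *\<^sub>R f' \<phi>) = f pi - f 0"
  proof (rule integral_FTC_Icc)
    show "(f has_vector_derivative f' \<phi>) (at \<phi> within {0..pi})" for \<phi>
      unfolding f_def f'_def has_real_derivative_iff_has_vector_derivative[symmetric] using s
      by (auto intro!: derivative_eq_intros simp: field_simps)
    show "continuous_on {0..pi} f'" unfolding f'_def by (intro continuous_intros) (use s in auto)
  qed auto
  then have "(LINT \<phi>:{0..pi}|lborel. f' \<phi>) = - 2 * exp (- s) * sin (\<nu> * pi) / s"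
    by (simp add: set_lebesgue_integral_def f_def)
  moreover have "f' \<phi> = exp (s * cos \<phi>) * cos ((\<nu> - 1) * \<phi>) - exp (s * cos \<phi>) * cos ((\<nu> + 1) * \<phi>) - 2 * \<nu> / s * (exp (s * cos \<phi>) * cos (\<nu> * \<phi>))" for \<phi>
    unfolding f'_def by (simp add: left_diff_distrib distrib_right cos_add cos_diff algebra_simps)
  ultimately have "(LINT \<phi>:{0..pi}|lborel. exp (s * cos \<phi>) * cos ((\<nu> - 1) * \<phi>) - exp (s * cos \<phi>) * cos ((\<nu> + 1) * \<phi>) - 2 * \<nu> / s * (exp (s * cos \<phi>) * cos (\<nu> * \<phi>)))
     = - 2 * exp (- s) * sin (\<nu> * pi) / s" by simp
  also have "(LINT \<phi>:{0..pi}|lborel. exp (s * cos \<phi>) * cos ((\<nu> - 1) * \<phi>) - exp (s * cos \<phi>) * cos ((\<nu> + 1) * \<phi>) - 2 * \<nu> / s * (exp (s * cos \<phi>) * cos (\<nu> * \<phi>)))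
    = schlaefli_cos (\<nu> - 1) s - schlaefli_cos (\<nu> + 1) s - 2 * \<nu> / s * schlaefli_cos \<nu> s"
    unfolding schlaefli_cos_def
    by (subst set_integral_diff(2), intro set_integral_diff(1) schlaefli_cos_integrable, intro set_integrable_mult_right schlaefli_cos_integrable,
        subst set_integral_diff(2)) (auto intro: schlaefli_cos_integrable)
  finally show ?thesis by simp
qed

lemma schlaefli_cosh_rec:
  assumes s: "s > 0"
  shows "schlaefli_cosh (\<nu> - 1) s - schlaefli_cosh (\<nu> + 1) s = 2 * exp (- s) / s - 2 * \<nu> / s * schlaefli_cosh \<nu> s"
proof -
  define f where "f = (\<lambda>u. - 2 * exp (- s * cosh u - \<nu> * u) / s)"
  define f' where "f' = (\<lambda>u. exp (- s * cosh u - (\<nu> - 1) * u) - exp (- s * cosh u - (\<nu> + 1) * u) + 2 * \<nu> / s * exp (- s * cosh u - \<nu> * u))"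
  obtain B where B: "\<And>u. u \<ge> 0 \<Longrightarrow> - s * cosh u - \<nu> * u \<le> B - u"
    by (rule cosh_linear_bound[OF s]) (rule that)
  have int: "set_integrable lborel {0..} f'"
    unfolding f'_def using schlaefli_cosh_integrable[OF s]
    by (intro set_integral_add(1) set_integral_diff(1) set_integrable_mult_right)
  have der: "(f has_real_derivative f' u) (at u)" for u
  proof -
    have "exp (- s * cosh u - (\<nu> - 1) * u) = exp u * exp (- s * cosh u - \<nu> * u)"
      "exp (- s * cosh u - (\<nu> + 1) * u) = exp (- u) * exp (- s * cosh u - \<nu> * u)"
      by (simp_all flip: exp_add add: algebra_simps)
    then have f'_eq: "f' u = - 2 * (exp (- s * cosh u - \<nu> * u) * (- s * sinh u - \<nu>)) / s"
      unfolding f'_def sinh_def using s by (simp add: field_simps)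
    show ?thesis
      unfolding f'_eq unfolding f_def using s by (auto intro!: derivative_eq_intros)
  qed
  have lim: "(f \<longlongrightarrow> 0) at_top"
  proof (rule Lim_null_comparison)
    have "((\<lambda>u. exp (B - u)) \<longlongrightarrow> 0) at_top"
    proof (rule filterlim_compose[OF exp_at_bot], unfold filterlim_at_bot, intro allI)
      fix Z :: real
      show "\<forall>\<^sub>F u in at_top. B - u \<le> Z"
        using eventually_ge_at_top[of "B - Z"] by eventually_elim linarith
    qed
    then show "((\<lambda>u. 2 / s * exp (B - u)) \<longlongrightarrow> 0) at_top" by (rule tendsto_mult_right_zero)
    show "\<forall>\<^sub>F u in at_top. norm (f u) \<le> 2 / s * exp (B - u)"
      using eventually_ge_at_top[of 0]
    proof eventually_elim
      case (elim u)
      then have "exp (- s * cosh u - \<nu> * u) \<le> exp (B - u)" using B by simp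
      then show ?case unfolding f_def using s by (simp add: divide_right_mono)
    qed
  qed
  have "(LBINT u=ereal 0..\<infinity>. f' u) = 0 - f 0"
  proof (rule interval_integral_FTC_integrable)
    show "(f has_vector_derivative f' u) (at u)" for u
      using der by (simp add: has_real_derivative_iff_has_vector_derivative)
    show "isCont f' u" for u unfolding f'_def cosh_def using s by (intro continuous_intros) auto
    show "set_integrable lborel (einterval (ereal 0) \<infinity>) f'"
      by (rule set_integrable_subset[OF int]) (auto simp: einterval_def)
    have "isCont f 0" using der DERIV_isCont by blast
    then have "(f \<longlongrightarrow> f 0) (at_right 0)" unfolding isCont_def by (rule filterlim_at_split[THEN iffD1, THEN conjunct2])
    then show "((f \<circ> real_of_ereal) \<longlongrightarrow> f 0) (at_right (ereal 0))"
      by (simp only: ereal_tendsto_simps1)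
    show "((f \<circ> real_of_ereal) \<longlongrightarrow> 0) (at_left \<infinity>)"
      using lim by (simp add: ereal_tendsto_simps1)
  qed auto
  also have "(LBINT u=ereal 0..\<infinity>. f' u) = (LINT u:{0..}|lborel. f' u)"
    unfolding interval_integral_to_infinity_eq
    by (rule set_integral_cong_set) (auto simp: set_borel_measurable_def f'_def cosh_def intro!: AE_I[of _ _ "{0}"])
  also have "\<dots> = schlaefli_cosh (\<nu> - 1) s - schlaefli_cosh (\<nu> + 1) s + 2 * \<nu> / s * schlaefli_cosh \<nu> s"
    unfolding f'_def schlaefli_cosh_def using schlaefli_cosh_integrable[OF s]
    by (subst set_integral_add(2), intro set_integral_diff(1), simp_all only: set_integrable_mult_right)
       (subst set_integral_diff(2), simp_all)
  finally show ?thesis by (simp add: f_def)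
qed


text \<open>The change of sign compensates the opposite sign with which the hyperbolic part
  satisfies its recurrence and its derivative formula, so that the combination obeys those of
  \<open>I\<close>.\<close>

lemma schlaefli_shift: "sin ((\<nu> - 1) * pi) = - sin (\<nu> * pi)" "sin ((\<nu> + 1) * pi) = - sin (\<nu> * pi)"
  by (simp_all add: left_diff_distrib distrib_right sin_diff sin_add)

lemma schlaefli_rec:
  assumes s: "s > 0"
  shows "schlaefli (\<nu> - 1) s - schlaefli (\<nu> + 1) s = 2 * \<nu> / s * schlaefli \<nu> s"
proof -
  have "schlaefli (\<nu> - 1) s - schlaefli (\<nu> + 1) s =
      (schlaefli_cos (\<nu> - 1) s - schlaefli_cos (\<nu> + 1) s) + sin (\<nu> * pi) * (schlaefli_cosh (\<nu> - 1) s - schlaefli_cosh (\<nu> + 1) s)"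
    unfolding schlaefli_def schlaefli_shift by (simp add: algebra_simps)
  also have "\<dots> = 2 * \<nu> / s * schlaefli \<nu> s"
    unfolding schlaefli_cos_rec[OF s] schlaefli_cosh_rec[OF s] schlaefli_def by (simp add: algebra_simps)
  finally show ?thesis .
qed

text \<open>The derivative is half the sum of the neighbouring orders; the recurrence eliminates one
  of them. With \<open>DERIV_schlaefli'\<close> this gives the same first-order system that
  \<open>I\<close> satisfies, which is the basis of the later comparison.\<close>

lemma DERIV_schlaefli:
  assumes s: "s > 0"
  shows "(schlaefli \<nu> has_real_derivative (schlaefli (\<nu> + 1) s + \<nu> / s * schlaefli \<nu> s)) (at s)"
proof -
  have "((\<lambda>s. schlaefli_cos \<nu> s - sin (\<nu> * pi) * schlaefli_cosh \<nu> s) has_real_derivative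
     ((schlaefli_cos (\<nu> - 1) s + schlaefli_cos (\<nu> + 1) s) / 2 - sin (\<nu> * pi) * (- (schlaefli_cosh (\<nu> - 1) s + schlaefli_cosh (\<nu> + 1) s) / 2))) (at s)"
    by (intro DERIV_diff DERIV_cmult DERIV_schlaefli_cos DERIV_schlaefli_cosh[OF s])
  moreover have "(schlaefli_cos (\<nu> - 1) s + schlaefli_cos (\<nu> + 1) s) / 2 - sin (\<nu> * pi) * (- (schlaefli_cosh (\<nu> - 1) s + schlaefli_cosh (\<nu> + 1) s) / 2)
      = (schlaefli (\<nu> - 1) s + schlaefli (\<nu> + 1) s) / 2"
    unfolding schlaefli_def schlaefli_shift by (simp add: field_simps)
  moreover have "(schlaefli (\<nu> - 1) s + schlaefli (\<nu> + 1) s) / 2 = schlaefli (\<nu> + 1) s + \<nu> / s * schlaefli \<nu> s"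
    using schlaefli_rec[OF s, of \<nu>] by (simp add: field_simps)
  ultimately show ?thesis unfolding schlaefli_def[abs_def] by simp
qed

lemma DERIV_schlaefli':
  assumes s: "s > 0"
  shows "(schlaefli (\<nu> + 1) has_real_derivative (schlaefli \<nu> s - (\<nu> + 1) / s * schlaefli (\<nu> + 1) s)) (at s)"
proof -
  have "schlaefli (\<nu> + 1 + 1) s + (\<nu> + 1) / s * schlaefli (\<nu> + 1) s = schlaefli \<nu> s - (\<nu> + 1) / s * schlaefli (\<nu> + 1) s"
    using schlaefli_rec[OF s, of "\<nu> + 1"] by (simp add: field_simps)
  with DERIV_schlaefli[OF s, of "\<nu> + 1"] show ?thesis by (simp only:)
qed

section \<open>Behaviour of the two parts near the origin\<close>

lemma schlaefli_cos_bound: "\<bar>schlaefli_cos \<nu> s\<bar> \<le> pi * exp \<bar>s\<bar>"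
proof -
  have "norm (LINT \<phi>:{0..pi}|lborel. exp (s * cos \<phi>) * cos (\<nu> * \<phi>)) \<le> (LINT \<phi>:{0..pi}|lborel. exp \<bar>s\<bar>)"
  proof (rule order.trans[OF set_integral_norm_bound[OF schlaefli_cos_integrable]], rule set_integral_mono)
    show "set_integrable lborel {0..pi} (\<lambda>\<phi>. norm (exp (s * cos \<phi>) * cos (\<nu> * \<phi>)))"
      by (intro set_integrable_norm schlaefli_cos_integrable)
    show "set_integrable lborel {0..pi} (\<lambda>\<phi>. exp \<bar>s\<bar>)"
      by (intro borel_integrable_atLeastAtMost' continuous_intros)
    fix \<phi> :: real
    have "\<bar>s * cos \<phi>\<bar> \<le> \<bar>s\<bar> * 1" unfolding abs_mult by (intro mult_left_mono) auto
    then have "exp (s * cos \<phi>) * \<bar>cos (\<nu> * \<phi>)\<bar> \<le> exp \<bar>s\<bar> * 1" by (intro mult_mono) auto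
    then show "norm (exp (s * cos \<phi>) * cos (\<nu> * \<phi>)) \<le> exp \<bar>s\<bar>" by (simp add: abs_mult)
  qed
  also have "(LINT \<phi>:{0..pi}|lborel. exp \<bar>s\<bar>) = pi * exp \<bar>s\<bar>"
    by (simp add: set_lebesgue_integral_def)
  finally show ?thesis unfolding schlaefli_cos_def by simp
qed

lemma set_integral_exp_decay:
  assumes "a > (0::real)"
  shows "(LINT u:{0..}|lborel. exp (- a * u)) = 1 / a"
  using set_borel_integral_eq_integral(2)[OF set_integrable_exp_decay[OF assms]]
    integral_unique[OF has_integral_exp_minus_to_infinity[OF assms, of 0]] by simp

lemma schlaefli_cosh_nonneg: "0 \<le> schlaefli_cosh \<nu> s"
  unfolding schlaefli_cosh_def set_lebesgue_integral_def by (intro Bochner_Integration.integral_nonneg) auto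

lemma schlaefli_cosh_bound:
  assumes "s > 0" "\<nu> > 0"
  shows "schlaefli_cosh \<nu> s \<le> 1 / \<nu>"
proof -
  have "schlaefli_cosh \<nu> s \<le> (LINT u:{0..}|lborel. exp (- \<nu> * u))"
    unfolding schlaefli_cosh_def
  proof (rule set_integral_mono)
    fix u :: real
    have "s * cosh u \<ge> 0" using assms by (intro mult_nonneg_nonneg) auto
    then show "exp (- s * cosh u - \<nu> * u) \<le> exp (- \<nu> * u)" by simp
  qed (intro schlaefli_cosh_integrable set_integrable_exp_decay assms)+
  with set_integral_exp_decay[OF assms(2)] show ?thesis by simp
qed

lemma Gamma_absolutely_integrable:
  "a > (0::real) \<Longrightarrow> (\<lambda>t. t powr (a - 1) / exp t) absolutely_integrable_on {0..}"
  using Gamma_integral_real[of a] by (intro nonnegative_absolutely_integrable_1) (auto simp: integrable_on_def)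

text \<open>The substitution is \<open>t = c * exp u\<close>. With \<open>c = s / 2\<close> the
  left-hand integrand is the hyperbolic one after \<open>s * cosh u\<close> has been replaced by its
  growing half.\<close>

lemma incomplete_Gamma_substitution:
  fixes a c :: real
  assumes c: "c > 0" and a: "a > 0"
  shows "set_integrable lborel {0..} (\<lambda>u. exp (- c * exp u + a * u))"
    "c powr a * (LINT u:{0..}|lborel. exp (- c * exp u + a * u)) = integral {c..} (\<lambda>t. t powr (a - 1) / exp t)"
proof -
  have sub: "g ` {0..} = {c..}" if "g = (\<lambda>u. c * exp u)" for g
  proof
    have "c * 1 \<le> c * exp u" if "u \<ge> 0" for u :: real using c that by (intro mult_left_mono) auto
    then show "g ` {0..} \<subseteq> {c..}" using that by auto
    show "{c..} \<subseteq> g ` {0..}"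
    proof
      fix v assume "v \<in> {c..}"
      then have "v = g (ln (v / c))" "ln (v / c) \<ge> 0" using c that by (auto simp: field_simps)
      then show "v \<in> g ` {0..}" by auto
    qed
  qed
  have int: "(\<lambda>t. t powr (a - 1) / exp t) absolutely_integrable_on {c..}"
    by (rule set_integrable_subset[OF Gamma_absolutely_integrable[OF a]]) (use c in auto)
  have "(\<lambda>u. \<bar>c * exp u\<bar> * ((c * exp u) powr (a - 1) / exp (c * exp u))) absolutely_integrable_on {0..} \<and>
        integral {0..} (\<lambda>u. \<bar>c * exp u\<bar> * ((c * exp u) powr (a - 1) / exp (c * exp u))) = integral {c..} (\<lambda>t. t powr (a - 1) / exp t)"
    by (subst has_absolute_integral_change_of_variables_1'[where g = "\<lambda>u. c * exp u" and g' = "\<lambda>u. c * exp u" and f = "\<lambda>t. t powr (a - 1) / exp t"])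
       (use int c in \<open>auto simp: sub inj_on_def intro!: derivative_eq_intros\<close>)
  moreover have "\<bar>c * exp u\<bar> * ((c * exp u) powr (a - 1) / exp (c * exp u)) = c powr a * exp (- c * exp u + a * u)" for u
  proof -
    have "(c * exp u) * (c * exp u) powr (a - 1) = (c * exp u) powr a"
      using c by (simp add: powr_diff)
    also have "\<dots> = c powr a * exp (a * u)"
      using c by (simp add: powr_mult exp_powr_real mult.commute)
    finally have X: "(c * exp u) * (c * exp u) powr (a - 1) = c powr a * exp (a * u)" .
    have "\<bar>c * exp u\<bar> * ((c * exp u) powr (a - 1) / exp (c * exp u)) = ((c * exp u) * (c * exp u) powr (a - 1)) / exp (c * exp u)"
      using c by simp
    also have "\<dots> = c powr a * (exp (a * u) / exp (c * exp u))" unfolding X by simp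
    also have "exp (a * u) / exp (c * exp u) = exp (- c * exp u + a * u)"
      unfolding exp_diff[symmetric] by simp
    finally show ?thesis .
  qed
  ultimately have "(\<lambda>u. c powr a * exp (- c * exp u + a * u)) absolutely_integrable_on {0..}"
    and eq: "integral {0..} (\<lambda>u. c powr a * exp (- c * exp u + a * u)) = integral {c..} (\<lambda>t. t powr (a - 1) / exp t)"
    by simp_all
  then have "(\<lambda>u. (1 / c powr a) * (c powr a * exp (- c * exp u + a * u))) absolutely_integrable_on {0..}"
    by (intro set_integrable_mult_right) simp
  then have "(\<lambda>u. exp (- c * exp u + a * u)) absolutely_integrable_on {0..}" using c by simp
  then show *: "set_integrable lborel {0..} (\<lambda>u. exp (- c * exp u + a * u))"
    unfolding set_integrable_def by (subst (asm) integrable_completion) auto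
  show "c powr a * (LINT u:{0..}|lborel. exp (- c * exp u + a * u)) = integral {c..} (\<lambda>t. t powr (a - 1) / exp t)"
    using eq set_borel_integral_eq_integral(2)[OF *] by simp
qed

text \<open>The missing piece over \<open>(0, c]\<close> is at most the integral of
  \<open>t powr (a - 1)\<close>, since \<open>exp t \<ge> 1\<close> there.\<close>

lemma incomplete_Gamma_bound:
  fixes a c :: real
  assumes c: "c > 0" and a: "a > 0"
  shows "\<bar>integral {c..} (\<lambda>t. t powr (a - 1) / exp t) - Gamma a\<bar> \<le> c powr a / a"
proof -
  define f where "f = (\<lambda>t::real. t powr (a - 1) / exp t)"
  have int: "f integrable_on S" if "S \<in> sets lebesgue" "S \<subseteq> {0..}" for S
    unfolding f_def using set_integrable_subset[OF Gamma_absolutely_integrable[OF a] that]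
    by (rule set_lebesgue_integral_eq_integral(1))
  have "integral {0<..} f = integral {0..} f"
    by (rule integral_spike_set) (rule negligible_subset[of "{0}"]; auto)+
  then have "integral {0<..} f = Gamma a"
    unfolding f_def using integral_unique[OF Gamma_integral_real[OF a]] by simp
  moreover have "integral {0<..} f = integral {0<..c} f + integral {c<..} f"
  proof -
    have "{0<..} = {0<..c} \<union> {c<..}" using c by auto
    then show ?thesis
    proof -
      have "negligible ({0<..c} \<inter> {c<..})" by (rule negligible_subset[OF negligible_empty]) auto
      moreover have "{0<..c} \<subseteq> {0..}" "{c<..} \<subseteq> {0..}" using c by auto
      ultimately show ?thesis
        unfolding \<open>{0<..} = {0<..c} \<union> {c<..}\<close> by (intro Henstock_Kurzweil_Integration.integral_Un int) auto
    qed
  qed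
  moreover have "integral {c<..} f = integral {c..} f"
    by (rule integral_spike_set) (rule negligible_subset[of "{c}"]; auto)+
  moreover have "integral {0<..c} f \<ge> 0"
    by (rule Henstock_Kurzweil_Integration.integral_nonneg[OF int]) (auto simp: f_def)
  moreover have "integral {0<..c} f \<le> integral {0<..c} (\<lambda>t. t powr (a - 1))"
  proof (rule integral_le[OF int])
    show "(\<lambda>t. t powr (a - 1)) integrable_on {0<..c}" using a c by (intro integrable_on_powr_from_0') auto
    show "f t \<le> t powr (a - 1)" if "t \<in> {0<..c}" for t
      using that unfolding f_def by (auto simp: divide_le_eq mult_le_cancel_left1)
  qed auto
  moreover have "integral {0<..c} (\<lambda>t. t powr (a - 1)) = c powr a / a"
  proof -
    have "integral {0<..c} (\<lambda>t. t powr (a - 1)) = integral {0..c} (\<lambda>t. t powr (a - 1))"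
      by (rule integral_spike_set) (rule negligible_subset[of "{0}"]; auto)+
    then show ?thesis using integral_unique[OF has_integral_powr_from_0[of "a - 1" c]] a c by simp
  qed
  ultimately show ?thesis unfolding f_def by linarith
qed

text \<open>Dropping the half \<open>exp (- u)\<close> of \<open>cosh u\<close> changes the
  integrand by a factor within \<open>s / 2 * exp (- u)\<close> of 1, and leaves an incomplete Gamma
  integral. The condition \<open>\<nu> < 0\<close> makes that Gamma integral converge at zero, and
  \<open>\<nu> > -1\<close> makes the error integrable. The two summands on the right are these two
  errors.\<close>

lemma schlaefli_cosh_asymptotics:
  assumes s: "s > 0" and \<nu>: "-1 < \<nu>" "\<nu> < 0"
  shows "\<bar>(s / 2) powr (- \<nu>) * schlaefli_cosh \<nu> s - Gamma (- \<nu>)\<bar> \<le> (s / 2) powr (- \<nu>) / (- \<nu>) + (s / 2) powr (- \<nu>) * (s / 2) / (\<nu> + 1)"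
proof -
  define I where "I = (LINT u:{0..}|lborel. exp (- (s / 2) * exp u + (- \<nu>) * u))"
  have s2: "s / 2 > 0" and \<nu>': "- \<nu> > 0" using s \<nu> by auto
  note sub = incomplete_Gamma_substitution[OF s2 \<nu>']
  have 1: "\<bar>(s / 2) powr (- \<nu>) * I - Gamma (- \<nu>)\<bar> \<le> (s / 2) powr (- \<nu>) / (- \<nu>)"
    unfolding I_def sub(2) by (rule incomplete_Gamma_bound[OF s2 \<nu>'])
  have bds: "exp (- s * cosh u - \<nu> * u) \<le> exp (- (s / 2) * exp u + (- \<nu>) * u)"
    "exp (- (s / 2) * exp u + (- \<nu>) * u) - exp (- s * cosh u - \<nu> * u) \<le> s / 2 * exp (- (\<nu> + 1) * u)" if "u \<ge> 0" for u
  proof -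
    let ?E = "exp (- (s / 2) * exp u + (- \<nu>) * u)"
    have eq: "exp (- s * cosh u - \<nu> * u) = ?E * exp (- (s / 2 * exp (- u)))"
      by (simp add: cosh_def field_simps flip: exp_add)
    have "exp (- (s / 2 * exp (- u))) \<le> 1" using s by simp
    then show "exp (- s * cosh u - \<nu> * u) \<le> ?E" unfolding eq by (simp add: mult_left_le)
    have "1 - exp (- (s / 2 * exp (- u))) \<le> s / 2 * exp (- u)"
      using exp_ge_add_one_self[of "- (s / 2 * exp (- u))"] by linarith
    moreover have "?E \<le> exp (- \<nu> * u)" using s by simp
    moreover have "0 \<le> 1 - exp (- (s / 2 * exp (- u)))" using s by simp
    ultimately have "?E * (1 - exp (- (s / 2 * exp (- u)))) \<le> exp (- \<nu> * u) * (s / 2 * exp (- u))"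
      by (intro mult_mono) auto
    also have "\<dots> = s / 2 * exp (- (\<nu> + 1) * u)"
      by (simp add: algebra_simps flip: exp_add)
    finally show "?E - exp (- s * cosh u - \<nu> * u) \<le> s / 2 * exp (- (\<nu> + 1) * u)"
      unfolding eq by (simp add: right_diff_distrib)
  qed
  have "schlaefli_cosh \<nu> s \<le> I"
    unfolding schlaefli_cosh_def I_def by (intro set_integral_mono schlaefli_cosh_integrable[OF s] sub(1) bds) auto
  moreover have "I - schlaefli_cosh \<nu> s \<le> s / 2 / (\<nu> + 1)"
  proof -
    have "I - schlaefli_cosh \<nu> s = (LINT u:{0..}|lborel. exp (- (s / 2) * exp u + (- \<nu>) * u) - exp (- s * cosh u - \<nu> * u))"
      unfolding schlaefli_cosh_def I_def by (rule set_integral_diff(2)[symmetric]) (intro schlaefli_cosh_integrable[OF s] sub(1))+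
    also have "\<dots> \<le> (LINT u:{0..}|lborel. s / 2 * exp (- (\<nu> + 1) * u))"
      by (intro set_integral_mono set_integral_diff(1) set_integrable_mult_right set_integrable_exp_decay schlaefli_cosh_integrable[OF s] sub(1) bds)
        (use \<nu> in auto)
    also have "\<dots> = s / 2 / (\<nu> + 1)"
      using set_integral_exp_decay[of "\<nu> + 1"] \<nu> by simp
    finally show ?thesis .
  qed
  ultimately have "\<bar>I - schlaefli_cosh \<nu> s\<bar> \<le> s / 2 / (\<nu> + 1)" by linarith
  then have "(s / 2) powr (- \<nu>) * \<bar>I - schlaefli_cosh \<nu> s\<bar> \<le> (s / 2) powr (- \<nu>) * (s / 2 / (\<nu> + 1))"
    by (intro mult_left_mono) auto
  then have "\<bar>(s / 2) powr (- \<nu>) * I - (s / 2) powr (- \<nu>) * schlaefli_cosh \<nu> s\<bar> \<le> (s / 2) powr (- \<nu>) * (s / 2) / (\<nu> + 1)"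
    unfolding right_diff_distrib[symmetric] abs_mult by simp
  with 1 show ?thesis by linarith
qed


text \<open>Converts the leading constant \<open>- sin (\<nu> * pi) * Gamma (- \<nu>)\<close> of the
  hyperbolic part into the constant term of the power series of \<open>I\<close>. It is the complex
  reflection formula restricted to real arguments.\<close>

lemma Gamma_reflection_real_neg:
  fixes \<nu> :: real
  assumes "-1 < \<nu>" "\<nu> < 0"
  shows "- sin (\<nu> * pi) * Gamma (- \<nu>) = pi / Gamma (\<nu> + 1)"
proof -
  have "Gamma (complex_of_real (- \<nu>)) * Gamma (1 - complex_of_real (- \<nu>)) = of_real pi / sin (of_real pi * complex_of_real (- \<nu>))"
    by (rule Gamma_reflection_complex)
  moreover have "1 - complex_of_real (- \<nu>) = complex_of_real (1 + \<nu>)"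
    "of_real pi * complex_of_real (- \<nu>) = complex_of_real (pi * (- \<nu>))" by simp_all
  ultimately have "complex_of_real (Gamma (- \<nu>) * Gamma (1 + \<nu>)) = complex_of_real (pi / sin (pi * (- \<nu>)))"
    by (simp only: Gamma_complex_of_real sin_of_real of_real_mult[symmetric] of_real_divide[symmetric])
  then have "Gamma (- \<nu>) * Gamma (1 + \<nu>) = pi / sin (pi * (- \<nu>))"
    by (simp only: of_real_eq_iff)
  moreover have "sin (pi * (- \<nu>)) > 0"
  proof (rule sin_gt_zero)
    show "0 < pi * (- \<nu>)" using assms by (intro mult_pos_pos) auto
    have "pi * (- \<nu>) < pi * 1" using assms by (intro mult_strict_left_mono) auto
    then show "pi * (- \<nu>) < pi" by simp
  qed
  moreover have "Gamma (1 + \<nu>) > 0" using assms by (intro Gamma_real_pos) auto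
  ultimately show ?thesis
    by (simp add: field_simps add.commute)
qed

lemma mod_bessel_I_rec:
  assumes "\<nu> > -1" "s > 0"
  shows "mod_bessel_I (\<nu> + 2) s = mod_bessel_I \<nu> s - 2 * (\<nu> + 1) / s * mod_bessel_I (\<nu> + 1) s"
proof -
  define A where "A = (s / 2) powr \<nu>"
  have e: "mod_bessel_I (\<nu> + 2) s = A * (s / 2)\<^sup>2 * bessel_P (\<nu> + 2) (s\<^sup>2 / 4)"
    "mod_bessel_I (\<nu> + 1) s = A * (s / 2) * bessel_P (\<nu> + 1) (s\<^sup>2 / 4)"
    "mod_bessel_I \<nu> s = A * bessel_P \<nu> (s\<^sup>2 / 4)"
    using assms by (simp_all add: mod_bessel_I_def powr_add A_def)
  show ?thesis
    unfolding e bessel_P_rec[OF assms(1), of "s\<^sup>2 / 4"]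
    using assms(2) by (simp add: field_simps power2_eq_square)
qed

lemma eventually_right_0: "(\<And>s. 0 < s \<Longrightarrow> s < 1 \<Longrightarrow> Q s) \<Longrightarrow> \<forall>\<^sub>F s in at_right (0::real). Q s"
  by (subst eventually_at_right[of 0 1]) (auto intro!: exI[of _ 1])

lemma powr_tendsto_0: "e > 0 \<Longrightarrow> ((\<lambda>s::real. s powr e) \<longlongrightarrow> 0) (at_right 0)"
  using tendsto_powr2[OF tendsto_ident_at tendsto_const[of e], of 0 "{0<..}"]
  by (auto simp: eventually_at_filter)

lemma bounded_times_powr_tendsto_0:
  assumes "e > 0" "\<And>s. 0 < s \<Longrightarrow> s < 1 \<Longrightarrow> \<bar>f s\<bar> \<le> B"
  shows "((\<lambda>s::real. s powr e * f s) \<longlongrightarrow> 0) (at_right 0)"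
proof (rule Lim_null_comparison)
  show "((\<lambda>s. s powr e * B) \<longlongrightarrow> 0) (at_right 0)"
    by (rule tendsto_mult_left_zero[OF powr_tendsto_0[OF assms(1)]])
  have "\<forall>\<^sub>F s in at_right 0. 0 < s \<and> s < (1::real)"
    by (rule eventually_right_0) simp
  then show "\<forall>\<^sub>F s in at_right 0. norm (s powr e * f s) \<le> s powr e * B"
    by eventually_elim (use assms(2) in \<open>auto simp: abs_mult intro!: mult_left_mono\<close>)
qed

text \<open>For \<open>\<nu> < 0\<close> the factor \<open>s powr (- \<nu>)\<close> annihilates the
  bounded trigonometric part and the limit comes from the hyperbolic one. For
  \<open>\<nu> = 0\<close> the sine vanishes and the limit comes from the trigonometric part
  alone.\<close>

lemma schlaefli_normalization:
  assumes \<nu>: "-1 < \<nu>" "\<nu> \<le> 0"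
  shows "((\<lambda>s. s powr (- \<nu>) * schlaefli \<nu> s) \<longlongrightarrow> pi * 2 powr (- \<nu>) / Gamma (\<nu> + 1)) (at_right 0)"
proof (cases "\<nu> = 0")
  case True
  have "isCont (schlaefli_cos 0) 0" using DERIV_schlaefli_cos DERIV_isCont by blast
  then have "(schlaefli_cos 0 \<longlongrightarrow> schlaefli_cos 0 0) (at_right 0)"
    unfolding isCont_def by (rule filterlim_at_split[THEN iffD1, THEN conjunct2])
  moreover have "schlaefli_cos 0 0 = pi"
    by (simp add: schlaefli_cos_def set_lebesgue_integral_def)
  moreover have "\<forall>\<^sub>F s in at_right 0. schlaefli_cos 0 s = s powr (- 0) * schlaefli 0 s"
    by (rule eventually_right_0) (simp add: schlaefli_def)
  ultimately show ?thesis
    using True by (simp add: Lim_transform_eventually)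
next
  case False
  then have \<nu>0: "\<nu> < 0" using \<nu> by simp
  have cos0: "((\<lambda>s. s powr (- \<nu>) * schlaefli_cos \<nu> s) \<longlongrightarrow> 0) (at_right 0)"
  proof (rule bounded_times_powr_tendsto_0)
    fix s :: real assume "0 < s" "s < 1"
    then have "pi * exp \<bar>s\<bar> \<le> pi * exp 1" by (intro mult_left_mono) auto
    then show "\<bar>schlaefli_cos \<nu> s\<bar> \<le> pi * exp 1" using schlaefli_cos_bound[of \<nu> s] by linarith
  qed (use \<nu>0 in simp)
  have half: "filterlim (\<lambda>s::real. s / 2) (at_right 0) (at_right 0)"
    by (auto simp: filterlim_at intro!: tendsto_eq_intros eventually_right_0)
  have "((\<lambda>s. (s / 2) powr (- \<nu>) / (- \<nu>) + (s / 2) powr (- \<nu>) * (s / 2) / (\<nu> + 1)) \<longlongrightarrow> 0 / (- \<nu>) + 0 * (0 / 2) / (\<nu> + 1)) (at_right 0)"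
    using \<nu> \<nu>0 by (intro tendsto_intros filterlim_compose[OF powr_tendsto_0 half]) auto
  then have lim0: "((\<lambda>s. (s / 2) powr (- \<nu>) / (- \<nu>) + (s / 2) powr (- \<nu>) * (s / 2) / (\<nu> + 1)) \<longlongrightarrow> 0) (at_right 0)" by simp
  have "((\<lambda>s. (s / 2) powr (- \<nu>) * schlaefli_cosh \<nu> s - Gamma (- \<nu>)) \<longlongrightarrow> 0) (at_right 0)"
  proof (rule Lim_null_comparison[OF _ lim0])
    have "\<forall>\<^sub>F s in at_right 0. 0 < (s::real)" by (rule eventually_right_0)
    then show "\<forall>\<^sub>F s in at_right 0. norm ((s / 2) powr (- \<nu>) * schlaefli_cosh \<nu> s - Gamma (- \<nu>))
       \<le> (s / 2) powr (- \<nu>) / (- \<nu>) + (s / 2) powr (- \<nu>) * (s / 2) / (\<nu> + 1)"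
      by eventually_elim (use schlaefli_cosh_asymptotics[OF _ \<nu>(1) \<nu>0] in simp)
  qed
  then have "((\<lambda>s. (s / 2) powr (- \<nu>) * schlaefli_cosh \<nu> s) \<longlongrightarrow> Gamma (- \<nu>)) (at_right 0)"
    by (rule LIM_zero_cancel)
  then have "((\<lambda>s. s powr (- \<nu>) * schlaefli_cos \<nu> s - sin (\<nu> * pi) * 2 powr (- \<nu>) * ((s / 2) powr (- \<nu>) * schlaefli_cosh \<nu> s))
     \<longlongrightarrow> 0 - sin (\<nu> * pi) * 2 powr (- \<nu>) * Gamma (- \<nu>)) (at_right 0)"
    by (intro tendsto_diff cos0 tendsto_mult tendsto_const)
  moreover have "0 - sin (\<nu> * pi) * 2 powr (- \<nu>) * Gamma (- \<nu>) = pi * 2 powr (- \<nu>) / Gamma (\<nu> + 1)"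
  proof -
    have "0 - sin (\<nu> * pi) * 2 powr (- \<nu>) * Gamma (- \<nu>) = 2 powr (- \<nu>) * (- sin (\<nu> * pi) * Gamma (- \<nu>))"
      by simp
    then show ?thesis unfolding Gamma_reflection_real_neg[OF \<nu>(1) \<nu>0] by simp
  qed
  moreover have "\<forall>\<^sub>F s in at_right 0. s powr (- \<nu>) * schlaefli_cos \<nu> s - sin (\<nu> * pi) * 2 powr (- \<nu>) * ((s / 2) powr (- \<nu>) * schlaefli_cosh \<nu> s)
      = s powr (- \<nu>) * schlaefli \<nu> s"
  proof -
    have "\<forall>\<^sub>F s in at_right 0. 0 < (s::real)" by (rule eventually_right_0)
    then show ?thesis
    proof eventually_elim
      case (elim s)
      have "2 powr (- \<nu>) * (s / 2) powr (- \<nu>) = s powr (- \<nu>)"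
        using elim by (simp flip: powr_mult)
      then show ?case unfolding schlaefli_def by (simp add: right_diff_distrib mult.assoc)
    qed
  qed
  ultimately show ?thesis by (simp add: Lim_transform_eventually)
qed

section \<open>Identification with the modified Bessel function\<close>

text \<open>Both pairs of consecutive orders solve the same linear system, so their Wronskian is
  constant. It tends to 0 at the origin, so the solutions are proportional, and the normalization
  gives the factor \<open>pi\<close>. The range \<open>-1 < \<nu> \<le> 0\<close> is the one in
  which order \<nu> has a known limit and the hyperbolic part of order \<open>\<nu> + 1\<close> is
  bounded.\<close>

lemma schlaefli_eq_base:
  assumes \<nu>: "-1 < \<nu>" "\<nu> \<le> 0" and s: "s > 0"
  shows "schlaefli \<nu> s = pi * mod_bessel_I \<nu> s \<and> schlaefli (\<nu> + 1) s = pi * mod_bessel_I (\<nu> + 1) s"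
proof -
  \<comment> \<open>The power weights remove the diagonal of the system, leaving
    \<open>a' = s powr (- 2 * \<nu> - 1) * b\<close> and
    \<open>b' = s powr (2 * \<nu> + 1) * a\<close>. They also give \<open>a\<close> a finite limit
    at the origin and make \<open>b\<close> vanish there. \<open>a0\<close> and \<open>b0\<close>
    are the same weighted functions formed from \<open>I\<close>.\<close>
  define a where "a = (\<lambda>s. s powr (- \<nu>) * schlaefli \<nu> s)"
  define b where "b = (\<lambda>s. s powr (\<nu> + 1) * schlaefli (\<nu> + 1) s)"
  define a0 where "a0 = (\<lambda>s. 2 powr (- \<nu>) * bessel_P \<nu> (s\<^sup>2 / 4))"
  define b0 where "b0 = (\<lambda>s. s powr (2 * \<nu> + 2) * (2 powr (- \<nu> - 1) * bessel_P (\<nu> + 1) (s\<^sup>2 / 4)))"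
  have a0I: "s powr (- \<nu>) * mod_bessel_I \<nu> s = a0 s" if "s > 0" for s
  proof -
    have "s powr (- \<nu>) * (s / 2) powr \<nu> = 2 powr (- \<nu>)"
      using that by (simp add: powr_divide powr_minus divide_simps)
    then show ?thesis unfolding mod_bessel_I_def a0_def by (simp only: mult.assoc[symmetric])
  qed
  have b0I: "s powr (\<nu> + 1) * mod_bessel_I (\<nu> + 1) s = b0 s" if "s > 0" for s
  proof -
    have "s powr (\<nu> + 1) * (s / 2) powr (\<nu> + 1) = s powr (2 * \<nu> + 2) * 2 powr (- \<nu> - 1)"
    proof -
      have "(s / 2) powr (\<nu> + 1) = s powr (\<nu> + 1) * 2 powr (- \<nu> - 1)"
      proof -
        have "- \<nu> - 1 = - (\<nu> + 1)" by simp
        then have "2 powr (- \<nu> - 1 :: real) = inverse (2 powr (\<nu> + 1))" by (simp only: powr_minus)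
        moreover have "(s / 2) powr (\<nu> + 1) = s powr (\<nu> + 1) / 2 powr (\<nu> + 1)"
          using that by (simp add: powr_divide)
        ultimately show ?thesis by (simp only: divide_inverse)
      qed
      moreover have "s powr (\<nu> + 1) * s powr (\<nu> + 1) = s powr (2 * \<nu> + 2)"
        by (simp flip: powr_add)
      ultimately show ?thesis by (simp only: mult.assoc[symmetric])
    qed
    then show ?thesis unfolding mod_bessel_I_def b0_def by (simp only: mult.assoc[symmetric])
  qed
  have da: "(a has_real_derivative s powr (- 2 * \<nu> - 1) * b s) (at s)" if s: "s > 0" for s
  proof -
    have "(a has_real_derivative (- \<nu> * s powr (- \<nu> - 1)) * schlaefli \<nu> s + (schlaefli (\<nu> + 1) s + \<nu> / s * schlaefli \<nu> s) * s powr (- \<nu>)) (at s)"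
      unfolding a_def using has_real_derivative_powr[OF s] DERIV_schlaefli[OF s] by (rule DERIV_mult)
    moreover have "(- \<nu> * s powr (- \<nu> - 1)) * schlaefli \<nu> s + (schlaefli (\<nu> + 1) s + \<nu> / s * schlaefli \<nu> s) * s powr (- \<nu>)
        = s powr (- 2 * \<nu> - 1) * b s"
    proof -
      have "s powr (- \<nu> - 1) = s powr (- \<nu>) / s" using s by (simp add: powr_diff)
      moreover have "s powr (- 2 * \<nu> - 1) * s powr (\<nu> + 1) = s powr (- \<nu>)" by (simp flip: powr_add)
      ultimately show ?thesis unfolding b_def mult.assoc[symmetric] by (simp add: algebra_simps)
    qed
    ultimately show ?thesis by simp
  qed
  have db: "(b has_real_derivative s powr (2 * \<nu> + 1) * a s) (at s)" if s: "s > 0" for s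
  proof -
    have "(b has_real_derivative ((\<nu> + 1) * s powr (\<nu> + 1 - 1)) * schlaefli (\<nu> + 1) s + (schlaefli \<nu> s - (\<nu> + 1) / s * schlaefli (\<nu> + 1) s) * s powr (\<nu> + 1)) (at s)"
      unfolding b_def using has_real_derivative_powr[OF s] DERIV_schlaefli'[OF s] by (rule DERIV_mult)
    moreover have "((\<nu> + 1) * s powr (\<nu> + 1 - 1)) * schlaefli (\<nu> + 1) s + (schlaefli \<nu> s - (\<nu> + 1) / s * schlaefli (\<nu> + 1) s) * s powr (\<nu> + 1)
        = s powr (2 * \<nu> + 1) * a s"
    proof -
      have "s powr (\<nu> + 1 - 1) = s powr (\<nu> + 1) / s" using s by (simp add: powr_add)
      moreover have "s powr (2 * \<nu> + 1) * s powr (- \<nu>) = s powr (\<nu> + 1)" by (simp flip: powr_add)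
      ultimately show ?thesis unfolding a_def mult.assoc[symmetric] by (simp add: algebra_simps)
    qed
    ultimately show ?thesis by simp
  qed
  have \<nu>1: "\<nu> + 1 > -1" using \<nu> by simp
  have da0: "(a0 has_real_derivative s powr (- 2 * \<nu> - 1) * b0 s) (at s)" if s: "s > 0" for s
  proof -
    have "(a0 has_real_derivative 2 powr (- \<nu>) * (bessel_P (\<nu> + 1) (s\<^sup>2 / 4) * (s / 2))) (at s)"
      unfolding a0_def by (auto intro!: derivative_eq_intros DERIV_chain2[OF DERIV_bessel_P[OF \<nu>(1)]])
    moreover have "2 powr (- \<nu>) * (bessel_P (\<nu> + 1) (s\<^sup>2 / 4) * (s / 2)) = s powr (- 2 * \<nu> - 1) * b0 s"
    proof -
      have "s powr (- 2 * \<nu> - 1) * s powr (2 * \<nu> + 2) = s" using s by (simp flip: powr_add)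
      moreover have "2 powr (- \<nu> - 1) = 2 powr (- \<nu>) / (2::real)" by (simp add: powr_diff)
      ultimately show ?thesis unfolding b0_def mult.assoc[symmetric] by (simp add: algebra_simps)
    qed
    ultimately show ?thesis by simp
  qed
  have db0: "(b0 has_real_derivative s powr (2 * \<nu> + 1) * a0 s) (at s)" if s: "s > 0" for s
  proof -
    have "(b0 has_real_derivative ((2 * \<nu> + 2) * s powr (2 * \<nu> + 2 - 1)) * (2 powr (- \<nu> - 1) * bessel_P (\<nu> + 1) (s\<^sup>2 / 4))
       + (2 powr (- \<nu> - 1) * (bessel_P (\<nu> + 1 + 1) (s\<^sup>2 / 4) * (s / 2))) * s powr (2 * \<nu> + 2)) (at s)"
      unfolding b0_def using s
      by (intro DERIV_mult has_real_derivative_powr) (auto intro!: derivative_eq_intros DERIV_chain2[OF DERIV_bessel_P[OF \<nu>1]])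
    moreover have "((2 * \<nu> + 2) * s powr (2 * \<nu> + 2 - 1)) * (2 powr (- \<nu> - 1) * bessel_P (\<nu> + 1) (s\<^sup>2 / 4))
       + (2 powr (- \<nu> - 1) * (bessel_P (\<nu> + 1 + 1) (s\<^sup>2 / 4) * (s / 2))) * s powr (2 * \<nu> + 2) = s powr (2 * \<nu> + 1) * a0 s"
    proof -
      have e: "2 * \<nu> + 2 - 1 = 2 * \<nu> + 1" "\<nu> + 1 + 1 = \<nu> + 2" by simp_all
      have p: "s powr (2 * \<nu> + 2) = s powr (2 * \<nu> + 1) * s" using s powr_add[of s "2 * \<nu> + 1" 1] by (simp add: add.assoc)
      have q: "2 powr (- \<nu>) = 2 * 2 powr (- \<nu> - 1 :: real)" by (simp add: powr_diff)
      show ?thesis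
        unfolding e p a0_def q bessel_P_rec[OF \<nu>(1), of "s\<^sup>2 / 4"] by (simp add: algebra_simps power2_eq_square)
    qed
    ultimately show ?thesis by simp
  qed
  have a0pos: "a0 s > 0" for s unfolding a0_def using \<nu> by (intro mult_pos_pos bessel_P_pos) auto
  have b0pos: "b0 s > 0" if "s > 0" for s unfolding b0_def using \<nu> that by (intro mult_pos_pos bessel_P_pos) auto
  have a_lim: "(a \<longlongrightarrow> pi * 2 powr (- \<nu>) / Gamma (\<nu> + 1)) (at_right 0)"
    unfolding a_def by (rule schlaefli_normalization[OF \<nu>])
  have a0_lim: "(a0 \<longlongrightarrow> 2 powr (- \<nu>) / Gamma (\<nu> + 1)) (at_right 0)"
  proof -
    have "continuous_on UNIV a0" unfolding a0_def using \<nu> by (intro continuous_intros) auto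
    then have "isCont a0 0" by (simp add: continuous_on_eq_continuous_at)
    then have "(a0 \<longlongrightarrow> a0 0) (at_right 0)"
      unfolding isCont_def by (rule filterlim_at_split[THEN iffD1, THEN conjunct2])
    moreover have "bessel_P \<nu> 0 = bessel_coeff \<nu> 0" unfolding bessel_P_def by (rule powser_zero)
    moreover have "bessel_coeff \<nu> 0 = 1 / Gamma (\<nu> + 1)"
      by (simp add: bessel_coeff_def rGamma_inverse_Gamma divide_inverse)
    moreover have "a0 0 = 2 powr (- \<nu>) * bessel_P \<nu> 0"
      unfolding a0_def by simp
    ultimately show ?thesis by (simp only: times_divide_eq_right mult_1_right)
  qed
  have b_lim: "(b \<longlongrightarrow> 0) (at_right 0)"
    unfolding b_def
  proof (rule bounded_times_powr_tendsto_0)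
    fix s :: real assume s: "0 < s" "s < 1"
    have "pi * exp \<bar>s\<bar> \<le> pi * exp 1" using s by (intro mult_left_mono) auto
    moreover have "\<bar>sin ((\<nu> + 1) * pi)\<bar> * \<bar>schlaefli_cosh (\<nu> + 1) s\<bar> \<le> 1 * (1 / (\<nu> + 1))"
      using schlaefli_cosh_bound[of s "\<nu> + 1"] schlaefli_cosh_nonneg[of "\<nu> + 1" s] s \<nu> by (intro mult_mono) auto
    moreover have "\<bar>schlaefli (\<nu> + 1) s\<bar> \<le> \<bar>schlaefli_cos (\<nu> + 1) s\<bar> + \<bar>sin ((\<nu> + 1) * pi)\<bar> * \<bar>schlaefli_cosh (\<nu> + 1) s\<bar>"
      unfolding schlaefli_def abs_mult[symmetric] by (rule abs_triangle_ineq4)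
    ultimately show "\<bar>schlaefli (\<nu> + 1) s\<bar> \<le> pi * exp 1 + 1 / (\<nu> + 1)"
      using schlaefli_cos_bound[of "\<nu> + 1" s] by linarith
  qed (use \<nu> in simp)
  have b0_lim: "(b0 \<longlongrightarrow> 0) (at_right 0)"
    unfolding b0_def
  proof (rule bounded_times_powr_tendsto_0)
    fix s :: real assume s: "0 < s" "s < 1"
    show "\<bar>2 powr (- \<nu> - 1) * bessel_P (\<nu> + 1) (s\<^sup>2 / 4)\<bar> \<le> 2 powr (- \<nu> - 1) * bessel_P (\<nu> + 1) (1 / 4)"
    proof -
      have "bessel_P (\<nu> + 1) (s\<^sup>2 / 4) \<le> bessel_P (\<nu> + 1) (1 / 4)"
      proof (rule DERIV_nonneg_imp_nondecreasing[where f = "bessel_P (\<nu> + 1)"])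
        show "s\<^sup>2 / 4 \<le> 1 / 4" using s by (simp add: power_le_one)
        fix t assume "s\<^sup>2 / 4 \<le> t" "t \<le> 1 / 4"
        then have "t \<ge> 0" using zero_le_power2[of s] by linarith
        then have "bessel_P (\<nu> + 1 + 1) t \<ge> 0" using \<nu> by (intro less_imp_le[OF bessel_P_pos]) auto
        then show "\<exists>d. (bessel_P (\<nu> + 1) has_real_derivative d) (at t) \<and> d \<ge> 0"
          using DERIV_bessel_P[OF \<nu>1, of t] by blast
      qed
      then show ?thesis using bessel_P_pos[OF \<nu>1, of "s\<^sup>2 / 4"] by (simp add: abs_mult)
    qed
  qed (use \<nu> in simp)
  \<comment> \<open>The Wronskian. At the origin both \<open>b\<close> and \<open>b0\<close> vanish
    while \<open>a\<close> and \<open>a0\<close> have finite limits, so the constant is 0; by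
    \<open>da\<close> and \<open>da0\<close> the derivative of \<open>a / a0\<close> is then 0 as
    well.\<close>
  define W where "W = (\<lambda>s. a s * b0 s - a0 s * b s)"
  have W_const: "\<exists>c. \<forall>s\<in>{0<..}. W s = c"
  proof (rule has_field_derivative_zero_constant)
    show "(W has_real_derivative 0) (at s within {0<..})" if "s \<in> {0<..}" for s
    proof -
      have s: "s > 0" using that by simp
      have "(W has_real_derivative (s powr (- 2 * \<nu> - 1) * b s * b0 s + s powr (2 * \<nu> + 1) * a0 s * a s
          - (s powr (- 2 * \<nu> - 1) * b0 s * b s + s powr (2 * \<nu> + 1) * a s * a0 s))) (at s)"
        unfolding W_def by (intro DERIV_diff DERIV_mult da db da0 db0 s)
      then have "(W has_real_derivative 0) (at s)" by (simp add: mult_ac)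
      then show ?thesis by (rule has_field_derivative_at_within)
    qed
  qed simp
  then obtain c where c: "\<And>s. s > 0 \<Longrightarrow> W s = c" by auto
  have "(W \<longlongrightarrow> pi * 2 powr (- \<nu>) / Gamma (\<nu> + 1) * 0 - 2 powr (- \<nu>) / Gamma (\<nu> + 1) * 0) (at_right 0)"
    unfolding W_def by (intro tendsto_intros a_lim b_lim a0_lim b0_lim)
  moreover have "(W \<longlongrightarrow> c) (at_right 0)"
    by (rule tendsto_eventually, rule eventually_right_0) (rule c)
  ultimately have "c = 0" by (simp add: tendsto_unique[OF trivial_limit_at_right_real])
  then have W0: "a s * b0 s = a0 s * b s" if "s > 0" for s using c[OF that] by (simp add: W_def)
  have "\<exists>d. \<forall>s\<in>{0<..}. a s / a0 s = d"
  proof (rule has_field_derivative_zero_constant)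
    show "((\<lambda>s. a s / a0 s) has_real_derivative 0) (at s within {0<..})" if "s \<in> {0<..}" for s
    proof -
      have s: "s > 0" using that by simp
      have "((\<lambda>s. a s / a0 s) has_real_derivative (s powr (- 2 * \<nu> - 1) * b s * a0 s - a s * (s powr (- 2 * \<nu> - 1) * b0 s)) / (a0 s * a0 s)) (at s)"
        using a0pos[of s] by (intro DERIV_divide da da0 s) auto
      moreover have "s powr (- 2 * \<nu> - 1) * b s * a0 s - a s * (s powr (- 2 * \<nu> - 1) * b0 s) = s powr (- 2 * \<nu> - 1) * (a0 s * b s - a s * b0 s)"
        by (simp add: algebra_simps)
      moreover have "a0 s * b s - a s * b0 s = 0" using W0[OF s] by simp
      ultimately have "((\<lambda>s. a s / a0 s) has_real_derivative 0) (at s)" by (simp only: mult_zero_right div_0)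
      then show ?thesis by (rule has_field_derivative_at_within)
    qed
  qed simp
  then obtain d where d: "\<And>s. s > 0 \<Longrightarrow> a s / a0 s = d" by auto
  have Gp: "Gamma (\<nu> + 1) > 0" using \<nu> by (intro Gamma_real_pos) auto
  have "((\<lambda>s. a s / a0 s) \<longlongrightarrow> (pi * 2 powr (- \<nu>) / Gamma (\<nu> + 1)) / (2 powr (- \<nu>) / Gamma (\<nu> + 1))) (at_right 0)"
    using Gp by (intro tendsto_divide a_lim a0_lim) auto
  moreover have "((\<lambda>s. a s / a0 s) \<longlongrightarrow> d) (at_right 0)"
    by (rule tendsto_eventually, rule eventually_right_0) (rule d)
  ultimately have "(pi * 2 powr (- \<nu>) / Gamma (\<nu> + 1)) / (2 powr (- \<nu>) / Gamma (\<nu> + 1)) = d"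
    by (rule tendsto_unique[OF trivial_limit_at_right_real])
  then have "d = pi" using Gp by simp
  then have a_eq: "a s = pi * a0 s" using d[OF s] a0pos[of s] by (simp add: field_simps)
  have b_eq: "b s = pi * b0 s" using W0[OF s] a0pos[of s] unfolding a_eq by simp
  have "s powr (- \<nu>) * schlaefli \<nu> s = s powr (- \<nu>) * (pi * mod_bessel_I \<nu> s)"
    using a_eq a0I[OF s] unfolding a_def by simp
  moreover have "s powr (\<nu> + 1) * schlaefli (\<nu> + 1) s = s powr (\<nu> + 1) * (pi * mod_bessel_I (\<nu> + 1) s)"
    using b_eq b0I[OF s] unfolding b_def by simp
  ultimately show ?thesis using s by simp
qed

text \<open>Induction upward from the base strip by the three-term recurrence, which requires two
  consecutive orders in the induction hypothesis. Every \<open>\<nu> > -1\<close> reaches the strip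
  after subtraction of \<open>nat \<lceil>\<nu>\<rceil>\<close>.\<close>

theorem schlaefli_eq:
  assumes \<nu>: "-1 < \<nu>" and s: "s > 0"
  shows "schlaefli \<nu> s = pi * mod_bessel_I \<nu> s"
proof -
  have step: "schlaefli (\<nu>0 + real n) s = pi * mod_bessel_I (\<nu>0 + real n) s \<and>
      schlaefli (\<nu>0 + real n + 1) s = pi * mod_bessel_I (\<nu>0 + real n + 1) s"
    if \<nu>0: "-1 < \<nu>0" "\<nu>0 \<le> 0" for \<nu>0 n
  proof (induction n)
    case 0
    then show ?case using schlaefli_eq_base[OF \<nu>0 s] by simp
  next
    case (Suc n)
    define \<kappa> where "\<kappa> = \<nu>0 + real n"
    have \<kappa>: "\<kappa> > -1" using \<nu>0 by (simp add: \<kappa>_def)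
    have IH: "schlaefli \<kappa> s = pi * mod_bessel_I \<kappa> s" "schlaefli (\<kappa> + 1) s = pi * mod_bessel_I (\<kappa> + 1) s"
      using Suc unfolding \<kappa>_def by auto
    have "schlaefli (\<kappa> + 2) s = schlaefli \<kappa> s - 2 * (\<kappa> + 1) / s * schlaefli (\<kappa> + 1) s"
    proof -
      have "\<kappa> + 1 + 1 = \<kappa> + 2" "\<kappa> + 1 - 1 = \<kappa>" by simp_all
      with schlaefli_rec[OF s, of "\<kappa> + 1"]
      have "schlaefli \<kappa> s - schlaefli (\<kappa> + 2) s = 2 * (\<kappa> + 1) / s * schlaefli (\<kappa> + 1) s" by (simp only:)
      then show ?thesis by linarith
    qed
    also have "\<dots> = pi * mod_bessel_I (\<kappa> + 2) s"
      unfolding IH mod_bessel_I_rec[OF \<kappa> s] by (simp add: algebra_simps)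
    finally have "schlaefli (\<kappa> + 2) s = pi * mod_bessel_I (\<kappa> + 2) s" .
    moreover have "\<nu>0 + real (Suc n) = \<kappa> + 1" "\<nu>0 + real (Suc n) + 1 = \<kappa> + 2" by (simp_all add: \<kappa>_def)
    ultimately show ?case using IH(2) by (simp only:)
  qed
  define n where "n = nat \<lceil>\<nu>\<rceil>"
  have "\<lceil>\<nu>\<rceil> \<ge> 0" using \<nu> by (simp add: le_ceiling_iff)
  then have "real n = of_int \<lceil>\<nu>\<rceil>" by (simp add: n_def)
  then have "-1 < \<nu> - real n" "\<nu> - real n \<le> 0" by linarith+
  from step[OF this, of n] show ?thesis by simp
qed

section \<open>Injectivity of the Laplace transform\<close>

text \<open>Lerch's argument. In the variable \<open>exp (- w)\<close> the transforms at
  \<open>q = 1, 2, 3, ...\<close> are moments, so by Weierstrass the integral against every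
  continuous function of \<open>exp (- w)\<close> vanishes. If \<open>g w0 > 0\<close>, a
  nonnegative test function supported where \<open>g\<close> is positive gives a
  contradiction.\<close>

lemma laplace_injective_aux:
  fixes g :: "real \<Rightarrow> real"
  assumes meas: "g \<in> borel_measurable borel"
    and int: "\<And>q. q > 0 \<Longrightarrow> set_integrable lborel {0<..} (\<lambda>w. exp (- q * w) * g w)"
    and zero: "\<And>q. q > 0 \<Longrightarrow> (LINT w:{0<..}|lborel. exp (- q * w) * g w) = 0"
    and w0: "w0 > 0" and cont: "isCont g w0"
  shows "\<not> g w0 > 0"
proof
  assume pos: "g w0 > 0"
  define c where "c = g w0 / 2"
  have c: "c > 0" "g w0 > c" using pos by (auto simp: c_def)
  have "\<forall>\<^sub>F w in at w0. g w > c"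
    using cont c(2) unfolding isCont_def by (rule order_tendstoD(1))
  then obtain d0 where d0: "d0 > 0" "\<And>w. w \<noteq> w0 \<Longrightarrow> dist w w0 < d0 \<Longrightarrow> g w > c"
    unfolding eventually_at by auto
  \<comment> \<open>The minimum with \<open>w0\<close> keeps the interval
    \<open>(w0 - d, w0 + d)\<close> inside the half line of integration.\<close>
  define d where "d = min d0 w0"
  have d: "d > 0" "d \<le> w0" using d0 w0 by (auto simp: d_def)
  have gc: "g w > c" if "\<bar>w - w0\<bar> < d" for w
    using d0(2)[of w] c(2) that by (cases "w = w0") (auto simp: d_def dist_real_def)
  define v1 where "v1 = exp (- (w0 + d))"
  define v2 where "v2 = exp (- (w0 - d))"
  \<comment> \<open>The product is positive exactly between \<open>v1\<close> and \<open>v2\<close>,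
    the images under \<open>exp (- w)\<close> of the ends of the interval on which
    \<open>g > c\<close>; the maximum with 0 cuts it off continuously elsewhere.\<close>
  define \<psi> where "\<psi> = (\<lambda>v. max 0 ((v - v1) * (v2 - v)))"
  define I where "I = (\<lambda>h. LINT w:{0<..}|lborel. h (exp (- w)) * (exp (- w) * g w))"
  have int1: "set_integrable lborel {0<..} (\<lambda>w. exp (- w) * g w)"
    using int[of 1] by simp
  define A where "A = (LINT w:{0<..}|lborel. \<bar>exp (- w) * g w\<bar>)"
  have A: "A \<ge> 0" unfolding A_def set_lebesgue_integral_def by (intro Bochner_Integration.integral_nonneg) auto
  have bnd_int: "set_integrable lborel {0<..} (\<lambda>w. h (exp (- w)) * (exp (- w) * g w))"
    if h: "continuous_on UNIV h" and b: "\<And>v. v \<in> {0..1} \<Longrightarrow> \<bar>h v\<bar> \<le> B" for h :: "real \<Rightarrow> real" and B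
  proof (rule set_integrable_bound)
    show "set_integrable lborel {0<..} (\<lambda>w. B * (exp (- w) * g w))"
      using int1 by (intro set_integrable_mult_right) simp
    have [measurable]: "h \<in> borel_measurable borel" using h by (rule borel_measurable_continuous_onI)
    show "set_borel_measurable lborel {0<..} (\<lambda>w. h (exp (- w)) * (exp (- w) * g w))"
      unfolding set_borel_measurable_def using meas by measurable
    show "AE w in lborel. w \<in> {0<..} \<longrightarrow> norm (h (exp (- w)) * (exp (- w) * g w)) \<le> norm (B * (exp (- w) * g w))"
    proof (intro AE_I2 impI)
      fix w :: real assume "w \<in> {0<..}"
      then have "\<bar>h (exp (- w))\<bar> \<le> B" by (intro b) auto
      then have "\<bar>h (exp (- w))\<bar> \<le> \<bar>B\<bar>" by linarith
      then show "norm (h (exp (- w)) * (exp (- w) * g w)) \<le> norm (B * (exp (- w) * g w))"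
        unfolding real_norm_def abs_mult by (intro mult_right_mono) auto
    qed
  qed
  have cbd: "\<exists>B. \<forall>v\<in>{0..1}. \<bar>h v\<bar> \<le> B" if "continuous_on UNIV h" for h :: "real \<Rightarrow> real"
  proof -
    have "bounded (h ` {0..1})"
      using that by (intro compact_imp_bounded compact_continuous_image) (auto intro: continuous_on_subset)
    then show ?thesis unfolding bounded_real by auto
  qed
  have cint: "set_integrable lborel {0<..} (\<lambda>w. h (exp (- w)) * (exp (- w) * g w))"
    if "continuous_on UNIV h" for h :: "real \<Rightarrow> real"
    using cbd[OF that] bnd_int[OF that] by blast
  \<comment> \<open>The power \<open>i\<close> contributes the transform at
    \<open>q = i + 1\<close>; the one additional \<open>exp (- w)\<close> is kept as a weight, which
    makes \<open>exp (- w) * g w\<close> integrable.\<close>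
  have poly0: "I (\<lambda>v. \<Sum>i\<le>n. a i * v ^ i) = 0" for a :: "nat \<Rightarrow> real" and n
  proof -
    have eq: "(\<Sum>i\<le>n. a i * exp (- w) ^ i) * (exp (- w) * g w) = (\<Sum>i\<le>n. a i * (exp (- (real i + 1) * w) * g w))" for w
    proof -
      have "exp (- w) ^ i * exp (- w) = exp (- (real i + 1) * w)" for i
        by (simp flip: exp_of_nat_mult exp_add add: algebra_simps)
      note k = this
      have "a i * exp (- w) ^ i * (exp (- w) * g w) = a i * (exp (- (real i + 1) * w) * g w)" for i
        unfolding k[symmetric] by (simp only: mult_ac)
      then show ?thesis unfolding sum_distrib_right by (intro sum.cong refl)
    qed
    have "I (\<lambda>v. \<Sum>i\<le>n. a i * v ^ i) = (\<Sum>i\<le>n. LINT w:{0<..}|lborel. a i * (exp (- (real i + 1) * w) * g w))"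
      unfolding I_def eq
      unfolding set_lebesgue_integral_def scaleR_sum_right
    proof (rule Bochner_Integration.integral_sum)
      fix i
      have "set_integrable lborel {0<..} (\<lambda>w. a i * (exp (- (real i + 1) * w) * g w))"
        by (intro set_integrable_mult_right int) simp
      then show "integrable lborel (\<lambda>w. indicat_real {0<..} w *\<^sub>R (a i * (exp (- (real i + 1) * w) * g w)))"
        unfolding set_integrable_def .
    qed
    also have "\<dots> = 0"
      using zero by (intro sum.neutral) (auto simp del: minus_add_distrib simp: add_pos_nonneg)
    finally show ?thesis .
  qed
  have cont_\<psi>: "continuous_on UNIV \<psi>" unfolding \<psi>_def by (intro continuous_intros)
  have "\<bar>I \<psi>\<bar> \<le> e * A" if e: "e > 0" for e
  proof -
    obtain p where p: "real_polynomial_function p" "\<And>v. v \<in> {0..1} \<Longrightarrow> \<bar>\<psi> v - p v\<bar> < e"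
      using Stone_Weierstrass_real_polynomial_function[OF compact_Icc continuous_on_subset[OF cont_\<psi>] e, of 0 1] by auto
    obtain a n where pe: "p = (\<lambda>v. \<Sum>i\<le>n. a i * v ^ i)"
      using p(1) unfolding real_polynomial_function_iff_sum by blast
    have cont_p: "continuous_on UNIV p" unfolding pe by (intro continuous_intros)
    have "I \<psi> = I \<psi> - I p" using poly0 pe by simp
    also have "\<dots> = (LINT w:{0<..}|lborel. \<psi> (exp (- w)) * (exp (- w) * g w) - p (exp (- w)) * (exp (- w) * g w))"
      unfolding I_def by (rule set_integral_diff(2)[symmetric]) (intro cint cont_\<psi> cont_p)+
    finally have eq: "I \<psi> = (LINT w:{0<..}|lborel. \<psi> (exp (- w)) * (exp (- w) * g w) - p (exp (- w)) * (exp (- w) * g w))" .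
    have "norm (I \<psi>) \<le> (LINT w:{0<..}|lborel. norm (\<psi> (exp (- w)) * (exp (- w) * g w) - p (exp (- w)) * (exp (- w) * g w)))"
      unfolding eq by (rule set_integral_norm_bound) (intro set_integral_diff(1) cint cont_\<psi> cont_p)
    also have "\<dots> \<le> (LINT w:{0<..}|lborel. e * \<bar>exp (- w) * g w\<bar>)"
    proof (rule set_integral_mono)
      show "set_integrable lborel {0<..} (\<lambda>w. norm (\<psi> (exp (- w)) * (exp (- w) * g w) - p (exp (- w)) * (exp (- w) * g w)))"
        by (intro set_integrable_norm set_integral_diff(1) cint cont_\<psi> cont_p)
      show "set_integrable lborel {0<..} (\<lambda>w. e * \<bar>exp (- w) * g w\<bar>)"
        by (intro set_integrable_mult_right set_integrable_abs int1)
      fix w :: real assume "w \<in> {0<..}"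
      then have "\<bar>\<psi> (exp (- w)) - p (exp (- w))\<bar> < e" by (intro p(2)) auto
      then show "norm (\<psi> (exp (- w)) * (exp (- w) * g w) - p (exp (- w)) * (exp (- w) * g w)) \<le> e * \<bar>exp (- w) * g w\<bar>"
        unfolding left_diff_distrib[symmetric] real_norm_def abs_mult[of "_ - _"] by (intro mult_right_mono) auto
    qed
    also have "\<dots> = e * A" unfolding A_def by simp
    finally show ?thesis by simp
  qed
  then have "\<bar>I \<psi>\<bar> \<le> 0 + e" if "e > 0" for e
  proof (cases "A = 0")
    case True
    have "\<bar>I \<psi>\<bar> \<le> 1 * A" by (rule \<open>\<And>e. e > 0 \<Longrightarrow> \<bar>I \<psi>\<bar> \<le> e * A\<close>) simp
    then show ?thesis using True that by simp
  next
    case False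
    then have "A > 0" using A by simp
    then have "\<bar>I \<psi>\<bar> \<le> e / A * A" using that by (intro \<open>\<And>e. e > 0 \<Longrightarrow> \<bar>I \<psi>\<bar> \<le> e * A\<close>) simp
    then show ?thesis using \<open>A > 0\<close> by simp
  qed
  then have I0: "I \<psi> = 0" using field_le_epsilon[of "\<bar>I \<psi>\<bar>" 0] by simp
  define F where "F = (\<lambda>w. indicator {0<..} w *\<^sub>R (\<psi> (exp (- w)) * (exp (- w) * g w)))"
  have \<psi>pos: "\<psi> (exp (- w)) > 0" if "\<bar>w - w0\<bar> < d" for w
  proof -
    have "exp (- w) > v1" "v2 > exp (- w)" using that unfolding v1_def v2_def by auto
    then show ?thesis unfolding \<psi>_def by (simp add: less_max_iff_disj)
  qed
  have \<psi>0: "\<psi> (exp (- w)) = 0" if "\<not> \<bar>w - w0\<bar> < d" for w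
  proof -
    have "exp (- w) \<le> v1 \<or> v2 \<le> exp (- w)" using that unfolding v1_def v2_def by auto
    moreover have "v1 \<le> v2" using d unfolding v1_def v2_def by auto
    ultimately have "(exp (- w) - v1) * (v2 - exp (- w)) \<le> 0"
      by (auto simp: mult_le_0_iff)
    then show ?thesis unfolding \<psi>_def by simp
  qed
  have Fnn: "F w \<ge> 0" for w
    using gc[of w] c(1) \<psi>0[of w] \<psi>pos[of w] unfolding F_def
    by (cases "\<bar>w - w0\<bar> < d") (auto intro!: mult_nonneg_nonneg)
  have "integrable lborel F" using cint[OF cont_\<psi>] unfolding F_def set_integrable_def .
  moreover have "integral\<^sup>L lborel F = 0" using I0 unfolding I_def F_def set_lebesgue_integral_def .
  ultimately have "AE w in lborel. F w = 0"
    using Fnn by (subst integral_nonneg_eq_0_iff_AE[symmetric]) auto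
  moreover have "F w \<noteq> 0" if "w \<in> {w0 - d<..<w0 + d}" for w
  proof -
    have w: "\<bar>w - w0\<bar> < d" "w > 0" using that d by auto
    then show ?thesis using \<psi>pos[OF w(1)] gc[OF w(1)] c(1) unfolding F_def by simp
  qed
  ultimately have "AE w in lborel. w \<notin> {w0 - d<..<w0 + d}"
    by (auto elim: eventually_mono)
  then have "{w0 - d<..<w0 + d} \<in> null_sets lborel"
    by (subst AE_iff_null_sets) auto
  then have "emeasure lborel {w0 - d<..<w0 + d} = 0" by (rule null_setsD1)
  then show False using d by (simp add: ennreal_eq_0_iff)
qed

lemma laplace_injective:
  fixes g :: "real \<Rightarrow> real"
  assumes meas: "g \<in> borel_measurable borel"
    and int: "\<And>q. q > 0 \<Longrightarrow> set_integrable lborel {0<..} (\<lambda>w. exp (- q * w) * g w)"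
    and zero: "\<And>q. q > 0 \<Longrightarrow> (LINT w:{0<..}|lborel. exp (- q * w) * g w) = 0"
    and w0: "w0 > 0" and cont: "isCont g w0"
  shows "g w0 = 0"
proof -
  have "\<not> g w0 > 0"
    by (rule laplace_injective_aux[OF assms])
  moreover have "\<not> - g w0 > 0"
  proof (rule laplace_injective_aux[where g = "\<lambda>w. - g w", OF _ _ _ w0])
    show "(\<lambda>w. - g w) \<in> borel_measurable borel" using meas by simp
    show "set_integrable lborel {0<..} (\<lambda>w. exp (- q * w) * - g w)" if "q > 0" for q
      using set_integrable_mult_right[of "-1" lborel, OF int[OF that]] by simp
    show "(LINT w:{0<..}|lborel. exp (- q * w) * - g w) = 0" if "q > 0" for q
      using set_integral_uminus[OF int[OF that]] zero[OF that] by simp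
    show "isCont (\<lambda>w. - g w) w0" using cont by (intro continuous_intros)
  qed
  ultimately show ?thesis by linarith
qed

section \<open>The angular integral\<close>

text \<open>A translation by \<open>A\<close>. For \<open>w \<le> A\<close> the base of the power is
  0 and \<open>0 powr \<mu> = 0\<close> for every real \<mu>, so the truncated power vanishes there
  even when \<open>\<mu> \<le> 0\<close>.\<close>

lemma laplace_shifted_power:
  fixes \<mu> q A :: real
  assumes \<mu>: "\<mu> > -1" and q: "q > 0" and A: "A \<ge> 0"
    and lm: "set_integrable lborel {0<..} (\<lambda>s. s powr \<mu> * exp (- q * s))"
    "(LINT s:{0<..}|lborel. s powr \<mu> * exp (- q * s)) = G"
  shows "set_integrable lborel {0<..} (\<lambda>w. exp (- q * w) * (max 0 (w - A)) powr \<mu>)"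
    "(LINT w:{0<..}|lborel. exp (- q * w) * (max 0 (w - A)) powr \<mu>) = exp (- q * A) * G"
proof -
  define h where "h = (\<lambda>v. indicator {0<..} v *\<^sub>R (v powr \<mu> * exp (- q * v)))"
  have eq: "indicator {0<..} w *\<^sub>R (exp (- q * w) * (max 0 (w - A)) powr \<mu>) = exp (- q * A) * h (- A + 1 * w)" for w
  proof (cases "w > A")
    case True
    then show ?thesis using A by (simp add: h_def mult_ac algebra_simps flip: exp_add)
  qed (simp add: h_def indicator_def)
  have hi: "integrable lborel h" using lm(1) by (simp add: h_def set_integrable_def)
  have "integrable lborel (\<lambda>w. h (- A + 1 * w))" by (rule lborel_integrable_real_affine[OF hi]) simp
  then show "set_integrable lborel {0<..} (\<lambda>w. exp (- q * w) * (max 0 (w - A)) powr \<mu>)"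
    unfolding set_integrable_def eq by (rule integrable_mult_right)
  have "(\<integral>w. h w \<partial>lborel) = \<bar>1\<bar> *\<^sub>R (\<integral>w. h (- A + 1 * w) \<partial>lborel)"
    by (rule lborel_integral_real_affine) simp
  then show "(LINT w:{0<..}|lborel. exp (- q * w) * (max 0 (w - A)) powr \<mu>) = exp (- q * A) * G"
    unfolding set_lebesgue_integral_def eq using lm(2) by (simp add: h_def set_lebesgue_integral_def)
qed

text \<open>Fubini, stated for a general weight \<open>c\<close> and threshold \<omega> so that it
  covers both parts of Schlaefli's integral. Since \<open>\<omega> \<phi> \<ge> 0\<close>, each
  truncated power is supported in the half line and its transform is
  \<open>G * exp (- q * \<omega> \<phi>)\<close>.\<close>

lemma laplace_mixture:
  fixes \<mu> q G :: real and c \<omega> :: "real \<Rightarrow> real" and S :: "real set"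
  assumes \<mu>: "\<mu> > -1" and q: "q > 0"
    and lm: "set_integrable lborel {0<..} (\<lambda>s. s powr \<mu> * exp (- q * s))"
    "(LINT s:{0<..}|lborel. s powr \<mu> * exp (- q * s)) = G"
    and meas: "c \<in> borel_measurable borel" "\<omega> \<in> borel_measurable borel" "S \<in> sets borel"
    and \<omega>: "\<And>\<phi>. \<phi> \<in> S \<Longrightarrow> \<omega> \<phi> \<ge> 0"
    and int: "set_integrable lborel S (\<lambda>\<phi>. c \<phi> * exp (- q * \<omega> \<phi>))"
  shows "set_integrable lborel {0<..} (\<lambda>w. exp (- q * w) * (LINT \<phi>:S|lborel. c \<phi> * (max 0 (w - \<omega> \<phi>)) powr \<mu>))"
    "(LINT w:{0<..}|lborel. exp (- q * w) * (LINT \<phi>:S|lborel. c \<phi> * (max 0 (w - \<omega> \<phi>)) powr \<mu>)) = G * (LINT \<phi>:S|lborel. c \<phi> * exp (- q * \<omega> \<phi>))"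
proof -
  define f where "f = (\<lambda>\<phi> w. (indicator S \<phi> * c \<phi>) * (indicator {0<..} w *\<^sub>R (exp (- q * w) * (max 0 (w - \<omega> \<phi>)) powr \<mu>)))"
  note [measurable] = meas
  have fm: "case_prod f \<in> borel_measurable (lborel \<Otimes>\<^sub>M lborel)"
    unfolding f_def by measurable
  have fi: "integrable lborel (f \<phi>)" for \<phi>
  proof (cases "\<phi> \<in> S")
    case True
    from laplace_shifted_power(1)[OF \<mu> q \<omega>[OF True] lm]
    show ?thesis unfolding f_def set_integrable_def by (rule integrable_mult_right)
  qed (simp add: f_def)
  have fval: "(\<integral>w. f \<phi> w \<partial>lborel) = G * (indicator S \<phi> *\<^sub>R (c \<phi> * exp (- q * \<omega> \<phi>)))" for \<phi>
  proof (cases "\<phi> \<in> S")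
    case True
    from laplace_shifted_power(2)[OF \<mu> q \<omega>[OF True] lm]
    show ?thesis using True unfolding f_def set_lebesgue_integral_def by simp
  qed (simp add: f_def)
  have fnorm: "(\<integral>w. norm (f \<phi> w) \<partial>lborel) = G * (norm (indicator S \<phi> *\<^sub>R (c \<phi> * exp (- q * \<omega> \<phi>))))" for \<phi>
  proof (cases "\<phi> \<in> S")
    case True
    have "norm (f \<phi> w) = \<bar>c \<phi>\<bar> * (indicator {0<..} w *\<^sub>R (exp (- q * w) * (max 0 (w - \<omega> \<phi>)) powr \<mu>))" for w
      using True by (auto simp: f_def abs_mult indicator_def)
    with laplace_shifted_power(2)[OF \<mu> q \<omega>[OF True] lm]
    show ?thesis using True unfolding set_lebesgue_integral_def by (simp add: abs_mult)
  qed (simp add: f_def)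
  have pint: "integrable (lborel \<Otimes>\<^sub>M lborel) (case_prod f)"
  proof (rule lborel_pair.Fubini_integrable[OF fm])
    show "integrable lborel (\<lambda>\<phi>. \<integral>w. norm (case (\<phi>, w) of (\<phi>, w) \<Rightarrow> f \<phi> w) \<partial>lborel)"
      unfolding prod.case fnorm by (rule integrable_mult_right[OF integrable_norm[OF int[unfolded set_integrable_def]]])
    show "AE \<phi> in lborel. integrable lborel (\<lambda>w. case (\<phi>, w) of (\<phi>, w) \<Rightarrow> f \<phi> w)"
      using fi by simp
  qed
  have snd: "(\<integral>\<phi>. f \<phi> w \<partial>lborel) = indicator {0<..} w *\<^sub>R (exp (- q * w) * (LINT \<phi>:S|lborel. c \<phi> * (max 0 (w - \<omega> \<phi>)) powr \<mu>))" for w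
  proof -
    have "(\<integral>\<phi>. f \<phi> w \<partial>lborel) = (\<integral>\<phi>. (indicator {0<..} w * exp (- q * w)) * (indicator S \<phi> *\<^sub>R (c \<phi> * (max 0 (w - \<omega> \<phi>)) powr \<mu>)) \<partial>lborel)"
      by (rule Bochner_Integration.integral_cong) (auto simp: f_def)
    then show ?thesis unfolding set_lebesgue_integral_def by simp
  qed
  show "set_integrable lborel {0<..} (\<lambda>w. exp (- q * w) * (LINT \<phi>:S|lborel. c \<phi> * (max 0 (w - \<omega> \<phi>)) powr \<mu>))"
    using lborel_pair.integrable_snd[OF pint] unfolding snd set_integrable_def .
  have "(\<integral>w. (\<integral>\<phi>. f \<phi> w \<partial>lborel) \<partial>lborel) = (\<integral>\<phi>. (\<integral>w. f \<phi> w \<partial>lborel) \<partial>lborel)"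
    by (rule lborel_pair.Fubini_integral[OF pint])
  then show "(LINT w:{0<..}|lborel. exp (- q * w) * (LINT \<phi>:S|lborel. c \<phi> * (max 0 (w - \<omega> \<phi>)) powr \<mu>)) = G * (LINT \<phi>:S|lborel. c \<phi> * exp (- q * \<omega> \<phi>))"
    unfolding snd fval set_lebesgue_integral_def by simp
qed

text \<open>
  The substitution \<open>1 - cos \<phi> = k r\<close> turns \<open>arc_E \<mu> \<nu> k\<close> into \<open>k powr (\<mu> + 1 / 2) * arc_H \<mu> \<nu> k\<close>, which can be
  differentiated in \<open>k\<close> under the integral; the derivative is \<open>k powr (\<mu> - 1 / 2) * arc_e \<mu> \<nu> k\<close>.
\<close>
definition arc_T :: "real \<Rightarrow> real \<Rightarrow> real" where
  "arc_T \<nu> s = cos (\<nu> * arccos (1 - s)) / sqrt (2 - s)"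

definition arc_T' :: "real \<Rightarrow> real \<Rightarrow> real" where
  "arc_T' \<nu> s = \<nu> * sin (\<nu> * arccos (1 - s)) * (- 1 / sqrt (s * (2 - s))) / sqrt (2 - s) + cos (\<nu> * arccos (1 - s)) / (2 * (2 - s) * sqrt (2 - s))"

definition arc_E :: "real \<Rightarrow> real \<Rightarrow> real \<Rightarrow> real" where
  "arc_E \<mu> \<nu> k = (LINT \<phi>:{0..pi}|lborel. cos (\<nu> * \<phi>) * (max 0 (k - (1 - cos \<phi>))) powr \<mu>)"

definition arc_H :: "real \<Rightarrow> real \<Rightarrow> real \<Rightarrow> real" where
  "arc_H \<mu> \<nu> k = (LINT r:{0<..<1}|lborel. (1 - r) powr \<mu> * r powr (- 1 / 2) * arc_T \<nu> (k * r))"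

definition arc_H' :: "real \<Rightarrow> real \<Rightarrow> real \<Rightarrow> real" where
  "arc_H' \<mu> \<nu> k = (LINT r:{0<..<1}|lborel. (1 - r) powr \<mu> * r powr (- 1 / 2) * (r * arc_T' \<nu> (k * r)))"

definition arc_e :: "real \<Rightarrow> real \<Rightarrow> real \<Rightarrow> real" where
  "arc_e \<mu> \<nu> k = (\<mu> + 1 / 2) * arc_H \<mu> \<nu> k + k * arc_H' \<mu> \<nu> k"

lemma DERIV_arccos_one_minus:
  assumes "0 < s" "s < 2"
  shows "((\<lambda>s. arccos (1 - s)) has_real_derivative 1 / sqrt (s * (2 - s))) (at s)"
proof -
  have "1 - (1 - s)\<^sup>2 = s * (2 - s)" by (simp add: power2_eq_square algebra_simps)
  then have "(arccos has_real_derivative inverse (- sqrt (s * (2 - s)))) (at (1 - s))"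
    using DERIV_arccos[of "1 - s"] assms by simp
  then have "((\<lambda>s. arccos (1 - s)) has_real_derivative inverse (- sqrt (s * (2 - s))) * (- 1)) (at s)"
    by (rule DERIV_chain2) (auto intro!: derivative_eq_intros)
  then show ?thesis by (simp add: divide_inverse)
qed

lemma DERIV_arc_T:
  assumes "0 < s" "s < 1"
  shows "(arc_T \<nu> has_real_derivative arc_T' \<nu> s) (at s)"
proof -
  have s2: "0 < s" "s < 2" "2 - s > 0" using assms by auto
  have "((\<lambda>s. cos (\<nu> * arccos (1 - s))) has_real_derivative (- sin (\<nu> * arccos (1 - s)) * (\<nu> * (1 / sqrt (s * (2 - s)))))) (at s)"
    by (intro DERIV_chain2[OF DERIV_cos] DERIV_cmult DERIV_arccos_one_minus s2)
  moreover have "((\<lambda>s. sqrt (2 - s)) has_real_derivative (inverse (sqrt (2 - s)) / 2 * (- 1))) (at s)"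
    by (rule DERIV_chain2[where f = sqrt and g = "\<lambda>s. 2 - s", OF DERIV_real_sqrt[OF s2(3)]]) (auto intro!: derivative_eq_intros)
  ultimately have "((\<lambda>s. cos (\<nu> * arccos (1 - s)) / sqrt (2 - s)) has_real_derivative
     ((- sin (\<nu> * arccos (1 - s)) * (\<nu> * (1 / sqrt (s * (2 - s))))) * sqrt (2 - s) - cos (\<nu> * arccos (1 - s)) * (inverse (sqrt (2 - s)) / 2 * (- 1)))
       / (sqrt (2 - s) * sqrt (2 - s))) (at s)"
    using s2 by (intro DERIV_divide) auto
  moreover have "((- sin (\<nu> * arccos (1 - s)) * (\<nu> * (1 / sqrt (s * (2 - s))))) * sqrt (2 - s) - cos (\<nu> * arccos (1 - s)) * (inverse (sqrt (2 - s)) / 2 * (- 1)))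
       / (sqrt (2 - s) * sqrt (2 - s)) = arc_T' \<nu> s"
  proof -
    have gen: "((- a * (\<nu> * (1 / b))) * r - c * (inverse r / 2 * (- 1))) / (r * r) = \<nu> * a * (- 1 / b) / r + c / (2 * d * r)"
      if "r > 0" "d = r * r" for a b c d r :: real
    proof -
      have "((- a * (\<nu> * i)) * r - c * (inverse r / 2 * (- 1))) / (r * r) = \<nu> * a * (- i) / r + c / (2 * (r * r) * r)" for i
        using that(1) by (simp add: field_simps)
      from this[of "1 / b"] show ?thesis using that(2) by simp
    qed
    show ?thesis unfolding arc_T'_def by (rule gen) (use s2 in auto)
  qed
  ultimately show ?thesis unfolding arc_T_def[abs_def] by simp
qed

lemma arccos_one_minus_le:
  assumes "0 < s" "s < 1"
  shows "0 \<le> arccos (1 - s)" "arccos (1 - s) \<le> 2 * sqrt s"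
proof -
  show "0 \<le> arccos (1 - s)" using assms by (intro arccos_lbound) auto
  have "(\<lambda>s. 2 * sqrt s - arccos (1 - s)) 0 \<le> (\<lambda>s. 2 * sqrt s - arccos (1 - s)) s"
  proof (rule DERIV_nonneg_imp_increasing_open[of 0 s])
    show "0 \<le> s" using assms by simp
    fix t assume t: "0 < t" "t < s"
    have "((\<lambda>s. 2 * sqrt s - arccos (1 - s)) has_real_derivative (2 * (inverse (sqrt t) / 2) - 1 / sqrt (t * (2 - t)))) (at t)"
      using t assms by (intro DERIV_diff DERIV_cmult DERIV_real_sqrt DERIV_arccos_one_minus) auto
    moreover have "1 / sqrt (t * (2 - t)) \<le> 1 / sqrt t"
    proof (rule divide_left_mono)
      have "t * 1 \<le> t * (2 - t)" using t assms by (intro mult_left_mono) auto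
      then show "sqrt t \<le> sqrt (t * (2 - t))" by simp
      have "0 < t" "0 < 2 - t" using t assms by auto
      then show "0 < sqrt (t * (2 - t)) * sqrt t" by simp
    qed simp
    then have "0 \<le> 2 * (inverse (sqrt t) / 2) - 1 / sqrt (t * (2 - t))" by (simp add: inverse_eq_divide)
    ultimately show "\<exists>y. ((\<lambda>s. 2 * sqrt s - arccos (1 - s)) has_real_derivative y) (at t) \<and> 0 \<le> y"
      by blast
  next
    show "continuous_on {0..s} (\<lambda>s. 2 * sqrt s - arccos (1 - s))"
      using assms by (intro continuous_intros) auto
  qed
  then show "arccos (1 - s) \<le> 2 * sqrt s" by simp
qed

lemma arc_T_bound: "0 < s \<Longrightarrow> s < 1 \<Longrightarrow> \<bar>arc_T \<nu> s\<bar> \<le> 1"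
proof -
  assume s: "0 < s" "s < 1"
  have "\<bar>cos (\<nu> * arccos (1 - s))\<bar> \<le> sqrt (2 - s)"
  proof -
    have "\<bar>cos (\<nu> * arccos (1 - s))\<bar> \<le> 1" by simp
    moreover have "1 \<le> sqrt (2 - s)" using s by simp
    ultimately show ?thesis by linarith
  qed
  then show ?thesis using s unfolding arc_T_def by (simp add: divide_le_eq_1)
qed

text \<open>The singular factor \<open>1 / sqrt s\<close> is harmless: the sine in front of it is at
  most \<open>\<bar>\<nu>\<bar> * arccos (1 - s)\<close>, which is of order \<open>sqrt s\<close> by
  \<open>arccos_one_minus_le\<close>.\<close>

lemma arc_T'_bound:
  assumes s: "0 < s" "s < 1"
  shows "\<bar>arc_T' \<nu> s\<bar> \<le> 2 * \<nu>\<^sup>2 + 1"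
proof -
  define \<theta> where "\<theta> = arccos (1 - s)"
  have \<theta>: "0 \<le> \<theta>" "\<theta> \<le> 2 * sqrt s" using arccos_one_minus_le[OF s] by (auto simp: \<theta>_def)
  have r: "1 \<le> sqrt (2 - s)" "sqrt (s * (2 - s)) \<ge> sqrt s" using s by auto
  have sq: "sqrt s > 0" using s by simp
  have "\<bar>sin (\<nu> * \<theta>)\<bar> \<le> \<bar>\<nu> * \<theta>\<bar>" by (rule abs_sin_x_le_abs_x)
  also have "\<dots> = \<bar>\<nu>\<bar> * \<theta>" using \<theta> by (simp add: abs_mult)
  also have "\<dots> \<le> \<bar>\<nu>\<bar> * (2 * sqrt s)" using \<theta> by (intro mult_left_mono) auto
  finally have 1: "\<bar>sin (\<nu> * \<theta>)\<bar> \<le> \<bar>\<nu>\<bar> * (2 * sqrt s)" .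
  have "\<bar>\<nu> * sin (\<nu> * \<theta>) * (- 1 / sqrt (s * (2 - s))) / sqrt (2 - s)\<bar> = \<bar>\<nu>\<bar> * \<bar>sin (\<nu> * \<theta>)\<bar> / sqrt (s * (2 - s)) / sqrt (2 - s)"
    using s by (simp add: abs_mult)
  also have "\<dots> \<le> \<bar>\<nu>\<bar> * (\<bar>\<nu>\<bar> * (2 * sqrt s)) / sqrt s / 1"
    using 1 r sq by (intro frac_le mult_left_mono divide_nonneg_nonneg mult_nonneg_nonneg) auto
  also have "\<dots> = 2 * \<nu>\<^sup>2" using sq by (simp add: power2_eq_square)
  finally have a: "\<bar>\<nu> * sin (\<nu> * \<theta>) * (- 1 / sqrt (s * (2 - s))) / sqrt (2 - s)\<bar> \<le> 2 * \<nu>\<^sup>2" .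
  have "\<bar>cos (\<nu> * \<theta>) / (2 * (2 - s) * sqrt (2 - s))\<bar> \<le> 1 / 1"
  proof -
    have "1 * 1 \<le> 2 * (2 - s) * sqrt (2 - s)" using r s by (intro mult_mono) auto
    then have "\<bar>cos (\<nu> * \<theta>)\<bar> / (2 * (2 - s) * sqrt (2 - s)) \<le> 1 / 1" by (intro frac_le) auto
    then show ?thesis using s by (simp add: abs_mult)
  qed
  with a show ?thesis
    unfolding arc_T'_def \<theta>_def[symmetric] by (intro order.trans[OF abs_triangle_ineq]) linarith
qed

lemma arc_T'_cont: "continuous_on {0<..<1} (arc_T' \<nu>)"
  unfolding arc_T'_def[abs_def] by (intro continuous_intros) auto

lemma arc_T_comp_cont:
  assumes "0 < k" "k < 1"
  shows "continuous_on {0<..<1} (\<lambda>r. arc_T \<nu> (k * r))" "continuous_on {0<..<1} (\<lambda>r. r * arc_T' \<nu> (k * r))"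
proof -
  have rr: "(\<lambda>r. k * r) ` {0<..<1} \<subseteq> {0<..<1}"
    using assms mult_strict_mono[of k 1 _ 1] by auto
  have "continuous_on {0<..<1} (arc_T \<nu>)"
    using DERIV_arc_T by (intro continuous_at_imp_continuous_on ballI) (auto intro: DERIV_isCont)
  then show "continuous_on {0<..<1} (\<lambda>r. arc_T \<nu> (k * r))"
    by (rule continuous_on_compose2[OF _ _ rr]) (intro continuous_intros)
  show "continuous_on {0<..<1} (\<lambda>r. r * arc_T' \<nu> (k * r))"
    by (intro continuous_intros continuous_on_compose2[OF arc_T'_cont _ rr])
qed

lemma arc_weight_integrable:
  fixes \<mu> :: real
  assumes "\<mu> > -1/2"
  shows "set_integrable lborel {0<..<1} (\<lambda>r. (1 - r) powr \<mu> * r powr (- 1 / 2))"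
proof -
  have "set_integrable lborel {0..1} (\<lambda>t. t powr (1 / 2 - 1) * (1 - t) powr (\<mu> + 1 - 1))"
    using assms by (intro integrable_Beta) auto
  then have "set_integrable lborel {0<..<1} (\<lambda>t. t powr (1 / 2 - 1) * (1 - t) powr (\<mu> + 1 - 1))"
    by (rule set_integrable_subset) auto
  then show ?thesis by (simp add: mult.commute)
qed

lemma arc_weighted_integrable:
  assumes \<mu>: "(\<mu>::real) > -1/2" and h: "continuous_on {0<..<1} h" "\<And>r. 0 < r \<Longrightarrow> r < 1 \<Longrightarrow> \<bar>h r\<bar> \<le> C"
  shows "set_integrable lborel {0<..<1} (\<lambda>r. (1 - r) powr \<mu> * r powr (- 1 / 2) * h r)"
proof (rule set_integrable_bound)
  show "set_integrable lborel {0<..<1} (\<lambda>r. C * ((1 - r) powr \<mu> * r powr (- 1 / 2)))"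
    using arc_weight_integrable[OF \<mu>] by (intro set_integrable_mult_right) simp
  show "set_borel_measurable lborel {0<..<1} (\<lambda>r. (1 - r) powr \<mu> * r powr (- 1 / 2) * h r)"
  proof -
    have "(\<lambda>r. indicator {0<..<1} r *\<^sub>R ((1 - r) powr \<mu> * r powr (- 1 / 2) * h r)) \<in> borel_measurable borel"
      by (rule borel_measurable_continuous_on_indicator) (use h(1) in \<open>auto intro!: continuous_intros\<close>)
    then show ?thesis unfolding set_borel_measurable_def by (simp only: measurable_lborel2)
  qed
  show "AE r in lborel. r \<in> {0<..<1} \<longrightarrow> norm ((1 - r) powr \<mu> * r powr (- 1 / 2) * h r) \<le> norm (C * ((1 - r) powr \<mu> * r powr (- 1 / 2)))"
  proof (intro AE_I2 impI)
    fix r :: real assume "r \<in> {0<..<1}"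
    then have "\<bar>h r\<bar> \<le> \<bar>C\<bar>" using h(2)[of r] by auto
    then have "((1 - r) powr \<mu> * r powr (- 1 / 2)) * \<bar>h r\<bar> \<le> ((1 - r) powr \<mu> * r powr (- 1 / 2)) * \<bar>C\<bar>"
      by (intro mult_left_mono) auto
    then show "norm ((1 - r) powr \<mu> * r powr (- 1 / 2) * h r) \<le> norm (C * ((1 - r) powr \<mu> * r powr (- 1 / 2)))"
      by (simp add: abs_mult mult_ac)
  qed
qed

lemma arc_weighted_bound:
  assumes \<mu>: "(\<mu>::real) > -1/2" and h: "continuous_on {0<..<1} h" "\<And>r. 0 < r \<Longrightarrow> r < 1 \<Longrightarrow> \<bar>h r\<bar> \<le> C"
  shows "\<bar>LINT r:{0<..<1}|lborel. (1 - r) powr \<mu> * r powr (- 1 / 2) * h r\<bar> \<le> C * (LINT r:{0<..<1}|lborel. (1 - r) powr \<mu> * r powr (- 1 / 2))"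
proof -
  have int: "set_integrable lborel {0<..<1} (\<lambda>r. (1 - r) powr \<mu> * r powr (- 1 / 2) * h r)"
    by (rule arc_weighted_integrable[OF assms])
  have "norm (LINT r:{0<..<1}|lborel. (1 - r) powr \<mu> * r powr (- 1 / 2) * h r) \<le> (LINT r:{0<..<1}|lborel. norm ((1 - r) powr \<mu> * r powr (- 1 / 2) * h r))"
    by (rule set_integral_norm_bound[OF int])
  also have "\<dots> \<le> (LINT r:{0<..<1}|lborel. C * ((1 - r) powr \<mu> * r powr (- 1 / 2)))"
  proof (rule set_integral_mono[OF set_integrable_norm[OF int]])
    show "set_integrable lborel {0<..<1} (\<lambda>r. C * ((1 - r) powr \<mu> * r powr (- 1 / 2)))"
      using arc_weight_integrable[OF \<mu>] by (intro set_integrable_mult_right) simp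
    fix r :: real assume "r \<in> {0<..<1}"
    then have "((1 - r) powr \<mu> * r powr (- 1 / 2)) * \<bar>h r\<bar> \<le> ((1 - r) powr \<mu> * r powr (- 1 / 2)) * C"
      using h(2)[of r] by (intro mult_left_mono) auto
    then show "norm ((1 - r) powr \<mu> * r powr (- 1 / 2) * h r) \<le> C * ((1 - r) powr \<mu> * r powr (- 1 / 2))"
      by (simp add: abs_mult mult_ac)
  qed
  finally show ?thesis by simp
qed

lemma DERIV_arc_H:
  assumes \<mu>: "(\<mu>::real) > -1/2" and k: "0 < k" "k < 1"
  shows "(arc_H \<mu> \<nu> has_real_derivative arc_H' \<mu> \<nu> k) (at k)"
proof -
  define \<delta> where "\<delta> = min k (1 - k)"
  have \<delta>: "\<delta> > 0" "\<delta> \<le> k" "\<delta> \<le> 1 - k" using k by (auto simp: \<delta>_def)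
  have rng: "0 < w" "w < 1" if "\<bar>w - k\<bar> < \<delta>" for w using that \<delta> by linarith+
  have rr: "0 < w * r" "w * r < 1" if "\<bar>w - k\<bar> < \<delta>" "0 < r" "r < 1" for w r
  proof -
    show "0 < w * r" using rng[OF that(1)] that by simp
    have "w * r < 1 * 1" using rng[OF that(1)] that by (intro mult_strict_mono) auto
    then show "w * r < 1" by simp
  qed
  have "((\<lambda>k. LINT r:{0<..<1}|lborel. (1 - r) powr \<mu> * r powr (- 1 / 2) * arc_T \<nu> (k * r)) has_real_derivative
     (LINT r:{0<..<1}|lborel. (1 - r) powr \<mu> * r powr (- 1 / 2) * (r * arc_T' \<nu> (k * r)))) (at k)"
    unfolding set_lebesgue_integral_def
  proof (rule has_real_derivative_LINT(1)[OF \<delta>(1), where B = "\<lambda>r. indicator {0<..<1} r *\<^sub>R ((1 - r) powr \<mu> * r powr (- 1 / 2) * (2 * \<nu>\<^sup>2 + 1))"])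
    fix w r assume w: "\<bar>w - k\<bar> < \<delta>"
    show "((\<lambda>k. indicat_real {0<..<1} r *\<^sub>R ((1 - r) powr \<mu> * r powr (- 1 / 2) * arc_T \<nu> (k * r))) has_real_derivative
       indicat_real {0<..<1} r *\<^sub>R ((1 - r) powr \<mu> * r powr (- 1 / 2) * (r * arc_T' \<nu> (w * r)))) (at w)"
    proof (cases "r \<in> {0<..<1}")
      case True
      have "((\<lambda>k. arc_T \<nu> (k * r)) has_real_derivative arc_T' \<nu> (w * r) * r) (at w)"
        using rr[OF w, of r] True by (intro DERIV_chain2[OF DERIV_arc_T]) (auto intro!: derivative_eq_intros)
      from DERIV_cmult[OF this, of "(1 - r) powr \<mu> * r powr (- 1 / 2)"] show ?thesis using True by (simp add: mult_ac)
    qed simp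
    show "\<bar>indicat_real {0<..<1} r *\<^sub>R ((1 - r) powr \<mu> * r powr (- 1 / 2) * (r * arc_T' \<nu> (w * r)))\<bar>
       \<le> indicat_real {0<..<1} r *\<^sub>R ((1 - r) powr \<mu> * r powr (- 1 / 2) * (2 * \<nu>\<^sup>2 + 1))"
    proof (cases "r \<in> {0<..<1}")
      case True
      have "\<bar>r * arc_T' \<nu> (w * r)\<bar> \<le> 1 * (2 * \<nu>\<^sup>2 + 1)"
        unfolding abs_mult using rr[OF w, of r] True by (intro mult_mono arc_T'_bound) auto
      then have "(1 - r) powr \<mu> * r powr (- 1 / 2) * \<bar>r * arc_T' \<nu> (w * r)\<bar> \<le> (1 - r) powr \<mu> * r powr (- 1 / 2) * (2 * \<nu>\<^sup>2 + 1)"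
        by (intro mult_left_mono) auto
      then show ?thesis using True by (simp add: abs_mult)
    qed simp
  next
    fix w assume w: "\<bar>w - k\<bar> < \<delta>"
    have "set_integrable lborel {0<..<1} (\<lambda>r. (1 - r) powr \<mu> * r powr (- 1 / 2) * arc_T \<nu> (w * r))"
      using rr[OF w] rng[OF w] by (intro arc_weighted_integrable[OF \<mu>, where C = 1] arc_T_bound arc_T_comp_cont) auto
    then show "integrable lborel (\<lambda>r. indicat_real {0<..<1} r *\<^sub>R ((1 - r) powr \<mu> * r powr (- 1 / 2) * arc_T \<nu> (w * r)))"
      by (simp add: set_integrable_def)
  next
    have "set_integrable lborel {0<..<1} (\<lambda>r. (1 - r) powr \<mu> * r powr (- 1 / 2) * (2 * \<nu>\<^sup>2 + 1))"
      by (intro arc_weighted_integrable[OF \<mu>, where C = "\<bar>2 * \<nu>\<^sup>2 + 1\<bar>"]) auto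
    then show "integrable lborel (\<lambda>r. indicat_real {0<..<1} r *\<^sub>R ((1 - r) powr \<mu> * r powr (- 1 / 2) * (2 * \<nu>\<^sup>2 + 1)))"
      by (simp add: set_integrable_def)
  qed
  then show ?thesis unfolding arc_H_def[abs_def] arc_H'_def .
qed

lemma arc_e_bound:
  assumes \<mu>: "(\<mu>::real) > -1/2"
  obtains C where "C > 0" "\<And>k. 0 < k \<Longrightarrow> k < 1 \<Longrightarrow> \<bar>arc_e \<mu> \<nu> k\<bar> \<le> C"
proof -
  define W where "W = (LINT r:{0<..<1}|lborel. (1 - r) powr \<mu> * r powr (- 1 / 2))"
  have W: "W \<ge> 0" unfolding W_def set_lebesgue_integral_def by (intro Bochner_Integration.integral_nonneg) (auto simp: indicator_def)
  have rr: "0 < k * r" "k * r < 1" if "0 < k" "k < 1" "0 < r" "r < 1" for k r :: real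
    using that mult_strict_mono[of k 1 r 1] by auto
  show thesis
  \<comment> \<open>The summand 1 makes the constant strictly positive even if \<open>W\<close> were
    0.\<close>
  proof (rule that[of "(\<mu> + 1 / 2) * W + (2 * \<nu>\<^sup>2 + 1) * W + 1"])
    show "(\<mu> + 1 / 2) * W + (2 * \<nu>\<^sup>2 + 1) * W + 1 > 0"
    proof -
      have "0 \<le> \<mu> + 1 / 2" using \<mu> by simp
      then have "0 \<le> (\<mu> + 1 / 2) * W" "0 \<le> (2 * \<nu>\<^sup>2 + 1) * W" using W by (auto intro!: mult_nonneg_nonneg)
      then show ?thesis by simp
    qed
    fix k :: real assume k: "0 < k" "k < 1"
    have 1: "\<bar>arc_H \<mu> \<nu> k\<bar> \<le> 1 * W"
      unfolding arc_H_def W_def using rr[OF k] k by (intro arc_weighted_bound[OF \<mu>] arc_T_bound arc_T_comp_cont) auto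
    have 2: "\<bar>arc_H' \<mu> \<nu> k\<bar> \<le> (2 * \<nu>\<^sup>2 + 1) * W"
      unfolding arc_H'_def W_def
    proof (rule arc_weighted_bound[OF \<mu> arc_T_comp_cont(2)[OF k]])
      fix r :: real assume r: "0 < r" "r < 1"
      have "\<bar>r\<bar> * \<bar>arc_T' \<nu> (k * r)\<bar> \<le> 1 * (2 * \<nu>\<^sup>2 + 1)"
        using rr[OF k r] r by (intro mult_mono arc_T'_bound) auto
      then show "\<bar>r * arc_T' \<nu> (k * r)\<bar> \<le> 2 * \<nu>\<^sup>2 + 1" by (simp add: abs_mult)
    qed
    have "\<bar>(\<mu> + 1 / 2) * arc_H \<mu> \<nu> k\<bar> \<le> (\<mu> + 1 / 2) * W"
      unfolding abs_mult using 1 \<mu> by (intro mult_mono) auto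
    moreover have "\<bar>k * arc_H' \<mu> \<nu> k\<bar> \<le> 1 * ((2 * \<nu>\<^sup>2 + 1) * W)"
      unfolding abs_mult using 2 k by (intro mult_mono) auto
    ultimately show "\<bar>arc_e \<mu> \<nu> k\<bar> \<le> (\<mu> + 1 / 2) * W + (2 * \<nu>\<^sup>2 + 1) * W + 1"
      unfolding arc_e_def by linarith
  qed
qed

text \<open>Continuity is required later for the continuity of the operator in \<open>t\<close> and
  for measurability. \<open>arc_H\<close> is differentiable; for \<open>arc_H'\<close> continuity
  comes from dominated convergence with the same majorant as in \<open>DERIV_arc_H\<close>.\<close>

lemma arc_e_cont:
  assumes \<mu>: "(\<mu>::real) > -1/2"
  shows "continuous_on {0<..<1} (arc_e \<mu> \<nu>)"
proof -
  have rr: "0 < k * r" "k * r < 1" if "0 < k" "k < 1" "0 < r" "r < 1" for k r :: real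
    using that mult_strict_mono[of k 1 r 1] by auto
  have "continuous_on {0<..<1} (arc_H \<mu> \<nu>)"
    using DERIV_arc_H[OF \<mu>] by (intro continuous_at_imp_continuous_on ballI) (auto intro: DERIV_isCont)
  moreover have "continuous_on {0<..<1} (arc_H' \<mu> \<nu>)"
    unfolding continuous_on_sequentially
  proof (intro allI ballI impI, elim conjE)
    fix X :: "nat \<Rightarrow> real" and k assume k: "k \<in> {0<..<1}" and X: "\<forall>n. X n \<in> {0<..<1}" and lim: "X \<longlonglongrightarrow> k"
    show "(arc_H' \<mu> \<nu> \<circ> X) \<longlonglongrightarrow> arc_H' \<mu> \<nu> k"
      unfolding o_def arc_H'_def set_lebesgue_integral_def
    proof (rule integral_dominated_convergence[where w = "\<lambda>r. indicator {0<..<1} r *\<^sub>R ((1 - r) powr \<mu> * r powr (- 1 / 2) * (2 * \<nu>\<^sup>2 + 1))"])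
      have "set_integrable lborel {0<..<1} (\<lambda>r. (1 - r) powr \<mu> * r powr (- 1 / 2) * (2 * \<nu>\<^sup>2 + 1))"
        by (intro arc_weighted_integrable[OF \<mu>, where C = "\<bar>2 * \<nu>\<^sup>2 + 1\<bar>"]) auto
      then show "integrable lborel (\<lambda>r. indicat_real {0<..<1} r *\<^sub>R ((1 - r) powr \<mu> * r powr (- 1 / 2) * (2 * \<nu>\<^sup>2 + 1)))"
        by (simp add: set_integrable_def)
      show "AE r in lborel. (\<lambda>i. indicat_real {0<..<1} r *\<^sub>R ((1 - r) powr \<mu> * r powr (- 1 / 2) * (r * arc_T' \<nu> (X i * r))))
         \<longlonglongrightarrow> indicat_real {0<..<1} r *\<^sub>R ((1 - r) powr \<mu> * r powr (- 1 / 2) * (r * arc_T' \<nu> (k * r)))"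
      proof (intro AE_I2)
        fix r :: real
        show "(\<lambda>i. indicat_real {0<..<1} r *\<^sub>R ((1 - r) powr \<mu> * r powr (- 1 / 2) * (r * arc_T' \<nu> (X i * r))))
         \<longlonglongrightarrow> indicat_real {0<..<1} r *\<^sub>R ((1 - r) powr \<mu> * r powr (- 1 / 2) * (r * arc_T' \<nu> (k * r)))"
        proof (cases "r \<in> {0<..<1}")
          case True
          have "(\<lambda>i. arc_T' \<nu> (X i * r)) \<longlonglongrightarrow> arc_T' \<nu> (k * r)"
          proof (rule continuous_on_tendsto_compose[OF arc_T'_cont])
            show "(\<lambda>i. X i * r) \<longlonglongrightarrow> k * r" by (intro tendsto_mult lim tendsto_const)
          qed (use True k X rr in auto)
          then show ?thesis by (intro tendsto_intros)
        qed simp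
      qed
      fix i
      show "AE r in lborel. norm (indicat_real {0<..<1} r *\<^sub>R ((1 - r) powr \<mu> * r powr (- 1 / 2) * (r * arc_T' \<nu> (X i * r))))
         \<le> indicat_real {0<..<1} r *\<^sub>R ((1 - r) powr \<mu> * r powr (- 1 / 2) * (2 * \<nu>\<^sup>2 + 1))"
      proof (intro AE_I2)
        fix r :: real
        show "norm (indicat_real {0<..<1} r *\<^sub>R ((1 - r) powr \<mu> * r powr (- 1 / 2) * (r * arc_T' \<nu> (X i * r))))
         \<le> indicat_real {0<..<1} r *\<^sub>R ((1 - r) powr \<mu> * r powr (- 1 / 2) * (2 * \<nu>\<^sup>2 + 1))"
        proof (cases "r \<in> {0<..<1}")
          case True
          have "\<bar>r * arc_T' \<nu> (X i * r)\<bar> \<le> 1 * (2 * \<nu>\<^sup>2 + 1)"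
            unfolding abs_mult using rr[of "X i" r] X True by (intro mult_mono arc_T'_bound) auto
          then have "(1 - r) powr \<mu> * r powr (- 1 / 2) * \<bar>r * arc_T' \<nu> (X i * r)\<bar> \<le> (1 - r) powr \<mu> * r powr (- 1 / 2) * (2 * \<nu>\<^sup>2 + 1)"
            by (intro mult_left_mono) auto
          then show ?thesis using True by (simp add: abs_mult)
        qed simp
      qed
    next
      have m: "(\<lambda>r. indicat_real {0<..<1} r *\<^sub>R ((1 - r) powr \<mu> * r powr (- 1 / 2) * (r * arc_T' \<nu> (u * r)))) \<in> borel_measurable lborel"
        if "0 < u" "u < 1" for u
      proof -
        have "(\<lambda>r. indicat_real {0<..<1} r *\<^sub>R ((1 - r) powr \<mu> * r powr (- 1 / 2) * (r * arc_T' \<nu> (u * r)))) \<in> borel_measurable borel"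
          by (rule borel_measurable_continuous_on_indicator)
            (auto intro!: continuous_intros arc_T_comp_cont(2)[OF that])
        then show ?thesis by (simp only: measurable_lborel2)
      qed
      show "(\<lambda>r. indicat_real {0<..<1} r *\<^sub>R ((1 - r) powr \<mu> * r powr (- 1 / 2) * (r * arc_T' \<nu> (k * r)))) \<in> borel_measurable lborel"
        using k by (intro m) auto
      show "(\<lambda>r. indicat_real {0<..<1} r *\<^sub>R ((1 - r) powr \<mu> * r powr (- 1 / 2) * (r * arc_T' \<nu> (X i * r)))) \<in> borel_measurable lborel" for i
        using X by (intro m) auto
    qed
  qed
  ultimately have "continuous_on {0<..<1} (\<lambda>k. (\<mu> + 1 / 2) * arc_H \<mu> \<nu> k + k * arc_H' \<mu> \<nu> k)"
    by (rule continuous_on_add[OF continuous_on_mult[OF continuous_on_const] continuous_on_mult[OF continuous_on_id]])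
  then show ?thesis unfolding arc_e_def[abs_def] .
qed

text \<open>The substitution \<open>\<phi> = arccos (1 - k * r)\<close> fixes the range of
  integration to the unit interval, so that \<open>k\<close> no longer appears in the limits and the
  leading power of \<open>k\<close> can be factored out.\<close>

lemma arc_E_eq:
  assumes \<mu>: "(\<mu>::real) > -1/2" and k: "0 < k" "k < 1"
  shows "arc_E \<mu> \<nu> k = k powr (\<mu> + 1 / 2) * arc_H \<mu> \<nu> k"
proof -
  define g where "g = (\<lambda>r. arccos (1 - k * r))"
  define g' where "g' = (\<lambda>r. k * (1 / sqrt (k * r * (2 - k * r))))"
  define f where "f = (\<lambda>\<phi>. cos (\<nu> * \<phi>) * (max 0 (k - (1 - cos \<phi>))) powr \<mu>)"
  have rr: "0 < k * r" "k * r < 1" if "r \<in> {0<..<1}" for r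
    using that k mult_strict_mono[of k 1 r 1] by auto
  have der: "(g has_field_derivative g' r) (at r within {0<..<1})" if "r \<in> {0<..<1}" for r
  proof -
    have "((\<lambda>r. arccos (1 - k * r)) has_real_derivative 1 / sqrt (k * r * (2 - k * r)) * k) (at r)"
      using rr[OF that] by (intro DERIV_chain2[OF DERIV_arccos_one_minus]) (auto intro!: derivative_eq_intros)
    then show ?thesis unfolding g_def g'_def by (auto intro: has_field_derivative_at_within simp: mult.commute)
  qed
  have inj: "inj_on g {0<..<1}"
  proof (rule inj_onI)
    fix r s assume "r \<in> {0<..<1}" "s \<in> {0<..<1}" "g r = g s"
    then have "cos (g r) = cos (g s)" by simp
    then have "1 - k * r = 1 - k * s"
      unfolding g_def using rr[OF \<open>r \<in> {0<..<1}\<close>] rr[OF \<open>s \<in> {0<..<1}\<close>] by (simp add: cos_arccos)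
    then show "r = s" using k by simp
  qed
  have img: "g ` {0<..<1} = {0<..<arccos (1 - k)}"
  proof
    show "g ` {0<..<1} \<subseteq> {0<..<arccos (1 - k)}"
    proof
      fix p assume "p \<in> g ` {0<..<1}"
      then obtain r where r: "r \<in> {0<..<1}" "p = arccos (1 - k * r)" by (auto simp: g_def)
      have "arccos 1 < p" unfolding r(2) using rr[OF r(1)] by (intro arccos_less_arccos) auto
      moreover have "k * r < k" using r k by simp
      then have "p < arccos (1 - k)" unfolding r(2) using rr[OF r(1)] k by (intro arccos_less_arccos) auto
      ultimately show "p \<in> {0<..<arccos (1 - k)}" by simp
    qed
    show "{0<..<arccos (1 - k)} \<subseteq> g ` {0<..<1}"
    proof
      fix p assume p: "p \<in> {0<..<arccos (1 - k)}"
      define r where "r = (1 - cos p) / k"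
      have pp: "0 < p" "p < arccos (1 - k)" "arccos (1 - k) \<le> pi" using p k by (auto intro!: arccos_ubound)
      have "cos p < cos 0" using pp by (intro cos_monotone_0_pi) auto
      moreover have "cos (arccos (1 - k)) < cos p" using pp by (intro cos_monotone_0_pi) auto
      then have "1 - k < cos p" using k by (simp add: cos_arccos)
      ultimately have "r \<in> {0<..<1}" using k by (auto simp: r_def divide_less_eq)
      moreover have "g r = p"
      proof -
        have "1 - k * r = cos p" using k by (simp add: r_def)
        then show ?thesis unfolding g_def using pp by (simp add: arccos_cos)
      qed
      ultimately show "p \<in> g ` {0<..<1}" by blast
    qed
  qed
  have val: "\<bar>g' r\<bar> * f (g r) = k powr (\<mu> + 1 / 2) * ((1 - r) powr \<mu> * r powr (- 1 / 2) * arc_T \<nu> (k * r))" if r: "r \<in> {0<..<1}" for r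
  proof -
    have c: "cos (g r) = 1 - k * r" unfolding g_def using rr[OF r] by (simp add: cos_arccos)
    have m: "max 0 (k - (1 - cos (g r))) = k * (1 - r)" unfolding c using r k by (simp add: algebra_simps)
    have g'p: "\<bar>g' r\<bar> = k / (sqrt k * sqrt r * sqrt (2 - k * r))"
      unfolding g'_def using rr[OF r] r k by (simp add: abs_mult real_sqrt_mult)
    have 1: "k powr (\<mu> + 1 / 2) = k powr \<mu> * sqrt k"
      using k powr_half_sqrt[of k] by (simp only: powr_add less_imp_le)
    have 2: "r powr (- 1 / 2) = 1 / sqrt r"
      using r powr_half_sqrt[of r] powr_minus_divide[of r "1 / 2"] by simp
    have 3: "(k * (1 - r)) powr \<mu> = k powr \<mu> * (1 - r) powr \<mu>"
      by (rule powr_mult)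
    have 4: "k / (sqrt k * sqrt r * b) = sqrt k * (1 / sqrt r) / b" for b
    proof -
      have "k / (sqrt k * sqrt r * b) = (k / sqrt k) * (1 / sqrt r) / b" by simp
      also have "k / sqrt k = sqrt k" using k by (intro real_div_sqrt) simp
      finally show ?thesis .
    qed
    have "f (g r) = cos (\<nu> * g r) * (k powr \<mu> * (1 - r) powr \<mu>)" unfolding f_def m 3 ..
    then show ?thesis
      unfolding g'p arc_T_def 1 2 4 by (simp add: g_def)
  qed
  have hint: "set_integrable lborel {0<..<1} (\<lambda>r. (1 - r) powr \<mu> * r powr (- 1 / 2) * arc_T \<nu> (k * r))"
    using rr k by (intro arc_weighted_integrable[OF \<mu>, where C = 1] arc_T_bound arc_T_comp_cont) auto
  then have kint: "set_integrable lborel {0<..<1} (\<lambda>r. k powr (\<mu> + 1 / 2) * ((1 - r) powr \<mu> * r powr (- 1 / 2) * arc_T \<nu> (k * r)))"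
    by (intro set_integrable_mult_right) simp
  have kval: "integral {0<..<1} (\<lambda>r. k powr (\<mu> + 1 / 2) * ((1 - r) powr \<mu> * r powr (- 1 / 2) * arc_T \<nu> (k * r))) = k powr (\<mu> + 1 / 2) * arc_H \<mu> \<nu> k"
    unfolding set_borel_integral_eq_integral(2)[OF kint, symmetric] arc_H_def by simp
  have "(\<lambda>r. k powr (\<mu> + 1 / 2) * ((1 - r) powr \<mu> * r powr (- 1 / 2) * arc_T \<nu> (k * r))) absolutely_integrable_on {0<..<1}"
    using kint unfolding set_integrable_def by (subst integrable_completion) auto
  then have "(\<lambda>r. \<bar>g' r\<bar> * f (g r)) absolutely_integrable_on {0<..<1}"
    by (rule set_integrable_cong[THEN iffD2, OF refl refl, rotated]) (rule val)
  moreover have "integral {0<..<1} (\<lambda>r. \<bar>g' r\<bar> * f (g r)) = k powr (\<mu> + 1 / 2) * arc_H \<mu> \<nu> k"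
    by (rule trans[OF Henstock_Kurzweil_Integration.integral_cong kval]) (rule val)
  ultimately have "f absolutely_integrable_on (g ` {0<..<1}) \<and> integral (g ` {0<..<1}) f = k powr (\<mu> + 1 / 2) * arc_H \<mu> \<nu> k"
    using has_absolute_integral_change_of_variables_1'[OF _ der inj, of f "k powr (\<mu> + 1 / 2) * arc_H \<mu> \<nu> k"] by auto
  then have fa: "f absolutely_integrable_on {0<..<arccos (1 - k)}" and fv: "integral {0<..<arccos (1 - k)} f = k powr (\<mu> + 1 / 2) * arc_H \<mu> \<nu> k"
    unfolding img by auto
  have fm [measurable]: "f \<in> borel_measurable borel" unfolding f_def by measurable
  have fs: "set_integrable lborel {0<..<arccos (1 - k)} f"
    using fa unfolding set_integrable_def by (subst (asm) integrable_completion) auto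
  have "arc_E \<mu> \<nu> k = (LINT \<phi>:{0<..<arccos (1 - k)}|lborel. f \<phi>)"
    unfolding arc_E_def f_def[symmetric] set_lebesgue_integral_def
  proof (rule integral_cong_AE)
    \<comment> \<open>The two ranges differ by the point 0 and by the angles from
      \<open>arccos (1 - k)\<close> on. At those angles the base of the power is 0, and
      \<open>0 powr \<mu> = 0\<close> for every real \<mu>.\<close>
    show "AE p in lborel. indicat_real {0..pi} p *\<^sub>R f p = indicat_real {0<..<arccos (1 - k)} p *\<^sub>R f p"
      using AE_lborel_singleton[of 0]
    proof eventually_elim
      case (elim p)
      have api: "arccos (1 - k) \<le> pi" using k by (intro arccos_ubound) auto
      have "f p = 0" if "p \<in> {0..pi}" "\<not> p < arccos (1 - k)"
      proof -
        have "cos p \<le> cos (arccos (1 - k))" using that k by (intro cos_monotone_0_pi_le arccos_lbound) auto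
        then have "cos p \<le> 1 - k" using k by (simp add: cos_arccos)
        then have "max 0 (k - (1 - cos p)) = 0" by simp
        then show ?thesis unfolding f_def by simp
      qed
      then show ?case using elim api by (auto simp: indicator_def)
    qed
  qed auto
  also have "\<dots> = integral {0<..<arccos (1 - k)} f" by (rule set_borel_integral_eq_integral(2)[OF fs])
  finally show ?thesis unfolding fv .
qed

lemma DERIV_arc_E:
  assumes \<mu>: "(\<mu>::real) > -1/2" and k: "0 < k" "k < 1"
  shows "(arc_E \<mu> \<nu> has_real_derivative k powr (\<mu> - 1 / 2) * arc_e \<mu> \<nu> k) (at k)"
proof -
  have "((\<lambda>k. k powr (\<mu> + 1 / 2) * arc_H \<mu> \<nu> k) has_real_derivative
     ((\<mu> + 1 / 2) * k powr (\<mu> + 1 / 2 - 1)) * arc_H \<mu> \<nu> k + arc_H' \<mu> \<nu> k * k powr (\<mu> + 1 / 2)) (at k)"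
    by (rule DERIV_mult[OF has_real_derivative_powr[OF k(1)] DERIV_arc_H[OF \<mu> k]])
  moreover have "((\<mu> + 1 / 2) * k powr (\<mu> + 1 / 2 - 1)) * arc_H \<mu> \<nu> k + arc_H' \<mu> \<nu> k * k powr (\<mu> + 1 / 2) = k powr (\<mu> - 1 / 2) * arc_e \<mu> \<nu> k"
  proof -
    have "\<mu> + 1 / 2 - 1 = \<mu> - 1 / 2" by simp
    moreover have "k powr (\<mu> + 1 / 2) = k powr (\<mu> - 1 / 2) * k"
      using k powr_add[of k "\<mu> - 1 / 2" 1] by (simp add: add.commute)
    ultimately show ?thesis unfolding arc_e_def by (simp add: algebra_simps)
  qed
  ultimately have "((\<lambda>k. k powr (\<mu> + 1 / 2) * arc_H \<mu> \<nu> k) has_real_derivative k powr (\<mu> - 1 / 2) * arc_e \<mu> \<nu> k) (at k)" by simp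
  then show ?thesis
    by (rule has_field_derivative_transform_within_open[where S = "{0<..<1}"]) (use k arc_E_eq[OF \<mu>] in auto)
qed

section \<open>The kernel\<close>

context bessel_triple
begin

section \<open>The Laplace transform of the primitive\<close>

text \<open>\<open>laplace_bessel_P_product\<close> read through \<open>s = y\<^sup>2\<close>. The
  choice \<open>p = 1 / (4 * q)\<close> produces the Gaussian of the statement, and
  \<open>a = x\<^sup>2 / 4\<close>, \<open>b = z\<^sup>2 / 4\<close> give
  \<open>a * b / p\<^sup>2 = (2 * x * z * q)\<^sup>2 / 4\<close>, the argument of the modified
  Bessel function.\<close>

lemma laplace_Phi:
  assumes q: "q > 0"
  shows "(LINT y:{0<..}|lborel. y * Phi y * exp (- (y\<^sup>2 / 4) / q)) = 2 * q * exp (- q * (x\<^sup>2 + z\<^sup>2)) * mod_bessel_I \<nu> (2 * x * z * q)"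
proof -
  define p where "p = 1 / (4 * q)"
  define a where "a = x\<^sup>2 / 4"
  define b where "b = z\<^sup>2 / 4"
  have p: "p > 0" and ab: "a \<ge> 0" "b \<ge> 0" using q by (auto simp: p_def a_def b_def)
  define f where "f = (\<lambda>s. (x * z / 4) powr \<nu> / 2 * (bessel_P \<nu> (- b * s) * (bessel_P \<nu> (- a * s) * (s powr \<nu> * exp (- p * s)))))"
  note lp = laplace_bessel_P_product[OF \<nu> p ab]
  have fs: "set_integrable lborel {0<..} f" unfolding f_def by (intro set_integrable_mult_right lp(1))
  have fv: "(LINT s:{0<..}|lborel. f s) = (x * z / 4) powr \<nu> / 2 * (exp (- (a + b) / p) * bessel_P \<nu> (a * b / p\<^sup>2) / p powr (\<nu> + 1))"
    unfolding f_def set_integral_mult_right lp(2) ..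
  have fa: "f absolutely_integrable_on {0<..}"
    using fs unfolding set_integrable_def by (subst integrable_completion) auto
  have img: "(\<lambda>y. y\<^sup>2) ` {0<..} = {0::real<..}"
  proof
    show "{0<..} \<subseteq> (\<lambda>y. y\<^sup>2) ` {0::real<..}"
    proof
      fix v :: real assume "v \<in> {0<..}"
      then have "v = (sqrt v)\<^sup>2" "sqrt v \<in> {0<..}" by auto
      then show "v \<in> (\<lambda>y. y\<^sup>2) ` {0<..}" by blast
    qed
  qed auto
  have inj: "inj_on (\<lambda>y. y\<^sup>2) {0::real<..}" by (rule inj_onI) (simp add: power2_eq_iff_nonneg)
  have "(\<lambda>y. \<bar>2 * y\<bar> * f (y\<^sup>2)) absolutely_integrable_on {0<..} \<and> integral {0<..} (\<lambda>y. \<bar>2 * y\<bar> * f (y\<^sup>2)) = integral {0<..} f"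
    by (subst has_absolute_integral_change_of_variables_1'[where g = "\<lambda>y. y\<^sup>2" and g' = "\<lambda>y. 2 * y"])
       (use fa img inj in \<open>auto intro!: derivative_eq_intros\<close>)
  note cv = this
  have val: "\<bar>2 * y\<bar> * f (y\<^sup>2) = y * Phi y * exp (- (y\<^sup>2 / 4) / q)" if "y \<in> {0<..}" for y
  proof -
    have y: "y > 0" using that by simp
    have 1: "(x * z / 4) powr \<nu> * (y\<^sup>2) powr \<nu> = (x * y / 2) powr \<nu> * (z * y / 2) powr \<nu>"
    proof -
      have "(x * z / 4) powr \<nu> * (y\<^sup>2) powr \<nu> = (x * z / 4 * y\<^sup>2) powr \<nu>" by (rule powr_mult[symmetric])
      also have "x * z / 4 * y\<^sup>2 = (x * y / 2) * (z * y / 2)" by (simp add: power2_eq_square)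
      also have "\<dots> powr \<nu> = (x * y / 2) powr \<nu> * (z * y / 2) powr \<nu>" by (rule powr_mult)
      finally show ?thesis .
    qed
    have 2: "bessel_J \<nu> (x * y) = (x * y / 2) powr \<nu> * bessel_P \<nu> (- a * y\<^sup>2)" "bessel_J \<nu> (z * y) = (z * y / 2) powr \<nu> * bessel_P \<nu> (- b * y\<^sup>2)"
      using \<nu> x z y by (simp_all add: bessel_J_eq a_def b_def power_mult_distrib)
    have 3: "- p * y\<^sup>2 = - (y\<^sup>2 / 4) / q" by (simp add: p_def)
    have "\<bar>2 * y\<bar> * f (y\<^sup>2) = y * (((x * z / 4) powr \<nu> * (y\<^sup>2) powr \<nu>) * (bessel_P \<nu> (- a * y\<^sup>2) * bessel_P \<nu> (- b * y\<^sup>2))) * exp (- p * y\<^sup>2)"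
      unfolding f_def using y by simp
    also have "\<dots> = y * Phi y * exp (- (y\<^sup>2 / 4) / q)"
      unfolding 1 3 Phi_def 2 by (simp only: mult_ac)
    finally show ?thesis .
  qed
  have "(\<lambda>y. y * Phi y * exp (- (y\<^sup>2 / 4) / q)) absolutely_integrable_on {0<..}"
    by (rule set_integrable_cong[THEN iffD1, OF refl refl _ conjunct1[OF cv]]) (rule val)
  then have gs: "set_integrable lborel {0<..} (\<lambda>y. y * Phi y * exp (- (y\<^sup>2 / 4) / q))"
    unfolding set_integrable_def by (subst (asm) integrable_completion) auto
  have "(LINT y:{0<..}|lborel. y * Phi y * exp (- (y\<^sup>2 / 4) / q)) = integral {0<..} (\<lambda>y. \<bar>2 * y\<bar> * f (y\<^sup>2))"
    unfolding set_borel_integral_eq_integral(2)[OF gs] by (rule Henstock_Kurzweil_Integration.integral_cong) (rule val[symmetric])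
  also have "\<dots> = (LINT s:{0<..}|lborel. f s)"
    unfolding conjunct2[OF cv] set_borel_integral_eq_integral(2)[OF fs] ..
  also have "\<dots> = 2 * q * exp (- q * (x\<^sup>2 + z\<^sup>2)) * mod_bessel_I \<nu> (2 * x * z * q)"
  proof -
    have E1: "- (a + b) / p = - q * (x\<^sup>2 + z\<^sup>2)" using q by (simp add: p_def a_def b_def field_simps)
    have E2: "a * b / p\<^sup>2 = (2 * x * z * q)\<^sup>2 / 4" using q by (simp add: p_def a_def b_def power2_eq_square field_simps)
    have E3: "(x * z / 4) powr \<nu> / 2 / p powr (\<nu> + 1) = 2 * q * (2 * x * z * q / 2) powr \<nu>"
    proof -
      have "p powr (\<nu> + 1) = 1 / (4 * q) powr (\<nu> + 1)" unfolding p_def by (simp only: powr_divide powr_one_eq_one)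
      then have "1 / p powr (\<nu> + 1) = (4 * q) powr (\<nu> + 1)" by (simp only: divide_divide_eq_right mult_1 div_by_1)
      also have "\<dots> = (4 * q) powr \<nu> * (4 * q)" unfolding powr_add using q by simp
      finally have "1 / p powr (\<nu> + 1) = (4 * q) powr \<nu> * (4 * q)" .
      moreover have "a / 2 / P = (a * b) * (2 * q)" if "1 / P = b * (4 * q)" for a b P :: real
      proof -
        have "a / 2 / P = a / 2 * (1 / P)" by simp
        also have "\<dots> = (a * b) * (2 * q)" unfolding that by simp
        finally show ?thesis .
      qed
      ultimately have "(x * z / 4) powr \<nu> / 2 / p powr (\<nu> + 1) = ((x * z / 4) powr \<nu> * (4 * q) powr \<nu>) * (2 * q)"
        by blast
      also have "(x * z / 4) powr \<nu> * (4 * q) powr \<nu> = (x * z / 4 * (4 * q)) powr \<nu>" by (rule powr_mult[symmetric])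
      also have "x * z / 4 * (4 * q) = 2 * x * z * q / 2" by simp
      finally show ?thesis by (simp only: mult.commute)
    qed
    have "(LINT s:{0<..}|lborel. f s) = ((x * z / 4) powr \<nu> / 2 / p powr (\<nu> + 1)) * (exp (- (a + b) / p) * bessel_P \<nu> (a * b / p\<^sup>2))"
      unfolding fv by simp
    then show ?thesis unfolding E1 E2 E3 mod_bessel_I_def by (simp only: mult_ac)
  qed
  finally show ?thesis .
qed

text \<open>After exchanging the integrals, the inner transform in \<open>w\<close> is
  \<open>laplace_bessel_P\<close> of order \<open>\<mu> + 1\<close> with
  \<open>a = y\<^sup>2 / 4\<close>. It yields a Gaussian in \<open>y\<close>, to which
  \<open>laplace_Phi\<close> applies.\<close>

lemma laplace_F:
  assumes q: "q > 0"
  shows "set_integrable lborel {0<..} (\<lambda>w. exp (- q * w) * F w)"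
    "(LINT w:{0<..}|lborel. exp (- q * w) * F w) = 2 / q powr (\<mu> + 1) * exp (- q * (x\<^sup>2 + z\<^sup>2)) * mod_bessel_I \<nu> (2 * x * z * q)"
    "F \<in> borel_measurable borel"
proof -
  define f where "f = (\<lambda>w y. (indicator {0<..} w * exp (- q * w)) * (indicator {0<..} y *\<^sub>R Fint w y))"
  have fm: "case_prod f \<in> borel_measurable (lborel \<Otimes>\<^sub>M lborel)"
    unfolding f_def by measurable
  obtain B where B: "\<And>y. B y \<ge> 0" "set_integrable lborel {0<..} B"
    "\<And>w y. w > 0 \<Longrightarrow> y > 0 \<Longrightarrow> \<bar>Fint w y\<bar> \<le> (w powr (\<mu> + 1) + w powr (\<mu> / 2 + 1 / 4)) * B y"
    by (rule Fint_dominated) (rule that)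
  define IB where "IB = (LINT y:{0<..}|lborel. B y)"
  define u where "u = (\<lambda>w. indicator {0<..} w *\<^sub>R (w powr (\<mu> + 1) * exp (- q * w) + w powr (\<mu> / 2 + 1 / 4) * exp (- q * w)))"
  have ui: "integrable lborel u"
  proof -
    have "set_integrable lborel {0<..} (\<lambda>w. w powr (\<mu> + 1) * exp (- q * w) + w powr (\<mu> / 2 + 1 / 4) * exp (- q * w))"
      using \<mu> by (intro set_integral_add(1) laplace_monomial(1) q) auto
    then show ?thesis by (simp add: u_def set_integrable_def)
  qed
  have fi: "integrable lborel (f w)" for w
  proof (cases "w > 0")
    case True
    from Fint_integrable[OF True] show ?thesis
      unfolding f_def set_integrable_def by (rule integrable_mult_right)
  qed (simp add: f_def)
  have fn: "(\<integral>y. norm (f w y) \<partial>lborel) \<le> u w * IB" for w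
  proof (cases "w > 0")
    case True
    have "(\<integral>y. norm (f w y) \<partial>lborel) \<le> (\<integral>y. u w * (indicator {0<..} y *\<^sub>R B y) \<partial>lborel)"
    proof (rule integral_mono)
      show "integrable lborel (\<lambda>y. norm (f w y))" by (rule integrable_norm[OF fi])
      show "integrable lborel (\<lambda>y. u w * (indicator {0<..} y *\<^sub>R B y))"
        using B(2) unfolding set_integrable_def by (rule integrable_mult_right)
      fix y :: real
      show "norm (f w y) \<le> u w * (indicator {0<..} y *\<^sub>R B y)"
      proof (cases "y > 0")
        case y: True
        have "exp (- q * w) * \<bar>Fint w y\<bar> \<le> exp (- q * w) * ((w powr (\<mu> + 1) + w powr (\<mu> / 2 + 1 / 4)) * B y)"
          using B(3)[OF True y] by (rule mult_left_mono) simp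
        then show ?thesis using True y by (simp add: f_def u_def abs_mult algebra_simps)
      qed (simp add: f_def)
    qed
    then show ?thesis by (simp add: IB_def set_lebesgue_integral_def)
  qed (simp add: f_def u_def)
  have pint: "integrable (lborel \<Otimes>\<^sub>M lborel) (case_prod f)"
  proof (rule lborel_pair.Fubini_integrable[OF fm])
    show "AE w in lborel. integrable lborel (\<lambda>y. case (w, y) of (w, y) \<Rightarrow> f w y)" using fi by simp
    show "integrable lborel (\<lambda>w. \<integral>y. norm (case (w, y) of (w, y) \<Rightarrow> f w y) \<partial>lborel)"
    proof (rule Bochner_Integration.integrable_bound)
      show "integrable lborel (\<lambda>w. u w * IB)" using ui by simp
      show "(\<lambda>w. \<integral>y. norm (case (w, y) of (w, y) \<Rightarrow> f w y) \<partial>lborel) \<in> borel_measurable lborel"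
        using fm by measurable
      show "AE w in lborel. norm (\<integral>y. norm (case (w, y) of (w, y) \<Rightarrow> f w y) \<partial>lborel) \<le> norm (u w * IB)"
      proof (intro AE_I2)
        fix w
        have "0 \<le> (\<integral>y. norm (f w y) \<partial>lborel)" by simp
        then show "norm (\<integral>y. norm (case (w, y) of (w, y) \<Rightarrow> f w y) \<partial>lborel) \<le> norm (u w * IB)"
          using fn[of w] by (simp only: prod.case real_norm_def)
      qed
    qed
  qed
  have fst: "(\<integral>y. f w y \<partial>lborel) = indicator {0<..} w *\<^sub>R (exp (- q * w) * F w)" for w
    unfolding f_def F_def set_lebesgue_integral_def by simp
  show "set_integrable lborel {0<..} (\<lambda>w. exp (- q * w) * F w)"
    using lborel_pair.integrable_fst[OF pint] unfolding fst set_integrable_def .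
  have \<mu>1: "\<mu> + 1 > -1" using \<mu> by simp
  have snd: "(\<integral>w. f w y \<partial>lborel) = 1 / q powr (\<mu> + 2) * (indicator {0<..} y *\<^sub>R (y * Phi y * exp (- (y\<^sup>2 / 4) / q)))" for y
  proof (cases "y > 0")
    case True
    have "(\<integral>w. f w y \<partial>lborel) = (\<integral>w. (y * Phi y) * (indicator {0<..} w *\<^sub>R (bessel_P (\<mu> + 1) (- (y\<^sup>2 / 4) * w) * (w powr (\<mu> + 1) * exp (- q * w)))) \<partial>lborel)"
      using True by (intro Bochner_Integration.integral_cong) (auto simp: f_def Fint_def mult_ac)
    also have "\<dots> = (y * Phi y) * (exp (- (y\<^sup>2 / 4) / q) / q powr (\<mu> + 1 + 1))"
      using laplace_bessel_P(2)[OF \<mu>1 q, of "y\<^sup>2 / 4"] by (simp add: set_lebesgue_integral_def)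
    finally show ?thesis using True by (simp add: mult_ac add.commute[of 2])
  qed (simp add: f_def)
  have "(\<integral>y. (\<integral>w. f w y \<partial>lborel) \<partial>lborel) = (\<integral>w. (\<integral>y. f w y \<partial>lborel) \<partial>lborel)"
    by (rule lborel_pair.Fubini_integral[OF pint])
  then have "(LINT w:{0<..}|lborel. exp (- q * w) * F w) = 1 / q powr (\<mu> + 2) * (LINT y:{0<..}|lborel. y * Phi y * exp (- (y\<^sup>2 / 4) / q))"
    unfolding snd fst set_lebesgue_integral_def by simp
  also have "\<dots> = 2 / q powr (\<mu> + 1) * exp (- q * (x\<^sup>2 + z\<^sup>2)) * mod_bessel_I \<nu> (2 * x * z * q)"
  proof -
    have "q powr (\<mu> + 2) = q powr (\<mu> + 1) * q" using q powr_add[of q "\<mu> + 1" 1] by (simp add: add.assoc)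
    then show ?thesis unfolding laplace_Phi[OF q] using q by simp
  qed
  finally show "(LINT w:{0<..}|lborel. exp (- q * w) * F w) = 2 / q powr (\<mu> + 1) * exp (- q * (x\<^sup>2 + z\<^sup>2)) * mod_bessel_I \<nu> (2 * x * z * q)" .
  show "F \<in> borel_measurable borel"
  proof -
    have "(\<lambda>w. \<integral>y. indicator {0<..} y *\<^sub>R Fint w y \<partial>lborel) \<in> borel_measurable lborel" by measurable
    then show ?thesis unfolding F_def[abs_def] set_lebesgue_integral_def by simp
  qed
qed

section \<open>Inversion of the transform and the value of the kernel integral\<close>

text \<open>With \<open>Dcosh\<close>, the inverse Laplace transforms of the two parts of
  Schlaefli's integral at \<open>2 * x * z * q\<close>, each multiplied by \<open>Gamma (\<mu> + 1)
  / q powr (\<mu> + 1) * exp (- q * (x\<^sup>2 + z\<^sup>2))\<close>.\<close>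

definition Dcos :: "real \<Rightarrow> real" where
  "Dcos w = (LINT \<phi>:{0..pi}|lborel. cos (\<nu> * \<phi>) * (max 0 (w - (x\<^sup>2 + z\<^sup>2 - 2 * x * z * cos \<phi>))) powr \<mu>)"

definition Dcosh :: "real \<Rightarrow> real" where
  "Dcosh w = (LINT u:{0..}|lborel. exp (- \<nu> * u) * (max 0 (w - (x\<^sup>2 + z\<^sup>2 + 2 * x * z * cosh u))) powr \<mu>)"

text \<open>The 2 comes from \<open>laplace_F\<close>, \<open>pi\<close> from
  \<open>schlaefli_eq\<close>, and the Gamma value from the transform of the power.\<close>

definition Dcoeff :: real where
  "Dcoeff = 2 / (pi * Gamma (\<mu> + 1))"

lemma xz_pos: "x * z > 0"
  using x z by simp

lemma angle_nonneg: "(x - z)\<^sup>2 \<le> x\<^sup>2 + z\<^sup>2 - 2 * x * z * cos \<phi>" "(x + z)\<^sup>2 \<le> x\<^sup>2 + z\<^sup>2 + 2 * x * z * cosh u"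
proof -
  have "2 * x * z * cos \<phi> \<le> 2 * x * z * 1" using xz_pos by (intro mult_left_mono) auto
  then show "(x - z)\<^sup>2 \<le> x\<^sup>2 + z\<^sup>2 - 2 * x * z * cos \<phi>" by (simp add: power2_diff)
  have "2 * x * z * 1 \<le> 2 * x * z * cosh u" using xz_pos cosh_real_ge_1[of u] by (intro mult_left_mono) auto
  then show "(x + z)\<^sup>2 \<le> x\<^sup>2 + z\<^sup>2 + 2 * x * z * cosh u" by (simp add: power2_sum)
qed

lemma laplace_D:
  assumes q: "q > 0"
  shows "set_integrable lborel {0<..} (\<lambda>w. exp (- q * w) * Dcos w)"
    "(LINT w:{0<..}|lborel. exp (- q * w) * Dcos w) = Gamma (\<mu> + 1) / q powr (\<mu> + 1) * (exp (- q * (x\<^sup>2 + z\<^sup>2)) * schlaefli_cos \<nu> (2 * x * z * q))"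
    "set_integrable lborel {0<..} (\<lambda>w. exp (- q * w) * Dcosh w)"
    "(LINT w:{0<..}|lborel. exp (- q * w) * Dcosh w) = Gamma (\<mu> + 1) / q powr (\<mu> + 1) * (exp (- q * (x\<^sup>2 + z\<^sup>2)) * schlaefli_cosh \<nu> (2 * x * z * q))"
proof -
  have \<mu>1: "\<mu> > -1" using \<mu> by simp
  have s: "2 * x * z * q > 0" using xz_pos q by (simp add: mult.assoc)
  note lm = laplace_monomial[OF \<mu>1 q]
  have e1: "cos (\<nu> * \<phi>) * exp (- q * (x\<^sup>2 + z\<^sup>2 - 2 * x * z * cos \<phi>)) = exp (- q * (x\<^sup>2 + z\<^sup>2)) * (exp (2 * x * z * q * cos \<phi>) * cos (\<nu> * \<phi>))" for \<phi>
    by (simp add: algebra_simps flip: exp_add)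
  have e2: "exp (- \<nu> * u) * exp (- q * (x\<^sup>2 + z\<^sup>2 + 2 * x * z * cosh u)) = exp (- q * (x\<^sup>2 + z\<^sup>2)) * exp (- (2 * x * z * q) * cosh u - \<nu> * u)" for u
    by (simp add: algebra_simps flip: exp_add)
  have i1: "set_integrable lborel {0..pi} (\<lambda>\<phi>. cos (\<nu> * \<phi>) * exp (- q * (x\<^sup>2 + z\<^sup>2 - 2 * x * z * cos \<phi>)))"
    unfolding e1 by (intro set_integrable_mult_right schlaefli_cos_integrable)
  have i2: "set_integrable lborel {0..} (\<lambda>u. exp (- \<nu> * u) * exp (- q * (x\<^sup>2 + z\<^sup>2 + 2 * x * z * cosh u)))"
    unfolding e2 by (intro set_integrable_mult_right schlaefli_cosh_integrable s)
  have n1: "0 \<le> x\<^sup>2 + z\<^sup>2 - 2 * x * z * cos \<phi>" for \<phi>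
    using angle_nonneg(1)[of \<phi>] zero_le_power2[of "x - z"] by linarith
  have n2: "0 \<le> x\<^sup>2 + z\<^sup>2 + 2 * x * z * cosh u" for u
    using angle_nonneg(2)[of u] zero_le_power2[of "x + z"] by linarith
  have m2: "(\<lambda>u. x\<^sup>2 + z\<^sup>2 + 2 * x * z * cosh u) \<in> borel_measurable borel" unfolding cosh_def by measurable
  have m1: "(\<lambda>\<phi>. x\<^sup>2 + z\<^sup>2 - 2 * x * z * cos \<phi>) \<in> borel_measurable borel" "(\<lambda>\<phi>. cos (\<nu> * \<phi>)) \<in> borel_measurable borel" "(\<lambda>u. exp (- \<nu> * u)) \<in> borel_measurable borel"
    by measurable
  have S: "{0..pi} \<in> sets borel" "{0::real..} \<in> sets borel" by auto
  note L1 = laplace_mixture[OF \<mu>1 q lm m1(2,1) S(1) n1 i1]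
  note L2 = laplace_mixture[OF \<mu>1 q lm m1(3) m2 S(2) n2 i2]
  show "set_integrable lborel {0<..} (\<lambda>w. exp (- q * w) * Dcos w)" using L1(1) unfolding Dcos_def .
  show "set_integrable lborel {0<..} (\<lambda>w. exp (- q * w) * Dcosh w)" using L2(1) unfolding Dcosh_def .
  show "(LINT w:{0<..}|lborel. exp (- q * w) * Dcos w) = Gamma (\<mu> + 1) / q powr (\<mu> + 1) * (exp (- q * (x\<^sup>2 + z\<^sup>2)) * schlaefli_cos \<nu> (2 * x * z * q))"
    using L1(2) unfolding Dcos_def e1 schlaefli_cos_def by simp
  show "(LINT w:{0<..}|lborel. exp (- q * w) * Dcosh w) = Gamma (\<mu> + 1) / q powr (\<mu> + 1) * (exp (- q * (x\<^sup>2 + z\<^sup>2)) * schlaefli_cosh \<nu> (2 * x * z * q))"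
    using L2(2) unfolding Dcosh_def e2 schlaefli_cosh_def by simp
qed

lemma Dcosh_0: "w \<le> (x + z)\<^sup>2 \<Longrightarrow> Dcosh w = 0"
proof -
  assume w: "w \<le> (x + z)\<^sup>2"
  have "max 0 (w - (x\<^sup>2 + z\<^sup>2 + 2 * x * z * cosh u)) = 0" for u
    using w angle_nonneg(2)[of u] by simp
  then show ?thesis unfolding Dcosh_def by simp
qed

lemma Dcos_0: "w \<le> (x - z)\<^sup>2 \<Longrightarrow> Dcos w = 0"
proof -
  assume w: "w \<le> (x - z)\<^sup>2"
  have "max 0 (w - (x\<^sup>2 + z\<^sup>2 - 2 * x * z * cos \<phi>)) = 0" for \<phi>
    using w angle_nonneg(1)[of \<phi>] by simp
  then show ?thesis unfolding Dcos_def by simp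
qed

text \<open>The identity \<open>w - (x\<^sup>2 + z\<^sup>2 - 2 * x * z * cos \<phi>) = 2 * x * z *
  (k - (1 - cos \<phi>))\<close> reduces the three parameters to the single quotient
  \<open>k\<close>, and \<open>k < 1\<close> means \<open>w < x\<^sup>2 + z\<^sup>2\<close>.\<close>

lemma Dcos_arc_E: "Dcos w = (2 * x * z) powr \<mu> * arc_E \<mu> \<nu> ((w - (x - z)\<^sup>2) / (2 * x * z))"
proof -
  let ?k = "(w - (x - z)\<^sup>2) / (2 * x * z)"
  have xz: "2 * x * z > 0" using xz_pos by simp
  have "cos (\<nu> * \<phi>) * (max 0 (w - (x\<^sup>2 + z\<^sup>2 - 2 * x * z * cos \<phi>))) powr \<mu> = (2 * x * z) powr \<mu> * (cos (\<nu> * \<phi>) * (max 0 (?k - (1 - cos \<phi>))) powr \<mu>)" for \<phi>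
  proof -
    have "w - (x\<^sup>2 + z\<^sup>2 - 2 * x * z * cos \<phi>) = (2 * x * z) * (?k - (1 - cos \<phi>))"
      using x z by (simp add: field_simps power2_diff power2_eq_square)
    then have "max 0 (w - (x\<^sup>2 + z\<^sup>2 - 2 * x * z * cos \<phi>)) = (2 * x * z) * max 0 (?k - (1 - cos \<phi>))"
      using xz by (simp add: max_mult_distrib_left)
    moreover have "((2 * x * z) * max 0 (?k - (1 - cos \<phi>))) powr \<mu> = (2 * x * z) powr \<mu> * (max 0 (?k - (1 - cos \<phi>))) powr \<mu>"
      by (rule powr_mult)
    ultimately show ?thesis by (simp only: mult.left_commute)
  qed
  note eq = this
  show ?thesis unfolding Dcos_def arc_E_def eq set_integral_mult_right ..
qed

lemma DERIV_Dcos: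
  assumes "(x - z)\<^sup>2 < w" "w < x\<^sup>2 + z\<^sup>2"
  shows "(Dcos has_real_derivative (2 * x * z) powr (- 1 / 2) * (w - (x - z)\<^sup>2) powr (\<mu> - 1 / 2) * arc_e \<mu> \<nu> ((w - (x - z)\<^sup>2) / (2 * x * z))) (at w)"
proof -
  define k where "k = (w - (x - z)\<^sup>2) / (2 * x * z)"
  have xz: "2 * x * z > 0" using xz_pos by simp
  have "w - (x - z)\<^sup>2 < 2 * x * z" using assms(2) by (simp add: power2_diff)
  then have k: "0 < k" "k < 1" using assms(1) xz by (auto simp: k_def)
  have "((\<lambda>w. (w - (x - z)\<^sup>2) / (2 * x * z)) has_real_derivative 1 / (2 * x * z)) (at w)"
    by (rule DERIV_cdivide) (auto intro!: derivative_eq_intros)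
  then have "((\<lambda>w. arc_E \<mu> \<nu> ((w - (x - z)\<^sup>2) / (2 * x * z))) has_real_derivative (k powr (\<mu> - 1 / 2) * arc_e \<mu> \<nu> k) * (1 / (2 * x * z))) (at w)"
    using DERIV_chain2[of "arc_E \<mu> \<nu>" _ "\<lambda>w. (w - (x - z)\<^sup>2) / (2 * x * z)" w] DERIV_arc_E[OF \<mu> k] unfolding k_def by blast
  then have "((\<lambda>w. (2 * x * z) powr \<mu> * arc_E \<mu> \<nu> ((w - (x - z)\<^sup>2) / (2 * x * z))) has_real_derivative
     (2 * x * z) powr \<mu> * ((k powr (\<mu> - 1 / 2) * arc_e \<mu> \<nu> k) * (1 / (2 * x * z)))) (at w)"
    by (rule DERIV_cmult)
  moreover have "(2 * x * z) powr \<mu> * ((k powr (\<mu> - 1 / 2) * arc_e \<mu> \<nu> k) * (1 / (2 * x * z)))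
      = (2 * x * z) powr (- 1 / 2) * (w - (x - z)\<^sup>2) powr (\<mu> - 1 / 2) * arc_e \<mu> \<nu> k"
  proof -
    have kp: "k powr (\<mu> - 1 / 2) = (w - (x - z)\<^sup>2) powr (\<mu> - 1 / 2) / (2 * x * z) powr (\<mu> - 1 / 2)"
      unfolding k_def by (rule powr_divide)
    have pw: "(2 * x * z) powr \<mu> = (2 * x * z) powr (- 1 / 2) * ((2 * x * z) powr (\<mu> - 1 / 2) * (2 * x * z))"
    proof -
      have "(2 * x * z) powr (- 1 / 2) * ((2 * x * z) powr (\<mu> - 1 / 2) * (2 * x * z) powr 1) = (2 * x * z) powr (- 1 / 2 + (\<mu> - 1 / 2 + 1))"
        by (simp only: powr_add)
      also have "- 1 / 2 + (\<mu> - 1 / 2 + 1) = \<mu>" by simp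
      finally show ?thesis using xz by (simp only: powr_one less_imp_le)
    qed
    have gen: "c * (r * d) * ((u / r * e) * (1 / d)) = c * u * e" if "r \<noteq> 0" "d \<noteq> 0" for c r d u e :: real
      using that by simp
    show ?thesis unfolding kp pw by (rule gen) (use xz in auto)
  qed
  ultimately have "((\<lambda>w. (2 * x * z) powr \<mu> * arc_E \<mu> \<nu> ((w - (x - z)\<^sup>2) / (2 * x * z))) has_real_derivative
     (2 * x * z) powr (- 1 / 2) * (w - (x - z)\<^sup>2) powr (\<mu> - 1 / 2) * arc_e \<mu> \<nu> k) (at w)" by (simp only:)
  then show ?thesis unfolding Dcos_arc_E[abs_def] k_def .
qed

text \<open>\<open>F\<close> and the full combination of \<open>Dcos\<close> and
  \<open>Dcosh\<close> have equal Laplace transforms. Injectivity gives equality at points of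
  continuity; for \<open>F\<close> continuity comes from \<open>DERIV_F\<close>, whence the
  exclusion of \<open>(x - z)\<^sup>2\<close>. The bound \<open>w < x\<^sup>2 + z\<^sup>2\<close>
  puts \<open>w\<close> below \<open>(x + z)\<^sup>2\<close>, where \<open>Dcosh\<close> is
  0.\<close>

lemma F_eq_Dcos:
  assumes w: "0 < w" "w < x\<^sup>2 + z\<^sup>2" "w \<noteq> (x - z)\<^sup>2"
  shows "F w = Dcoeff * Dcos w"
proof -
  define g where "g = (\<lambda>w. F w - Dcoeff * Dcos w + Dcoeff * sin (\<nu> * pi) * Dcosh w)"
  have wlt: "w < (x + z)\<^sup>2" using w(2) xz_pos by (simp add: power2_sum)
  have Gp: "Gamma (\<mu> + 1) > 0" using \<mu> by (intro Gamma_real_pos) auto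
  have Dm: "Dcos \<in> borel_measurable borel" "Dcosh \<in> borel_measurable borel"
  proof -
    have "(\<lambda>w. \<integral>\<phi>. indicator {0..pi} \<phi> *\<^sub>R (cos (\<nu> * \<phi>) * (max 0 (w - (x\<^sup>2 + z\<^sup>2 - 2 * x * z * cos \<phi>))) powr \<mu>) \<partial>lborel) \<in> borel_measurable lborel"
      by measurable
    then show "Dcos \<in> borel_measurable borel" unfolding Dcos_def[abs_def] set_lebesgue_integral_def by simp
    have "(\<lambda>w. \<integral>u. indicator {0..} u *\<^sub>R (exp (- \<nu> * u) * (max 0 (w - (x\<^sup>2 + z\<^sup>2 + 2 * x * z * ((exp u + exp (- u)) / 2)))) powr \<mu>) \<partial>lborel) \<in> borel_measurable lborel"
      by measurable
    then show "Dcosh \<in> borel_measurable borel" unfolding Dcosh_def[abs_def] set_lebesgue_integral_def cosh_field_def by simp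
  qed
  have eg: "exp (- q * w) * g w = exp (- q * w) * F w - Dcoeff * (exp (- q * w) * Dcos w) + Dcoeff * sin (\<nu> * pi) * (exp (- q * w) * Dcosh w)" for q w
    by (simp add: g_def algebra_simps)
  have "g w = 0"
  proof (rule laplace_injective[OF _ _ _ w(1)])
    show "g \<in> borel_measurable borel" unfolding g_def using Dm laplace_F(3)[of 1] by measurable
    fix q :: real assume q: "q > 0"
    note I = laplace_F(1)[OF q] laplace_D(1,3)[OF q]
    have I2: "set_integrable lborel {0<..} (\<lambda>w. Dcoeff * (exp (- q * w) * Dcos w))" "set_integrable lborel {0<..} (\<lambda>w. Dcoeff * sin (\<nu> * pi) * (exp (- q * w) * Dcosh w))"
      using I by (intro set_integrable_mult_right; simp)+
    show "set_integrable lborel {0<..} (\<lambda>w. exp (- q * w) * g w)"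
      unfolding eg by (intro set_integral_add(1) set_integral_diff(1) I I2)
    have s: "2 * x * z * q > 0" using xz_pos q by (simp add: mult.assoc)
    have "(LINT w:{0<..}|lborel. exp (- q * w) * g w) = (LINT w:{0<..}|lborel. exp (- q * w) * F w) - Dcoeff * (LINT w:{0<..}|lborel. exp (- q * w) * Dcos w) + Dcoeff * sin (\<nu> * pi) * (LINT w:{0<..}|lborel. exp (- q * w) * Dcosh w)"
      unfolding eg set_integral_add(2)[OF set_integral_diff(1)[OF I(1) I2(1)] I2(2)] set_integral_diff(2)[OF I(1) I2(1)] set_integral_mult_right ..
    also have "\<dots> = 2 / q powr (\<mu> + 1) * exp (- q * (x\<^sup>2 + z\<^sup>2)) * mod_bessel_I \<nu> (2 * x * z * q)
       - Dcoeff * Gamma (\<mu> + 1) / q powr (\<mu> + 1) * exp (- q * (x\<^sup>2 + z\<^sup>2)) * schlaefli \<nu> (2 * x * z * q)"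
      unfolding laplace_F(2)[OF q] laplace_D(2,4)[OF q] schlaefli_def by (simp add: divide_inverse algebra_simps)
    also have "\<dots> = 0"
      unfolding schlaefli_eq[OF \<nu> s] Dcoeff_def using Gp by simp
    finally show "(LINT w:{0<..}|lborel. exp (- q * w) * g w) = 0" .
  next
    have cF: "isCont F w"
    proof -
      define t0 where "t0 = sqrt w"
      have t0: "t0 > 0" "t0\<^sup>2 = w" using w by (auto simp: t0_def)
      have ne: "t0 \<noteq> \<bar>x - z\<bar>" "t0 \<noteq> x + z" using t0(2) w(3) wlt by (auto simp flip: t0(2))
      obtain d where "(F has_real_derivative d) (at (t0\<^sup>2))"
        by (rule DERIV_F[OF t0(1) ne]) (rule that)
      then show ?thesis unfolding t0(2) by (rule DERIV_isCont)
    qed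
    have cD: "isCont Dcos w"
    proof (cases "w < (x - z)\<^sup>2")
      case True
      have "\<forall>\<^sub>F w in nhds w. Dcos w = 0"
        using eventually_nhds_in_open[of "{..<(x - z)\<^sup>2}" w] True by (auto elim!: eventually_mono intro: Dcos_0)
      then show ?thesis by (subst isCont_cong[of _ "\<lambda>_. 0"]) auto
    next
      case False
      then show ?thesis using DERIV_isCont[OF DERIV_Dcos] w by simp
    qed
    have "\<forall>\<^sub>F w in nhds w. Dcosh w = 0"
      using eventually_nhds_in_open[of "{..<(x + z)\<^sup>2}" w] wlt by (auto elim!: eventually_mono intro: Dcosh_0)
    then have "isCont Dcosh w" by (subst isCont_cong[of _ "\<lambda>_. 0"]) auto
    then show "isCont g w" unfolding g_def using cF cD by (intro continuous_intros)
  qed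
  then show ?thesis using Dcosh_0[of w] wlt by (simp add: g_def)
qed

lemma truncated_limit:
  assumes t: "t > 0" "t\<^sup>2 < x\<^sup>2 + z\<^sup>2" and ne: "t \<noteq> \<bar>x - z\<bar>"
  shows "((\<lambda>R. LINT y:{0<..<R}|lborel. Gint (t\<^sup>2) y) \<longlongrightarrow>
     (if t < \<bar>x - z\<bar> then 0 else Dcoeff * ((2 * x * z) powr (- 1 / 2) * (t\<^sup>2 - (x - z)\<^sup>2) powr (\<mu> - 1 / 2) * arc_e \<mu> \<nu> ((t\<^sup>2 - (x - z)\<^sup>2) / (2 * x * z))))) at_top"
proof -
  define w where "w = t\<^sup>2"
  have w: "0 < w" "w < x\<^sup>2 + z\<^sup>2" using t by (auto simp: w_def)
  have wne: "w \<noteq> (x - z)\<^sup>2" using ne t(1) unfolding w_def by (metis abs_of_pos power2_abs power2_eq_iff_nonneg abs_ge_zero less_imp_le)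
  have "t \<noteq> x + z"
  proof
    assume "t = x + z"
    then have "t\<^sup>2 = x\<^sup>2 + z\<^sup>2 + 2 * (x * z)" by (simp add: power2_sum)
    then show False using t(2) xz_pos by simp
  qed
  then obtain g where g: "((\<lambda>R. LINT y:{0<..<R}|lborel. Gint (t\<^sup>2) y) \<longlongrightarrow> g) at_top" "(F has_real_derivative g) (at (t\<^sup>2))"
    by (rule DERIV_F[OF t(1) ne]) (rule that)
  \<comment> \<open>An open neighbourhood of \<open>w\<close> on one side of
    \<open>(x - z)\<^sup>2\<close>: on it \<open>F_eq_Dcos\<close> holds throughout, so the
    derivatives at \<open>w\<close> agree as well.\<close>
  define S where "S = (if t < \<bar>x - z\<bar> then {0<..<(x - z)\<^sup>2} \<inter> {..<x\<^sup>2 + z\<^sup>2} else {(x - z)\<^sup>2<..<x\<^sup>2 + z\<^sup>2})"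
  have lt: "t < \<bar>x - z\<bar> \<longleftrightarrow> w < (x - z)\<^sup>2"
    unfolding w_def using t(1) by (metis abs_ge_zero less_imp_le power2_abs power_mono_iff power_strict_mono not_less pos2)
  have S: "open S" "w \<in> S" using w wne lt by (auto simp: S_def)
  have FS: "F v = Dcoeff * Dcos v" if "v \<in> S" for v
  proof (rule F_eq_Dcos)
    show "0 < v"
    proof (cases "t < \<bar>x - z\<bar>")
      case True
      then show ?thesis using that by (simp add: S_def)
    next
      case False
      then have "(x - z)\<^sup>2 < v" using that by (simp add: S_def)
      then show ?thesis by (rule le_less_trans[OF zero_le_power2])
    qed
    show "v < x\<^sup>2 + z\<^sup>2" "v \<noteq> (x - z)\<^sup>2" using that by (auto simp: S_def split: if_splits)
  qed
  define d where "d = (if t < \<bar>x - z\<bar> then 0 else (2 * x * z) powr (- 1 / 2) * (w - (x - z)\<^sup>2) powr (\<mu> - 1 / 2) * arc_e \<mu> \<nu> ((w - (x - z)\<^sup>2) / (2 * x * z)))"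
  have "(Dcos has_real_derivative d) (at w)"
  proof (cases "t < \<bar>x - z\<bar>")
    case True
    have "((\<lambda>_. 0) has_real_derivative 0) (at w)" by simp
    then have "(Dcos has_real_derivative 0) (at w)"
      by (rule has_field_derivative_transform_within_open[OF _ S]) (use True in \<open>auto simp: S_def Dcos_0\<close>)
    then show ?thesis using True by (simp add: d_def)
  next
    case False
    then show ?thesis using DERIV_Dcos[of w] w wne lt by (simp add: d_def)
  qed
  then have "((\<lambda>w. Dcoeff * Dcos w) has_real_derivative Dcoeff * d) (at w)" by (rule DERIV_cmult)
  then have "(F has_real_derivative Dcoeff * d) (at w)"
    by (rule has_field_derivative_transform_within_open[OF _ S]) (rule FS[symmetric])
  then have "g = Dcoeff * d" using g(2) unfolding w_def[symmetric] by (rule DERIV_unique[rotated])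
  then have "(if t < \<bar>x - z\<bar> then 0 else Dcoeff * ((2 * x * z) powr (- 1 / 2) * (t\<^sup>2 - (x - z)\<^sup>2) powr (\<mu> - 1 / 2) * arc_e \<mu> \<nu> ((t\<^sup>2 - (x - z)\<^sup>2) / (2 * x * z)))) = g"
    unfolding d_def w_def by simp
  with g(1) show ?thesis by (simp only:)
qed

end

text \<open>The angular function is hidden behind \<open>e\<close>, of which only continuity and
  boundedness are passed on. Of the power \<open>t powr (- 2 * (\<alpha> + \<beta>))\<close> one
  half is the normalization in \<open>K\<close> and the other comes from
  \<open>bessel_product_eq\<close>.\<close>

theorem kernel_formula:
  assumes \<alpha>: "\<alpha> > -1" and \<mu>: "\<alpha> + \<beta> > -1/2"
  obtains e C where "continuous_on {0<..<1} e" "C > 0" "\<And>k. 0 < k \<Longrightarrow> k < 1 \<Longrightarrow> \<bar>e k\<bar> \<le> C"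
    "\<And>t x z. 0 < t \<Longrightarrow> t < x / 2 \<Longrightarrow> z > 0 \<Longrightarrow> \<bar>x - z\<bar> \<noteq> t \<Longrightarrow>
      K \<alpha> \<beta> t x z = (if t < \<bar>x - z\<bar> then 0 else t powr (- 2 * (\<alpha> + \<beta>)) * (x * z) powr (- \<alpha> - 1 / 2)
        * (t\<^sup>2 - (x - z)\<^sup>2) powr (\<alpha> + \<beta> - 1 / 2) * e ((t\<^sup>2 - (x - z)\<^sup>2) / (2 * x * z)))"
proof -
  define m where "m = \<alpha> + \<beta>"
  have m: "m > -1/2" using \<mu> by (simp add: m_def)
  have Gp: "Gamma (m + 1) > 0" using m by (intro Gamma_real_pos) auto
  \<comment> \<open>What remains of the constants: \<open>2 / pi\<close> from \<open>Dcoeff\<close>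
    and \<open>2 powr (- 1 / 2)\<close> from \<open>(2 * x * z) powr (- 1 / 2)\<close>. The Gamma
    value and the powers of 2 in the definition of \<open>K\<close> cancel.\<close>
  define c where "c = 2 / pi * 2 powr (- 1 / 2)"
  obtain C where C: "C > 0" "\<And>k. 0 < k \<Longrightarrow> k < 1 \<Longrightarrow> \<bar>arc_e m \<alpha> k\<bar> \<le> C"
    by (rule arc_e_bound[OF m]) (rule that)
  have c: "c > 0" by (simp add: c_def)
  show thesis
  proof (rule that[of "\<lambda>k. c * arc_e m \<alpha> k" "c * C"])
    show "continuous_on {0<..<1} (\<lambda>k. c * arc_e m \<alpha> k)" by (intro continuous_intros arc_e_cont m)
    show "c * C > 0" using c C by simp
    show "\<bar>c * arc_e m \<alpha> k\<bar> \<le> c * C" if "0 < k" "k < 1" for k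
      using C(2)[OF that] c by (simp add: abs_mult)
    fix t x z :: real assume t: "0 < t" "t < x / 2" and z: "z > 0" and ne: "\<bar>x - z\<bar> \<noteq> t"
    have x: "x > 0" using t by simp
    interpret bessel_triple m \<alpha> x z by unfold_locales (use m \<alpha> x z in auto)
    have "t\<^sup>2 < x\<^sup>2" using t by (intro power_strict_mono) auto
    then have t2: "t\<^sup>2 < x\<^sup>2 + z\<^sup>2" using zero_le_power2[of z] by linarith
    define G where "G = (if t < \<bar>x - z\<bar> then 0 else Dcoeff * ((2 * x * z) powr (- 1 / 2) * (t\<^sup>2 - (x - z)\<^sup>2) powr (m - 1 / 2) * arc_e m \<alpha> ((t\<^sup>2 - (x - z)\<^sup>2) / (2 * x * z))))"
    have lim: "((\<lambda>R. LINT y:{0<..<R}|lborel. Gint (t\<^sup>2) y) \<longlongrightarrow> G) at_top"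
      unfolding G_def by (rule truncated_limit[OF t(1) t2]) (use ne in simp)
    have eq: "(LINT y:{0<..<R}|lborel. bessel_J m (t * y) * bessel_J \<alpha> (x * y) * bessel_J \<alpha> (z * y) * y powr (1 - m))
       = 1 / (2 powr m * t powr m) * (LINT y:{0<..<R}|lborel. Gint (t\<^sup>2) y)" for R
    proof -
      have "(LINT y:{0<..<R}|lborel. bessel_J m (t * y) * bessel_J \<alpha> (x * y) * bessel_J \<alpha> (z * y) * y powr (1 - m))
         = (LINT y:{0<..<R}|lborel. 1 / (2 powr m * t powr m) * Gint (t\<^sup>2) y)"
        using bessel_product_eq[OF t(1)] by (intro set_lebesgue_integral_cong) (auto simp: bessel_product_def)
      then show ?thesis by (simp only: set_integral_mult_right)
    qed
    have "((\<lambda>R. LINT y:{0<..<R}|lborel. bessel_J m (t * y) * bessel_J \<alpha> (x * y) * bessel_J \<alpha> (z * y) * y powr (1 - m))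
       \<longlongrightarrow> 1 / (2 powr m * t powr m) * G) at_top"
      unfolding eq by (intro tendsto_mult tendsto_const lim)
    \<comment> \<open>\<open>Lim\<close> is a choice operator, so its value is known only now that
      convergence has been shown.\<close>
    then have Lim: "Lim at_top (\<lambda>R. LINT y:{0<..<R}|lborel. bessel_J m (t * y) * bessel_J \<alpha> (x * y) * bessel_J \<alpha> (z * y) * y powr (1 - m))
       = 1 / (2 powr m * t powr m) * G"
      by (intro tendsto_Lim) auto
    have m1: "1 - \<alpha> - \<beta> = 1 - m" by (simp add: m_def)
    have K: "K \<alpha> \<beta> t x z = 2 powr m * Gamma (m + 1) / (t powr m * (x * z) powr \<alpha>) * (1 / (2 powr m * t powr m) * G)"
      unfolding K_def m1 m_def[symmetric] Lim ..
    show "K \<alpha> \<beta> t x z = (if t < \<bar>x - z\<bar> then 0 else t powr (- 2 * (\<alpha> + \<beta>)) * (x * z) powr (- \<alpha> - 1 / 2)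
        * (t\<^sup>2 - (x - z)\<^sup>2) powr (\<alpha> + \<beta> - 1 / 2) * (c * arc_e m \<alpha> ((t\<^sup>2 - (x - z)\<^sup>2) / (2 * x * z))))"
    proof (cases "t < \<bar>x - z\<bar>")
      case True
      then show ?thesis unfolding K G_def by simp
    next
      case False
      have p1: "t powr (- 2 * m) = 1 / (t powr m * t powr m)"
      proof -
        have "t powr m * t powr m = t powr (2 * m)" by (simp flip: powr_add)
        then show ?thesis by (simp add: powr_minus divide_inverse)
      qed
      have p2: "(x * z) powr (- \<alpha> - 1 / 2) = (x * z) powr (- 1 / 2) / (x * z) powr \<alpha>"
      proof -
        have "- \<alpha> - 1 / 2 = - 1 / 2 - \<alpha>" by simp
        then show ?thesis by (simp only: powr_diff)
      qed
      have p3: "(2 * x * z) powr (- 1 / 2) = 2 powr (- 1 / 2) * (x * z) powr (- 1 / 2)"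
        using x z by (simp add: powr_mult mult.assoc)
      have "K \<alpha> \<beta> t x z = 2 powr m * Gamma (m + 1) / (t powr m * (x * z) powr \<alpha>) * (1 / (2 powr m * t powr m) *
          (2 / (pi * Gamma (m + 1)) * (2 powr (- 1 / 2) * (x * z) powr (- 1 / 2) * (t\<^sup>2 - (x - z)\<^sup>2) powr (m - 1 / 2) * arc_e m \<alpha> ((t\<^sup>2 - (x - z)\<^sup>2) / (2 * x * z)))))"
        unfolding K G_def Dcoeff_def p3 using False by simp
      also have "\<dots> = t powr (- 2 * m) * (x * z) powr (- \<alpha> - 1 / 2) * (t\<^sup>2 - (x - z)\<^sup>2) powr (m - 1 / 2) * (c * arc_e m \<alpha> ((t\<^sup>2 - (x - z)\<^sup>2) / (2 * x * z)))"
        unfolding p1 p2 c_def using Gp t x z by (simp add: field_simps)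
      finally show ?thesis using False unfolding m_def by simp
    qed
  qed
qed

section \<open>Local maximal averages\<close>

text \<open>On the line, dropping redundant intervals replaces the Vitali covering lemma and avoids dilated intervals, which could leave the half line.\<close>
lemma minimal_subcover_overlap:
  fixes l r :: "'i \<Rightarrow> real"
  assumes "finite I"
  shows "\<exists>J\<subseteq>I. (\<Union>i\<in>J. {l i<..<r i}) = (\<Union>i\<in>I. {l i<..<r i}) \<and> (\<forall>p. card {i\<in>J. p \<in> {l i<..<r i}} \<le> 2)"
  using assms
proof (induction "card I" arbitrary: I rule: less_induct)
  case less
  show ?case
  proof (cases "\<forall>p. card {i\<in>I. p \<in> {l i<..<r i}} \<le> 2")
    case True
    then show ?thesis by blast
  next
    case False
    then obtain p where p: "\<not> card {i\<in>I. p \<in> {l i<..<r i}} \<le> 2" by blast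
    define A where "A = {i\<in>I. p \<in> {l i<..<r i}}"
    have A: "finite A" "card A \<ge> 3" "A \<subseteq> I" using p less.prems by (auto simp: A_def)
    then have "A \<noteq> {}" by auto
    obtain a where a: "a \<in> A" "\<And>i. i \<in> A \<Longrightarrow> l a \<le> l i"
      using ex_min_if_finite[of "l ` A"] A(1) \<open>A \<noteq> {}\<close> by (metis (no_types, lifting) finite_imageI image_iff image_is_empty not_less)
    obtain b where b: "b \<in> A" "\<And>i. i \<in> A \<Longrightarrow> r i \<le> r b"
    proof -
      have "Max (r ` A) \<in> r ` A" using A(1) \<open>A \<noteq> {}\<close> by (intro Max_in) auto
      then obtain b where "b \<in> A" "r b = Max (r ` A)" by auto
      then show thesis using that[of b] A(1) by simp
    qed
    have "card {a, b} \<le> 2" by (simp add: card_insert_if)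
    then have "\<not> A \<subseteq> {a, b}" using A(2) card_mono[of "{a, b}" A] by auto
    then obtain c where c: "c \<in> A" "c \<noteq> a" "c \<noteq> b" by blast
    have sub: "{l c<..<r c} \<subseteq> {l a<..<r a} \<union> {l b<..<r b}"
    proof
      fix q assume q: "q \<in> {l c<..<r c}"
      have "l a < p" "p < r a" "l b < p" "p < r b" "l a \<le> l c" "r c \<le> r b"
        using a b c(1) by (auto simp: A_def)
      then show "q \<in> {l a<..<r a} \<union> {l b<..<r b}"
        using q by (cases "q \<le> p") auto
    qed
    have "card (I - {c}) < card I" using c A(3) less.prems by (intro card_Diff1_less) auto
    from less.hyps[OF this] obtain J where J: "J \<subseteq> I - {c}" "(\<Union>i\<in>J. {l i<..<r i}) = (\<Union>i\<in>I - {c}. {l i<..<r i})"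
      "\<forall>p. card {i\<in>J. p \<in> {l i<..<r i}} \<le> 2" using less.prems by auto
    have "(\<Union>i\<in>I - {c}. {l i<..<r i}) = (\<Union>i\<in>I. {l i<..<r i})"
    proof
      show "(\<Union>i\<in>I. {l i<..<r i}) \<subseteq> (\<Union>i\<in>I - {c}. {l i<..<r i})"
      proof
        fix q assume "q \<in> (\<Union>i\<in>I. {l i<..<r i})"
        then obtain i where i: "i \<in> I" "q \<in> {l i<..<r i}" by blast
        show "q \<in> (\<Union>i\<in>I - {c}. {l i<..<r i})"
        proof (cases "i = c")
          case True
          then have "q \<in> {l a<..<r a} \<or> q \<in> {l b<..<r b}" using i sub by blast
          moreover have "a \<in> I - {c}" "b \<in> I - {c}" using a b c A(3) by auto
          ultimately show ?thesis by blast
        qed (use i in blast)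
      qed
    qed auto
    then have "(\<Union>i\<in>J. {l i<..<r i}) = (\<Union>i\<in>I. {l i<..<r i})" unfolding J(2) .
    moreover have "J \<subseteq> I" using J(1) by blast
    ultimately show ?thesis using J(3) by blast
  qed
qed

section \<open>Weak type (1,1) of the local averages with power weights\<close>

text \<open>The factor 2 is the overlap bound of the thinned family: summing the hypothesis over it
  counts no point more than twice. Passing to the thinned family leaves the union unchanged.\<close>

lemma overlap_emeasure_le:
  fixes l r :: "'i \<Rightarrow> real"
  assumes "finite I" and sets: "sets N = sets (lebesgue_on {0<..})"
    and sub: "\<And>i. i \<in> I \<Longrightarrow> {l i<..<r i} \<subseteq> {0<..}"
    and g: "g \<in> borel_measurable N"
    and le: "\<And>i. i \<in> I \<Longrightarrow> emeasure N {l i<..<r i} \<le> c * (\<integral>\<^sup>+z. g z * indicator {l i<..<r i} z \<partial>N)"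
  shows "emeasure N (\<Union>i\<in>I. {l i<..<r i}) \<le> 2 * c * (\<integral>\<^sup>+z. g z \<partial>N)"
proof -
  obtain J where J: "J \<subseteq> I" "(\<Union>i\<in>J. {l i<..<r i}) = (\<Union>i\<in>I. {l i<..<r i})"
    "\<And>p. card {i\<in>J. p \<in> {l i<..<r i}} \<le> 2"
    using minimal_subcover_overlap[OF assms(1), of l r] by blast
  have fin: "finite J" using J(1) assms(1) by (rule finite_subset)
  have meas: "{l i<..<r i} \<in> sets N" if "i \<in> J" for i
    unfolding sets using sub that J(1) by (subst sets_restrict_space_iff) auto
  have "emeasure N (\<Union>i\<in>J. {l i<..<r i}) \<le> (\<Sum>i\<in>J. emeasure N {l i<..<r i})"
    using meas fin by (intro emeasure_subadditive_finite) auto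
  also have "\<dots> \<le> (\<Sum>i\<in>J. c * (\<integral>\<^sup>+z. g z * indicator {l i<..<r i} z \<partial>N))"
    using le J(1) by (intro sum_mono) auto
  also have "\<dots> = c * (\<integral>\<^sup>+z. (\<Sum>i\<in>J. g z * indicator {l i<..<r i} z) \<partial>N)"
  proof -
    have "(\<Sum>i\<in>J. (\<integral>\<^sup>+z. g z * indicator {l i<..<r i} z \<partial>N)) = (\<integral>\<^sup>+z. (\<Sum>i\<in>J. g z * indicator {l i<..<r i} z) \<partial>N)"
      using meas g by (intro nn_integral_sum[symmetric]) auto
    then show ?thesis by (simp only: sum_distrib_left[symmetric])
  qed
  also have "\<dots> \<le> c * (\<integral>\<^sup>+z. 2 * g z \<partial>N)"
  proof (intro mult_left_mono nn_integral_mono)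
    fix z
    have "(\<Sum>i\<in>J. g z * indicator {l i<..<r i} z) = g z * of_nat (card {i\<in>J. z \<in> {l i<..<r i}})"
      unfolding sum_distrib_left[symmetric] indicator_def using fin
      by (simp add: sum.If_cases Int_def)
    also have "\<dots> \<le> g z * of_nat 2"
      using J(3)[of z] by (intro mult_left_mono) (auto simp: of_nat_mono)
    finally show "(\<Sum>i\<in>J. g z * indicator {l i<..<r i} z) \<le> 2 * g z" by (simp add: mult.commute)
  qed simp
  also have "\<dots> = 2 * c * (\<integral>\<^sup>+z. g z \<partial>N)"
    using g by (subst nn_integral_cmult) (auto simp: mult_ac)
  finally show ?thesis unfolding J(2) .
qed

lemma sets_power_measure [simp, measurable_cong]: "sets (power_measure \<delta>) = sets (lebesgue_on {0<..})"
  by (simp add: power_measure_def)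

lemma space_power_measure [simp]: "space (power_measure \<delta>) = {0<..}"
  by (simp add: power_measure_def)

lemma measurable_powr_lebesgue_on [measurable]: "(\<lambda>x::real. x powr \<delta>) \<in> borel_measurable (lebesgue_on {0<..})"
  by (intro measurable_restrict_space1 measurable_completion) simp

lemma nn_integral_power_measure:
  assumes "g \<in> borel_measurable (lebesgue_on {0<..})"
  shows "(\<integral>\<^sup>+z. g z \<partial>power_measure \<delta>) = (\<integral>\<^sup>+z. ennreal (z powr \<delta>) * g z * indicator {0<..} z \<partial>lebesgue)"
proof -
  have "(\<integral>\<^sup>+z. g z \<partial>power_measure \<delta>) = (\<integral>\<^sup>+z. ennreal (z powr \<delta>) * g z \<partial>lebesgue_on {0<..})"
    unfolding power_measure_def using assms by (subst nn_integral_density) auto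
  then show ?thesis by (simp add: nn_integral_restrict_space)
qed

text \<open>Between \<open>x / 2\<close> and \<open>3 * x / 2\<close> the ratio of \<open>z\<close>
  to \<open>x\<close> lies between \<open>1 / 2\<close> and 2, so a power weight varies by at most
  \<open>2 powr \<bar>\<delta>\<bar>\<close> in either direction.\<close>

lemma powr_comparable:
  fixes x z \<delta> :: real
  assumes "x > 0" "x / 2 \<le> z" "z \<le> 3 * x / 2"
  shows "z powr \<delta> \<le> (2 powr \<bar>\<delta>\<bar>) * x powr \<delta>" "x powr \<delta> \<le> (2 powr \<bar>\<delta>\<bar>) * z powr \<delta>"
proof -
  have z: "z > 0" using assms by linarith
  have 1: "u powr \<delta> \<le> (2 powr \<bar>\<delta>\<bar>) * v powr \<delta>" if "u > 0" "v > 0" "u \<le> 2 * v" "v \<le> 2 * u" for u v :: real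
  proof (cases "\<delta> \<ge> 0")
    case True
    have "u powr \<delta> \<le> (2 * v) powr \<delta>" using that True by (intro powr_mono2) auto
    then show ?thesis using True that by (simp add: powr_mult)
  next
    case False
    have "u powr \<delta> \<le> (v / 2) powr \<delta>" using that False by (intro powr_mono2') auto
    also have "\<dots> = 2 powr (- \<delta>) * v powr \<delta>" using that by (simp add: powr_divide powr_minus divide_simps)
    finally show ?thesis using False by simp
  qed
  show "z powr \<delta> \<le> (2 powr \<bar>\<delta>\<bar>) * x powr \<delta>" "x powr \<delta> \<le> (2 powr \<bar>\<delta>\<bar>) * z powr \<delta>"
    using assms z by (intro 1; linarith)+
qed

text \<open>Formulated for functions with values in the extended nonnegative reals, so that powers,
  truncations and representatives of \<open>f\<close> can be inserted directly.\<close>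

definition local_avg :: "(real \<Rightarrow> ennreal) \<Rightarrow> real \<Rightarrow> ennreal" where
  "local_avg g x = (SUP t\<in>{0<..<x / 2}. ennreal (1 / (2 * t)) * (\<integral>\<^sup>+z\<in>{x - t..x + t}. g z \<partial>lebesgue))"

lemma local_HL_eq_local_avg: "local_HL f x = local_avg (\<lambda>z. ennreal (norm (f z))) x"
  unfolding local_HL_def local_avg_def ..

text \<open>The weight is frozen at \<open>x\<close> once for the measure of the interval and once
  for the integral, which yields \<open>2 powr (2 * \<bar>\<delta>\<bar>)\<close>. The interval is
  taken open for the covering argument; its endpoints are null.\<close>

lemma local_avg_interval_bound:
  assumes g: "g \<in> borel_measurable (lebesgue_on {0<..})" and x: "x > 0" and t: "0 < t" "t < x / 2" and s: "s > 0"
    and big: "ennreal s < ennreal (1 / (2 * t)) * (\<integral>\<^sup>+z\<in>{x - t..x + t}. g z \<partial>lebesgue)"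
  shows "emeasure (power_measure \<delta>) {x - t<..<x + t}
     \<le> ennreal (2 powr (2 * \<bar>\<delta>\<bar>) / s) * (\<integral>\<^sup>+z. g z * indicator {x - t<..<x + t} z \<partial>power_measure \<delta>)"
proof -
  let ?I = "{x - t<..<x + t}"
  define c where "c = (2::real) powr \<bar>\<delta>\<bar>"
  have c: "c > 0" "c * c = 2 powr (2 * \<bar>\<delta>\<bar>)" by (simp_all add: c_def flip: powr_add)
  have I: "?I \<subseteq> {0<..}" using t x by auto
  have Im: "?I \<in> sets (lebesgue_on {0<..})" using I by (subst sets_restrict_space_iff) auto
  have gm: "(\<lambda>z. g z * indicator {0<..} z) \<in> borel_measurable lebesgue"
    using g by (subst borel_measurable_restrict_space_iff_ennreal[symmetric]) auto
  have Il: "?I \<in> sets lebesgue" by (rule sets_completionI_sets) simp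
  have Ii: "(indicator ?I :: real \<Rightarrow> ennreal) \<in> borel_measurable lebesgue" by (rule borel_measurable_indicator[OF Il])
  have comp: "z powr \<delta> \<le> c * x powr \<delta>" "x powr \<delta> \<le> c * z powr \<delta>" if "z \<in> ?I" for z
    unfolding c_def using that t x by (intro powr_comparable; simp)+
  have 1: "emeasure (power_measure \<delta>) ?I \<le> ennreal (c * x powr \<delta>) * ennreal (2 * t)"
  proof -
    have "emeasure (power_measure \<delta>) ?I = (\<integral>\<^sup>+z. indicator ?I z \<partial>power_measure \<delta>)"
      using Im by simp
    also have "\<dots> = (\<integral>\<^sup>+z. ennreal (z powr \<delta>) * indicator ?I z * indicator {0<..} z \<partial>lebesgue)"
      by (rule nn_integral_power_measure) (rule borel_measurable_indicator[OF Im])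
    also have "\<dots> \<le> (\<integral>\<^sup>+z. ennreal (c * x powr \<delta>) * indicator ?I z \<partial>lebesgue)"
      using comp(1) by (intro nn_integral_mono) (auto simp: indicator_def intro!: ennreal_leI)
    also have "\<dots> = ennreal (c * x powr \<delta>) * ennreal (2 * t)"
      unfolding nn_integral_cmult[OF Ii] using Il t by simp
    finally show ?thesis .
  qed
  have 2: "(\<integral>\<^sup>+z\<in>{x - t..x + t}. g z \<partial>lebesgue) * ennreal (x powr \<delta>) \<le> ennreal c * (\<integral>\<^sup>+z. g z * indicator ?I z \<partial>power_measure \<delta>)"
  proof -
    have "(\<integral>\<^sup>+z\<in>{x - t..x + t}. g z \<partial>lebesgue) = (\<integral>\<^sup>+z. (g z * indicator {0<..} z) * indicator ?I z \<partial>lebesgue)"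
    proof (rule nn_integral_cong_AE)
      have "AE z in lebesgue. z \<noteq> x - t \<and> z \<noteq> x + t"
        by (intro AE_conjI) (auto intro!: AE_I[of _ _ "{_}"])
      then show "AE z in lebesgue. g z * indicator {x - t..x + t} z = (g z * indicator {0<..} z) * indicator ?I z"
        by eventually_elim (use I in \<open>auto simp: indicator_def\<close>)
    qed
    then have "(\<integral>\<^sup>+z\<in>{x - t..x + t}. g z \<partial>lebesgue) * ennreal (x powr \<delta>)
       = (\<integral>\<^sup>+z. ennreal (x powr \<delta>) * ((g z * indicator {0<..} z) * indicator ?I z) \<partial>lebesgue)"
      unfolding nn_integral_cmult[OF borel_measurable_times_ennreal[OF gm Ii]] by (simp only: mult.commute)
    also have "\<dots> \<le> (\<integral>\<^sup>+z. ennreal c * (ennreal (z powr \<delta>) * (g z * indicator ?I z) * indicator {0<..} z) \<partial>lebesgue)"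
    proof (rule nn_integral_mono)
      fix z
      show "ennreal (x powr \<delta>) * ((g z * indicator {0<..} z) * indicator ?I z) \<le> ennreal c * (ennreal (z powr \<delta>) * (g z * indicator ?I z) * indicator {0<..} z)"
      proof (cases "z \<in> ?I")
        case True
        have "ennreal (x powr \<delta>) \<le> ennreal c * ennreal (z powr \<delta>)"
          using comp(2)[OF True] c by (simp flip: ennreal_mult)
        then have "ennreal (x powr \<delta>) * g z \<le> ennreal c * ennreal (z powr \<delta>) * g z" by (rule mult_right_mono) simp
        then show ?thesis using True I by (auto simp: indicator_def mult.assoc)
      qed simp
    qed
    also have "\<dots> = ennreal c * (\<integral>\<^sup>+z. ennreal (z powr \<delta>) * (g z * indicator ?I z) * indicator {0<..} z \<partial>lebesgue)"
    proof (rule nn_integral_cmult)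
      have "(\<lambda>z. ennreal (z powr \<delta>) * ((g z * indicator {0<..} z) * indicator ?I z)) \<in> borel_measurable lebesgue"
      proof (rule borel_measurable_times_ennreal[OF _ borel_measurable_times_ennreal[OF gm Ii]])
        show "(\<lambda>z. ennreal (z powr \<delta>)) \<in> borel_measurable lebesgue"
          by (rule measurable_completion) measurable
      qed
      moreover have "(\<lambda>z. ennreal (z powr \<delta>) * ((g z * indicator {0<..} z) * indicator ?I z)) = (\<lambda>z. ennreal (z powr \<delta>) * (g z * indicator ?I z) * indicator {0<..} z)"
        by (rule ext) (simp only: mult_ac)
      ultimately show "(\<lambda>z. ennreal (z powr \<delta>) * (g z * indicator ?I z) * indicator {0<..} z) \<in> borel_measurable lebesgue"
        by (simp only:)
    qed
    also have "(\<integral>\<^sup>+z. ennreal (z powr \<delta>) * (g z * indicator ?I z) * indicator {0<..} z \<partial>lebesgue) = (\<integral>\<^sup>+z. g z * indicator ?I z \<partial>power_measure \<delta>)"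
      using g Im by (subst nn_integral_power_measure) (auto intro!: borel_measurable_times_ennreal)
    finally show ?thesis .
  qed
  define G where "G = (\<integral>\<^sup>+z\<in>{x - t..x + t}. g z \<partial>lebesgue)"
  have "ennreal (2 * t) = ennreal (1 / s) * (ennreal s * ennreal (2 * t))"
    using s t by (simp flip: ennreal_mult)
  also have "\<dots> \<le> ennreal (1 / s) * (ennreal (1 / (2 * t)) * G * ennreal (2 * t))"
    using big unfolding G_def by (intro mult_left_mono mult_right_mono) auto
  also have "\<dots> = ennreal (1 / s) * ((ennreal (1 / (2 * t)) * ennreal (2 * t)) * G)" by (simp only: mult_ac)
  also have "ennreal (1 / (2 * t)) * ennreal (2 * t) = 1" using t by (simp flip: ennreal_mult)
  finally have "ennreal (2 * t) \<le> ennreal (1 / s) * G" by simp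
  then have "ennreal (c * x powr \<delta>) * ennreal (2 * t) \<le> ennreal (c * x powr \<delta>) * (ennreal (1 / s) * G)"
    by (rule mult_left_mono) simp
  also have "\<dots> = ennreal c * ennreal (1 / s) * (G * ennreal (x powr \<delta>))"
    using c by (simp add: ennreal_mult mult_ac)
  also have "\<dots> \<le> ennreal c * ennreal (1 / s) * (ennreal c * (\<integral>\<^sup>+z. g z * indicator ?I z \<partial>power_measure \<delta>))"
    using 2 unfolding G_def by (rule mult_left_mono) simp
  also have "\<dots> = ennreal (2 powr (2 * \<bar>\<delta>\<bar>) / s) * (\<integral>\<^sup>+z. g z * indicator ?I z \<partial>power_measure \<delta>)"
    using c s by (simp add: mult.assoc[symmetric] flip: ennreal_mult)
  finally show ?thesis using 1 by (rule order.trans[rotated])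
qed

text \<open>The level set is enclosed in the union \<open>V\<close> of all open intervals with a
  large average, which is open and hence measurable. Lindelof gives a countable subfamily, whose
  finite unions exhaust \<open>V\<close> and satisfy the bound of
  \<open>overlap_emeasure_le\<close>.\<close>

lemma local_avg_weak_type:
  assumes g: "g \<in> borel_measurable (lebesgue_on {0<..})" and s: "s > 0"
  obtains V where "V \<in> sets (power_measure \<delta>)" "{x\<in>{0<..}. local_avg g x > ennreal s} \<subseteq> V"
    "emeasure (power_measure \<delta>) V \<le> ennreal (2 * 2 powr (2 * \<bar>\<delta>\<bar>) / s) * (\<integral>\<^sup>+z. g z \<partial>power_measure \<delta>)"
proof -
  define P where "P = {(x, t). x > 0 \<and> 0 < t \<and> t < x / 2 \<and> ennreal s < ennreal (1 / (2 * t)) * (\<integral>\<^sup>+z\<in>{x - t..x + t}. g z \<partial>lebesgue)}"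
  define I where "I = (\<lambda>(x::real, t). {x - t<..<x + t})"
  define V where "V = (\<Union>p\<in>P. I p)"
  have opn: "open S" if "S \<in> I ` P" for S
    using that by (auto simp: I_def)
  obtain F where F: "F \<subseteq> I ` P" "countable F" "\<Union>F = V"
    by (rule Lindelof[of "I ` P", OF opn]) (auto simp: V_def)
  have sub: "{x\<in>{0<..}. local_avg g x > ennreal s} \<subseteq> V"
  proof
    fix x assume "x \<in> {x\<in>{0<..}. local_avg g x > ennreal s}"
    then obtain t where "(x, t) \<in> P" unfolding local_avg_def less_SUP_iff P_def by auto
    moreover from this have "x \<in> I (x, t)" unfolding I_def P_def by auto
    ultimately show "x \<in> V" unfolding V_def by blast
  qed
  have "V \<subseteq> {0<..}" unfolding V_def I_def P_def by auto
  moreover have "open V" unfolding V_def I_def by auto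
  ultimately have Vm: "V \<in> sets (power_measure \<delta>)"
    by (simp, subst sets_restrict_space_iff) auto
  have fin: "emeasure (power_measure \<delta>) (\<Union>i\<in>Q. {fst i - snd i<..<fst i + snd i}) \<le> ennreal (2 * 2 powr (2 * \<bar>\<delta>\<bar>) / s) * (\<integral>\<^sup>+z. g z \<partial>power_measure \<delta>)"
    if Q: "finite Q" "Q \<subseteq> P" for Q
  proof -
    have "emeasure (power_measure \<delta>) (\<Union>i\<in>Q. {fst i - snd i<..<fst i + snd i}) \<le> 2 * ennreal (2 powr (2 * \<bar>\<delta>\<bar>) / s) * (\<integral>\<^sup>+z. g z \<partial>power_measure \<delta>)"
    proof (rule overlap_emeasure_le[OF Q(1)])
      fix i assume "i \<in> Q"
      then have i: "fst i > 0" "0 < snd i" "snd i < fst i / 2" "ennreal s < ennreal (1 / (2 * snd i)) * (\<integral>\<^sup>+z\<in>{fst i - snd i..fst i + snd i}. g z \<partial>lebesgue)"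
        using Q(2) unfolding P_def by auto
      show "{fst i - snd i<..<fst i + snd i} \<subseteq> {0<..}" using i by auto
      show "emeasure (power_measure \<delta>) {fst i - snd i<..<fst i + snd i}
        \<le> ennreal (2 powr (2 * \<bar>\<delta>\<bar>) / s) * (\<integral>\<^sup>+z. g z * indicator {fst i - snd i<..<fst i + snd i} z \<partial>power_measure \<delta>)"
        by (rule local_avg_interval_bound[OF g i(1-3) s i(4)])
    qed (use g in simp_all)
    then show ?thesis using s by (simp add: ennreal_mult'[symmetric] flip: ennreal_numeral)
  qed
  show thesis
  proof (rule that[OF Vm sub])
    show "emeasure (power_measure \<delta>) V \<le> ennreal (2 * 2 powr (2 * \<bar>\<delta>\<bar>) / s) * (\<integral>\<^sup>+z. g z \<partial>power_measure \<delta>)"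
    proof (cases "P = {}")
      case True
      then show ?thesis by (simp add: V_def)
    next
      case False
      then have "F \<noteq> {} \<or> V = {}" using F by auto
      then consider "V = {}" | "F \<noteq> {}" by blast
      then show ?thesis
      proof cases
        case 2
        define e where "e = from_nat_into F"
        have "\<forall>n. \<exists>p\<in>P. e n = I p" using from_nat_into[OF 2] F(1) unfolding e_def by blast
        then obtain q where q: "\<And>n. q n \<in> P" "\<And>n. e n = I (q n)" by metis
        define U where "U = (\<lambda>n. \<Union>i\<in>q ` {..n}. {fst i - snd i<..<fst i + snd i})"
        have Um: "U n \<in> sets (power_measure \<delta>)" for n
        proof -
          have "snd p < fst p" if "p \<in> P" for p using that by (auto simp: P_def)
          then have "U n \<subseteq> {0<..}" using q(1) unfolding U_def by (auto intro: less_trans[OF diff_gt_0_iff_gt[THEN iffD2]])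
          moreover have "open (U n)" unfolding U_def by auto
          ultimately show ?thesis by (simp, subst sets_restrict_space_iff) auto
        qed
        have VU: "V = (\<Union>n. U n)"
        proof -
          have "F = range e" unfolding e_def by (simp add: range_from_nat_into[OF 2 F(2)])
          then have "V = (\<Union>n. I (q n))" using F(3) q(2) by auto
          then show ?thesis unfolding U_def I_def by (auto simp: case_prod_beta)
        qed
        have "incseq U" unfolding U_def incseq_def by (intro allI impI UN_mono image_mono) auto
        then have "(SUP n. emeasure (power_measure \<delta>) (U n)) = emeasure (power_measure \<delta>) V"
          unfolding VU using Um by (intro SUP_emeasure_incseq) auto
        moreover have "(SUP n. emeasure (power_measure \<delta>) (U n)) \<le> ennreal (2 * 2 powr (2 * \<bar>\<delta>\<bar>) / s) * (\<integral>\<^sup>+z. g z \<partial>power_measure \<delta>)"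
          unfolding U_def using q(1) by (intro SUP_least fin) auto
        ultimately show ?thesis by simp
      qed simp
    qed
  qed
qed

section \<open>From weak type to strong type\<close>

lemma nn_integral_powr_from_0:
  assumes "p > 0" "b \<ge> 0"
  shows "(\<integral>\<^sup>+s. ennreal (p * s powr (p - 1)) * indicator {0..b} s \<partial>lborel) = ennreal (b powr p)"
proof -
  have "((\<lambda>s. p * s powr (p - 1)) has_integral p * (b powr (p - 1 + 1) / (p - 1 + 1))) {0..b}"
    using assms by (intro has_integral_mult_right has_integral_powr_from_0) auto
  then have "((\<lambda>s. p * s powr (p - 1)) has_integral (b powr p)) {0..b}" using assms by simp
  then have "(\<integral>\<^sup>+s. ennreal (indicator {0..b} s * (p * s powr (p - 1))) \<partial>lborel) = ennreal (b powr p)"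
    using assms by (intro nn_integral_has_integral_lebesgue) auto
  moreover have "ennreal (indicator {0..b} s * (p * s powr (p - 1))) = ennreal (p * s powr (p - 1)) * indicator {0..b} s" for s
    by (auto simp: indicator_def)
  ultimately show ?thesis by simp
qed

lemma ennpowr_layer_cake:
  assumes p: "p > 0"
  shows "(\<integral>\<^sup>+s. ennreal (p * s powr (p - 1)) * indicator {s. 0 < s \<and> ennreal s < a} s \<partial>lborel) = ennpowr a p"
proof (cases a)
  case (real b)
  have "AE s in lborel. ennreal (p * s powr (p - 1)) * indicator {s. 0 < s \<and> ennreal s < a} s = ennreal (p * s powr (p - 1)) * indicator {0..b} s"
    using AE_lborel_singleton[of 0] AE_lborel_singleton[of b]
    by eventually_elim (use real in \<open>auto simp: indicator_def ennreal_less_iff\<close>)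
  then have "(\<integral>\<^sup>+s. ennreal (p * s powr (p - 1)) * indicator {s. 0 < s \<and> ennreal s < a} s \<partial>lborel) = ennreal (b powr p)"
    using nn_integral_powr_from_0[OF p real(1)] by (subst nn_integral_cong_AE) auto
  then show ?thesis using real by (simp add: ennpowr_def)
next
  case top
  let ?I = "\<integral>\<^sup>+s. ennreal (p * s powr (p - 1)) * indicator {s. 0 < s \<and> ennreal s < a} s \<partial>lborel"
  have ge: "ennreal (b powr p) \<le> ?I" if "b \<ge> 0" for b
    unfolding nn_integral_powr_from_0[OF p that, symmetric]
    using AE_lborel_singleton[of 0]
    by (intro nn_integral_mono_AE, eventually_elim) (use top in \<open>auto simp: indicator_def\<close>)
  have "?I = \<infinity>"
  proof (rule ccontr)
    assume "?I \<noteq> \<infinity>"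
    then obtain c where c: "?I = ennreal c" "c \<ge> 0" by (cases ?I) auto
    have "ennreal (((c + 1) powr (1 / p)) powr p) \<le> ennreal c" using ge[of "(c + 1) powr (1 / p)"] c by simp
    then show False using c p by (simp add: powr_powr)
  qed
  then show ?thesis using top by (simp add: ennpowr_def)
qed

lemma ennpowr_mult_eq:
  assumes "k > 1"
  shows "a * ennpowr (2 * a) (k - 1) = ennreal (2 powr (k - 1)) * ennpowr a k"
proof (cases a)
  case (real b)
  have "2 * ennreal b = ennreal (2 * b)" using real by (simp add: ennreal_mult)
  moreover have "b * b powr (k - 1) = b powr k"
  proof (cases "b = 0")
    case False
    then show ?thesis using real powr_add[of b 1 "k - 1"] by simp
  qed simp
  ultimately show ?thesis
    using real by (simp add: ennpowr_def powr_mult flip: ennreal_mult)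
next
  case top
  then show ?thesis by (simp add: ennpowr_def ennreal_mult_top ennreal_top_mult)
qed

text \<open>Marcinkiewicz interpolation with the truncation already built into the hypothesis: at
  level \<open>s\<close> only the part of \<open>g\<close> above \<open>s / 2\<close> counts. The
  layer-cake formula is used with exponent \<open>k\<close> for \<open>G\<close> and
  \<open>k - 1\<close> for \<open>2 * g\<close>; the factor \<open>k / (k - 1)\<close> arises from
  the change of density and \<open>2 powr (k - 1)\<close> from the factor 2.\<close>

lemma strong_type_from_weak:
  fixes G g :: "'a \<Rightarrow> ennreal"
  assumes "sigma_finite_measure N" and [measurable]: "G \<in> borel_measurable N" "g \<in> borel_measurable N"
    and A: "A \<ge> 0" and k: "k > 1"
    and weak: "\<And>s. s > 0 \<Longrightarrow> emeasure N {x\<in>space N. ennreal s < G x} \<le> ennreal (A / s) * (\<integral>\<^sup>+x. g x * indicator {x. ennreal s < 2 * g x} x \<partial>N)"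
  shows "(\<integral>\<^sup>+x. ennpowr (G x) k \<partial>N) \<le> ennreal (A * k / (k - 1) * 2 powr (k - 1)) * (\<integral>\<^sup>+x. ennpowr (g x) k \<partial>N)"
proof -
  interpret N: sigma_finite_measure N by fact
  interpret P: pair_sigma_finite N lborel ..
  define h where "h = (\<lambda>p s. ennreal (p * s powr (p - 1)))"
  have [measurable]: "h p \<in> borel_measurable borel" for p unfolding h_def by measurable
  have Gm: "{x \<in> space N. ennreal s < G x} \<in> sets N" for s by measurable
  have "(\<integral>\<^sup>+x. ennpowr (G x) k \<partial>N) = (\<integral>\<^sup>+x. \<integral>\<^sup>+s. h k s * indicator {s. 0 < s \<and> ennreal s < G x} s \<partial>lborel \<partial>N)"
    unfolding h_def using k by (subst ennpowr_layer_cake) auto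
  also have "\<dots> = (\<integral>\<^sup>+x. \<integral>\<^sup>+s. h k s * (if 0 < s \<and> ennreal s < G x then 1 else 0) \<partial>lborel \<partial>N)"
    by (intro nn_integral_cong) (simp add: indicator_def)
  also have "\<dots> = (\<integral>\<^sup>+s. \<integral>\<^sup>+x. h k s * (if 0 < s \<and> ennreal s < G x then 1 else 0) \<partial>N \<partial>lborel)"
    by (rule P.Fubini'[symmetric]) measurable
  also have "\<dots> \<le> (\<integral>\<^sup>+s. \<integral>\<^sup>+x. ennreal (A * k / (k - 1)) * (g x * (h (k - 1) s * (if 0 < s \<and> ennreal s < 2 * g x then 1 else 0))) \<partial>N \<partial>lborel)"
  proof (rule nn_integral_mono)
    fix s :: real
    show "(\<integral>\<^sup>+x. h k s * (if 0 < s \<and> ennreal s < G x then 1 else 0) \<partial>N) \<le> (\<integral>\<^sup>+x. ennreal (A * k / (k - 1)) * (g x * (h (k - 1) s * (if 0 < s \<and> ennreal s < 2 * g x then 1 else 0))) \<partial>N)"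
    proof (cases "s > 0")
      case True
      have "(\<integral>\<^sup>+x. h k s * (if 0 < s \<and> ennreal s < G x then 1 else 0) \<partial>N) = h k s * (\<integral>\<^sup>+x. indicator {x\<in>space N. ennreal s < G x} x \<partial>N)"
        using True by (subst nn_integral_cmult[symmetric]) (auto intro!: nn_integral_cong simp: indicator_def)
      also have "\<dots> = h k s * emeasure N {x\<in>space N. ennreal s < G x}" using Gm by simp
      also have "\<dots> \<le> h k s * (ennreal (A / s) * (\<integral>\<^sup>+x. g x * indicator {x. ennreal s < 2 * g x} x \<partial>N))"
        by (intro mult_left_mono weak True) simp
      also have "h k s * (ennreal (A / s) * (\<integral>\<^sup>+x. g x * indicator {x. ennreal s < 2 * g x} x \<partial>N))
         = (ennreal (A * k / (k - 1)) * h (k - 1) s) * (\<integral>\<^sup>+x. g x * indicator {x. ennreal s < 2 * g x} x \<partial>N)"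
      proof -
        have "h k s * ennreal (A / s) = ennreal (A * k / (k - 1)) * h (k - 1) s"
        proof -
          have "s powr (k - 1) = s powr (k - 1 - 1) * s" using True powr_add[of s "k - 1 - 1" 1] by simp
          then have "k * s powr (k - 1) * (A / s) = A * k / (k - 1) * ((k - 1) * s powr (k - 1 - 1))" using True k by simp
          then show ?thesis unfolding h_def using True k A by (simp flip: ennreal_mult)
        qed
        then show ?thesis by (simp only: mult.assoc[symmetric])
      qed
      also have "\<dots> = (\<integral>\<^sup>+x. (ennreal (A * k / (k - 1)) * h (k - 1) s) * (g x * indicator {x. ennreal s < 2 * g x} x) \<partial>N)"
      proof (rule nn_integral_cmult[symmetric])
        have "(\<lambda>x. g x * (if ennreal s < 2 * g x then 1 else 0)) \<in> borel_measurable N" by measurable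
        then show "(\<lambda>x. g x * indicator {x. ennreal s < 2 * g x} x) \<in> borel_measurable N" by (simp add: indicator_def)
      qed
      also have "\<dots> = (\<integral>\<^sup>+x. ennreal (A * k / (k - 1)) * (g x * (h (k - 1) s * (if 0 < s \<and> ennreal s < 2 * g x then 1 else 0))) \<partial>N)"
        using True by (intro nn_integral_cong) (simp add: indicator_def mult_ac)
      finally show ?thesis .
    qed simp
  qed
  also have "\<dots> = (\<integral>\<^sup>+x. \<integral>\<^sup>+s. ennreal (A * k / (k - 1)) * (g x * (h (k - 1) s * (if 0 < s \<and> ennreal s < 2 * g x then 1 else 0))) \<partial>lborel \<partial>N)"
    by (rule P.Fubini') measurable
  also have "\<dots> = (\<integral>\<^sup>+x. ennreal (A * k / (k - 1)) * (g x * ennpowr (2 * g x) (k - 1)) \<partial>N)"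
  proof (rule nn_integral_cong)
    fix x
    have "(\<integral>\<^sup>+s. h (k - 1) s * (if 0 < s \<and> ennreal s < 2 * g x then 1 else 0) \<partial>lborel) = ennpowr (2 * g x) (k - 1)"
    proof -
      have "(\<integral>\<^sup>+s. h (k - 1) s * (if 0 < s \<and> ennreal s < 2 * g x then 1 else 0) \<partial>lborel)
        = (\<integral>\<^sup>+s. h (k - 1) s * indicator {s. 0 < s \<and> ennreal s < 2 * g x} s \<partial>lborel)"
        by (rule nn_integral_cong) (simp add: indicator_def)
      then show ?thesis using ennpowr_layer_cake[of "k - 1" "2 * g x"] k unfolding h_def by simp
    qed
    then show "(\<integral>\<^sup>+s. ennreal (A * k / (k - 1)) * (g x * (h (k - 1) s * (if 0 < s \<and> ennreal s < 2 * g x then 1 else 0))) \<partial>lborel)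
       = ennreal (A * k / (k - 1)) * (g x * ennpowr (2 * g x) (k - 1))"
      by (simp add: nn_integral_cmult)
  qed
  also have "\<dots> = (\<integral>\<^sup>+x. ennreal (A * k / (k - 1) * 2 powr (k - 1)) * ennpowr (g x) k \<partial>N)"
  proof -
    have "ennreal (A * k / (k - 1) * 2 powr (k - 1)) = ennreal (A * k / (k - 1)) * ennreal (2 powr (k - 1))"
      using A k by (intro ennreal_mult) auto
    then show ?thesis unfolding ennpowr_mult_eq[OF k] by (simp only: mult.assoc)
  qed
  also have "\<dots> = ennreal (A * k / (k - 1) * 2 powr (k - 1)) * (\<integral>\<^sup>+x. ennpowr (g x) k \<partial>N)"
  proof (rule nn_integral_cmult)
    have "(\<lambda>x. if g x = \<infinity> then \<infinity> else ennreal (enn2real (g x) powr k)) \<in> borel_measurable N" by measurable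
    then show "(\<lambda>x. ennpowr (g x) k) \<in> borel_measurable N" by (simp add: ennpowr_def[abs_def])
  qed
  finally show ?thesis .
qed

lemma sigma_finite_power_measure: "sigma_finite_measure (power_measure \<delta>)"
proof
  define A where "A = range (\<lambda>n::nat. {1 / real (Suc n)..real (Suc n)})"
  have "emeasure (power_measure \<delta>) {1 / real (Suc n)..real (Suc n)} \<noteq> \<infinity>" for n
  proof -
    let ?J = "{1 / real (Suc n)..real (Suc n)}"
    have J: "?J \<subseteq> {0<..}"
    proof
      fix z assume "z \<in> ?J"
      moreover have "0 < 1 / real (Suc n)" by simp
      ultimately show "z \<in> {0<..}" by (simp only: atLeastAtMost_iff greaterThan_iff) linarith
    qed
    have Jm: "?J \<in> sets (lebesgue_on {0<..})" using J by (subst sets_restrict_space_iff) auto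
    have "continuous_on ?J (\<lambda>z. z powr \<delta>)" using J by (intro continuous_intros) auto
    then have "bounded ((\<lambda>z. z powr \<delta>) ` ?J)" by (intro compact_imp_bounded compact_continuous_image) auto
    then obtain B where B: "\<And>z. z \<in> ?J \<Longrightarrow> z powr \<delta> \<le> B" unfolding bounded_real by force
    have "emeasure (power_measure \<delta>) ?J = (\<integral>\<^sup>+z. indicator ?J z \<partial>power_measure \<delta>)" using Jm by simp
    also have "\<dots> = (\<integral>\<^sup>+z. ennreal (z powr \<delta>) * indicator ?J z * indicator {0<..} z \<partial>lebesgue)"
      by (rule nn_integral_power_measure) (rule borel_measurable_indicator[OF Jm])
    also have "\<dots> \<le> (\<integral>\<^sup>+z. ennreal B * indicator ?J z \<partial>lebesgue)"
      by (rule nn_integral_mono) (use B in \<open>auto simp: indicator_def intro: ennreal_leI\<close>)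
    also have "\<dots> = ennreal B * emeasure lebesgue ?J"
      by (rule nn_integral_cmult_indicator) (rule sets_completionI_sets, simp)
    also have "\<dots> < \<infinity>"
    proof -
      have "emeasure lebesgue ?J \<noteq> \<infinity>"
        using fmeasurableD2[OF lmeasurable_cbox[of "1 / real (Suc n)" "real (Suc n)"]] by (simp only: box_real infinity_ennreal_def) simp
      then have "emeasure lebesgue ?J < top" by (simp only: infinity_ennreal_def top.not_eq_extremum)
      then show ?thesis by (simp only: ennreal_mult_less_top infinity_ennreal_def) simp
    qed
    finally show ?thesis by simp
  qed
  moreover have "{1 / real (Suc n)..real (Suc n)} \<in> sets (power_measure \<delta>)" for n
    by (simp, subst sets_restrict_space_iff) (auto intro: less_le_trans[of 0 "1 / real (Suc n)"])
  moreover have "\<Union>A = {0<..}"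
  proof
    show "{0<..} \<subseteq> \<Union>A"
    proof
      fix z :: real assume "z \<in> {0<..}"
      then have z: "z > 0" by simp
      obtain n where n: "max z (1 / z) \<le> real n" using real_arch_simple by blast
      then have "1 / z \<le> real (Suc n)" "z \<le> real (Suc n)" by auto
      then have "1 / real (Suc n) \<le> z" using z by (simp add: field_simps)
      then show "z \<in> \<Union>A" using \<open>z \<le> real (Suc n)\<close> unfolding A_def by auto
    qed
  qed (auto simp: A_def intro: less_le_trans[of 0 "1 / real (Suc _)"])
  ultimately show "\<exists>A. countable A \<and> A \<subseteq> sets (power_measure \<delta>) \<and> \<Union> A = space (power_measure \<delta>) \<and> (\<forall>a\<in>A. emeasure (power_measure \<delta>) a \<noteq> \<infinity>)"
    by (intro exI[of _ A]) (auto simp: A_def)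
qed

text \<open>The part of \<open>g\<close> not exceeding \<open>s / 2\<close> has all averages at most
  \<open>s / 2\<close>. Hence an average above \<open>s\<close> forces an average above
  \<open>s / 2\<close> of the remaining part.\<close>

lemma local_avg_truncate:
  assumes g: "g \<in> borel_measurable (lebesgue_on {0<..})" and s: "s > 0"
  shows "local_avg g x \<le> local_avg (\<lambda>z. g z * indicator {z. ennreal s < 2 * g z} z) x + ennreal (s / 2)"
  unfolding local_avg_def
proof (rule SUP_least)
  fix t assume "t \<in> {0<..<x / 2}"
  then have t: "0 < t" "t < x / 2" by auto
  let ?J = "{x - t..x + t}"
  let ?g1 = "\<lambda>z. g z * indicator {z. ennreal s < 2 * g z} z"
  have J: "?J \<subseteq> {0<..}" using t by auto
  have Jm: "?J \<in> sets lebesgue" by (rule sets_completionI_sets) simp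
  have g1m: "?g1 \<in> borel_measurable (lebesgue_on {0<..})"
  proof -
    note [measurable] = g
    have "(\<lambda>z. g z * (if ennreal s < 2 * g z then 1 else 0)) \<in> borel_measurable (lebesgue_on {0<..})" by measurable
    then show ?thesis by (simp add: indicator_def)
  qed
  have g1J: "(\<lambda>z. ?g1 z * indicator ?J z) \<in> borel_measurable lebesgue"
  proof -
    have "(\<lambda>z. ?g1 z * indicator {0<..} z) \<in> borel_measurable lebesgue"
      using g1m by (subst borel_measurable_restrict_space_iff_ennreal[symmetric]) auto
    then have "(\<lambda>z. (?g1 z * indicator {0<..} z) * indicator ?J z) \<in> borel_measurable lebesgue"
      using borel_measurable_indicator[OF Jm] by (rule borel_measurable_times_ennreal)
    moreover have "(\<lambda>z. (?g1 z * indicator {0<..} z) * indicator ?J z) = (\<lambda>z. ?g1 z * indicator ?J z)"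
      by (rule ext) (use J in \<open>auto simp: indicator_def\<close>)
    ultimately show ?thesis by simp
  qed
  have pt: "g z \<le> ?g1 z + ennreal (s / 2)" for z
  proof (cases "ennreal s < 2 * g z")
    case False
    then have "2 * g z \<le> ennreal s" by simp
    then have "2 * g z \<le> 2 * ennreal (s / 2)" using s by (simp flip: ennreal_numeral ennreal_mult)
    then have "g z \<le> ennreal (s / 2)" by (subst (asm) ennreal_mult_le_mult_iff) auto
    then show ?thesis using False by simp
  qed simp
  have "(\<integral>\<^sup>+z\<in>?J. g z \<partial>lebesgue) \<le> (\<integral>\<^sup>+z. ?g1 z * indicator ?J z + ennreal (s / 2) * indicator ?J z \<partial>lebesgue)"
    using pt by (intro nn_integral_mono) (auto simp: indicator_def)
  also have "\<dots> = (\<integral>\<^sup>+z\<in>?J. ?g1 z \<partial>lebesgue) + ennreal (s / 2) * ennreal (2 * t)"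
    using nn_integral_add[OF g1J, of "\<lambda>z. ennreal (s / 2) * indicator ?J z"] Jm t
    by (simp add: nn_integral_cmult_indicator)
  finally have "ennreal (1 / (2 * t)) * (\<integral>\<^sup>+z\<in>?J. g z \<partial>lebesgue) \<le> ennreal (1 / (2 * t)) * ((\<integral>\<^sup>+z\<in>?J. ?g1 z \<partial>lebesgue) + ennreal (s / 2) * ennreal (2 * t))"
    by (rule mult_left_mono) simp
  also have "\<dots> = ennreal (1 / (2 * t)) * (\<integral>\<^sup>+z\<in>?J. ?g1 z \<partial>lebesgue) + ennreal (s / 2)"
  proof -
    have "ennreal (1 / (2 * t)) * (ennreal (s / 2) * ennreal (2 * t)) = ennreal (s / 2)"
      using t s by (simp flip: ennreal_mult)
    then show ?thesis by (simp add: distrib_left)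
  qed
  also have "\<dots> \<le> (SUP t\<in>{0<..<x / 2}. ennreal (1 / (2 * t)) * (\<integral>\<^sup>+z\<in>{x - t..x + t}. ?g1 z \<partial>lebesgue)) + ennreal (s / 2)"
    using t by (intro add_right_mono SUP_upper) auto
  finally show "ennreal (1 / (2 * t)) * (\<integral>\<^sup>+z\<in>?J. g z \<partial>lebesgue)
     \<le> (SUP t\<in>{0<..<x / 2}. ennreal (1 / (2 * t)) * (\<integral>\<^sup>+z\<in>{x - t..x + t}. ?g1 z \<partial>lebesgue)) + ennreal (s / 2)" .
qed

text \<open>\<open>G\<close> stands for a measurable function below the maximal average, to which
  Fubini can be applied. Halving the level in \<open>local_avg_truncate\<close> turns the constant 2
  of the weak type estimate into 4.\<close>

theorem local_avg_strong_type:
  assumes g: "g \<in> borel_measurable (lebesgue_on {0<..})" and G: "G \<in> borel_measurable (lebesgue_on {0<..})"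
    and le: "\<And>x. x > 0 \<Longrightarrow> G x \<le> local_avg g x" and k: "k > 1"
  shows "(\<integral>\<^sup>+x. ennpowr (G x) k \<partial>power_measure \<delta>) \<le> ennreal (4 * 2 powr (2 * \<bar>\<delta>\<bar>) * k / (k - 1) * 2 powr (k - 1)) * (\<integral>\<^sup>+x. ennpowr (g x) k \<partial>power_measure \<delta>)"
proof (rule strong_type_from_weak[OF sigma_finite_power_measure _ _ _ k])
  show "G \<in> borel_measurable (power_measure \<delta>)" "g \<in> borel_measurable (power_measure \<delta>)"
    using g G by simp_all
  show "0 \<le> 4 * 2 powr (2 * \<bar>\<delta>\<bar>)" by simp
  fix s :: real assume s: "s > 0"
  let ?g1 = "\<lambda>z. g z * indicator {z. ennreal s < 2 * g z} z"
  have g1m: "?g1 \<in> borel_measurable (lebesgue_on {0<..})"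
  proof -
    note [measurable] = g
    have "(\<lambda>z. g z * (if ennreal s < 2 * g z then 1 else 0)) \<in> borel_measurable (lebesgue_on {0<..})" by measurable
    then show ?thesis by (simp add: indicator_def)
  qed
  have s2: "s / 2 > 0" using s by simp
  obtain V where V: "V \<in> sets (power_measure \<delta>)" "{x\<in>{0<..}. local_avg ?g1 x > ennreal (s / 2)} \<subseteq> V"
    "emeasure (power_measure \<delta>) V \<le> ennreal (2 * 2 powr (2 * \<bar>\<delta>\<bar>) / (s / 2)) * (\<integral>\<^sup>+z. ?g1 z \<partial>power_measure \<delta>)"
    by (rule local_avg_weak_type[OF g1m s2]) (rule that)
  have "{x \<in> space (power_measure \<delta>). ennreal s < G x} \<subseteq> V"
  proof (rule subset_trans[OF _ V(2)], rule subsetI)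
    fix x assume "x \<in> {x \<in> space (power_measure \<delta>). ennreal s < G x}"
    then have x: "x > 0" "ennreal s < G x" by auto
    have "ennreal (s / 2) + ennreal (s / 2) = ennreal s" using s by (simp flip: ennreal_plus)
    then have "ennreal (s / 2) + ennreal (s / 2) < local_avg ?g1 x + ennreal (s / 2)"
      using less_le_trans[OF x(2) order.trans[OF le[OF x(1)] local_avg_truncate[OF g s]]] by simp
    then have "ennreal (s / 2) < local_avg ?g1 x" by (meson add_right_mono not_le)
    then show "x \<in> {x\<in>{0<..}. local_avg ?g1 x > ennreal (s / 2)}" using x by simp
  qed
  then have "emeasure (power_measure \<delta>) {x \<in> space (power_measure \<delta>). ennreal s < G x} \<le> emeasure (power_measure \<delta>) V"
    using V(1) by (rule emeasure_mono)
  also note V(3)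
  finally show "emeasure (power_measure \<delta>) {x \<in> space (power_measure \<delta>). ennreal s < G x}
     \<le> ennreal (4 * 2 powr (2 * \<bar>\<delta>\<bar>) / s) * (\<integral>\<^sup>+x. ?g1 x \<partial>power_measure \<delta>)" by simp
qed

section \<open>The truncated maximal operator\<close>

text \<open>A Lebesgue measurable function is changed on a null set so that joint Borel
  measurability in \<open>t\<close>, \<open>x\<close>, \<open>z\<close> becomes available for
  integrals depending on parameters. The integrals do not see the change.\<close>

lemma borel_representative:
  fixes f :: "real \<Rightarrow> complex"
  assumes "f \<in> borel_measurable (lebesgue_on {0<..})"
  obtains g where "g \<in> borel_measurable borel" "AE z in lborel. z > 0 \<longrightarrow> f z = g z"
proof -
  let ?h = "\<lambda>z. indicator {0<..} z *\<^sub>R f z"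
  have h: "?h \<in> borel_measurable lebesgue"
    using assms by (subst (asm) borel_measurable_restrict_space_iff) auto
  have hr: "(\<lambda>z. Re (?h z)) \<in> borel_measurable lebesgue" by (rule measurable_compose[OF h borel_measurable_Re])
  have hi: "(\<lambda>z. Im (?h z)) \<in> borel_measurable lebesgue" by (rule measurable_compose[OF h borel_measurable_Im])
  obtain a where a: "a \<in> borel_measurable lborel" "AE z in lborel. Re (?h z) = a z"
    using completion_ex_borel_measurable_real[OF hr] by blast
  obtain b where b: "b \<in> borel_measurable lborel" "AE z in lborel. Im (?h z) = b z"
    using completion_ex_borel_measurable_real[OF hi] by blast
  have ab [measurable]: "a \<in> borel_measurable borel" "b \<in> borel_measurable borel" using a(1) b(1) by simp_all
  show thesis
  proof (rule that[of "\<lambda>z. complex_of_real (a z) + \<i> * complex_of_real (b z)"])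
    show "(\<lambda>z. complex_of_real (a z) + \<i> * complex_of_real (b z)) \<in> borel_measurable borel" by measurable
    show "AE z in lborel. z > 0 \<longrightarrow> f z = complex_of_real (a z) + \<i> * complex_of_real (b z)"
      using a(2) b(2) by eventually_elim (auto simp: complex_eq_iff)
  qed
qed

text \<open>The majorants may vary with \<open>n\<close> as long as their integrals converge. This
  is what continuity in \<open>t\<close> requires for \<open>\<alpha> + \<beta> < 1 / 2\<close>,
  where the kernel is unbounded at \<open>\<bar>x - z\<bar> = t\<close> and the singularity moves
  with \<open>t\<close>.\<close>

lemma generalized_dominated_convergence:
  fixes f :: "'a \<Rightarrow> 'b::{banach, second_countable_topology}" and D :: "nat \<Rightarrow> 'a \<Rightarrow> real"
  assumes meas [measurable]: "f \<in> borel_measurable N" "\<And>n. F n \<in> borel_measurable N"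
    and D: "\<And>n. integrable N (D n)" "integrable N d"
    and lim: "AE x in N. (\<lambda>n. F n x) \<longlonglongrightarrow> f x" "AE x in N. (\<lambda>n. D n x) \<longlonglongrightarrow> d x"
    and limD: "(\<lambda>n. \<integral>x. D n x \<partial>N) \<longlonglongrightarrow> (\<integral>x. d x \<partial>N)"
    and bound: "\<And>n. AE x in N. norm (F n x) \<le> D n x"
  shows "(\<lambda>n. \<integral>x. F n x \<partial>N) \<longlonglongrightarrow> (\<integral>x. f x \<partial>N)"
proof -
  have bd: "AE x in N. \<forall>n. norm (F n x) \<le> D n x" using bound by (simp add: AE_all_countable)
  have fd: "AE x in N. norm (f x) \<le> d x"
    using lim bd
  proof eventually_elim
    case (elim x)
    show ?case by (rule LIMSEQ_le[OF tendsto_norm[OF elim(1)] elim(2)]) (use elim(3) in auto)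
  qed
  have Fi: "integrable N (F n)" for n
    by (rule Bochner_Integration.integrable_bound[OF D(1)[of n] meas(2)]) (use bound[of n] in eventually_elim, auto)
  have fi: "integrable N f"
    by (rule Bochner_Integration.integrable_bound[OF D(2) meas(1)]) (use fd in eventually_elim, auto)
  have Dm [measurable]: "D n \<in> borel_measurable N" "d \<in> borel_measurable N" for n using D by auto
  let ?E = "\<lambda>n x. norm (F n x - f x)"
  have Ei: "integrable N (?E n)" for n using Fi fi by (intro integrable_norm Bochner_Integration.integrable_diff)
  have mi: "(\<lambda>n. \<integral>x. min (?E n x) (2 * d x) \<partial>N) \<longlonglongrightarrow> (\<integral>x. 0 \<partial>N)"
  proof (rule integral_dominated_convergence[where w = "\<lambda>x. 2 * d x"])
    show "integrable N (\<lambda>x. 2 * d x)" using D(2) by simp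
    show "AE x in N. (\<lambda>n. min (?E n x) (2 * d x)) \<longlonglongrightarrow> 0"
      using lim(1) fd
    proof eventually_elim
      case (elim x)
      have "(\<lambda>n. F n x - f x) \<longlonglongrightarrow> f x - f x" by (intro tendsto_diff elim tendsto_const)
      then have "(\<lambda>n. ?E n x) \<longlonglongrightarrow> 0" using tendsto_norm_zero by fastforce
      then have "(\<lambda>n. min (?E n x) (2 * d x)) \<longlonglongrightarrow> min 0 (2 * d x)" by (intro tendsto_min tendsto_const)
      moreover have "0 \<le> d x" by (rule order.trans[OF norm_ge_zero elim(2)])
      ultimately show ?case by (simp add: min_def)
    qed
    show "AE x in N. norm (min (?E n x) (2 * d x)) \<le> 2 * d x" for n
      using fd
    proof eventually_elim
      case (elim x)
      have "0 \<le> d x" by (rule order.trans[OF norm_ge_zero elim])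
      then show ?case by (simp add: min_def)
    qed
  qed measurable
  have pi: "(\<lambda>n. \<integral>x. max 0 (d x - D n x) \<partial>N) \<longlonglongrightarrow> (\<integral>x. 0 \<partial>N)"
  proof (rule integral_dominated_convergence[where w = d])
    show "AE x in N. (\<lambda>n. max 0 (d x - D n x)) \<longlonglongrightarrow> 0"
      using lim(2)
    proof eventually_elim
      case (elim x)
      have "(\<lambda>n. max 0 (d x - D n x)) \<longlonglongrightarrow> max 0 (d x - d x)" by (intro tendsto_max tendsto_diff elim tendsto_const)
      then show ?case by simp
    qed
    show "AE x in N. norm (max 0 (d x - D n x)) \<le> d x" for n
      using fd bd
    proof eventually_elim
      case (elim x)
      have "0 \<le> d x" "0 \<le> D n x" by (rule order.trans[OF norm_ge_zero elim(1)], rule order.trans[OF norm_ge_zero elim(2)[rule_format]])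
      then show ?case by (simp add: max_def)
    qed
  qed (use D in measurable)
  have mint: "integrable N (\<lambda>x. min (?E n x) (2 * d x))" "integrable N (\<lambda>x. max 0 (d x - D n x))" for n
    using Ei D by (auto intro!: integrable_min integrable_max)
  \<comment> \<open>Pointwise: if the error is at most \<open>2 * d\<close>, the other two terms add
    up to the positive part of \<open>D n - d\<close>; otherwise the error is at most
    \<open>D n + d = 2 * d + (D n - d)\<close>. The outer integrals tend to 0 by ordinary dominated
    convergence and the middle term by \<open>limD\<close>.\<close>
  have le: "(\<integral>x. ?E n x \<partial>N) \<le> (\<integral>x. min (?E n x) (2 * d x) \<partial>N) + ((\<integral>x. D n x \<partial>N) - (\<integral>x. d x \<partial>N)) + (\<integral>x. max 0 (d x - D n x) \<partial>N)" for n
  proof -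
    have "(\<integral>x. ?E n x \<partial>N) \<le> (\<integral>x. min (?E n x) (2 * d x) + (D n x - d x) + max 0 (d x - D n x) \<partial>N)"
    proof (rule integral_mono_AE[OF Ei])
      show "integrable N (\<lambda>x. min (?E n x) (2 * d x) + (D n x - d x) + max 0 (d x - D n x))"
        by (intro Bochner_Integration.integrable_add Bochner_Integration.integrable_diff mint D)
      show "AE x in N. ?E n x \<le> min (?E n x) (2 * d x) + (D n x - d x) + max 0 (d x - D n x)"
        using fd bd
      proof eventually_elim
        case (elim x)
        have "?E n x \<le> D n x + d x"
          using norm_triangle_ineq4[of "F n x" "f x"] elim(1) elim(2)[rule_format, of n] by linarith
        then show ?case by (simp add: min_def max_def)
      qed
    qed
    also have "\<dots> = (\<integral>x. min (?E n x) (2 * d x) \<partial>N) + ((\<integral>x. D n x \<partial>N) - (\<integral>x. d x \<partial>N)) + (\<integral>x. max 0 (d x - D n x) \<partial>N)"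
      using mint D by (simp add: Bochner_Integration.integral_add Bochner_Integration.integral_diff)
    finally show ?thesis .
  qed
  have "(\<lambda>n. (\<integral>x. min (?E n x) (2 * d x) \<partial>N) + ((\<integral>x. D n x \<partial>N) - (\<integral>x. d x \<partial>N)) + (\<integral>x. max 0 (d x - D n x) \<partial>N)) \<longlonglongrightarrow> 0 + ((\<integral>x. d x \<partial>N) - (\<integral>x. d x \<partial>N)) + 0"
    using mi pi by (intro tendsto_add tendsto_diff limD tendsto_const) simp_all
  then have R: "(\<lambda>n. (\<integral>x. min (?E n x) (2 * d x) \<partial>N) + ((\<integral>x. D n x \<partial>N) - (\<integral>x. d x \<partial>N)) + (\<integral>x. max 0 (d x - D n x) \<partial>N)) \<longlonglongrightarrow> 0"
    by simp
  have "(\<lambda>n. (\<integral>x. F n x \<partial>N) - (\<integral>x. f x \<partial>N)) \<longlonglongrightarrow> 0"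
  proof (rule Lim_null_comparison[OF _ R], rule always_eventually, rule allI)
    fix n
    have "norm ((\<integral>x. F n x \<partial>N) - (\<integral>x. f x \<partial>N)) = norm (\<integral>x. F n x - f x \<partial>N)"
      using Fi fi by (simp add: Bochner_Integration.integral_diff)
    also have "\<dots> \<le> (\<integral>x. ?E n x \<partial>N)" by (rule integral_norm_bound)
    also note le[of n]
    finally show "norm ((\<integral>x. F n x \<partial>N) - (\<integral>x. f x \<partial>N)) \<le> (\<integral>x. min (?E n x) (2 * d x) \<partial>N) + ((\<integral>x. D n x \<partial>N) - (\<integral>x. d x \<partial>N)) + (\<integral>x. max 0 (d x - D n x) \<partial>N)" .
  qed
  then show ?thesis by (rule LIM_zero_cancel)
qed

section \<open>Averages against the profile of the kernel\<close>

definition bump :: "real \<Rightarrow> real \<Rightarrow> real" where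
  "bump c u = (if \<bar>u\<bar> < 1 then (1 - u\<^sup>2) powr c else 0)"

lemma bump_nonneg [simp]: "0 \<le> bump c u"
  by (simp add: bump_def)

lemma bump_measurable [measurable]: "bump c \<in> borel_measurable borel"
  unfolding bump_def[abs_def] by measurable

lemma bump_powr: "p > 0 \<Longrightarrow> bump c u powr p = bump (c * p) u"
  by (simp add: bump_def powr_powr)

lemma bump_le_1: "c \<ge> 0 \<Longrightarrow> bump c u \<le> 1"
proof -
  assume c: "c \<ge> 0"
  have "(1 - u\<^sup>2) powr c \<le> 1 powr c" if "\<bar>u\<bar> < 1"
  proof (rule powr_mono2[OF c])
    show "0 \<le> 1 - u\<^sup>2" using that by (simp add: abs_square_le_1 less_imp_le)
  qed simp
  then show ?thesis by (simp add: bump_def)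
qed

lemma bump_scale_0: "t > 0 \<Longrightarrow> t \<le> \<bar>y\<bar> \<Longrightarrow> bump c (y / t) = 0"
  by (simp add: bump_def)

lemma isCont_bump_scale:
  assumes "t > 0" "\<bar>y\<bar> \<noteq> t"
  shows "isCont (\<lambda>t. bump c (y / t)) t"
proof (cases "\<bar>y\<bar> < t")
  case True
  have "\<forall>\<^sub>F s in nhds t. bump c (y / s) = (1 - (y / s)\<^sup>2) powr c"
    using eventually_nhds_in_open[of "{\<bar>y\<bar><..}" t] True
    by (auto elim!: eventually_mono simp: bump_def)
  moreover have "(y / t)\<^sup>2 < 1" using True assms by (simp add: abs_square_less_1)
  then have "isCont (\<lambda>s. (1 - (y / s)\<^sup>2) powr c) t" using assms by (intro continuous_intros) auto
  ultimately show ?thesis by (subst isCont_cong) auto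
next
  case False
  then have "\<forall>\<^sub>F s in nhds t. bump c (y / s) = 0"
    using eventually_nhds_in_open[of "{0<..<\<bar>y\<bar>}" t] assms
    by (auto elim!: eventually_mono simp: bump_def)
  then show ?thesis by (subst isCont_cong[of _ "\<lambda>_. 0"]) auto
qed

text \<open>\<open>1 - u\<^sup>2\<close> factors into \<open>1 - u\<close> and \<open>1 + u\<close>.
  For negative \<open>c\<close> the factor that is at least 1 may be dropped, which leaves an
  integrable endpoint power; for \<open>c \<ge> 0\<close> the profile is bounded.\<close>

lemma bump_integrable:
  assumes "c > -1"
  shows "integrable lborel (bump c)"
proof -
  define h where "h = (\<lambda>y::real. indicator {0<..1} y *\<^sub>R y powr c)"
  have h: "integrable lborel h"
    using set_integrable_powr_0[of c 1] assms by (simp add: h_def set_integrable_def)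
  have i: "integrable lborel (\<lambda>u::real. indicator {-1..1} u *\<^sub>R (1::real))"
    using finite_measure.integrable_const by (simp add: integrable_real_indicator)
  have h1: "integrable lborel (\<lambda>u. h (1 + (-1) * u))" by (rule lborel_integrable_real_affine[OF h]) simp
  have h2: "integrable lborel (\<lambda>u. h (1 + 1 * u))" by (rule lborel_integrable_real_affine[OF h]) simp
  show ?thesis
  proof (rule Bochner_Integration.integrable_bound[OF Bochner_Integration.integrable_add[OF i Bochner_Integration.integrable_add[OF h1 h2]]])
    show "bump c \<in> borel_measurable lborel" by simp
    show "AE u in lborel. norm (bump c u) \<le> norm (indicator {-1..1} u *\<^sub>R 1 + (h (1 + (-1) * u) + h (1 + 1 * u)))"
    proof (rule AE_I2)
      fix u :: real
      have hn: "h y \<ge> 0" for y by (simp add: h_def)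
      have "bump c u \<le> indicator {-1..1} u *\<^sub>R 1 + (h (1 + (-1) * u) + h (1 + 1 * u))"
      proof (cases "\<bar>u\<bar> < 1")
        case u: True
        show ?thesis
        proof (cases "c \<ge> 0")
          case True
          then show ?thesis using bump_le_1[OF True, of u] u hn[of "1 + (-1) * u"] hn[of "1 + 1 * u"] by (auto simp: indicator_def)
        next
          case False
          have sq: "1 - u\<^sup>2 = (1 - u) * (1 + u)" by (simp add: power2_eq_square algebra_simps)
          show ?thesis
          proof (cases "u \<ge> 0")
            case True
            have "(1 - u) * 1 \<le> (1 - u) * (1 + u)" using True u by (intro mult_left_mono) auto
            then have "(1 - u\<^sup>2) powr c \<le> (1 - u) powr c" unfolding sq using False u by (intro powr_mono2') auto
            then have "bump c u \<le> h (1 - u)" using True u by (simp add: bump_def h_def)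
            then show ?thesis using u hn[of "1 + u"] by (simp add: indicator_def)
          next
            case neg: False
            have "1 * (1 + u) \<le> (1 - u) * (1 + u)" using neg u by (intro mult_right_mono) auto
            then have "(1 - u\<^sup>2) powr c \<le> (1 + u) powr c" unfolding sq using False u by (intro powr_mono2') auto
            then have "bump c u \<le> h (1 + u)" using neg u by (simp add: bump_def h_def)
            then show ?thesis using u hn[of "1 - u"] by (simp add: indicator_def)
          qed
        qed
      qed (use hn[of "1 + (-1) * u"] hn[of "1 + 1 * u"] in \<open>simp add: bump_def\<close>)
      then show "norm (bump c u) \<le> norm (indicator {-1..1} u *\<^sub>R 1 + (h (1 + (-1) * u) + h (1 + 1 * u)))" by simp
    qed
  qed
qed

lemma bump_scale_integral:
  assumes "c > -1" "t > 0"
  shows "integrable lborel (\<lambda>z. bump c ((x - z) / t))"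
    "(LINT z|lborel. bump c ((x - z) / t)) = t * (LINT u|lborel. bump c u)"
proof -
  have e: "(x - z) / t = x / t + (- 1 / t) * z" for z by (simp add: diff_divide_distrib)
  have "has_bochner_integral lborel (bump c) (LINT u|lborel. bump c u)"
    by (rule has_bochner_integral_integrable[OF bump_integrable[OF assms(1)]])
  then have "has_bochner_integral lborel (\<lambda>z. bump c (x / t + (- 1 / t) * z)) ((LINT u|lborel. bump c u) /\<^sub>R \<bar>- 1 / t\<bar>)"
    using assms by (subst (asm) lborel_has_bochner_integral_real_affine_iff[where c = "- 1 / t" and t = "x / t"]) auto
  then have "has_bochner_integral lborel (\<lambda>z. bump c ((x - z) / t)) (t * (LINT u|lborel. bump c u))"
    unfolding e using assms by simp
  then show "integrable lborel (\<lambda>z. bump c ((x - z) / t))" "(LINT z|lborel. bump c ((x - z) / t)) = t * (LINT u|lborel. bump c u)"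
    by (auto simp: has_bochner_integral_iff)
qed

lemma local_avg_cong_AE:
  assumes "AE z in lborel. z > 0 \<longrightarrow> a z = b z"
  shows "local_avg a x = local_avg b x"
  unfolding local_avg_def nn_integral_completion
proof (rule SUP_cong[OF refl])
  fix t assume t: "t \<in> {0<..<x / 2}"
  have "(\<integral>\<^sup>+z\<in>{x - t..x + t}. a z \<partial>lborel) = (\<integral>\<^sup>+z\<in>{x - t..x + t}. b z \<partial>lborel)"
    by (rule nn_integral_cong_AE) (use assms in eventually_elim, use t in \<open>auto simp: indicator_def\<close>)
  then show "ennreal (1 / (2 * t)) * (\<integral>\<^sup>+z\<in>{x - t..x + t}. a z \<partial>lborel) = ennreal (1 / (2 * t)) * (\<integral>\<^sup>+z\<in>{x - t..x + t}. b z \<partial>lborel)"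
    by simp
qed

lemma integral_le_local_avg:
  assumes "0 < t" "t < x / 2"
  shows "(\<integral>\<^sup>+z\<in>{x - t..x + t}. g z \<partial>lborel) \<le> ennreal (2 * t) * local_avg g x"
proof -
  have "ennreal (1 / (2 * t)) * (\<integral>\<^sup>+z\<in>{x - t..x + t}. g z \<partial>lborel) \<le> local_avg g x"
    unfolding local_avg_def nn_integral_completion by (rule SUP_upper) (use assms in auto)
  then have "ennreal (2 * t) * (ennreal (1 / (2 * t)) * (\<integral>\<^sup>+z\<in>{x - t..x + t}. g z \<partial>lborel)) \<le> ennreal (2 * t) * local_avg g x"
    by (rule mult_left_mono) simp
  moreover have "ennreal (2 * t) * ennreal (1 / (2 * t)) = 1" using assms by (simp flip: ennreal_mult)
  ultimately show ?thesis by (simp add: mult.assoc[symmetric])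
qed

lemma bump_average_bounded:
  assumes c: "c \<ge> 0" and t: "0 < t" "t < x / 2" and \<phi>: "\<phi> \<in> borel_measurable borel" "\<And>z. \<phi> z \<ge> 0"
  shows "(\<integral>\<^sup>+z. ennreal (bump c ((x - z) / t) / t * \<phi> z) \<partial>lborel) \<le> 2 * local_avg (\<lambda>z. ennreal (\<phi> z)) x"
proof -
  note [measurable] = \<phi>(1)
  have "(\<integral>\<^sup>+z. ennreal (bump c ((x - z) / t) / t * \<phi> z) \<partial>lborel) \<le> (\<integral>\<^sup>+z. ennreal (1 / t) * (ennreal (\<phi> z) * indicator {x - t..x + t} z) \<partial>lborel)"
  proof (rule nn_integral_mono)
    fix z
    show "ennreal (bump c ((x - z) / t) / t * \<phi> z) \<le> ennreal (1 / t) * (ennreal (\<phi> z) * indicator {x - t..x + t} z)"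
    proof (cases "\<bar>x - z\<bar> < t")
      case True
      have "bump c ((x - z) / t) / t * \<phi> z \<le> 1 / t * \<phi> z"
        using bump_le_1[OF c] t \<phi>(2) by (intro mult_right_mono divide_right_mono) auto
      moreover have "z \<in> {x - t..x + t}" using True by auto
      ultimately show ?thesis using t \<phi>(2) by (simp add: ennreal_leI flip: ennreal_mult)
    next
      case False
      then have "bump c ((x - z) / t) = 0" using t by (intro bump_scale_0) auto
      then show ?thesis by simp
    qed
  qed
  also have "\<dots> = ennreal (1 / t) * (\<integral>\<^sup>+z\<in>{x - t..x + t}. ennreal (\<phi> z) \<partial>lborel)"
    by (rule nn_integral_cmult) measurable
  also have "\<dots> \<le> ennreal (1 / t) * (ennreal (2 * t) * local_avg (\<lambda>z. ennreal (\<phi> z)) x)"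
    by (intro mult_left_mono integral_le_local_avg t) simp
  also have "\<dots> = 2 * local_avg (\<lambda>z. ennreal (\<phi> z)) x"
  proof -
    have "ennreal (1 / t) * ennreal (2 * t) = 2" using t by (simp flip: ennreal_mult)
    then show ?thesis by (simp add: mult.assoc[symmetric])
  qed
  finally show ?thesis .
qed

text \<open>Young's inequality is applied pointwise after scaling the function by a free level
  \<open>m\<close>. Choosing \<open>m\<close> at the size of the power mean makes both terms of
  order \<open>m\<close>, and the resulting bound is that of Hoelder's inequality.\<close>

lemma bump_average_power:
  fixes c r q :: real
  assumes r: "r > 1" "q > 1" "1 / q + 1 / r = 1" and cq: "c * q > -1"
    and t: "0 < t" "t < x / 2" and \<phi>: "\<phi> \<in> borel_measurable borel" "\<And>z. \<phi> z \<ge> 0"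
  shows "(\<integral>\<^sup>+z. ennreal (bump c ((x - z) / t) / t * \<phi> z) \<partial>lborel)
     \<le> ennreal ((LINT u|lborel. bump (c * q) u) + 2) * ennpowr (local_avg (\<lambda>z. ennreal (\<phi> z powr r)) x) (1 / r)"
proof -
  note [measurable] = \<phi>(1)
  define N where "N = (LINT u|lborel. bump (c * q) u)"
  have N: "N \<ge> 0" unfolding N_def by (rule Bochner_Integration.integral_nonneg) simp
  define L where "L = local_avg (\<lambda>z. ennreal (\<phi> z powr r)) x"
  have main: "(\<integral>\<^sup>+z. ennreal (bump c ((x - z) / t) / t * \<phi> z) \<partial>lborel) \<le> ennreal (N + 2) * ennpowr L (1 / r)"
  proof (cases L)
    case top
    have "ennreal (N + 2) * ennpowr L (1 / r) = \<infinity>" using N unfolding top ennpowr_def by (simp add: ennreal_mult_top)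
    then show ?thesis by simp
  next
    case (real l)
    show ?thesis
    proof (rule ennreal_le_epsilon)
      fix d :: real assume d: "d > 0"
      \<comment> \<open>The shift keeps \<open>m\<close> positive when \<open>l = 0\<close>;
        multiplied by \<open>N + 2\<close> in the final estimate it costs exactly
        \<open>d\<close>.\<close>
      define m where "m = l powr (1 / r) + d / (N + 2)"
      have "0 < d / (N + 2)" using d N by simp
      then have m: "m > 0" "l powr (1 / r) \<le> m" unfolding m_def using powr_ge_zero[of l "1 / r"] by linarith+
      have lm: "l \<le> m powr r"
      proof -
        have "(l powr (1 / r)) powr r \<le> m powr r" using m r by (intro powr_mono2) auto
        then show ?thesis using r real(1) by (simp add: powr_powr)
      qed
      have pt: "bump c ((x - z) / t) / t * \<phi> z \<le> (m / t) * bump (c * q) ((x - z) / t) + (m / t * m powr (- r)) * (\<phi> z powr r * indicator {x - t..x + t} z)" for z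
      proof (cases "\<bar>x - z\<bar> < t")
        case True
        let ?a = "bump c ((x - z) / t)"
        let ?b = "\<phi> z / m"
        have b: "?b \<ge> 0" using m \<phi>(2) by simp
        have "?a * ?b \<le> ?a powr q / q + ?b powr r / r"
          by (rule Youngs_inequality) (use r b in auto)
        also have "\<dots> \<le> ?a powr q / 1 + ?b powr r / 1"
          by (intro add_mono divide_left_mono) (use r in auto)
        also have "\<dots> = bump (c * q) ((x - z) / t) + m powr (- r) * \<phi> z powr r"
        proof -
          have "?b powr r = m powr (- r) * \<phi> z powr r" 
            unfolding powr_divide[of "\<phi> z" m r] powr_minus by (simp add: divide_inverse)
          moreover have "?a powr q = bump (c * q) ((x - z) / t)" using r by (intro bump_powr) simp
          ultimately show ?thesis by simp
        qed
        finally have "(m / t) * (?a * ?b) \<le> (m / t) * (bump (c * q) ((x - z) / t) + m powr (- r) * \<phi> z powr r)"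
          using m t by (intro mult_left_mono) auto
        moreover have "(m / t) * (?a * ?b) = ?a / t * \<phi> z" using m by simp
        moreover have "z \<in> {x - t..x + t}" using True by auto
        ultimately show ?thesis by (simp add: distrib_left mult.assoc)
      next
        case False
        then have "bump c ((x - z) / t) = 0" using t by (intro bump_scale_0) auto
        then show ?thesis using m t by simp
      qed
      have "(\<integral>\<^sup>+z. ennreal (bump c ((x - z) / t) / t * \<phi> z) \<partial>lborel)
        \<le> (\<integral>\<^sup>+z. ennreal (m / t) * ennreal (bump (c * q) ((x - z) / t)) + ennreal (m / t * m powr (- r)) * (ennreal (\<phi> z powr r) * indicator {x - t..x + t} z) \<partial>lborel)"
      proof (rule nn_integral_mono)
        fix z
        have i: "ennreal (\<phi> z powr r) * indicator {x - t..x + t} z = ennreal (\<phi> z powr r * indicator {x - t..x + t} z)"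
          by (simp add: indicator_def)
        have "ennreal (bump c ((x - z) / t) / t * \<phi> z) \<le> ennreal ((m / t) * bump (c * q) ((x - z) / t) + (m / t * m powr (- r)) * (\<phi> z powr r * indicator {x - t..x + t} z))"
          by (rule ennreal_leI[OF pt])
        also have "\<dots> = ennreal (m / t) * ennreal (bump (c * q) ((x - z) / t)) + ennreal (m / t * m powr (- r)) * (ennreal (\<phi> z powr r) * indicator {x - t..x + t} z)"
        proof -
          have gen: "ennreal (a * b + a' * b') = ennreal a * ennreal b + ennreal a' * ennreal b'" if "a \<ge> 0" "b \<ge> 0" "a' \<ge> 0" "b' \<ge> 0" for a b a' b'
            using that by (simp add: ennreal_plus ennreal_mult)
          show ?thesis unfolding i by (rule gen) (use m t in auto)
        qed
        finally show "ennreal (bump c ((x - z) / t) / t * \<phi> z) \<le> ennreal (m / t) * ennreal (bump (c * q) ((x - z) / t)) + ennreal (m / t * m powr (- r)) * (ennreal (\<phi> z powr r) * indicator {x - t..x + t} z)" .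
      qed
      also have "\<dots> = (\<integral>\<^sup>+z. ennreal (m / t) * ennreal (bump (c * q) ((x - z) / t)) \<partial>lborel) + (\<integral>\<^sup>+z. ennreal (m / t * m powr (- r)) * (ennreal (\<phi> z powr r) * indicator {x - t..x + t} z) \<partial>lborel)"
        by (rule nn_integral_add) measurable
      also have "(\<integral>\<^sup>+z. ennreal (m / t) * ennreal (bump (c * q) ((x - z) / t)) \<partial>lborel) = ennreal (m / t) * (\<integral>\<^sup>+z. ennreal (bump (c * q) ((x - z) / t)) \<partial>lborel)"
        by (rule nn_integral_cmult) measurable
      also have "(\<integral>\<^sup>+z. ennreal (bump (c * q) ((x - z) / t)) \<partial>lborel) = ennreal (t * N)"
        unfolding N_def bump_scale_integral(2)[OF cq t(1), of x, symmetric]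
        by (rule nn_integral_eq_integral[OF bump_scale_integral(1)[OF cq t(1)]]) simp
      also have "(\<integral>\<^sup>+z. ennreal (m / t * m powr (- r)) * (ennreal (\<phi> z powr r) * indicator {x - t..x + t} z) \<partial>lborel) = ennreal (m / t * m powr (- r)) * (\<integral>\<^sup>+z\<in>{x - t..x + t}. ennreal (\<phi> z powr r) \<partial>lborel)"
        by (rule nn_integral_cmult) measurable
      also have "ennreal (m / t) * ennreal (t * N) + ennreal (m / t * m powr (- r)) * (\<integral>\<^sup>+z\<in>{x - t..x + t}. ennreal (\<phi> z powr r) \<partial>lborel)
         \<le> ennreal (m / t) * ennreal (t * N) + ennreal (m / t * m powr (- r)) * (ennreal (2 * t) * ennreal l)"
        using integral_le_local_avg[OF t, of "\<lambda>z. ennreal (\<phi> z powr r)"] unfolding L_def[symmetric] real(2)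
        by (intro add_left_mono mult_left_mono) auto
      also have "\<dots> = ennreal (m * N + 2 * m * (m powr (- r) * l))"
        using m t N real(1) by (simp add: mult_ac flip: ennreal_mult ennreal_plus)
      also have "\<dots> \<le> ennreal (m * N + 2 * m * 1)"
      proof (intro ennreal_leI add_left_mono mult_left_mono)
        have "m powr (- r) * l \<le> m powr (- r) * m powr r" using lm by (intro mult_left_mono) auto
        also have "\<dots> = 1" using m by (simp flip: powr_add)
        finally show "m powr (- r) * l \<le> 1" .
      qed (use m in simp)
      also have "m * N + 2 * m * 1 = (N + 2) * l powr (1 / r) + d"
      proof -
        have "m * N + 2 * m * 1 = (N + 2) * m" by (simp add: algebra_simps)
        also have "\<dots> = (N + 2) * l powr (1 / r) + (N + 2) * (d / (N + 2))" unfolding m_def by (rule distrib_left)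
        also have "(N + 2) * (d / (N + 2)) = d" using N by simp
        finally show ?thesis .
      qed
      also have "ennreal ((N + 2) * l powr (1 / r) + d) = ennreal (N + 2) * ennpowr L (1 / r) + ennreal d"
        using N d real by (simp add: ennpowr_def ennreal_plus ennreal_mult)
      finally show "(\<integral>\<^sup>+z. ennreal (bump c ((x - z) / t) / t * \<phi> z) \<partial>lborel) \<le> ennreal (N + 2) * ennpowr L (1 / r) + ennreal d" .
    qed
  qed
  then show ?thesis unfolding N_def L_def .
qed

section \<open>The kernel against the density of the measure\<close>

text \<open>Used with \<open>m = \<alpha> + \<beta>\<close> and \<open>a = \<alpha> + 1 / 2\<close>,
  so that \<open>z powr (2 * a)\<close> is the density of the measure. The powers of
  \<open>x\<close> and \<open>z\<close> then combine to \<open>(z / x) powr a\<close>, which is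
  bounded on the support.\<close>

lemma kernel_power_identity:
  fixes a m t y x z :: real
  assumes "0 < t" "\<bar>y\<bar> < t" "x > 0" "z > 0"
  shows "t powr (- 2 * m) * (x * z) powr (- a) * (t\<^sup>2 - y\<^sup>2) powr (m - 1 / 2) * z powr (2 * a) = bump (m - 1 / 2) (y / t) / t * (z / x) powr a"
proof -
  have u: "\<bar>y / t\<bar> < 1" using assms by simp
  have 0: "t\<^sup>2 - y\<^sup>2 = t powr 2 * (1 - (y / t)\<^sup>2)" using assms by (simp add: field_simps)
  have 1: "(t\<^sup>2 - y\<^sup>2) powr (m - 1 / 2) = t powr (2 * m - 1) * bump (m - 1 / 2) (y / t)"
  proof -
    have "2 * (m - 1 / 2) = 2 * m - 1" by simp
    then have "(t powr 2) powr (m - 1 / 2) = t powr (2 * m - 1)" by (simp only: powr_powr)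
    then show ?thesis unfolding 0 powr_mult using u by (simp add: bump_def)
  qed
  have 2: "t powr (- 2 * m) * t powr (2 * m - 1) = 1 / t"
  proof -
    have "t powr (- 2 * m) * t powr (2 * m - 1) = t powr (- 1)" by (simp flip: powr_add)
    also have "\<dots> = 1 / t" using assms by (simp add: powr_minus_divide)
    finally show ?thesis .
  qed
  have 3: "(x * z) powr (- a) * z powr (2 * a) = (z / x) powr a"
  proof -
    have "z powr (2 * a) = z powr a * z powr a" by (simp flip: powr_add)
    moreover have "z powr (- a) * z powr a = 1" using assms by (simp flip: powr_add)
    moreover have "x powr (- a) = 1 / x powr a" by (rule powr_minus_divide)
    moreover have "p * n * (k * k) = k * p" if "n * k = 1" for p n k :: real
    proof -
      have "p * n * (k * k) = (n * k) * (k * p)" by (simp only: mult_ac)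
      then show ?thesis using that by simp
    qed
    ultimately show ?thesis by (simp only: powr_mult powr_divide) simp
  qed
  have "t powr (- 2 * m) * (x * z) powr (- a) * (t\<^sup>2 - y\<^sup>2) powr (m - 1 / 2) * z powr (2 * a)
    = (t powr (- 2 * m) * t powr (2 * m - 1)) * bump (m - 1 / 2) (y / t) * ((x * z) powr (- a) * z powr (2 * a))"
    unfolding 1 by (simp only: mult_ac)
  then show ?thesis unfolding 2 3 by simp
qed

text \<open>Isolates what the operator estimates use of the kernel: its explicit singular factor and
  a bounded continuous remainder.\<close>

locale truncated_kernel =
  fixes \<alpha> \<beta> A :: real and e :: "real \<Rightarrow> real"
  assumes e_cont: "continuous_on {0<..<1} e" and A_pos: "A > 0" and e_bound: "\<And>k. 0 < k \<Longrightarrow> k < 1 \<Longrightarrow> \<bar>e k\<bar> \<le> A"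
    and K_eq: "\<And>t x z. 0 < t \<Longrightarrow> t < x / 2 \<Longrightarrow> z > 0 \<Longrightarrow> \<bar>x - z\<bar> \<noteq> t \<Longrightarrow>
      K \<alpha> \<beta> t x z = (if t < \<bar>x - z\<bar> then 0 else t powr (- 2 * (\<alpha> + \<beta>)) * (x * z) powr (- \<alpha> - 1 / 2)
        * (t\<^sup>2 - (x - z)\<^sup>2) powr (\<alpha> + \<beta> - 1 / 2) * e ((t\<^sup>2 - (x - z)\<^sup>2) / (2 * x * z)))"
begin

definition E :: "real \<Rightarrow> real" where
  "E k = indicator {0<..<1} k *\<^sub>R e k"

text \<open>The kernel multiplied by the density of the measure. It equals \<open>K\<close> times
  the density except where \<open>\<bar>x - z\<bar> = t\<close>, a null set in \<open>z\<close>, and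
  through the extension \<open>E\<close> of \<open>e\<close> by 0 it is jointly Borel measurable in
  all three variables.\<close>

definition W :: "real \<Rightarrow> real \<Rightarrow> real \<Rightarrow> real" where
  "W t x z = bump (\<alpha> + \<beta> - 1 / 2) ((x - z) / t) / t * (z / x) powr (\<alpha> + 1 / 2) * E ((t\<^sup>2 - (x - z)\<^sup>2) / (2 * x * z))"

definition B :: real where
  "B = A * 2 powr \<bar>\<alpha> + 1 / 2\<bar>"

lemma B_pos: "B > 0"
  using A_pos by (simp add: B_def)

lemma E_measurable [measurable]: "E \<in> borel_measurable borel"
  unfolding E_def[abs_def] by (rule borel_measurable_continuous_on_indicator[OF _ e_cont]) simp

lemma E_le: "\<bar>E k\<bar> \<le> A"
  using e_bound[of k] A_pos by (cases "k \<in> {0<..<1}") (auto simp: E_def)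

lemma W_measurable [measurable (raw)]:
  assumes [measurable]: "t \<in> borel_measurable N" "x \<in> borel_measurable N" "z \<in> borel_measurable N"
  shows "(\<lambda>w. W (t w) (x w) (z w)) \<in> borel_measurable N"
  unfolding W_def by measurable

lemma angle_range:
  fixes t x z :: real
  assumes "0 < t" "t < x / 2" "\<bar>x - z\<bar> < t"
  shows "z > 0" "0 < (t\<^sup>2 - (x - z)\<^sup>2) / (2 * x * z)" "(t\<^sup>2 - (x - z)\<^sup>2) / (2 * x * z) < 1"
proof -
  show z: "z > 0" using assms by linarith
  have x: "x > 0" using assms by simp
  have "\<bar>x - z\<bar>\<^sup>2 < t\<^sup>2" using assms by (intro power_strict_mono) auto
  then have 1: "0 < t\<^sup>2 - (x - z)\<^sup>2" by simp
  have "t\<^sup>2 < x\<^sup>2" using assms by (intro power_strict_mono) auto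
  then have "t\<^sup>2 - (x - z)\<^sup>2 < 2 * x * z" using zero_le_power2[of z] unfolding power2_diff by linarith
  then show "0 < (t\<^sup>2 - (x - z)\<^sup>2) / (2 * x * z)" "(t\<^sup>2 - (x - z)\<^sup>2) / (2 * x * z) < 1"
    using 1 x z by (auto simp: divide_less_eq)
qed

lemma W_eq_0: "0 < t \<Longrightarrow> t \<le> \<bar>x - z\<bar> \<Longrightarrow> W t x z = 0"
  unfolding W_def by (simp add: bump_scale_0)

lemma K_eq_W:
  assumes t: "0 < t" "t < x / 2" and z: "z > 0" and ne: "\<bar>x - z\<bar> \<noteq> t"
  shows "K \<alpha> \<beta> t x z * z powr (2 * \<alpha> + 1) = W t x z"
proof (cases "t < \<bar>x - z\<bar>")
  case True
  then show ?thesis using K_eq[OF assms] W_eq_0[of t x z] t by simp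
next
  case False
  then have lt: "\<bar>x - z\<bar> < t" using ne by simp
  have x: "x > 0" using t by simp
  have p: "- \<alpha> - 1 / 2 = - (\<alpha> + 1 / 2)" "2 * \<alpha> + 1 = 2 * (\<alpha> + 1 / 2)" by simp_all
  have E: "E ((t\<^sup>2 - (x - z)\<^sup>2) / (2 * x * z)) = e ((t\<^sup>2 - (x - z)\<^sup>2) / (2 * x * z))"
    using angle_range[OF t lt] by (simp add: E_def)
  have "K \<alpha> \<beta> t x z * z powr (2 * \<alpha> + 1) = (t powr (- 2 * (\<alpha> + \<beta>)) * (x * z) powr (- (\<alpha> + 1 / 2)) * (t\<^sup>2 - (x - z)\<^sup>2) powr (\<alpha> + \<beta> - 1 / 2) * z powr (2 * (\<alpha> + 1 / 2)))
     * e ((t\<^sup>2 - (x - z)\<^sup>2) / (2 * x * z))"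
    unfolding K_eq[OF assms] p using False by simp
  then show ?thesis unfolding kernel_power_identity[OF t(1) lt x z] W_def E .
qed

lemma W_bound:
  assumes t: "0 < t" "t < x / 2"
  shows "\<bar>W t x z\<bar> \<le> B * (bump (\<alpha> + \<beta> - 1 / 2) ((x - z) / t) / t)"
proof (cases "\<bar>x - z\<bar> < t")
  case True
  have x: "x > 0" using t by simp
  have "z powr (\<alpha> + 1 / 2) \<le> 2 powr \<bar>\<alpha> + 1 / 2\<bar> * x powr (\<alpha> + 1 / 2)"
    by (rule powr_comparable) (use True t in linarith)+
  then have q: "(z / x) powr (\<alpha> + 1 / 2) \<le> 2 powr \<bar>\<alpha> + 1 / 2\<bar>"
    using x by (simp add: powr_divide divide_le_eq)
  have "(z / x) powr (\<alpha> + 1 / 2) * \<bar>E ((t\<^sup>2 - (x - z)\<^sup>2) / (2 * x * z))\<bar> \<le> 2 powr \<bar>\<alpha> + 1 / 2\<bar> * A"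
    by (intro mult_mono q E_le) auto
  then have "bump (\<alpha> + \<beta> - 1 / 2) ((x - z) / t) / t * ((z / x) powr (\<alpha> + 1 / 2) * \<bar>E ((t\<^sup>2 - (x - z)\<^sup>2) / (2 * x * z))\<bar>)
     \<le> bump (\<alpha> + \<beta> - 1 / 2) ((x - z) / t) / t * (2 powr \<bar>\<alpha> + 1 / 2\<bar> * A)"
    using t by (intro mult_left_mono) auto
  then show ?thesis using t by (simp add: W_def B_def abs_mult mult_ac)
next
  case False
  then show ?thesis using W_eq_0[of t x z] bump_scale_0[of t "x - z"] t by simp
qed

lemma isCont_W:
  assumes t: "0 < t" "t < x / 2" and ne: "\<bar>x - z\<bar> \<noteq> t"
  shows "isCont (\<lambda>t. W t x z) t"
proof (cases "\<bar>x - z\<bar> < t")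
  case True
  have kc: "isCont (\<lambda>t. (t\<^sup>2 - (x - z)\<^sup>2) / (2 * x * z)) t"
    using angle_range(1)[OF t True] t by (intro continuous_intros) auto
  have Ec: "isCont E k" if "0 < k" "k < 1" for k
  proof -
    have "\<forall>\<^sub>F k in nhds k. E k = e k"
      using eventually_nhds_in_open[of "{0<..<1}" k] that by (auto elim!: eventually_mono simp: E_def)
    moreover have "isCont e k" using e_cont that by (simp add: continuous_on_eq_continuous_at)
    ultimately show ?thesis by (subst isCont_cong) auto
  qed
  have "isCont (\<lambda>t. E ((t\<^sup>2 - (x - z)\<^sup>2) / (2 * x * z))) t"
    by (rule isCont_o2[OF kc Ec]) (rule angle_range[OF t True])+
  moreover have "isCont (\<lambda>t. bump (\<alpha> + \<beta> - 1 / 2) ((x - z) / t)) t" by (rule isCont_bump_scale[OF t(1) ne])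
  ultimately show ?thesis unfolding W_def using t by (intro continuous_intros) auto
next
  case False
  have "\<forall>\<^sub>F s in nhds t. W s x z = 0"
    using eventually_nhds_in_open[of "{0<..<\<bar>x - z\<bar>}" t] False ne t by (auto elim!: eventually_mono intro!: W_eq_0)
  then show ?thesis by (subst isCont_cong[of _ "\<lambda>_. 0"]) auto
qed

lemma kernel_measurable:
  assumes t: "0 < t" "t < x / 2"
  shows "(\<lambda>z. K \<alpha> \<beta> t x z) \<in> borel_measurable (lebesgue_on {0<..})"
proof (rule measurable_discrete_difference[where f = "\<lambda>z. W t x z / z powr (2 * \<alpha> + 1)" and X = "{x - t, x + t}"])
  have "(\<lambda>z. W t x z / z powr (2 * \<alpha> + 1)) \<in> borel_measurable lborel" by measurable
  then show "(\<lambda>z. W t x z / z powr (2 * \<alpha> + 1)) \<in> borel_measurable (lebesgue_on {0<..})"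
    by (intro measurable_restrict_space1 measurable_completion)
  show "{z} \<in> sets (lebesgue_on {0<..})" if "z \<in> {x - t, x + t}" for z
    using that t by (subst sets_restrict_space_iff) auto
  show "W t x z / z powr (2 * \<alpha> + 1) = K \<alpha> \<beta> t x z" if "z \<in> space (lebesgue_on {0<..})" "z \<notin> {x - t, x + t}" for z
  proof -
    have z: "z > 0" using that by simp
    have "\<bar>x - z\<bar> \<noteq> t" using that by (auto simp: abs_if)
    then show ?thesis using K_eq_W[OF t z] z by (simp add: field_simps)
  qed
qed auto

lemma M_eq_lborel:
  fixes f g :: "real \<Rightarrow> complex"
  assumes t: "0 < t" "t < x / 2" and f: "f \<in> borel_measurable (lebesgue_on {0<..})"
    and g: "g \<in> borel_measurable borel" "AE z in lborel. z > 0 \<longrightarrow> f z = g z"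
  shows "integrable (mu \<alpha>) (\<lambda>z. complex_of_real (K \<alpha> \<beta> t x z) * f z) \<longleftrightarrow> integrable lborel (\<lambda>z. W t x z *\<^sub>R g z)" (is ?I)
    and "M \<alpha> \<beta> t f x = (LINT z|lborel. W t x z *\<^sub>R g z)" (is ?M)
proof -
  let ?F = "\<lambda>z. complex_of_real (K \<alpha> \<beta> t x z) * f z"
  let ?h = "\<lambda>z. indicator {0<..} z *\<^sub>R (z powr (2 * \<alpha> + 1) *\<^sub>R ?F z)"
  have Fm [measurable]: "?F \<in> borel_measurable (lebesgue_on {0<..})"
  proof (rule borel_measurable_times[OF measurable_compose[OF kernel_measurable[OF t]] f])
    show "complex_of_real \<in> borel_measurable borel"
      by (intro borel_measurable_continuous_onI continuous_intros)
  qed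
  have pm: "(\<lambda>z. z powr (2 * \<alpha> + 1)) \<in> borel_measurable (lebesgue_on {0<..})" by measurable
  have S: "{0<..} \<inter> space lebesgue \<in> sets (lebesgue :: real measure)" by simp
  have hm: "?h \<in> borel_measurable lebesgue"
    using borel_measurable_scaleR[OF pm Fm] unfolding borel_measurable_restrict_space_iff[OF S] .
  note [measurable] = g(1)
  have Wm: "(\<lambda>z. W t x z *\<^sub>R g z) \<in> borel_measurable lborel" by measurable
  have Wml: "(\<lambda>z. W t x z *\<^sub>R g z) \<in> borel_measurable lebesgue" by (rule measurable_completion[OF Wm])
  have eq: "AE z in lebesgue. ?h z = W t x z *\<^sub>R g z"
  proof (rule AE_completion)
    show "AE z in lborel. ?h z = W t x z *\<^sub>R g z"
      using g(2) AE_lborel_singleton[of "x - t"] AE_lborel_singleton[of "x + t"]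
    proof eventually_elim
      case (elim z)
      then have ne: "\<bar>x - z\<bar> \<noteq> t" by (auto simp: abs_if)
      show ?case
      proof (cases "z > 0")
        case True
        then show ?thesis using elim(1) K_eq_W[OF t True ne, symmetric] by (simp add: scaleR_conv_of_real mult_ac)
      next
        case False
        then show ?thesis using t W_eq_0[of t x z] by simp
      qed
    qed
  qed
  have "integrable (mu \<alpha>) ?F \<longleftrightarrow> integrable (lebesgue_on {0<..}) (\<lambda>z. z powr (2 * \<alpha> + 1) *\<^sub>R ?F z)"
    unfolding power_measure_def by (rule integrable_density[OF Fm pm]) simp
  also have "\<dots> \<longleftrightarrow> integrable lebesgue ?h" by (rule integrable_restrict_space[OF S])
  also have "\<dots> \<longleftrightarrow> integrable lebesgue (\<lambda>z. W t x z *\<^sub>R g z)" by (rule integrable_cong_AE[OF hm Wml eq])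
  also have "\<dots> \<longleftrightarrow> integrable lborel (\<lambda>z. W t x z *\<^sub>R g z)" by (rule integrable_completion[OF Wm])
  finally show ?I .
  have "M \<alpha> \<beta> t f x = (LINT z|lebesgue_on {0<..}. z powr (2 * \<alpha> + 1) *\<^sub>R ?F z)"
    unfolding M_def power_measure_def by (rule integral_density[OF Fm pm]) simp
  also have "\<dots> = (LINT z|lebesgue. ?h z)" by (rule integral_restrict_space[OF S])
  also have "\<dots> = (LINT z|lebesgue. W t x z *\<^sub>R g z)" by (rule integral_cong_AE[OF hm Wml eq])
  also have "\<dots> = (LINT z|lborel. W t x z *\<^sub>R g z)" by (rule integral_completion[OF Wm])
  finally show ?M .
qed

text \<open>If \<open>R\<close> is finite, the bound already implies that the defining integrals
  exist, so the value \<infinity> prescribed for their failure does not occur; if \<open>R\<close>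
  is infinite there is nothing to show.\<close>

lemma M_tru_le:
  fixes f g :: "real \<Rightarrow> complex"
  assumes f: "f \<in> borel_measurable (lebesgue_on {0<..})"
    and g: "g \<in> borel_measurable borel" "AE z in lborel. z > 0 \<longrightarrow> f z = g z"
    and le: "\<And>t. 0 < t \<Longrightarrow> t < x / 2 \<Longrightarrow>
      ennreal B * (\<integral>\<^sup>+z. ennreal (bump (\<alpha> + \<beta> - 1 / 2) ((x - z) / t) / t * norm (g z)) \<partial>lborel) \<le> R"
  shows "M_tru \<alpha> \<beta> f x \<le> R"
  unfolding M_tru_def
proof (rule SUP_least)
  fix t assume "t \<in> {0<..<x / 2}"
  then have t: "0 < t" "t < x / 2" by auto
  note [measurable] = g(1)
  have "(\<integral>\<^sup>+z. ennreal (norm (W t x z *\<^sub>R g z)) \<partial>lborel)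
     \<le> (\<integral>\<^sup>+z. ennreal B * ennreal (bump (\<alpha> + \<beta> - 1 / 2) ((x - z) / t) / t * norm (g z)) \<partial>lborel)"
  proof (rule nn_integral_mono)
    fix z
    have "norm (W t x z *\<^sub>R g z) \<le> B * (bump (\<alpha> + \<beta> - 1 / 2) ((x - z) / t) / t) * norm (g z)"
      using mult_right_mono[OF W_bound[OF t, of z] norm_ge_zero[of "g z"]] by simp
    then have "ennreal (norm (W t x z *\<^sub>R g z)) \<le> ennreal (B * (bump (\<alpha> + \<beta> - 1 / 2) ((x - z) / t) / t * norm (g z)))"
      by (intro ennreal_leI) (simp only: mult.assoc)
    also have "\<dots> = ennreal B * ennreal (bump (\<alpha> + \<beta> - 1 / 2) ((x - z) / t) / t * norm (g z))"
      using B_pos t by (intro ennreal_mult) auto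
    finally show "ennreal (norm (W t x z *\<^sub>R g z)) \<le> ennreal B * ennreal (bump (\<alpha> + \<beta> - 1 / 2) ((x - z) / t) / t * norm (g z))" .
  qed
  also have "\<dots> = ennreal B * (\<integral>\<^sup>+z. ennreal (bump (\<alpha> + \<beta> - 1 / 2) ((x - z) / t) / t * norm (g z)) \<partial>lborel)"
    by (rule nn_integral_cmult) measurable
  also note le[OF t]
  finally have bd: "(\<integral>\<^sup>+z. ennreal (norm (W t x z *\<^sub>R g z)) \<partial>lborel) \<le> R" .
  show "(if integrable (mu \<alpha>) (\<lambda>z. complex_of_real (K \<alpha> \<beta> t x z) * f z) then ennreal (norm (M \<alpha> \<beta> t f x)) else \<infinity>) \<le> R"
  proof (cases "R = \<infinity>")
    case False
    have "(\<integral>\<^sup>+z. ennreal (norm (W t x z *\<^sub>R g z)) \<partial>lborel) < \<infinity>"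
      using bd False by (metis infinity_ennreal_def order_le_less_trans top.not_eq_extremum)
    then have int: "integrable lborel (\<lambda>z. W t x z *\<^sub>R g z)" by (intro integrableI_bounded) measurable
    have "ennreal (norm (M \<alpha> \<beta> t f x)) \<le> R"
      unfolding M_eq_lborel(2)[OF t f g] by (rule order.trans[OF integral_norm_bound_ennreal[OF int] bd])
    then show ?thesis using int unfolding M_eq_lborel(1)[OF t f g] by simp
  qed simp
qed

text \<open>The integral is continuous in \<open>t\<close>, by dominated convergence with the
  majorants \<open>D x t\<close> depending on \<open>t\<close>. Hence the supremum may be taken over
  \<open>t = s * x\<close> with rational \<open>s\<close>.\<close>

lemma M_tru_measurable:
  fixes f g :: "real \<Rightarrow> complex"
  assumes f: "f \<in> borel_measurable (lebesgue_on {0<..})"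
    and g: "g \<in> borel_measurable borel" "AE z in lborel. z > 0 \<longrightarrow> f z = g z"
    and D: "\<And>x t. 0 < t \<Longrightarrow> t < x / 2 \<Longrightarrow> integrable lborel (D x t)"
    and bound: "\<And>x t z. 0 < t \<Longrightarrow> t < x / 2 \<Longrightarrow> \<bar>W t x z\<bar> * norm (g z) \<le> D x t z"
    and D_cont: "\<And>x t z. 0 < t \<Longrightarrow> t < x / 2 \<Longrightarrow> \<bar>x - z\<bar> \<noteq> t \<Longrightarrow> isCont (\<lambda>t. D x t z) t"
    and Dint_cont: "\<And>x t. 0 < t \<Longrightarrow> t < x / 2 \<Longrightarrow> isCont (\<lambda>t. LINT z|lborel. D x t z) t"
  shows "M_tru \<alpha> \<beta> f \<in> borel_measurable (power_measure \<delta>)"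
proof -
  note [measurable] = g(1)
  define T where "T = (\<lambda>t x. LINT z|lborel. W t x z *\<^sub>R g z)"
  \<comment> \<open>Ratios \<open>t / x\<close> are made rational instead of \<open>t\<close>
    itself, so that the countable index set is the same for every \<open>x\<close>.\<close>
  define Q where "Q = \<rat> \<inter> {0<..<1 / 2::real}"
  have int: "integrable lborel (\<lambda>z. W t x z *\<^sub>R g z)" if "0 < t" "t < x / 2" for t x
  proof (rule Bochner_Integration.integrable_bound[OF D[OF that]])
    show "AE z in lborel. norm (W t x z *\<^sub>R g z) \<le> norm (D x t z)"
      using bound[OF that] by (intro AE_I2) (simp add: order.trans[OF _ abs_ge_self])
  qed measurable
  have Tc: "continuous_on {0<..<x / 2} (\<lambda>t. T t x)" for x
    unfolding continuous_on_sequentially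
  proof (intro allI ballI impI, elim conjE)
    fix X :: "nat \<Rightarrow> real" and a assume a: "a \<in> {0<..<x / 2}" and X: "\<forall>n. X n \<in> {0<..<x / 2}" and lim: "X \<longlonglongrightarrow> a"
    have a2: "0 < a" "a < x / 2" and X2: "0 < X n" "X n < x / 2" for n using a X by auto
    have ae: "AE z in lborel. \<bar>x - z\<bar> \<noteq> a"
      using AE_lborel_singleton[of "x - a"] AE_lborel_singleton[of "x + a"] by eventually_elim (auto simp: abs_if)
    have "(\<lambda>n. LINT z|lborel. W (X n) x z *\<^sub>R g z) \<longlonglongrightarrow> (LINT z|lborel. W a x z *\<^sub>R g z)"
    proof (rule generalized_dominated_convergence[where D = "\<lambda>n. D x (X n)" and d = "D x a"])
      show "AE z in lborel. (\<lambda>n. W (X n) x z *\<^sub>R g z) \<longlonglongrightarrow> W a x z *\<^sub>R g z"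
        using ae
      proof eventually_elim
        case (elim z)
        show ?case by (intro tendsto_scaleR tendsto_const isCont_tendsto_compose[OF isCont_W[OF a2 elim] lim])
      qed
      show "AE z in lborel. (\<lambda>n. D x (X n) z) \<longlonglongrightarrow> D x a z"
        using ae
      proof eventually_elim
        case (elim z)
        show ?case by (rule isCont_tendsto_compose[OF D_cont[OF a2 elim] lim])
      qed
      show "(\<lambda>n. LINT z|lborel. D x (X n) z) \<longlonglongrightarrow> (LINT z|lborel. D x a z)"
        by (rule isCont_tendsto_compose[OF Dint_cont[OF a2] lim])
      show "AE z in lborel. norm (W (X n) x z *\<^sub>R g z) \<le> D x (X n) z" for n
        using bound[OF X2] by (intro AE_I2) simp
      show "integrable lborel (D x (X n))" for n by (rule D[OF X2])
      show "integrable lborel (D x a)" by (rule D[OF a2])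
    qed measurable
    then show "((\<lambda>t. T t x) \<circ> X) \<longlonglongrightarrow> T a x" by (simp add: o_def T_def)
  qed
  have eq: "M_tru \<alpha> \<beta> f x = (SUP s\<in>Q. ennreal (norm (T (s * x) x)))" if x: "x > 0" for x
  proof -
    have "M_tru \<alpha> \<beta> f x = (SUP t\<in>{0<..<x / 2}. ennreal (norm (T t x)))"
      unfolding M_tru_def
    proof (rule SUP_cong[OF refl])
      fix t assume "t \<in> {0<..<x / 2}"
      then have t: "0 < t" "t < x / 2" by auto
      show "(if integrable (mu \<alpha>) (\<lambda>z. complex_of_real (K \<alpha> \<beta> t x z) * f z) then ennreal (norm (M \<alpha> \<beta> t f x)) else \<infinity>) = ennreal (norm (T t x))"
        unfolding M_eq_lborel[OF t f g] T_def using int[OF t] by simp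
    qed
    also have "\<dots> = (SUP s\<in>Q. ennreal (norm (T (s * x) x)))"
    proof (rule antisym)
      show "(SUP s\<in>Q. ennreal (norm (T (s * x) x))) \<le> (SUP t\<in>{0<..<x / 2}. ennreal (norm (T t x)))"
      proof (rule SUP_mono)
        fix s assume "s \<in> Q"
        then have "0 < s" "s < 1 / 2" by (auto simp: Q_def)
        then have "0 < s * x" "s * x < 1 / 2 * x" using x by (auto intro!: mult_strict_right_mono)
        then have "s * x \<in> {0<..<x / 2}" by simp
        then show "\<exists>t\<in>{0<..<x / 2}. ennreal (norm (T (s * x) x)) \<le> ennreal (norm (T t x))" by blast
      qed
      show "(SUP t\<in>{0<..<x / 2}. ennreal (norm (T t x))) \<le> (SUP s\<in>Q. ennreal (norm (T (s * x) x)))"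
      proof (rule SUP_least)
        fix t assume t: "t \<in> {0<..<x / 2}"
        show "ennreal (norm (T t x)) \<le> (SUP s\<in>Q. ennreal (norm (T (s * x) x)))"
        proof (rule ccontr)
          assume "\<not> ennreal (norm (T t x)) \<le> (SUP s\<in>Q. ennreal (norm (T (s * x) x)))"
          then have lt: "(SUP s\<in>Q. ennreal (norm (T (s * x) x))) < ennreal (norm (T t x))" by (simp add: not_le)
          have "isCont (\<lambda>t. T t x) t" using Tc[of x] t by (simp add: continuous_on_eq_continuous_at)
          then have "((\<lambda>t. ennreal (norm (T t x))) \<longlongrightarrow> ennreal (norm (T t x))) (at t)"
            unfolding isCont_def by (intro tendsto_ennrealI tendsto_norm)
          then have "\<forall>\<^sub>F s in at t. (SUP s\<in>Q. ennreal (norm (T (s * x) x))) < ennreal (norm (T s x))"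
            using lt by (rule order_tendstoD(1))
          then obtain d where d: "d > 0" "\<And>s. s \<noteq> t \<Longrightarrow> dist s t < d \<Longrightarrow> (SUP s\<in>Q. ennreal (norm (T (s * x) x))) < ennreal (norm (T s x))"
            unfolding eventually_at by auto
          define b where "b = min (x / 2) (t + d)"
          have "t < b" using t d(1) by (simp add: b_def)
          then have "t / x < b / x" using x by (simp add: divide_strict_right_mono)
          then obtain s where s: "s \<in> \<rat>" "t / x < s" "s < b / x" using Rats_dense_in_real by blast
          have sx: "t < s * x" "s * x < b" using s x by (simp_all add: pos_divide_less_eq pos_less_divide_eq)
          have "s * x < 1 / 2 * x" using sx(2) by (simp add: b_def)
          then have "s < 1 / 2" using x by (simp only: mult_less_cancel_right_pos)
          moreover have "0 < t / x" using t x by simp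
          then have "0 < s" using s(2) by (rule order.strict_trans)
          ultimately have "s \<in> Q" using s(1) by (simp add: Q_def)
          then have "ennreal (norm (T (s * x) x)) \<le> (SUP s\<in>Q. ennreal (norm (T (s * x) x)))" by (rule SUP_upper)
          moreover have "dist (s * x) t < d" using sx by (simp add: b_def dist_real_def)
          ultimately show False using d(2)[of "s * x"] sx(1) by (simp add: not_less[symmetric])
        qed
      qed
    qed
    finally show ?thesis .
  qed
  have "countable Q" unfolding Q_def using countable_rat by (rule countable_Int1)
  moreover have "(\<lambda>x. ennreal (norm (T (s * x) x))) \<in> borel_measurable borel" for s
    unfolding T_def by measurable
  ultimately have "(\<lambda>x. SUP s\<in>Q. ennreal (norm (T (s * x) x))) \<in> borel_measurable lborel"
    by (intro borel_measurable_SUP) simp_all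
  then have "(\<lambda>x. SUP s\<in>Q. ennreal (norm (T (s * x) x))) \<in> borel_measurable (lebesgue_on {0<..})"
    by (intro measurable_restrict_space1 measurable_completion)
  then have "M_tru \<alpha> \<beta> f \<in> borel_measurable (lebesgue_on {0<..})"
    by (subst measurable_cong[OF eq]) auto
  then show ?thesis by simp
qed

text \<open>For \<open>\<alpha> + \<beta> \<ge> 1 / 2\<close> the profile is at most 1, so the
  majorant depends on \<open>t\<close> only through the factor \<open>B / t\<close>.\<close>

lemma M_tru_measurable_bounded:
  fixes f g :: "real \<Rightarrow> complex"
  assumes \<mu>: "\<alpha> + \<beta> \<ge> 1 / 2" and f: "f \<in> borel_measurable (lebesgue_on {0<..})"
    and g: "g \<in> borel_measurable borel" "AE z in lborel. z > 0 \<longrightarrow> f z = g z"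
    and loc: "\<And>x. x > 0 \<Longrightarrow> integrable lborel (\<lambda>z. norm (g z) * indicator {x / 2..3 * x / 2} z)"
  shows "M_tru \<alpha> \<beta> f \<in> borel_measurable (power_measure \<delta>)"
proof (rule M_tru_measurable[OF f g, where D = "\<lambda>x t z. B / t * (norm (g z) * indicator {x / 2..3 * x / 2} z)"])
  fix x t :: real assume t: "0 < t" "t < x / 2"
  then have x: "x > 0" by simp
  show "integrable lborel (\<lambda>z. B / t * (norm (g z) * indicator {x / 2..3 * x / 2} z))"
    using loc[OF x] by (rule integrable_mult_right)
  show "\<bar>W t x z\<bar> * norm (g z) \<le> B / t * (norm (g z) * indicator {x / 2..3 * x / 2} z)" for z
  proof (cases "\<bar>x - z\<bar> < t")
    case True
    have "\<bar>W t x z\<bar> \<le> B * (bump (\<alpha> + \<beta> - 1 / 2) ((x - z) / t) / t)" by (rule W_bound[OF t])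
    also have "\<dots> \<le> B * (1 / t)"
      using t B_pos \<mu> by (intro mult_left_mono divide_right_mono bump_le_1) auto
    finally have "\<bar>W t x z\<bar> * norm (g z) \<le> B * (1 / t) * norm (g z)" by (rule mult_right_mono) simp
    moreover have "z \<in> {x / 2..3 * x / 2}" using True t by auto
    ultimately show ?thesis by simp
  next
    case False
    then show ?thesis using W_eq_0[of t x z] t B_pos by simp
  qed
  show "isCont (\<lambda>t. B / t * (norm (g z) * indicator {x / 2..3 * x / 2} z)) t" for z
    using t by (intro continuous_intros) auto
  show "isCont (\<lambda>t. LINT z|lborel. B / t * (norm (g z) * indicator {x / 2..3 * x / 2} z)) t"
  proof -
    have eq: "(LINT z|lborel. B / t * (norm (g z) * indicator {x / 2..3 * x / 2} z)) = B / t * (LINT z|lborel. norm (g z) * indicator {x / 2..3 * x / 2} z)" for t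
      by (rule integral_mult_right_zero)
    have "isCont (\<lambda>t. B / t * c) t" for c using t by (intro continuous_intros) auto
    then show ?thesis unfolding eq .
  qed
qed

text \<open>Young's inequality gives a majorant whose singular part is a rescaled profile. It moves
  with \<open>t\<close>, but its integral is explicit and continuous in \<open>t\<close>.\<close>

lemma M_tru_measurable_power:
  fixes f g :: "real \<Rightarrow> complex" and r q :: real
  assumes r: "r > 1" "q > 1" "1 / q + 1 / r = 1" and cq: "(\<alpha> + \<beta> - 1 / 2) * q > -1"
    and f: "f \<in> borel_measurable (lebesgue_on {0<..})"
    and g: "g \<in> borel_measurable borel" "AE z in lborel. z > 0 \<longrightarrow> f z = g z"
    and loc: "\<And>x. x > 0 \<Longrightarrow> integrable lborel (\<lambda>z. norm (g z) powr r * indicator {x / 2..3 * x / 2} z)"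
  shows "M_tru \<alpha> \<beta> f \<in> borel_measurable (power_measure \<delta>)"
proof (rule M_tru_measurable[OF f g, where D = "\<lambda>x t z. (B / t) powr q * bump ((\<alpha> + \<beta> - 1 / 2) * q) ((x - z) / t) + norm (g z) powr r * indicator {x / 2..3 * x / 2} z"])
  fix x t :: real assume t: "0 < t" "t < x / 2"
  then have x: "x > 0" by simp
  let ?c = "\<alpha> + \<beta> - 1 / 2"
  note bi = bump_scale_integral[OF cq, of _ x]
  show "integrable lborel (\<lambda>z. (B / t) powr q * bump (?c * q) ((x - z) / t) + norm (g z) powr r * indicator {x / 2..3 * x / 2} z)"
    by (intro Bochner_Integration.integrable_add integrable_mult_right bi(1) loc t x)
  show "\<bar>W t x z\<bar> * norm (g z) \<le> (B / t) powr q * bump (?c * q) ((x - z) / t) + norm (g z) powr r * indicator {x / 2..3 * x / 2} z" for z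
  proof (cases "\<bar>x - z\<bar> < t")
    case True
    let ?a = "B / t * bump ?c ((x - z) / t)"
    have a: "?a \<ge> 0" using B_pos t by simp
    have "\<bar>W t x z\<bar> \<le> ?a" using W_bound[OF t, of z] by simp
    then have "\<bar>W t x z\<bar> * norm (g z) \<le> ?a * norm (g z)" by (rule mult_right_mono) simp
    also have "\<dots> \<le> ?a powr q / q + norm (g z) powr r / r"
      by (rule Youngs_inequality[OF r(2,1,3) a]) simp
    also have "\<dots> \<le> ?a powr q / 1 + norm (g z) powr r / 1"
      by (intro add_mono divide_left_mono) (use r in auto)
    also have "?a powr q = (B / t) powr q * bump (?c * q) ((x - z) / t)"
      unfolding powr_mult using r by (simp add: bump_powr)
    finally show ?thesis using True t by (simp add: indicator_def abs_less_iff)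
  next
    case False
    then show ?thesis using W_eq_0[of t x z] t by simp
  qed
  show "isCont (\<lambda>t. (B / t) powr q * bump (?c * q) ((x - z) / t) + norm (g z) powr r * indicator {x / 2..3 * x / 2} z) t"
    if "\<bar>x - z\<bar> \<noteq> t" for z
    using t B_pos isCont_bump_scale[OF t(1) that] by (intro continuous_intros) auto
  \<comment> \<open>The scaling formula for the integral of the profile is available for positive
    \<open>s\<close> only, hence the passage to a neighbourhood of \<open>t\<close>.\<close>
  have "\<forall>\<^sub>F s in nhds t. s \<in> {0<..}" by (rule eventually_nhds_in_open) (use t in auto)
  then have "\<forall>\<^sub>F t in nhds t. (LINT z|lborel. (B / t) powr q * bump (?c * q) ((x - z) / t) + norm (g z) powr r * indicator {x / 2..3 * x / 2} z)
     = (B / t) powr q * (t * (LINT u|lborel. bump (?c * q) u)) + (LINT z|lborel. norm (g z) powr r * indicator {x / 2..3 * x / 2} z)"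
  proof (rule eventually_mono)
    fix s :: real assume "s \<in> {0<..}"
    then have s: "s > 0" by simp
    show "(LINT z|lborel. (B / s) powr q * bump (?c * q) ((x - z) / s) + norm (g z) powr r * indicator {x / 2..3 * x / 2} z)
     = (B / s) powr q * (s * (LINT u|lborel. bump (?c * q) u)) + (LINT z|lborel. norm (g z) powr r * indicator {x / 2..3 * x / 2} z)"
      unfolding Bochner_Integration.integral_add[OF integrable_mult_right[OF bi(1)[OF s]] loc[OF x]] integral_mult_right_zero bi(2)[OF s] ..
  qed
  moreover have "isCont (\<lambda>t. (B / t) powr q * (t * (LINT u|lborel. bump (?c * q) u)) + (LINT z|lborel. norm (g z) powr r * indicator {x / 2..3 * x / 2} z)) t"
  proof -
    have "isCont (\<lambda>t. (B / t) powr q * (t * c) + d) t" for c d using t B_pos by (intro continuous_intros) auto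
    then show ?thesis .
  qed
  ultimately show "isCont (\<lambda>t. LINT z|lborel. (B / t) powr q * bump (?c * q) ((x - z) / t) + norm (g z) powr r * indicator {x / 2..3 * x / 2} z) t"
    by (rule isCont_cong[THEN iffD2])
qed

end

section \<open>Powers of extended reals and local integrability\<close>

lemma ennpowr_ennreal: "a \<ge> 0 \<Longrightarrow> ennpowr (ennreal a) p = ennreal (a powr p)"
  by (simp add: ennpowr_def)

lemma ennpowr_mono: "a \<le> b \<Longrightarrow> p \<ge> 0 \<Longrightarrow> ennpowr a p \<le> ennpowr b p"
  by (cases a; cases b) (auto simp: ennpowr_ennreal ennpowr_def top_unique intro!: ennreal_leI powr_mono2)

lemma ennpowr_ennpowr: "ennpowr (ennpowr a p) q = ennpowr a (p * q)"
  by (cases a) (auto simp: ennpowr_def powr_powr)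

lemma ennpowr_one [simp]: "ennpowr a 1 = a"
  by (cases a) (auto simp: ennpowr_def)

lemma ennpowr_cmult: "c > 0 \<Longrightarrow> ennpowr (ennreal c * a) p = ennreal (c powr p) * ennpowr a p"
proof (cases a)
  case (real b)
  assume c: "c > 0"
  have eq: "ennreal c * a = ennreal (c * b)" using c real by (simp add: ennreal_mult)
  have "ennpowr (ennreal (c * b)) p = ennreal ((c * b) powr p)" using c real by (intro ennpowr_ennreal) simp
  also have "\<dots> = ennreal (c powr p) * ennreal (b powr p)" by (simp add: powr_mult ennreal_mult)
  also have "ennreal (b powr p) = ennpowr a p" using real by (simp add: ennpowr_ennreal)
  finally show ?thesis unfolding eq .
next
  case top
  assume "c > 0"
  then show ?thesis using top by (simp add: ennpowr_def ennreal_mult_top)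
qed

lemma ennpowr_measurable [measurable (raw)]:
  assumes [measurable]: "g \<in> borel_measurable N"
  shows "(\<lambda>x. ennpowr (g x) p) \<in> borel_measurable N"
  unfolding ennpowr_def by measurable

text \<open>The compact intervals from \<open>1 / (n + 1)\<close> to \<open>n + 1\<close> exhaust
  the half line; on each of them integrability includes measurability, and the truncations converge
  pointwise.\<close>

lemma locally_integrable_measurable:
  assumes "locally_integrable f"
  shows "f \<in> borel_measurable (lebesgue_on {0<..})"
proof -
  have S: "{0<..} \<inter> space lebesgue \<in> sets (lebesgue :: real measure)" by simp
  let ?J = "\<lambda>n::nat. {1 / real (Suc n)..real (Suc n)}"
  have "(\<lambda>z. indicator {0<..} z *\<^sub>R f z) \<in> borel_measurable lebesgue"
  proof (rule borel_measurable_LIMSEQ_metric)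
    fix n :: nat
    have "?J n \<subseteq> {0<..}"
    proof
      fix z assume "z \<in> ?J n"
      moreover have "0 < 1 / real (Suc n)" by simp
      ultimately show "z \<in> {0<..}" by (simp only: atLeastAtMost_iff greaterThan_iff) linarith
    qed
    then have "set_integrable lebesgue (?J n) f" using assms unfolding locally_integrable_def by simp
    then show "(\<lambda>z. indicator (?J n) z *\<^sub>R f z) \<in> borel_measurable lebesgue"
      unfolding set_integrable_def by (rule borel_measurable_integrable)
  next
    fix z :: real
    show "(\<lambda>n. indicator (?J n) z *\<^sub>R f z) \<longlonglongrightarrow> indicator {0<..} z *\<^sub>R f z"
    proof (cases "z > 0")
      case True
      obtain N where N: "max z (1 / z) \<le> real N" using real_arch_simple by blast
      have "\<forall>\<^sub>F n in sequentially. indicator (?J n) z *\<^sub>R f z = indicator {0<..} z *\<^sub>R f z"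
        using eventually_ge_at_top[of N]
      proof eventually_elim
        case (elim n)
        have "1 / z \<le> real (Suc n)" "z \<le> real (Suc n)" using N elim by auto
        moreover from this(1) have "1 / real (Suc n) \<le> z" using True by (simp add: field_simps)
        ultimately show ?case using True by (simp add: indicator_def)
      qed
      then show ?thesis by (rule tendsto_eventually)
    next
      case False
      have "z \<notin> ?J n" for n
      proof -
        have "0 < 1 / real (Suc n)" by simp
        then show ?thesis using False by (simp only: atLeastAtMost_iff) linarith
      qed
      then show ?thesis using False by simp
    qed
  qed
  then show ?thesis unfolding borel_measurable_restrict_space_iff[OF S] .
qed

text \<open>With \<open>1 / q = 1 - 1 / r\<close> the hypothesis says
  \<open>1 / 2 - m < 1 / q\<close>, which is the condition that the \<open>q\<close>-th power of the
  profile with exponent \<open>m - 1 / 2\<close> is integrable.\<close>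

lemma conjugate_exponent:
  fixes r m :: real
  assumes "r > 1" "1 / r < m + 1 / 2"
  obtains q where "q > 1" "1 / q + 1 / r = 1" "(m - 1 / 2) * q > -1"
proof (rule that[of "r / (r - 1)"])
  show "1 < r / (r - 1)" using assms by (simp add: less_divide_eq)
  show *: "1 / (r / (r - 1)) + 1 / r = 1" using assms by (simp add: field_simps)
  have "(1 / 2 - m) * (r / (r - 1)) < (1 / (r / (r - 1))) * (r / (r - 1))"
  proof (rule mult_strict_right_mono)
    show "1 / 2 - m < 1 / (r / (r - 1))" using * assms(2) by linarith
    show "0 < r / (r - 1)" using assms by simp
  qed
  also have "\<dots> = 1" using assms by simp
  finally have "(1 / 2 - m) * (r / (r - 1)) < 1" .
  moreover have "(m - 1 / 2) * (r / (r - 1)) = - ((1 / 2 - m) * (r / (r - 1)))" by (simp only: minus_mult_left minus_diff_eq)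
  ultimately show "(m - 1 / 2) * (r / (r - 1)) > -1" by linarith
qed

text \<open>On the interval the weight is bounded below by a multiple of
  \<open>x powr \<delta>\<close>, and \<open>u powr r \<le> 1 + u powr p\<close> lowers the
  exponent.\<close>

lemma Lp_locally_integrable:
  fixes f g :: "real \<Rightarrow> complex"
  assumes f: "f \<in> borel_measurable (lebesgue_on {0<..})" and fin: "(\<integral>\<^sup>+z. ennreal (norm (f z) powr p) \<partial>power_measure \<delta>) < \<infinity>"
    and g: "g \<in> borel_measurable borel" "AE z in lborel. z > 0 \<longrightarrow> f z = g z"
    and r: "0 < r" "r \<le> p" and x: "x > 0"
  shows "integrable lborel (\<lambda>z. norm (g z) powr r * indicator {x / 2..3 * x / 2} z)"
proof (rule integrableI_bounded)
  note [measurable] = g(1)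
  define c where "c = 2 powr \<bar>\<delta>\<bar> / x powr \<delta>"
  have c: "c > 0" using x by (simp add: c_def)
  show "(\<lambda>z. norm (g z) powr r * indicator {x / 2..3 * x / 2} z) \<in> borel_measurable lborel" by measurable
  have "(\<integral>\<^sup>+z. ennreal (norm (norm (g z) powr r * indicator {x / 2..3 * x / 2} z)) \<partial>lborel)
     \<le> (\<integral>\<^sup>+z. indicator {x / 2..3 * x / 2} z + ennreal c * (ennreal (z powr \<delta>) * ennreal (norm (g z) powr p) * indicator {0<..} z) \<partial>lborel)"
  proof (rule nn_integral_mono)
    fix z
    show "ennreal (norm (norm (g z) powr r * indicator {x / 2..3 * x / 2} z)) \<le> indicator {x / 2..3 * x / 2} z + ennreal c * (ennreal (z powr \<delta>) * ennreal (norm (g z) powr p) * indicator {0<..} z)"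
    proof (cases "z \<in> {x / 2..3 * x / 2}")
      case True
      then have z: "x / 2 \<le> z" "z \<le> 3 * x / 2" by auto
      have z0: "z > 0" using z x by linarith
      have 1: "norm (g z) powr r \<le> 1 + norm (g z) powr p"
      proof (cases "norm (g z) \<le> 1")
        case True
        have "norm (g z) powr r \<le> 1 powr r" using True r by (intro powr_mono2) auto
        moreover have "0 \<le> norm (g z) powr p" by simp
        ultimately show ?thesis by (simp only: powr_one_eq_one)
      next
        case False
        then have "norm (g z) powr r \<le> norm (g z) powr p" using r by (intro powr_mono) auto
        then show ?thesis by simp
      qed
      have "x powr \<delta> \<le> 2 powr \<bar>\<delta>\<bar> * z powr \<delta>" by (rule powr_comparable(2)[OF x z])
      then have "1 \<le> c * z powr \<delta>" using x by (simp add: c_def le_divide_eq)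
      then have "1 * norm (g z) powr p \<le> c * z powr \<delta> * norm (g z) powr p" by (rule mult_right_mono) simp
      with 1 have "norm (g z) powr r \<le> 1 + c * (z powr \<delta> * norm (g z) powr p)" by (simp add: mult.assoc)
      then have "ennreal (norm (g z) powr r) \<le> ennreal (1 + c * (z powr \<delta> * norm (g z) powr p))" by (rule ennreal_leI)
      also have "\<dots> = 1 + ennreal c * (ennreal (z powr \<delta>) * ennreal (norm (g z) powr p))"
        using c by (simp add: ennreal_plus ennreal_mult)
      finally show ?thesis using True z0 by simp
    qed simp
  qed
  also have "\<dots> = (\<integral>\<^sup>+z. indicator {x / 2..3 * x / 2} z \<partial>lborel) + (\<integral>\<^sup>+z. ennreal c * (ennreal (z powr \<delta>) * ennreal (norm (g z) powr p) * indicator {0<..} z) \<partial>lborel)"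
    by (rule nn_integral_add) measurable
  also have "(\<integral>\<^sup>+z. ennreal c * (ennreal (z powr \<delta>) * ennreal (norm (g z) powr p) * indicator {0<..} z) \<partial>lborel) = ennreal c * (\<integral>\<^sup>+z. ennreal (norm (f z) powr p) \<partial>power_measure \<delta>)"
  proof -
    have fm: "(\<lambda>z. ennreal (norm (f z) powr p)) \<in> borel_measurable (lebesgue_on {0<..})"
      using f by measurable
    have "(\<integral>\<^sup>+z. ennreal c * (ennreal (z powr \<delta>) * ennreal (norm (g z) powr p) * indicator {0<..} z) \<partial>lborel) = ennreal c * (\<integral>\<^sup>+z. ennreal (z powr \<delta>) * ennreal (norm (g z) powr p) * indicator {0<..} z \<partial>lborel)"
      by (rule nn_integral_cmult) measurable
    also have "(\<integral>\<^sup>+z. ennreal (z powr \<delta>) * ennreal (norm (g z) powr p) * indicator {0<..} z \<partial>lborel) = (\<integral>\<^sup>+z. ennreal (z powr \<delta>) * ennreal (norm (f z) powr p) * indicator {0<..} z \<partial>lborel)"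
      by (rule nn_integral_cong_AE) (use g(2) in eventually_elim, auto simp: indicator_def)
    finally show ?thesis unfolding nn_integral_power_measure[OF fm] nn_integral_completion .
  qed
  also have "(\<integral>\<^sup>+z. indicator {x / 2..3 * x / 2} z \<partial>lborel) + ennreal c * (\<integral>\<^sup>+z. ennreal (norm (f z) powr p) \<partial>power_measure \<delta>) < \<infinity>"
    using fin x by (simp add: ennreal_mult_less_top)
  finally show "(\<integral>\<^sup>+z. ennreal (norm (norm (g z) powr r * indicator {x / 2..3 * x / 2} z)) \<partial>lborel) < \<infinity>" .
qed

lemma in_Lp_finite:
  assumes "in_Lp (power_measure \<delta>) p f"
  shows "f \<in> borel_measurable (lebesgue_on {0<..})" "(\<integral>\<^sup>+z. ennreal (norm (f z) powr p) \<partial>power_measure \<delta>) < \<infinity>"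
proof -
  show "f \<in> borel_measurable (lebesgue_on {0<..})" 
    using assms unfolding in_Lp_def measurable_cong_sets[OF sets_power_measure refl] by blast
  have "ennpowr (\<integral>\<^sup>+z. ennreal (norm (f z) powr p) \<partial>power_measure \<delta>) (1 / p) < \<infinity>"
    using assms by (simp add: in_Lp_def Lp_norm_def ennpowr_ennreal)
  then show "(\<integral>\<^sup>+z. ennreal (norm (f z) powr p) \<partial>power_measure \<delta>) < \<infinity>"
    by (cases "(\<integral>\<^sup>+z. ennreal (norm (f z) powr p) \<partial>power_measure \<delta>) = \<infinity>") (auto simp: ennpowr_def top.not_eq_extremum)
qed

section \<open>Pointwise, strong type and weak type bounds\<close>

context truncated_kernel
begin

lemma M_tru_le_HL:
  assumes \<mu>: "\<alpha> + \<beta> \<ge> 1 / 2" and f: "f \<in> borel_measurable (lebesgue_on {0<..})"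
  shows "M_tru \<alpha> \<beta> f x \<le> ennreal (2 * B) * local_HL f x"
proof -
  obtain g where g: "g \<in> borel_measurable borel" "AE z in lborel. z > 0 \<longrightarrow> f z = g z"
    by (rule borel_representative[OF f]) (rule that)
  note [measurable] = g(1)
  have HL: "local_HL f x = local_avg (\<lambda>z. ennreal (norm (g z))) x"
    unfolding local_HL_eq_local_avg by (rule local_avg_cong_AE) (use g(2) in eventually_elim, simp)
  show ?thesis
  proof (rule M_tru_le[OF f g])
    fix t assume t: "0 < t" "t < x / 2"
    have "ennreal B * (\<integral>\<^sup>+z. ennreal (bump (\<alpha> + \<beta> - 1 / 2) ((x - z) / t) / t * norm (g z)) \<partial>lborel)
      \<le> ennreal B * (2 * local_avg (\<lambda>z. ennreal (norm (g z))) x)"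
      by (intro mult_left_mono bump_average_bounded t) (use \<mu> in \<open>simp_all, measurable\<close>)
    also have "\<dots> = ennreal (2 * B) * local_HL f x"
    proof -
      have "ennreal (2 * B) = ennreal B * 2" using B_pos by (simp add: ennreal_mult mult.commute)
      then show ?thesis unfolding HL by (simp only: mult.assoc)
    qed
    finally show "ennreal B * (\<integral>\<^sup>+z. ennreal (bump (\<alpha> + \<beta> - 1 / 2) ((x - z) / t) / t * norm (g z)) \<partial>lborel) \<le> ennreal (2 * B) * local_HL f x" .
  qed
qed

text \<open>The exponent \<gamma> is free because any power of \<open>z\<close> is comparable with
  that of \<open>x\<close> on the interval. The choice \<open>\<gamma> = \<beta>\<close> gives the
  pointwise bound of the theorem, and \<open>\<gamma> = 0\<close> serves the bounds in
  \<open>L^p\<close>.\<close>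

lemma M_tru_le_HL_power:
  assumes r: "r > 1" "1 / r < \<alpha> + \<beta> + 1 / 2"
  obtains C where "C > 0" "\<And>f x. f \<in> borel_measurable (lebesgue_on {0<..}) \<Longrightarrow> x > 0 \<Longrightarrow>
    M_tru \<alpha> \<beta> f x \<le> ennreal C * (ennreal (x powr \<gamma>) * ennpowr (local_HL (\<lambda>z. norm (complex_of_real (z powr (- \<gamma>)) * f z) powr r) x) (1 / r))"
proof -
  obtain q where q: "q > 1" "1 / q + 1 / r = 1" "(\<alpha> + \<beta> - 1 / 2) * q > -1"
    by (rule conjugate_exponent[OF r]) (rule that)
  define N where "N = (LINT u|lborel. bump ((\<alpha> + \<beta> - 1 / 2) * q) u) + 2"
  have "0 \<le> (LINT u|lborel. bump ((\<alpha> + \<beta> - 1 / 2) * q) u)" by (rule Bochner_Integration.integral_nonneg) simp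
  then have N: "N > 0" unfolding N_def by linarith
  define c where "c = (2::real) powr \<bar>\<gamma>\<bar>"
  have c: "c > 0" by (simp add: c_def)
  show thesis
  proof (rule that[of "B * (c * N)"])
    show "B * (c * N) > 0" using B_pos c N by simp
    fix f :: "real \<Rightarrow> complex" and x :: real
    assume f: "f \<in> borel_measurable (lebesgue_on {0<..})" and x: "x > 0"
    obtain g where g: "g \<in> borel_measurable borel" "AE z in lborel. z > 0 \<longrightarrow> f z = g z"
      by (rule borel_representative[OF f]) (rule that)
    note [measurable] = g(1)
    define \<psi> where "\<psi> = (\<lambda>z. z powr (- \<gamma>) * norm (g z))"
    have \<psi>: "\<psi> \<in> borel_measurable borel" "\<And>z. \<psi> z \<ge> 0" by (simp_all add: \<psi>_def)
    note [measurable] = \<psi>(1)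
    define L where "L = local_HL (\<lambda>z. norm (complex_of_real (z powr (- \<gamma>)) * f z) powr r) x"
    have HL: "L = local_avg (\<lambda>z. ennreal (\<psi> z powr r)) x"
      unfolding L_def local_HL_eq_local_avg
      by (rule local_avg_cong_AE) (use g(2) in eventually_elim, simp add: \<psi>_def norm_mult)
    show "M_tru \<alpha> \<beta> f x \<le> ennreal (B * (c * N)) * (ennreal (x powr \<gamma>) * ennpowr (local_HL (\<lambda>z. norm (complex_of_real (z powr (- \<gamma>)) * f z) powr r) x) (1 / r))"
      unfolding L_def[symmetric]
    proof (rule M_tru_le[OF f g])
      fix t assume t: "0 < t" "t < x / 2"
      let ?b = "\<lambda>z. bump (\<alpha> + \<beta> - 1 / 2) ((x - z) / t) / t"
      have pt: "?b z * norm (g z) \<le> (c * x powr \<gamma>) * (?b z * \<psi> z)" for z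
      proof (cases "\<bar>x - z\<bar> < t")
        case True
        have z: "x / 2 \<le> z" "z \<le> 3 * x / 2" using True t by linarith+
        then have z0: "z > 0" using x by linarith
        have "norm (g z) = z powr \<gamma> * \<psi> z" using z0 by (simp add: \<psi>_def powr_minus)
        also have "\<dots> \<le> (c * x powr \<gamma>) * \<psi> z"
          unfolding c_def by (intro mult_right_mono powr_comparable(1)[OF x z] \<psi>(2))
        finally have "?b z * norm (g z) \<le> ?b z * ((c * x powr \<gamma>) * \<psi> z)"
          using t by (intro mult_left_mono) auto
        then show ?thesis by (simp only: mult.left_commute)
      next
        case False
        then have "bump (\<alpha> + \<beta> - 1 / 2) ((x - z) / t) = 0" using t by (intro bump_scale_0) auto
        then show ?thesis by simp
      qed
      have "(\<integral>\<^sup>+z. ennreal (?b z * norm (g z)) \<partial>lborel) \<le> (\<integral>\<^sup>+z. ennreal (c * x powr \<gamma>) * ennreal (?b z * \<psi> z) \<partial>lborel)"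
      proof (rule nn_integral_mono)
        fix z
        have "ennreal (?b z * norm (g z)) \<le> ennreal ((c * x powr \<gamma>) * (?b z * \<psi> z))" by (rule ennreal_leI[OF pt])
        also have "\<dots> = ennreal (c * x powr \<gamma>) * ennreal (?b z * \<psi> z)"
          by (rule ennreal_mult) (use c t \<psi>(2) in auto)
        finally show "ennreal (?b z * norm (g z)) \<le> ennreal (c * x powr \<gamma>) * ennreal (?b z * \<psi> z)" .
      qed
      also have "\<dots> = ennreal (c * x powr \<gamma>) * (\<integral>\<^sup>+z. ennreal (?b z * \<psi> z) \<partial>lborel)"
        by (rule nn_integral_cmult) measurable
      also have "\<dots> \<le> ennreal (c * x powr \<gamma>) * (ennreal N * ennpowr L (1 / r))"
        unfolding HL N_def by (intro mult_left_mono bump_average_power[OF r(1) q t \<psi>]) simp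
      finally have "ennreal B * (\<integral>\<^sup>+z. ennreal (?b z * norm (g z)) \<partial>lborel) \<le> ennreal B * (ennreal (c * x powr \<gamma>) * (ennreal N * ennpowr L (1 / r)))"
        by (rule mult_left_mono) simp
      also have "\<dots> = ennreal (B * (c * N)) * (ennreal (x powr \<gamma>) * ennpowr L (1 / r))"
        using B_pos c N by (simp add: ennreal_mult mult_ac)
      finally show "ennreal B * (\<integral>\<^sup>+z. ennreal (?b z * norm (g z)) \<partial>lborel) \<le> ennreal (B * (c * N)) * (ennreal (x powr \<gamma>) * ennpowr L (1 / r))" .
    qed
  qed
qed

text \<open>The pointwise bound with an exponent \<open>r\<close> strictly below \<open>p\<close>
  leaves the maximal average of \<open>\<bar>f\<bar> powr r\<close> to be controlled in
  \<open>L^k\<close> with \<open>k = p / r > 1\<close>, where the strong type estimate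
  holds.\<close>

lemma M_tru_bounded_on_Lp:
  assumes p: "p > 1" "1 / p < \<alpha> + \<beta> + 1 / 2"
  shows "bounded_on_Lp (power_measure \<delta>) p (M_tru \<alpha> \<beta>)"
proof -
  \<comment> \<open>\<open>w\<close> is the reciprocal of \<open>r\<close>. The three conditions
    \<open>1 < r\<close>, \<open>r < p\<close> and \<open>1 / r < \<alpha> + \<beta> + 1 / 2\<close>
    are compatible exactly because both entries of the minimum exceed \<open>1 / p\<close>.\<close>
  obtain w where w: "1 / p < w" "w < min 1 (\<alpha> + \<beta> + 1 / 2)"
    using dense[of "1 / p" "min 1 (\<alpha> + \<beta> + 1 / 2)"] p by auto
  define r where "r = 1 / w"
  have "0 < 1 / p" using p by simp
  then have w0: "w > 0" using w by linarith
  have r: "r > 1" "1 / r < \<alpha> + \<beta> + 1 / 2" "r < p"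
    using w w0 p by (auto simp: r_def field_simps)
  obtain q where q: "q > 1" "1 / q + 1 / r = 1" "(\<alpha> + \<beta> - 1 / 2) * q > -1"
    by (rule conjugate_exponent[OF r(1,2)]) (rule that)
  obtain C where C: "C > 0" "\<And>f x. f \<in> borel_measurable (lebesgue_on {0<..}) \<Longrightarrow> x > 0 \<Longrightarrow>
    M_tru \<alpha> \<beta> f x \<le> ennreal C * (ennreal (x powr 0) * ennpowr (local_HL (\<lambda>z. norm (complex_of_real (z powr (- 0)) * f z) powr r) x) (1 / r))"
    by (rule M_tru_le_HL_power[OF r(1,2), where \<gamma> = 0]) (rule that)
  define k where "k = p / r"
  have k: "k > 1" "r * k = p" using r by (auto simp: k_def)
  define C2 where "C2 = 4 * 2 powr (2 * \<bar>\<delta>\<bar>) * k / (k - 1) * 2 powr (k - 1)"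
  have C2: "C2 > 0" using k by (simp add: C2_def)
  show ?thesis
    unfolding bounded_on_Lp_def
  proof (intro exI[of _ "(C powr p * C2) powr (1 / p)"] conjI allI impI)
    show "(C powr p * C2) powr (1 / p) > 0" using C(1) C2 by simp
    fix f assume L: "in_Lp (power_measure \<delta>) p f"
    note f = in_Lp_finite[OF L]
    obtain g where g: "g \<in> borel_measurable borel" "AE z in lborel. z > 0 \<longrightarrow> f z = g z"
      by (rule borel_representative[OF f(1)]) (rule that)
    show meas: "M_tru \<alpha> \<beta> f \<in> borel_measurable (power_measure \<delta>)"
      by (rule M_tru_measurable_power[OF r(1) q f(1) g]) (rule Lp_locally_integrable[OF f g], use r in auto)
    have measl [measurable]: "M_tru \<alpha> \<beta> f \<in> borel_measurable (lebesgue_on {0<..})" using meas by simp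
    \<comment> \<open>Dividing by \<open>C\<close> and raising to the power \<open>r\<close> inverts
      the right-hand side of the pointwise bound, so that \<open>G\<close> lies below the average of
      \<open>\<bar>f\<bar> powr r\<close> itself.\<close>
    define G where "G = (\<lambda>x. ennpowr (ennreal (1 / C) * M_tru \<alpha> \<beta> f x) r)"
    define h where "h = (\<lambda>z. ennreal (norm (f z) powr r))"
    have hm: "h \<in> borel_measurable (lebesgue_on {0<..})" unfolding h_def using f(1) by measurable
    have Gm: "G \<in> borel_measurable (lebesgue_on {0<..})" unfolding G_def by measurable
    have Gle: "G x \<le> local_avg h x" if x: "x > 0" for x
    proof -
      have HL: "local_HL (\<lambda>z. norm (complex_of_real (z powr (- 0)) * f z) powr r) x = local_avg h x"
        unfolding local_HL_eq_local_avg by (rule local_avg_cong_AE) (simp add: h_def)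
      have "M_tru \<alpha> \<beta> f x \<le> ennreal C * ennpowr (local_avg h x) (1 / r)"
        using C(2)[OF f(1) x] x unfolding HL by simp
      then have "ennreal (1 / C) * M_tru \<alpha> \<beta> f x \<le> ennreal (1 / C) * (ennreal C * ennpowr (local_avg h x) (1 / r))"
        by (rule mult_left_mono) simp
      also have "\<dots> = ennpowr (local_avg h x) (1 / r)"
      proof -
        have "ennreal (1 / C) * ennreal C = 1" using C(1) by (simp flip: ennreal_mult)
        then show ?thesis by (simp add: mult.assoc[symmetric])
      qed
      finally have "G x \<le> ennpowr (ennpowr (local_avg h x) (1 / r)) r" unfolding G_def using r by (intro ennpowr_mono) auto
      then show ?thesis using r by (simp add: ennpowr_ennpowr)
    qed
    have e: "ennpowr (G x) k = ennreal ((1 / C) powr p) * ennpowr (M_tru \<alpha> \<beta> f x) p" for x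
      unfolding G_def ennpowr_ennpowr k(2) using C(1) by (intro ennpowr_cmult) simp
    have eh: "ennpowr (h z) k = ennpowr (ennreal (norm (f z))) p" for z
      unfolding h_def by (simp add: ennpowr_ennreal powr_powr k(2))
    have "ennreal ((1 / C) powr p) * (\<integral>\<^sup>+x. ennpowr (M_tru \<alpha> \<beta> f x) p \<partial>power_measure \<delta>) = (\<integral>\<^sup>+x. ennpowr (G x) k \<partial>power_measure \<delta>)"
      unfolding e by (rule nn_integral_cmult[symmetric]) (use meas in measurable)
    also have "\<dots> \<le> ennreal C2 * (\<integral>\<^sup>+z. ennpowr (ennreal (norm (f z))) p \<partial>power_measure \<delta>)"
      using local_avg_strong_type[OF hm Gm Gle k(1)] unfolding eh C2_def .
    finally have "ennreal (C powr p) * (ennreal ((1 / C) powr p) * (\<integral>\<^sup>+x. ennpowr (M_tru \<alpha> \<beta> f x) p \<partial>power_measure \<delta>))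
       \<le> ennreal (C powr p) * (ennreal C2 * (\<integral>\<^sup>+z. ennpowr (ennreal (norm (f z))) p \<partial>power_measure \<delta>))"
      by (rule mult_left_mono) simp
    moreover have "ennreal (C powr p) * ennreal ((1 / C) powr p) = 1"
      using C(1) by (simp add: powr_divide flip: ennreal_mult)
    moreover have "ennreal (C powr p) * ennreal C2 = ennreal (C powr p * C2)"
      using C2 by (simp add: ennreal_mult)
    ultimately have "(\<integral>\<^sup>+x. ennpowr (M_tru \<alpha> \<beta> f x) p \<partial>power_measure \<delta>)
       \<le> ennreal (C powr p * C2) * (\<integral>\<^sup>+z. ennpowr (ennreal (norm (f z))) p \<partial>power_measure \<delta>)"
      by (simp only: mult.assoc[symmetric]) simp
    then have "Lp_norm (power_measure \<delta>) p (M_tru \<alpha> \<beta> f) \<le> ennpowr (ennreal (C powr p * C2) * (\<integral>\<^sup>+z. ennpowr (ennreal (norm (f z))) p \<partial>power_measure \<delta>)) (1 / p)"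
      unfolding Lp_norm_def using p by (intro ennpowr_mono) auto
    also have "\<dots> = ennreal ((C powr p * C2) powr (1 / p)) * Lp_norm (power_measure \<delta>) p (\<lambda>x. ennreal (norm (f x)))"
      unfolding Lp_norm_def using C(1) C2 by (intro ennpowr_cmult) simp
    finally show "Lp_norm (power_measure \<delta>) p (M_tru \<alpha> \<beta> f) \<le> ennreal ((C powr p * C2) powr (1 / p)) * Lp_norm (power_measure \<delta>) p (\<lambda>x. ennreal (norm (f x)))" .
  qed
qed

text \<open>By the pointwise bound a value above \<open>s\<close> forces the local average above
  \<open>s / (2 * B)\<close>, so the level set lies in the open set of the covering argument at that
  level.\<close>

lemma M_tru_weak_type:
  assumes \<mu>: "\<alpha> + \<beta> \<ge> 1 / 2"
  shows "weak_type_1_1 (power_measure \<delta>) (M_tru \<alpha> \<beta>)"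
  unfolding weak_type_1_1_def
proof (intro exI[of _ "2 * 2 powr (2 * \<bar>\<delta>\<bar>) * (2 * B)"] conjI allI impI)
  show "2 * 2 powr (2 * \<bar>\<delta>\<bar>) * (2 * B) > 0" using B_pos by simp
  fix f assume L: "in_Lp (power_measure \<delta>) 1 f"
  note f = in_Lp_finite[OF L]
  obtain g where g: "g \<in> borel_measurable borel" "AE z in lborel. z > 0 \<longrightarrow> f z = g z"
    by (rule borel_representative[OF f(1)]) (rule that)
  have loc: "integrable lborel (\<lambda>z. norm (g z) * indicator {x / 2..3 * x / 2} z)" if "x > 0" for x
    using Lp_locally_integrable[OF f g _ _ that, of 1] by simp
  show "M_tru \<alpha> \<beta> f \<in> borel_measurable (power_measure \<delta>)"
    by (rule M_tru_measurable_bounded[OF \<mu> f(1) g loc])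
  fix s :: real assume s: "s > 0"
  let ?h = "\<lambda>z. ennreal (norm (f z))"
  have hm: "?h \<in> borel_measurable (lebesgue_on {0<..})" using f(1) by measurable
  have sB: "s / (2 * B) > 0" using s B_pos by simp
  obtain V where V: "V \<in> sets (power_measure \<delta>)" "{x\<in>{0<..}. local_avg ?h x > ennreal (s / (2 * B))} \<subseteq> V"
    "emeasure (power_measure \<delta>) V \<le> ennreal (2 * 2 powr (2 * \<bar>\<delta>\<bar>) / (s / (2 * B))) * (\<integral>\<^sup>+z. ?h z \<partial>power_measure \<delta>)"
    by (rule local_avg_weak_type[OF hm sB]) (rule that)
  have "{x \<in> space (power_measure \<delta>). M_tru \<alpha> \<beta> f x > ennreal s} \<subseteq> V"
  proof (rule subset_trans[OF _ V(2)], rule subsetI)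
    fix x assume "x \<in> {x \<in> space (power_measure \<delta>). M_tru \<alpha> \<beta> f x > ennreal s}"
    then have x: "x > 0" "ennreal s < M_tru \<alpha> \<beta> f x" by auto
    have "ennreal (s / (2 * B)) < local_avg ?h x"
    proof (rule ccontr)
      assume "\<not> ennreal (s / (2 * B)) < local_avg ?h x"
      then have "local_avg ?h x \<le> ennreal (s / (2 * B))" by simp
      then have "ennreal (2 * B) * local_avg ?h x \<le> ennreal (2 * B) * ennreal (s / (2 * B))" by (rule mult_left_mono) simp
      also have "\<dots> = ennreal s" using s B_pos by (simp flip: ennreal_mult)
      finally have "M_tru \<alpha> \<beta> f x \<le> ennreal s"
        using M_tru_le_HL[OF \<mu> f(1), of x] unfolding local_HL_eq_local_avg by (rule order.trans[rotated])
      then show False using x(2) by simp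
    qed
    then show "x \<in> {x\<in>{0<..}. local_avg ?h x > ennreal (s / (2 * B))}" using x(1) by simp
  qed
  then have "emeasure (power_measure \<delta>) {x \<in> space (power_measure \<delta>). M_tru \<alpha> \<beta> f x > ennreal s} \<le> emeasure (power_measure \<delta>) V"
    using V(1) by (rule emeasure_mono)
  also note V(3)
  finally have "ennreal s * emeasure (power_measure \<delta>) {x \<in> space (power_measure \<delta>). M_tru \<alpha> \<beta> f x > ennreal s}
     \<le> ennreal s * (ennreal (2 * 2 powr (2 * \<bar>\<delta>\<bar>) / (s / (2 * B))) * (\<integral>\<^sup>+z. ?h z \<partial>power_measure \<delta>))"
    by (rule mult_left_mono) simp
  also have "\<dots> = ennreal (2 * 2 powr (2 * \<bar>\<delta>\<bar>) * (2 * B)) * (\<integral>\<^sup>+z. ?h z \<partial>power_measure \<delta>)"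
  proof -
    have "ennreal s * ennreal (2 * 2 powr (2 * \<bar>\<delta>\<bar>) / (s / (2 * B))) = ennreal (s * (2 * 2 powr (2 * \<bar>\<delta>\<bar>) / (s / (2 * B))))"
      using s B_pos by (intro ennreal_mult[symmetric]) auto
    also have "s * (2 * 2 powr (2 * \<bar>\<delta>\<bar>) / (s / (2 * B))) = 2 * 2 powr (2 * \<bar>\<delta>\<bar>) * (2 * B)" using s B_pos by simp
    finally show ?thesis by (simp only: mult.assoc[symmetric])
  qed
  also have "(\<integral>\<^sup>+z. ?h z \<partial>power_measure \<delta>) = Lp_norm (power_measure \<delta>) 1 ?h" unfolding Lp_norm_def by simp
  finally show "ennreal s * emeasure (power_measure \<delta>) {x \<in> space (power_measure \<delta>). M_tru \<alpha> \<beta> f x > ennreal s}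
     \<le> ennreal (2 * 2 powr (2 * \<bar>\<delta>\<bar>) * (2 * B)) * Lp_norm (power_measure \<delta>) 1 ?h" .
qed

end

theorem proposition1p10:
  fixes \<alpha> \<beta> :: real
  assumes "\<alpha> > -1" and "\<alpha> + \<beta> > -1 / 2"
  shows
    "(\<alpha> + \<beta> \<ge> 1 / 2 \<longrightarrow>
        (\<exists>C>0. \<forall>f. locally_integrable f \<longrightarrow>
           (\<forall>x>0. M_tru \<alpha> \<beta> f x \<le> ennreal C * local_HL f x)))
     \<and> (\<alpha> + \<beta> < 1 / 2 \<longrightarrow>
        (\<forall>\<theta>>0. 1 / (1 + \<theta>) < \<alpha> + \<beta> + 1 / 2 \<longrightarrow>
          (\<exists>C>0. \<forall>f. locally_integrable f \<longrightarrow>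
             (\<forall>x>0. M_tru \<alpha> \<beta> f x \<le>
                ennreal C * (ennreal (x powr \<beta>) *
                  ennpowr
                    (local_HL (\<lambda>z. norm (complex_of_real (z powr (-\<beta>)) * f z) powr (1 + \<theta>)) x)
                    (1 / (1 + \<theta>)))))))
     \<and> (\<forall>p>1. 1 / p < \<alpha> + \<beta> + 1 / 2 \<longrightarrow>
          (\<forall>\<delta>. bounded_on_Lp (power_measure \<delta>) p (M_tru \<alpha> \<beta>)))
     \<and> (\<alpha> + \<beta> \<ge> 1 / 2 \<longrightarrow>
          (\<forall>\<delta>. weak_type_1_1 (power_measure \<delta>) (M_tru \<alpha> \<beta>)))"
proof -
  obtain e A where "continuous_on {0<..<1} e" "A > 0" "\<And>k. 0 < k \<Longrightarrow> k < 1 \<Longrightarrow> \<bar>e k\<bar> \<le> A"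
    "\<And>t x z. 0 < t \<Longrightarrow> t < x / 2 \<Longrightarrow> z > 0 \<Longrightarrow> \<bar>x - z\<bar> \<noteq> t \<Longrightarrow>
      K \<alpha> \<beta> t x z = (if t < \<bar>x - z\<bar> then 0 else t powr (- 2 * (\<alpha> + \<beta>)) * (x * z) powr (- \<alpha> - 1 / 2)
        * (t\<^sup>2 - (x - z)\<^sup>2) powr (\<alpha> + \<beta> - 1 / 2) * e ((t\<^sup>2 - (x - z)\<^sup>2) / (2 * x * z)))"
    by (rule kernel_formula[OF assms]) (rule that)
  then interpret truncated_kernel \<alpha> \<beta> A e by (rule truncated_kernel.intro)
  show ?thesis
  proof (intro conjI impI allI)
    assume "\<alpha> + \<beta> \<ge> 1 / 2"
    then show "\<exists>C>0. \<forall>f. locally_integrable f \<longrightarrow> (\<forall>x>0. M_tru \<alpha> \<beta> f x \<le> ennreal C * local_HL f x)"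
      using B_pos M_tru_le_HL locally_integrable_measurable by (intro exI[of _ "2 * B"]) auto
  next
    fix \<theta> :: real assume \<theta>: "\<theta> > 0" "1 / (1 + \<theta>) < \<alpha> + \<beta> + 1 / 2"
    have r: "1 + \<theta> > 1" using \<theta> by simp
    obtain C where "C > 0" "\<And>f x. f \<in> borel_measurable (lebesgue_on {0<..}) \<Longrightarrow> x > 0 \<Longrightarrow>
      M_tru \<alpha> \<beta> f x \<le> ennreal C * (ennreal (x powr \<beta>) * ennpowr (local_HL (\<lambda>z. norm (complex_of_real (z powr (- \<beta>)) * f z) powr (1 + \<theta>)) x) (1 / (1 + \<theta>)))"
      by (rule M_tru_le_HL_power[OF r \<theta>(2), where \<gamma> = \<beta>]) (rule that)
    then show "\<exists>C>0. \<forall>f. locally_integrable f \<longrightarrow> (\<forall>x>0. M_tru \<alpha> \<beta> f x \<le>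
        ennreal C * (ennreal (x powr \<beta>) * ennpowr (local_HL (\<lambda>z. norm (complex_of_real (z powr (- \<beta>)) * f z) powr (1 + \<theta>)) x) (1 / (1 + \<theta>))))"
      using locally_integrable_measurable by (intro exI[of _ C]) auto
  qed (simp_all add: M_tru_bounded_on_Lp M_tru_weak_type)
qed


end
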